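(* Let $k,u\geq 1$ be integers and let $\Phi_{k,u}$ be the planar graph consisting of two vertices joined by three internally vertex-disjoint paths of lengths $2k+1$, $2$ and $2u+1$; this is the reduced $B$-graph of the standard alternating diagram of the pretzel knot $P(2k+1,2,2u+1)$. Then the tail of $\Phi_{k,u}$ is \[ T_{\Phi_{k,u}}(q)=(q;q)^2_\infty\sum_{l_1=0}^{\infty}\cdots\sum_{l_k=0}^{\infty}\ \sum_{p_1=0}^{\infty}\cdots\sum_{p_u=0}^{\infty} g(q;l_1,\dots,l_k)\,g(q;p_1,\dots,p_u)\,(q;q)_{l_k+p_u}, \] where for nonnegative integers $l_1,\dots,l_m$ \[ g(q;l_1,\dots,l_m)=\frac{q^{\sum_{j=1}^{m} i_j(i_j+1)}}{(q;q)^2_{l_m}\prod_{j=1}^{m-1}(q;q)_{l_j}},\qquad i_j=\sum_{s=j}^{m} l_s . \]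
   Context: Notation: $(a;q)_n=\prod_{j=0}^{n-1}(1-aq^j)$ and $(q;q)_\infty=\prod_{j\ge 1}(1-q^j)$. Pretzel knots: for positive integers $a_1,\dots,a_n$, $P(a_1,\dots,a_n)$ is the pretzel link obtained by placing $n$ vertical twist regions side by side, the $i$-th containing $a_i$ half-twists all of the same handedness, and joining their ends in the standard way at the top and bottom; the resulting diagram is alternating. Colored Jones polynomial: for a framed link $L$ in $S^3$, decorate each component with the $n$-th Jones–Wenzl idempotent and evaluate in the Kauffman bracket skein module of $S^3$ (variable $A$, with $\Delta_n=(-1)^n\frac{A^{2(n+1)}-A^{-2(n+1)}}{A^2-A^{-2}}$); after normalizing the framing this gives $\tilde J_{n,L}(A)$, and the (reduced) colored Jones polynomial is $J_{n+1,L}(q)=\tilde J_{n,L}(A)/\Delta_n$ with $A=q^{1/4}$; $J_{2,L}$ is the Jones polynomial. Tail: for $P_1,P_2\in\mathbb{Z}[q^{-1}][[q]]$ write $P_1\doteq_n P_2$ if, after multiplying each by a suitable $\pm q^{s}$ so that its expansion starts with its lowest-degree term, their first $n$ coefficients agree. For an alternating link $L$, the tail of its colored Jones polynomial is the power series $T_L(q)$ with $T_L(q)\doteq_n J_{n,L}(q)$ for all $n\ge 1$. Reduced $B$-graph and tail of a graph: for a link diagram $D$, the all-$B$ state is obtained by replacing every crossing by its $B$-smoothing; the $B$-graph has one vertex per circle of this state and one edge per smoothed crossing, and the reduced $B$-graph is obtained by replacing parallel edges by single edges. For a planar graph $G$, the tail $T_G$ denotes the tail of the colored Jones polynomial of an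 alternating link diagram $D$ whose reduced $B$-graph is $G$ (e.g. obtained by replacing each edge of $G$ by a crossing); it depends only on $G$. *)

theory Defs
  imports "HOL-Computational_Algebra.Formal_Laurent_Series" "HOL-Library.FuncSet"
begin

section \<open>Laurent series in the skein variable A\<close>

text \<open>All skein-theoretic quantities live in the field of formal Laurent series
  over the rationals in the variable A (fls_X). Only Laurent polynomials and
  quotients of them by the quantum integers occur.\<close>

type_synonym lser = "rat fls"

definition varA :: lser where "varA = fls_X"
definition varAinv :: lser where "varAinv = fls_X_inv"

text \<open>Value of a trivial circle: delta = -A^2 - A^(-2) (= Delta_1).\<close>
definition loop_val :: lser where
  "loop_val = - (varA ^ 2) - (varAinv ^ 2)"

text \<open>Delta_n = (-1)^n (A^(2(n+1)) - A^(-2(n+1))) / (A^2 - A^(-2)).\<close>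
definition Delta :: "nat \<Rightarrow> lser" where
  "Delta n = (-1) ^ n * (varA ^ (2 * (n + 1)) - varAinv ^ (2 * (n + 1)))
                      / (varA ^ 2 - varAinv ^ 2)"

section \<open>Graph components (closed loops)\<close>

text \<open>Number of connected components of the undirected graph with edge set E
  (vertices: all endpoints of edges).\<close>
definition n_components :: "('p \<times> 'p) set \<Rightarrow> nat" where
  "n_components E = card ((\<lambda>x. ((E \<union> E\<inverse>)\<^sup>*) `` {x}) ` Field E)"

section \<open>Temperley--Lieb algebra and Jones--Wenzl idempotents\<close>

datatype tlpos = Bot nat | Top nat

text \<open>An element of the Temperley-Lieb algebra TL_n: a formal linear combination
  (as a list) of planar matchings of the 2n boundary points Bot 0..n-1 (bottom,
  left to right) and Top 0..n-1 (top, left to right). A matching is a set of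
  pairs (orientation of a pair is irrelevant).\<close>
type_synonym tl = "(lser \<times> (tlpos \<times> tlpos) set) list"

definition tl_id :: "nat \<Rightarrow> tl" where
  "tl_id n = [(1, {(Bot i, Top i) | i. i < n})]"

text \<open>The generator e_(i+1) of TL_n (0-indexed strands i, i+1 capped/cupped).\<close>
definition tl_e :: "nat \<Rightarrow> nat \<Rightarrow> tl" where
  "tl_e n i = [(1, {(Bot i, Bot (Suc i)), (Top i, Top (Suc i))}
                   \<union> {(Bot j, Top j) | j. j < n \<and> j \<noteq> i \<and> j \<noteq> Suc i})]"

text \<open>x \<otimes> 1 : add a vertical strand on the right of an element of TL_n.\<close>
definition tl_tensor1 :: "nat \<Rightarrow> tl \<Rightarrow> tl" where
  "tl_tensor1 n x = map (\<lambda>(c, M). (c, insert (Bot n, Top n) M)) x"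

definition tl_smult :: "lser \<Rightarrow> tl \<Rightarrow> tl" where
  "tl_smult c x = map (\<lambda>(d, M). (c * d, M)) x"

definition tl_minus :: "tl \<Rightarrow> tl \<Rightarrow> tl" where
  "tl_minus x y = x @ tl_smult (-1) y"

text \<open>Stacking of matchings M (below) and N (above) in TL_n: the top points of M
  are glued to the bottom points of N.\<close>
definition stack_graph :: "nat \<Rightarrow> (tlpos \<times> tlpos) set \<Rightarrow> (tlpos \<times> tlpos) set
    \<Rightarrow> ((bool \<times> tlpos) \<times> (bool \<times> tlpos)) set" where
  "stack_graph n M N =
     (\<lambda>(a, b). ((False, a), (False, b))) ` M \<union> (\<lambda>(a, b). ((True, a), (True, b))) ` N
     \<union> {((False, Top i), (True, Bot i)) | i. i < n}"

definition stack_boundary :: "nat \<Rightarrow> (bool \<times> tlpos) set" where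
  "stack_boundary n = {(False, Bot i) | i. i < n} \<union> {(True, Top i) | i. i < n}"

definition stack_match :: "nat \<Rightarrow> (tlpos \<times> tlpos) set \<Rightarrow> (tlpos \<times> tlpos) set
    \<Rightarrow> (tlpos \<times> tlpos) set" where
  "stack_match n M N =
     (let E = stack_graph n M N; R = (E \<union> E\<inverse>)\<^sup>*; B = stack_boundary n in
      {(snd x, snd y) | x y. x \<in> B \<and> y \<in> B \<and> x \<noteq> y \<and> (x, y) \<in> R})"

text \<open>Number of closed loops created by the stacking.\<close>
definition stack_loops :: "nat \<Rightarrow> (tlpos \<times> tlpos) set \<Rightarrow> (tlpos \<times> tlpos) set \<Rightarrow> nat" where
  "stack_loops n M N =
     (let E = stack_graph n M N; R = (E \<union> E\<inverse>)\<^sup>*; B = stack_boundary n in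
      card {R `` {x} | x. x \<in> Field E \<and> R `` {x} \<inter> B = {}})"

text \<open>Product x y in TL_n (y stacked on top of x), closed loops evaluated to delta.\<close>
definition tl_comp :: "nat \<Rightarrow> tl \<Rightarrow> tl \<Rightarrow> tl" where
  "tl_comp n x y =
     concat (map (\<lambda>(c, M). map (\<lambda>(d, N). (c * d * loop_val ^ stack_loops n M N, stack_match n M N)) y) x)"

text \<open>Jones--Wenzl idempotents via Wenzl's recursion
  f_(n+1) = f_n \<otimes> 1 - (Delta_(n-1)/Delta_n) (f_n \<otimes> 1) e_n (f_n \<otimes> 1).\<close>
fun jw :: "nat \<Rightarrow> tl" where
  "jw 0 = [(1, {})]"
| "jw (Suc 0) = tl_id 1"
| "jw (Suc (Suc m)) =
     (let F = tl_tensor1 (Suc m) (jw (Suc m)) in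
      tl_minus F (tl_smult (Delta m / Delta (Suc m))
                   (tl_comp (Suc (Suc m)) (tl_comp (Suc (Suc m)) F (tl_e (Suc (Suc m)) m)) F)))"

section \<open>Kauffman bracket state sums of planar networks\<close>

text \<open>A planar network: a finite index set I of boxes; box i carries a linear combination
  B i of matchings of its endpoints; W is the set of arcs joining endpoints.
  The Kauffman bracket is the state sum over a choice of one term per box, each closed
  loop counting delta.\<close>
definition skein_eval :: "'i set \<Rightarrow> ('i \<Rightarrow> (lser \<times> ('p \<times> 'p) set) list)
    \<Rightarrow> ('p \<times> 'p) set \<Rightarrow> lser" where
  "skein_eval I B W =
     (\<Sum>\<sigma> \<in> PiE I (\<lambda>i. {..<length (B i)}).
        (\<Prod>i\<in>I. fst (B i ! \<sigma> i)) *
        loop_val ^ n_components (W \<union> (\<Union>i\<in>I. snd (B i ! \<sigma> i))))"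

text \<open>A crossing with endpoints p0,p1,p2,p3 in counterclockwise order, where p0,p2 lie
  on the over-strand and p1,p3 on the under-strand:
  <X> = A <A-smoothing> + A^(-1) <B-smoothing>, the A-smoothing joining the two regions
  swept by the over-strand when rotated counterclockwise.\<close>
definition crossing_box :: "'p \<Rightarrow> 'p \<Rightarrow> 'p \<Rightarrow> 'p \<Rightarrow> (lser \<times> ('p \<times> 'p) set) list" where
  "crossing_box p0 p1 p2 p3 =
     [(varA, {(p0, p3), (p1, p2)}), (varAinv, {(p0, p1), (p2, p3)})]"

section \<open>Link diagrams and their coloured (cabled) Kauffman bracket\<close>

text \<open>A link diagram is given by a finite set of crossings C and a set of edges.
  Each crossing has four slots 0,1,2,3 in counterclockwise order, slots 0 and 2 on
  the over-strand, slots 1 and 3 on the under-strand.  An edge ((c,s),(c',s')) joins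
  slot s of crossing c to slot s' of crossing c'.\<close>

datatype 'c cpt = Grid 'c nat nat nat | JWpt tlpos

text \<open>n-parallel blackboard cabling: crossing c becomes an n x n grid of crossings
  Grid c h v _ (row h = 0 northmost, column v = 0 westmost in a local picture where
  slot 0 is west, 1 south, 2 east, 3 north); the n strands at a slot are numbered
  0..n-1 counterclockwise around the crossing.\<close>
definition slot_pt :: "nat \<Rightarrow> 'c \<Rightarrow> nat \<Rightarrow> nat \<Rightarrow> 'c cpt" where
  "slot_pt n c s j =
     (if s = 0 then Grid c j 0 0
      else if s = 1 then Grid c (n - 1) j 1
      else if s = 2 then Grid c (n - 1 - j) (n - 1) 2
      else Grid c 0 (n - 1 - j) 3)"

definition grid_arcs :: "nat \<Rightarrow> 'c set \<Rightarrow> ('c cpt \<times> 'c cpt) set" where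
  "grid_arcs n C =
     {(Grid c h v 2, Grid c h (Suc v) 0) | c h v. c \<in> C \<and> h < n \<and> Suc v < n}
   \<union> {(Grid c (Suc h) v 3, Grid c h v 1) | c h v. c \<in> C \<and> Suc h < n \<and> v < n}"

text \<open>Arcs along the cabled edges; on the distinguished edge e0 the n-th Jones-Wenzl
  idempotent is inserted (bottom points on the first end, top points on the second).
  Strand j at one end of an edge continues as strand n-1-j at the other end.\<close>
definition edge_arcs :: "nat \<Rightarrow> (('c \<times> nat) \<times> ('c \<times> nat)) set \<Rightarrow> (('c \<times> nat) \<times> ('c \<times> nat))
    \<Rightarrow> ('c cpt \<times> 'c cpt) set" where
  "edge_arcs n Ed e0 =
     {(slot_pt n c s j, slot_pt n c' s' (n - 1 - j)) | c s c' s' j.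
        ((c, s), (c', s')) \<in> Ed \<and> ((c, s), (c', s')) \<noteq> e0 \<and> j < n}
   \<union> {(slot_pt n (fst (fst e0)) (snd (fst e0)) j, JWpt (Bot j)) | j. j < n}
   \<union> {(JWpt (Top j), slot_pt n (fst (snd e0)) (snd (snd e0)) (n - 1 - j)) | j. j < n}"

definition cabled_boxes :: "nat \<Rightarrow> ('c \<times> nat \<times> nat) option
    \<Rightarrow> (lser \<times> ('c cpt \<times> 'c cpt) set) list" where
  "cabled_boxes n b =
     (case b of
        None \<Rightarrow> map (\<lambda>(c, M). (c, (\<lambda>(x, y). (JWpt x, JWpt y)) ` M)) (jw n)
      | Some (c, h, v) \<Rightarrow> crossing_box (Grid c h v 0) (Grid c h v 1) (Grid c h v 2) (Grid c h v 3))"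

text \<open>Kauffman bracket <D^n> of the diagram (C, Ed) of a knot, decorated with the n-th
  Jones--Wenzl idempotent (inserted on the edge e0).\<close>
definition coloured_bracket :: "nat \<Rightarrow> 'c set \<Rightarrow> (('c \<times> nat) \<times> ('c \<times> nat)) set
    \<Rightarrow> (('c \<times> nat) \<times> ('c \<times> nat)) \<Rightarrow> lser" where
  "coloured_bracket n C Ed e0 =
     skein_eval (Some ` (C \<times> {..<n} \<times> {..<n}) \<union> {None}) (cabled_boxes n)
                (grid_arcs n C \<union> edge_arcs n Ed e0)"

text \<open>Framing normalisation with writhe w: J~_n = ((-1)^n A^(n^2+2n))^(-w) <D^n>;
  reduced coloured Jones polynomial J_(n+1) = J~_n / Delta_n (as a series in A, A = q^(1/4)).\<close>
definition coloured_jones :: "nat \<Rightarrow> 'c set \<Rightarrow> (('c \<times> nat) \<times> ('c \<times> nat)) set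
    \<Rightarrow> (('c \<times> nat) \<times> ('c \<times> nat)) \<Rightarrow> int \<Rightarrow> lser" where
  "coloured_jones N C Ed e0 w =
     (let n = N - 1 in
      (-1) ^ (n * nat \<bar>w\<bar>) * fls_X_intpow (- w * int (n ^ 2 + 2 * n))
        * coloured_bracket n C Ed e0 / Delta n)"

section \<open>The standard alternating diagram of the pretzel knot P(a0,a1,a2)\<close>

text \<open>Crossing (r,t) is the t-th crossing (from the top) of the r-th vertical twist region.
  Its slots 0,1,2,3 are its SW, SE, NE, NW endpoints (counterclockwise); the over-strand
  runs SW-NE in every crossing, so all half-twists have the same handedness and the
  diagram is alternating. Tops of consecutive regions are joined NE to NW, bottoms
  SE to SW, region 2 being joined back to region 0 by arcs around the outside.\<close>
definition pretzel_crossings :: "(nat \<Rightarrow> nat) \<Rightarrow> (nat \<times> nat) set" where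
  "pretzel_crossings a = {(r, t). r < 3 \<and> t < a r}"

definition pretzel_edges :: "(nat \<Rightarrow> nat) \<Rightarrow> (((nat \<times> nat) \<times> nat) \<times> ((nat \<times> nat) \<times> nat)) set" where
  "pretzel_edges a =
     {(((r, t), 0), ((r, Suc t), 3)) | r t. r < 3 \<and> Suc t < a r}
   \<union> {(((r, t), 1), ((r, Suc t), 2)) | r t. r < 3 \<and> Suc t < a r}
   \<union> {(((r, 0), 2), (((r + 1) mod 3, 0), 3)) | r. r < 3}
   \<union> {(((r, a r - 1), 1), (((r + 1) mod 3, a ((r + 1) mod 3) - 1), 0)) | r. r < 3}"

definition pretzel_jw_edge :: "((nat \<times> nat) \<times> nat) \<times> ((nat \<times> nat) \<times> nat)" where
  "pretzel_jw_edge = (((0, 0), 2), ((1, 0), 3))"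

text \<open>The twist counts (2k+1, 2, 2u+1).\<close>
definition pretzel_twists :: "nat \<Rightarrow> nat \<Rightarrow> nat \<Rightarrow> nat" where
  "pretzel_twists k u r = (if r = 0 then 2 * k + 1 else if r = 1 then 2 else 2 * u + 1)"

text \<open>Writhe of this diagram of P(2k+1,2,2u+1) (a knot): the crossings of the two odd
  regions are positive, those of the middle region negative.\<close>
definition pretzel_writhe :: "nat \<Rightarrow> nat \<Rightarrow> int" where
  "pretzel_writhe k u = int (2 * k + 1) + int (2 * u + 1) - 2"

definition jones_pretzel :: "nat \<Rightarrow> nat \<Rightarrow> nat \<Rightarrow> lser" where
  "jones_pretzel k u N =
     coloured_jones N (pretzel_crossings (pretzel_twists k u))
        (pretzel_edges (pretzel_twists k u)) pretzel_jw_edge (pretzel_writhe k u)"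

section \<open>q-series and the tail relation\<close>

text \<open>A Laurent series P in A is read as a series in q = A^4. Its normalised q-expansion
  (multiplying by a power of q so that it starts with its lowest-degree term) has
  j-th coefficient P_(d+4j), d the lowest A-degree; this requires all A-exponents of
  P to be congruent to d mod 4 (so that P is +-q^s times a series in integral powers of q).\<close>
definition is_q_series :: "lser \<Rightarrow> bool" where
  "is_q_series P \<longleftrightarrow> (\<forall>m. fls_nth P m \<noteq> 0 \<longrightarrow> (4::int) dvd (m - fls_subdegree P))"

definition qcoeff_norm :: "lser \<Rightarrow> nat \<Rightarrow> rat" where
  "qcoeff_norm P j = fls_nth P (fls_subdegree P + 4 * int j)"

text \<open>P \<doteq>_n T: after normalising both by +-q^s, the first n coefficients agree.\<close>
definition tail_agree :: "nat \<Rightarrow> lser \<Rightarrow> rat fps \<Rightarrow> bool" where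
  "tail_agree n P T \<longleftrightarrow> P \<noteq> 0 \<and> T \<noteq> 0 \<and> is_q_series P \<and>
     (\<exists>\<epsilon> \<in> {1, -1}. \<forall>j < n. qcoeff_norm P j = \<epsilon> * fps_nth T (subdegree T + j))"

text \<open>(q;q)_n and (q;q)_infinity (the latter coefficientwise: the coefficient of q^N of
  the infinite product equals that of its truncation at j = N).\<close>
definition qpoch :: "nat \<Rightarrow> rat fps" where
  "qpoch n = (\<Prod>j<n. 1 - fps_X ^ (j + 1))"

definition qpoch_inf :: "rat fps" where
  "qpoch_inf = Abs_fps (\<lambda>N. fps_nth (\<Prod>j\<in>{1..N}. (1 - fps_X ^ j :: rat fps)) N)"

text \<open>g(q; l_1,...,l_m) with i_j = l_j + ... + l_m.\<close>
definition g_fun :: "nat \<Rightarrow> (nat \<Rightarrow> nat) \<Rightarrow> rat fps" where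
  "g_fun m l =
     fps_X ^ (\<Sum>j\<in>{1..m}. (\<Sum>s\<in>{j..m}. l s) * ((\<Sum>s\<in>{j..m}. l s) + 1))
     * inverse (qpoch (l m) ^ 2 * (\<Prod>j\<in>{1..m-1}. qpoch (l j)))"

text \<open>The (k+u)-fold sum over l_1..l_k, p_1..p_u \<ge> 0 of
  g(q;l) g(q;p) (q;q)_(l_k+p_u), as a formal power series: the coefficient of q^N only
  receives contributions from tuples with all entries \<le> N (each term has q-order
  \<ge> l_1+...+l_k and \<ge> p_1+...+p_u).\<close>
definition tail_sum :: "nat \<Rightarrow> nat \<Rightarrow> rat fps" where
  "tail_sum k u = Abs_fps (\<lambda>N.
     \<Sum>l \<in> {1..k} \<rightarrow>\<^sub>E {0..N}. \<Sum>p \<in> {1..u} \<rightarrow>\<^sub>E {0..N}.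
        fps_nth (g_fun k l * g_fun u p * qpoch (l k + p u)) N)"

definition tail_formula :: "nat \<Rightarrow> nat \<Rightarrow> rat fps" where
  "tail_formula k u = qpoch_inf ^ 2 * tail_sum k u"

end

theory Submission
  imports Defs
begin

text \<open>The diagram is three twist regions closed by a frame. Linear combinations of matchings of the strands at
  the regions act as operators on functionals, and the bracket of the diagram is one matrix entry of a product of
  such operators. One projector on a knot can be copied to all six edges of the frame; between projectors every
  twist region becomes a combination of diagrams with \<open>n - t\<close> turnbacks, with Gaussian binomials as
  coefficients. The resulting theta networks satisfy a first-order recursion in each region, which is diagonalised
  by \<open>eta\<close>, so that the bracket is a single sum over \<open>s\<close> of products of one factor for each region. Modulo
  \<open>q ^ (n + 1)\<close> the factor of a region is evaluated by the q-binomial theorem and Durfee squares, and the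
  remaining sum over \<open>s\<close> by the expansion of \<open>(q;q)_m / (q;q)_\<infinity>\<close>.\<close>

section \<open>Matchings of labelled points\<close>

lifting_forget fls.lifting

text \<open>Diagrams are never multiplied as matchings with loop counts. A diagram acts on
  functionals of matchings by pulling them back along gluing, so associativity of stacking is
  composition of maps and the loops are recorded in the factor of \<open>E\<close>. Generators
  \<open>E x y\<close> exist for all pairs of labels, planar or not, and isotopies become identities
  among them, mostly consequences of \<open>E a b * E b c = E a b * Sw a c\<close>.

  The expansion of the twist regions is a triple sum that couples the regions through theta
  networks. An arc closing a face of the frame can be evaluated in either adjacent region, so the
  bubble operators of the three regions agree on these networks. Their common eigenvectors are the
  \<open>eta n s\<close>, with eigenvalue \<open>-[s][2n+1-s]/[n]^2\<close>; the weights
  \<open>Delta (2 * (n - s))\<close> come from the networks in which two regions are turned back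
  completely. This decouples the regions.

  The term for \<open>s\<close> carries a factor \<open>q^s\<close>. Its other factors are therefore
  needed only modulo \<open>q^(n+1-s)\<close>, and at this precision the products in
  \<open>eta\<close> become ordinary q-factorials.\<close>

datatype lab = Lab (column: nat) (is_top: bool) (is_right: bool) (strand: nat)

text \<open>A state tells how the part of the diagram read so far joins its free ends: bottom labels
  are the lower ends of the strands, top labels their current upper ends. The matching is on all
  labels, so that no operation depends on the number of strands. \<open>strand\<close> counts
  outwards from the middle of a twist region.\<close>

typedef state = "{p :: lab => lab. (\<forall>x. p (p x) = x) \<and> (\<forall>x. p x \<noteq> x)}"
 morphisms partner State
proof -
 let ?p = "\<lambda>x. case x of Lab r t s i => Lab r (\<not> t) s i"
 have "?p \<in> {p. (\<forall>x. p (p x) = x) \<and> (\<forall>x. p x \<noteq> x)}" by (auto split: lab.splits)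
 then show ?thesis by blast
qed

setup_lifting type_definition_state

lemma partner_partner [simp]: "partner s (partner s x) = x"
 by transfer simp

lemma partner_neq [simp]: "partner s x \<noteq> x" "x \<noteq> partner s x"
proof -
 show "partner s x \<noteq> x" by transfer simp
 then show "x \<noteq> partner s x" by (rule not_sym)
qed

lemma partner_inject [simp]: "partner s x = partner s y \<longleftrightarrow> x = y"
 by (metis partner_partner)

lemma partner_flip: "partner s x = y \<longleftrightarrow> partner s y = x"
 by auto

text \<open>Gluing a cap onto \<open>x\<close> and \<open>y\<close> joins their former partners, and
  the cup above it is a new arc between \<open>x\<close> and \<open>y\<close>. If they were partners
  already, the state stays the same and the closed loop is counted in \<open>E\<close>; the case
  \<open>x = y\<close> is a default.\<close>

lift_definition cup :: "lab => lab => state => state" is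
 "\<lambda>x y p. if x = y then p else p(p x := p y, p y := p x, x := y, y := x)"
 subgoal for x y p
  by (cases "x = y"; cases "p x = y") (auto, metis+)
 done

lemma partner_cup: "x \<noteq> y ==> partner (cup x y s) =
  (partner s)(partner s x := partner s y, partner s y := partner s x, x := y, y := x)"
 by transfer simp

lemma state_eqI: "(\<And>x. partner s x = partner t x) ==> s = t"
 by transfer auto

lemma cup_same: "partner s x = y ==> cup x y s = s"
 by (rule state_eqI) (auto simp: partner_cup)

lemma cup_sym: "cup x y s = cup y x s"
 by (cases "x = y") (auto intro!: state_eqI simp: partner_cup)

definition transp :: "'a => 'a => 'a => 'a" where
 "transp x y z = (if z = x then y else if z = y then x else z)"

lemma transp_transp [simp]: "transp x y (transp x y z) = z"
 by (simp add: transp_def)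

lift_definition swap :: "lab => lab => state => state" is
 "\<lambda>x y p z. transp x y (p (transp x y z))"
 by (metis transp_transp)

section \<open>The ring of linear operators on functionals of matchings\<close>

text \<open>Since an operator acts on functionals, the leftmost factor of a product is the one that
  meets the state first: products read the diagram upwards.\<close>

typedef op = "{T :: (state => lser) => state => lser.
  (\<forall>f g. T (\<lambda>s. f s + g s) = (\<lambda>s. T f s + T g s)) \<and> (\<forall>c f. T (\<lambda>s. c * f s) = (\<lambda>s. c * T f s))}"
 morphisms ap Op
 by (rule exI[of _ id]) auto

setup_lifting type_definition_op

lemma ap_add: "ap T (\<lambda>s. f s + g s) = (\<lambda>s. ap T f s + ap T g s)"
 by transfer auto

lemma ap_scale: "ap T (\<lambda>s. c * f s) = (\<lambda>s. c * ap T f s)"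
 by transfer auto

lemma op_eqI: "(\<And>f s. ap S f s = ap T f s) ==> S = T"
 by transfer (auto simp: fun_eq_iff)

instantiation op :: ring_1
begin

lift_definition zero_op :: op is "\<lambda>f s. 0" by simp
lift_definition one_op :: op is "\<lambda>f. f" by simp
lift_definition plus_op :: "op => op => op" is "\<lambda>S T f s. S f s + T f s"
 by (auto simp: fun_eq_iff algebra_simps)
lift_definition minus_op :: "op => op => op" is "\<lambda>S T f s. S f s - T f s"
 by (auto simp: fun_eq_iff algebra_simps)
lift_definition uminus_op :: "op => op" is "\<lambda>S f s. - S f s"
 by (auto simp: fun_eq_iff algebra_simps)
lift_definition times_op :: "op => op => op" is "\<lambda>S T f. S (T f)"
 by simp

instance
proof
 fix a b c :: op
 show "a * b * c = a * (b * c)" by transfer simp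
 show "(a + b) * c = a * c + b * c" by transfer simp
 show "a * (b + c) = a * b + a * c" by transfer auto
 show "1 * a = a" "a * 1 = a" by (transfer; simp)+
 show "a + b + c = a + (b + c)" "a + b = b + a" "0 + a = a" "- a + a = 0" "a - b = a + - b"
  by (transfer; auto simp: fun_eq_iff algebra_simps)+
 show "(0::op) \<noteq> 1"
  by transfer (auto simp: fun_eq_iff intro!: exI[of _ "\<lambda>s. 1"])
qed

end

lift_definition sc :: "lser => op" is "\<lambda>c f s. c * f s"
 by (auto simp: fun_eq_iff algebra_simps)

lemma ap_simps [simp]:
 "ap 0 f s = 0" "ap 1 f = f" "ap (S + T) f s = ap S f s + ap T f s"
 "ap (S - T) f s = ap S f s - ap T f s" "ap (- S) f s = - ap S f s"
 "ap (S * T) f = ap S (ap T f)" "ap (sc c) f s = c * f s"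
 by (transfer; simp)+

lemma ap_sc: "ap (sc c) f = (\<lambda>s. c * f s)"
 by (rule ext) simp

lemma sc_simps: "sc 0 = 0" "sc 1 = 1" "sc (a + b) = sc a + sc b" "sc (a - b) = sc a - sc b"
 "sc (- a) = - sc a" "sc (a * b) = sc a * sc b"
 by (rule op_eqI; simp add: algebra_simps)+

lemma sc_sum: "sc (sum f A) = (\<Sum>i\<in>A. sc (f i))"
 by (induction A rule: infinite_finite_induct) (simp_all add: sc_simps)

lemma sc_central: "T * sc c = sc c * T"
 by (rule op_eqI) (simp add: ap_sc ap_scale)

text \<open>Ordered rewriting: scalars move to the front of a product.\<close>
lemma sc_left_commute: "NO_MATCH (sc b) T ==> T * (sc c * S) = sc c * (T * S)"
 by (metis mult.assoc sc_central)

lemma sc_commute': "NO_MATCH (sc b) T ==> T * sc c = sc c * T"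
 by (rule sc_central)

lemmas sc_front = sc_commute' sc_left_commute

section \<open>Turnback generators and transpositions of labels\<close>

definition E :: "lab => lab => op" where
 "E x y = Op (\<lambda>f s. (if partner s x = y then loop_val else 1) * f (cup x y s))"

definition Sw :: "lab => lab => op" where
 "Sw x y = Op (\<lambda>f s. f (swap x y s))"

lemma ap_E [simp]: "ap (E x y) f s = (if partner s x = y then loop_val else 1) * f (cup x y s)"
 unfolding E_def by (subst Op_inverse) (simp_all add: distrib_left mult.left_commute)

lemma ap_Sw [simp]: "ap (Sw x y) f s = f (swap x y s)"
 unfolding Sw_def by (subst Op_inverse) simp_all

lemma partner_swap: "partner (swap x y s) z = transp x y (partner s (transp x y z))"
 by transfer simp

lemma E_sym: "E x y = E y x"
 by (rule op_eqI) (auto simp: cup_sym partner_flip)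

lemma E_square: "x \<noteq> y ==> E x y * E x y = sc loop_val * E x y"
proof (rule op_eqI)
 fix f s assume "x \<noteq> y"
 then have 1: "partner (cup x y s) x = y" by (simp add: partner_cup)
 then show "ap (E x y * E x y) f s = ap (sc loop_val * E x y) f s"
  using cup_same[OF 1] by simp
qed

lemma Sw_square: "Sw x y * Sw x y = 1"
proof (rule op_eqI)
 fix f s
 have "swap x y (swap x y s) = s" by (rule state_eqI) (simp add: partner_swap)
 then show "ap (Sw x y * Sw x y) f s = ap 1 f s" by simp
qed

lemma Sw_E: "Sw x y * E a b = E (transp x y a) (transp x y b) * Sw x y"
proof (rule op_eqI)
 fix f s
 have 1: "partner (swap x y s) a = b \<longleftrightarrow> partner s (transp x y a) = transp x y b"
  by (metis partner_swap transp_transp)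
 have 2: "cup a b (swap x y s) = swap x y (cup (transp x y a) (transp x y b) s)"
 proof (cases "a = b")
  case True
  then show ?thesis by (simp add: cup.rep_eq state_eqI partner_swap)
 next
  case False
  then have n: "transp x y a \<noteq> transp x y b" by (metis transp_transp)
  show ?thesis
  proof (rule state_eqI)
   fix z
   have 3: "transp x y z = w \<longleftrightarrow> z = transp x y w" for w by (metis transp_transp)
   show "partner (cup a b (swap x y s)) z = partner (swap x y (cup (transp x y a) (transp x y b) s)) z"
    by (simp add: partner_cup[OF False] partner_swap partner_cup[OF n] 3)
  qed
 qed
 show "ap (Sw x y * E a b) f s = ap (E (transp x y a) (transp x y b) * Sw x y) f s"
  by (simp add: 1 2)
qed

text \<open>Once \<open>a\<close> and \<open>b\<close> are partners, capping \<open>b\<close> with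
  \<open>c\<close> hands the partner of \<open>c\<close> to \<open>a\<close>. No loop arises and
  only the names \<open>a\<close> and \<open>c\<close> are exchanged. The relations for three and
  four labels below follow from this by conjugation with \<open>Sw\<close>.\<close>

lemma E_E_Sw:
 assumes "distinct [a, b, c]"
 shows "E a b * E b c = E a b * Sw a c"
proof (rule op_eqI)
 fix f s
 have n: "a \<noteq> c" "b \<noteq> c" "a \<noteq> b" using assms by auto
 define t where "t = cup a b s"
 have t: "partner t a = b" "partner t b = a" using n by (auto simp: partner_cup t_def)
 obtain C where C: "partner t c = C" "partner t C = c" by simp
 have d: "C \<noteq> a" "C \<noteq> b" "C \<noteq> c" using t C n by auto
 have "cup b c t = swap a c t"
 proof (rule state_eqI)
  fix z
  consider "z = a" | "z = b" | "z = c" | "z = C" | "z \<noteq> a" "z \<noteq> b" "z \<noteq> c" "z \<noteq> C" by blast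
  then show "partner (cup b c t) z = partner (swap a c t) z"
  proof cases
   case 5
   then have "partner t z \<noteq> a" "partner t z \<noteq> c" using t C by (metis partner_partner)+
   with 5 show ?thesis using t C n d by (simp add: partner_cup[OF n(2)] partner_swap transp_def)
  qed (use t C n d in \<open>simp_all add: partner_cup[OF n(2)] partner_swap transp_def\<close>)
 qed
 then show "ap (E a b * E b c) f s = ap (E a b * Sw a c) f s"
  using t n unfolding t_def by simp
qed

lemma E_comm:
 assumes "distinct [a, b, c, d]"
 shows "E a b * E c d = E c d * E a b"
proof (rule op_eqI)
 fix f s
 have n: "a \<noteq> b" "c \<noteq> d" "a \<noteq> c" "a \<noteq> d" "b \<noteq> c" "b \<noteq> d" using assms by auto
 obtain A B C D where p: "partner s a = A" "partner s b = B" "partner s c = C" "partner s d = D" by blast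
 then have q: "partner s A = a" "partner s B = b" "partner s C = c" "partner s D = d" by auto
 have m: "A \<noteq> a" "B \<noteq> b" "C \<noteq> c" "D \<noteq> d" using p by auto
 have i: "A \<noteq> B" "A \<noteq> C" "A \<noteq> D" "B \<noteq> C" "B \<noteq> D" "C \<noteq> D" using p n by (metis partner_inject)+
 have fl: "C = a \<longleftrightarrow> A = c" "D = a \<longleftrightarrow> A = d" "C = b \<longleftrightarrow> B = c" "D = b \<longleftrightarrow> B = d"
  "B = a \<longleftrightarrow> A = b" "D = c \<longleftrightarrow> C = d" using p q by metis+
 note facts = p q m i n m[symmetric] i[symmetric] n[symmetric] fl
 \<comment> \<open>The second cap closes a loop if its ends were partners from the start or if the
   first cap has just joined them; the latter condition is symmetric in the two caps.\<close>
 have w1: "partner (cup a b s) c = d \<longleftrightarrow> C = d \<or> A = c \<and> B = d \<or> A = d \<and> B = c"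
  by (simp add: partner_cup facts) (metis facts)
 have w2: "partner (cup c d s) a = b \<longleftrightarrow> A = b \<or> A = c \<and> B = d \<or> A = d \<and> B = c"
  by (simp add: partner_cup facts) (metis facts)
 have c: "cup c d (cup a b s) = cup a b (cup c d s)"
 proof (cases "A = b \<or> C = d")
  case True
  then show ?thesis using cup_same w1 w2 p by metis
 next
  case False
  show ?thesis
  proof (rule state_eqI)
   fix z
   consider "A = c" "B = d" | "A = c" "B \<noteq> d" | "A = d" "B = c" | "A = d" "B \<noteq> c" | "A \<noteq> c" "A \<noteq> d" "B = c"
    | "A \<noteq> c" "A \<noteq> d" "B = d" | "A \<noteq> c" "A \<noteq> d" "B \<noteq> c" "B \<noteq> d"  by blast
   then show "partner (cup c d (cup a b s)) z = partner (cup a b (cup c d s)) z"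
    by cases (use facts False in \<open>simp_all add: partner_cup fun_upd_apply\<close>)
  qed
 qed
 have h: "C = d ==> A \<noteq> c \<and> A \<noteq> d" using fl i n by metis
 show "ap (E a b * E c d) f s = ap (E c d * E a b) f s"
  unfolding ap_simps ap_E w1 w2 c p by (cases "A = b"; cases "C = d"; cases "A = c \<and> B = d \<or> A = d \<and> B = c")
   (simp_all add: n n[symmetric] h)
qed

lemma varA_nz [simp]: "varA \<noteq> 0"
 by (simp add: varA_def)

lemma varAinv_eq: "varAinv = inverse varA"
 by (simp add: varA_def varAinv_def fls_inverse_X(1))

lemma varA_varAinv [simp]: "varA * varAinv = 1" "varAinv * varA = 1"
 by (simp_all add: varAinv_eq)

lemma varAinv_nz [simp]: "varAinv \<noteq> 0"
 by (simp add: varAinv_eq)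

lemma loop_val_nz [simp]: "loop_val \<noteq> 0"
proof
 assume "loop_val = 0"
 then have "fls_nth loop_val 2 = 0" by simp
 then show False
  by (simp add: loop_val_def varA_def varAinv_def)
qed

lemma sc_merge: "sc a * sc b = sc (a * b)" "sc a * (sc b * T) = sc (a * b) * T"
 by (simp_all add: sc_simps mult.assoc)

lemmas sc_normal = algebra_simps sc_front sc_merge

lemma sc_cancel:
 assumes "c \<noteq> 0" "sc c * S = sc c * T"
 shows "S = T"
proof -
 have "sc (inverse c) * (sc c * S) = sc (inverse c) * (sc c * T)" using assms by simp
 then show ?thesis using assms(1) by (simp add: mult.assoc[symmetric] sc_simps(6)[symmetric] sc_simps)
qed

lemma push: "S * T = T' * S' ==> S * (T * Z) = T' * (S' * Z)" for Z :: "'a::semigroup_mult"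
 by (simp add: mult.assoc[symmetric])

lemma E_E_E: "distinct [a, b, c] ==> E a b * (E b c * E a b) = E a b"
proof -
 assume d: "distinct [a, b, c]"
 have "E a b * (E b c * E a b) = E a b * Sw a c * E a b"
  using E_E_Sw[OF d] by (simp add: mult.assoc[symmetric])
 also have "... = E a b * E b c * Sw a c"
  using d by (auto simp: mult.assoc Sw_E transp_def E_sym)
 also have "... = E a b"
  by (simp add: E_E_Sw[OF d] mult.assoc Sw_square)
 finally show ?thesis .
qed

text \<open>Conjugation by the transposition hidden in \<open>E a b * E b c\<close> turns
  \<open>E d a\<close> into \<open>E d c\<close>.\<close>

lemma E_E_E_slide: "distinct [a, b, c, d] ==> E a b * (E b c * E d a) = E d c * (E a b * E b c)"
proof -
 assume d: "distinct [a, b, c, d]"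
 then have d3: "distinct [a, b, c]" by auto
 have "E a b * (E b c * E d a) = E a b * Sw a c * E d a"
  using E_E_Sw[OF d3] by (simp add: mult.assoc[symmetric])
 also have "... = E a b * E d c * Sw a c"
  using d by (auto simp: mult.assoc Sw_E transp_def)
 also have "E a b * E d c = E d c * E a b" using d by (intro E_comm) auto
 finally show ?thesis by (simp add: mult.assoc E_E_Sw[OF d3])
qed

text \<open>With \<open>a a'\<close> and \<open>b b'\<close> the ends of two neighbouring strands,
  this passes a closing arc from one strand to the next, which is the recursive term of
  \<open>bubble\<close>.\<close>

lemma E_E_E_E: "distinct [a, a', b, b'] ==> E a a' * (E b a * (E b' a' * E a a')) = E a a' * E b b'"
proof -
 assume d: "distinct [a, a', b, b']"
 then have d3: "distinct [a, a', b']" "distinct [a', a, b]" by auto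
 have "E b a * E b' a' = E b' a' * E b a" using d by (intro E_comm) auto
 then have "E a a' * (E b a * (E b' a' * E a a')) = E a a' * (E a' b' * (E b a * E a a'))"
  by (simp add: mult.assoc[symmetric] E_sym[of b' a'])
 also have "... = E a a' * Sw a b' * (E b a * E a a')"
  using E_E_Sw[OF d3(1)] by (simp add: mult.assoc[symmetric])
 also have "... = E a a' * (E b b' * (E b' a' * Sw a b'))"
 proof -
  have 1: "Sw a b' * E b a = E b b' * Sw a b'" "Sw a b' * E a a' = E b' a' * Sw a b'"
   using d by (auto simp: Sw_E transp_def)
  show ?thesis by (simp add: mult.assoc push[OF 1(1)] 1(2))
 qed
 also have "... = E b b' * (E a a' * (E a' b' * Sw a b'))"
  using E_comm[of a a' b b'] d by (simp add: mult.assoc[symmetric] E_sym[of b' a'])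
 also have "... = E b b' * (E a a' * (Sw a b' * Sw a b'))"
  using E_E_Sw[OF d3(1)] by (simp add: mult.assoc[symmetric])
 also have "... = E a a' * E b b'"
  using E_comm[of a a' b b'] d by (simp add: Sw_square)
 finally show ?thesis .
qed

section \<open>Cabled crossings\<close>

text \<open>Read upwards, the A-smoothing of a crossing in a twist region leaves two vertical
  strands and the B-smoothing is the turnback.\<close>

definition crossing :: "lab => lab => op" where
 "crossing x y = sc varA + sc varAinv * E x y"

lemma commute_crossing: "T * E x y = E x y * T ==> T * crossing x y = crossing x y * T"
 by (simp add: crossing_def algebra_simps sc_front)

lemma intertwine_crossing: "T * E x y = E x' y' * T ==> T * crossing x y = crossing x' y' * T"
 by (simp add: crossing_def algebra_simps sc_front)

lemma E_crossing:
 assumes "x \<noteq> y"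
 shows "E x y * crossing x y = sc (- (varAinv ^ 3)) * E x y"
proof -
 have "E x y * crossing x y = sc (varA + varAinv * loop_val) * E x y"
  using E_square[OF assms] by (simp add: crossing_def sc_simps(3) sc_normal)
 also have "varA + varAinv * loop_val = - (varAinv ^ 3)"
  unfolding loop_val_def varAinv_eq power2_eq_square power3_eq_cube by (simp add: algebra_simps)
 finally show ?thesis .
qed

text \<open>A turnback slides through two crossings. After expansion each side consists of
  \<open>E a b * E b c\<close> and a multiple of \<open>A^2 + delta + A^-2\<close>, which vanishes
  by the value of the loop.\<close>

lemma E_crossing_crossing:
 assumes "distinct [a, b, c]"
 shows "E a b * (crossing b c * crossing a b) = crossing b c * (crossing a b * E b c)"
proof -
 have nd: "a \<noteq> b" "b \<noteq> c" and d': "distinct [c, b, a]" using assms by auto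
 have bc: "E b c * (E a b * E b c) = E b c"
  using E_E_E[OF d'] by (simp add: E_sym[of c b] E_sym[of b a])
 have aux: "varA * varA + loop_val + varAinv * varAinv = 0"
  unfolding loop_val_def power2_eq_square by (simp only: diff_conv_add_uminus) simp
 have "E a b * (crossing b c * crossing a b) =
   sc (varA * varA + loop_val + varAinv * varAinv) * E a b + E a b * E b c"
  using E_E_E[OF assms] E_square[OF nd(1)]
  by (simp add: crossing_def sc_simps(1-3) sc_normal)
 moreover have "crossing b c * (crossing a b * E b c) =
   sc (varA * varA + loop_val + varAinv * varAinv) * E b c + E a b * E b c"
  using bc E_square[OF nd(2)]
  by (simp add: crossing_def sc_simps(1-3) sc_normal)
 ultimately show ?thesis by (simp add: aux sc_simps)
qed

lemma push2: "S * (T * U) = T' * (U' * S') ==> S * (T * (U * Z)) = T' * (U' * (S' * Z))"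
 for Z :: "'a::semigroup_mult"
 by (metis mult.assoc)

lemma crossing_sym: "crossing x y = crossing y x"
 by (simp add: crossing_def E_sym)

primrec chain :: "lab => lab list => op" where
 "chain x [] = 1"
| "chain x (y # ys) = E x y * chain y ys"

text \<open>Labels name positions, not strands: the strand entering at \<open>x\<close> crosses the
  positions \<open>ys\<close> in turn, and after each crossing it sits at the position just
  passed.\<close>

primrec strand_row :: "lab => lab list => op" where
 "strand_row x [] = 1"
| "strand_row x (y # ys) = crossing x y * strand_row y ys"

text \<open>Both lists start in the middle, so the positions from left to right are
  \<open>rev xs @ ys\<close>. The innermost left strand crosses first; after that the right cable
  has moved one position to the left, onto \<open>butlast (x # ys)\<close>.\<close>

primrec cable :: "lab list => lab list => op" where
 "cable [] ys = 1"
| "cable (x # xs) ys = strand_row x ys * cable xs (butlast (x # ys))"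

lemma cable_Nil [simp]: "cable xs [] = 1"
 by (induction xs) auto

lemma commute_chain:
 "successively (\<lambda>a b. T * E a b = E a b * T) (x # ys) ==> T * chain x ys = chain x ys * T"
proof (induction ys arbitrary: x)
 case (Cons y ys)
 then show ?case by (simp add: push[of T "E x y" "E x y" T] mult.assoc)
qed simp

lemma intertwine_strand_row:
 "successively (\<lambda>a b. T * E a b = E (f a) (f b) * T) (x # ys) ==>
  T * strand_row x ys = strand_row (f x) (map f ys) * T"
proof (induction ys arbitrary: x)
 case (Cons y ys)
 then show ?case
  by (simp add: push[OF intertwine_crossing[of T x y "f x" "f y"]] mult.assoc)
qed simp

lemma successively_butlast: "successively P xs ==> successively P (butlast xs)"
 by (metis append_butlast_last_id butlast.simps(1) successively_append_iff)

lemma intertwine_cable: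
 "successively (\<lambda>a b. T * E a b = E (f a) (f b) * T) (rev xs @ ys) ==>
  T * cable xs ys = cable (map f xs) (map f ys) * T"
proof (induction xs arbitrary: ys)
 case (Cons x xs)
 have 1: "successively (\<lambda>a b. T * E a b = E (f a) (f b) * T) (x # ys)"
  using Cons.prems by (auto simp: successively_append_iff)
 have "successively (\<lambda>a b. T * E a b = E (f a) (f b) * T) (butlast (rev xs @ (x # ys)))"
  using Cons.prems by (intro successively_butlast) simp
 then have 2: "successively (\<lambda>a b. T * E a b = E (f a) (f b) * T) (rev xs @ butlast (x # ys))"
  by (simp add: butlast_append split: if_splits)
 show ?case
  using push[OF intertwine_strand_row[OF 1]] Cons.IH[OF 2] by (simp add: mult.assoc map_butlast)
qed simp

lemma commute_strand_row:
 "successively (\<lambda>a b. T * E a b = E a b * T) (x # ys) ==> T * strand_row x ys = strand_row x ys * T"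
 using intertwine_strand_row[of T "\<lambda>x. x"] by simp

lemma commute_cable:
 "successively (\<lambda>a b. T * E a b = E a b * T) (rev xs @ ys) ==> T * cable xs ys = cable xs ys * T"
 using intertwine_cable[of T "\<lambda>x. x"] by simp

lemma successively_distinctI:
 "distinct xs ==> (\<And>a b. a \<in> set xs ==> b \<in> set xs ==> a \<noteq> b ==> P a b) ==> successively P xs"
 by (induction xs rule: induct_list012) auto

lemma E_strand_row_commute:
 "distinct (a # b # x # ys) ==> E a b * strand_row x ys = strand_row x ys * E a b"
 by (rule commute_strand_row, rule successively_distinctI) (auto intro!: E_comm)

lemma E_chain_commute:
 "distinct (a # b # x # ys) ==> E a b * chain x ys = chain x ys * E a b"
 by (rule commute_chain, rule successively_distinctI) (auto intro!: E_comm)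

lemma E_cable_commute:
 "distinct (a # b # xs @ ys) ==> E a b * cable xs ys = cable xs ys * E a b"
 by (rule commute_cable, rule successively_distinctI) (auto intro!: E_comm)

lemma crossing_cable_commute:
 "distinct (a # b # xs @ ys) ==> cable xs ys * crossing a b = crossing a b * cable xs ys"
 by (rule commute_crossing) (rule E_cable_commute[symmetric])

section \<open>Sliding cups through cabled crossings\<close>

lemma E_strand_row_slide:
 "distinct (x # ys) ==> Suc i < length ys ==>
  E (ys ! i) (ys ! Suc i) * strand_row x ys = strand_row x ys * E ((x # ys) ! i) (ys ! i)"
proof (induction ys arbitrary: x i)
 case (Cons y ys)
 show ?case
 proof (cases i)
  case 0
  then obtain z zs where ys: "ys = z # zs" using Cons.prems by (cases ys) auto
  have d: "distinct [z, y, x]" "distinct (x # y # z # zs)" using Cons.prems ys by auto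
  have c: "E y z * (crossing x y * crossing y z) = crossing x y * (crossing y z * E x y)"
   using E_crossing_crossing[OF d(1)] by (simp add: crossing_sym[of y x] crossing_sym[of z y] E_sym[of z y] E_sym[of y x])
  then show ?thesis
   using 0 ys E_strand_row_commute[OF d(2)] by (simp add: mult.assoc push2[OF c])
 next
  case (Suc j)
  then have j: "Suc j < length ys" using Cons.prems by simp
  then have "ys ! j \<in> set ys" "ys ! Suc j \<in> set ys" "ys ! j \<noteq> ys ! Suc j"
   using Cons.prems by (simp_all add: nth_eq_iff_index_eq)
  moreover have "x \<notin> set ys" "y \<notin> set ys" "x \<noteq> y" using Cons.prems by auto
  ultimately have "distinct [ys ! j, ys ! Suc j, x, y]"
   by (metis distinct_length_2_or_more distinct_singleton)
  note d = this
  have c: "E (ys ! j) (ys ! Suc j) * crossing x y = crossing x y * E (ys ! j) (ys ! Suc j)"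
   by (rule commute_crossing) (rule E_comm[OF d])
  then show ?thesis
   using Suc Cons.IH[OF _ j] Cons.prems by (simp add: push[OF c] mult.assoc)
 qed
qed simp

text \<open>A turnback between neighbours of the right cable is pulled through all left strands, one
  row at a time, and comes out at the left, where the right cable leaves the crossing.\<close>

lemma E_cable_slide_right:
 "distinct (xs @ ys) ==> Suc i < length ys ==>
  E (ys ! i) (ys ! Suc i) * cable xs ys = cable xs ys * E ((rev xs @ ys) ! i) ((rev xs @ ys) ! Suc i)"
proof (induction xs arbitrary: ys)
 case (Cons x xs)
 let ?zs = "butlast (x # ys)"
 have z: "?zs ! i = (x # ys) ! i" "?zs ! Suc i = (x # ys) ! Suc i" "Suc i < length ?zs"
  using Cons.prems by (cases i; auto simp: nth_butlast)+
 have "distinct (xs @ ?zs)" using Cons.prems by (auto simp: distinct_butlast dest: in_set_butlastD)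
 from Cons.IH[OF this z(3)]
 have IH: "E ((x # ys) ! i) (ys ! i) * cable xs ?zs
   = cable xs ?zs * E ((rev xs @ ?zs) ! i) ((rev xs @ ?zs) ! Suc i)"
  unfolding z by simp
 have "rev xs @ ?zs = butlast (rev (x # xs) @ ys)" by (simp add: butlast_append)
 then have "(rev xs @ ?zs) ! j = (rev (x # xs) @ ys) ! j" if "j \<le> Suc i" for j
  using that Cons.prems by (simp only: nth_butlast) (auto simp: nth_butlast)
 then show ?case
  using push[OF E_strand_row_slide[of x ys i]] IH Cons.prems by (simp add: mult.assoc)
qed simp

text \<open>A turnback between two neighbouring left strands passes one pair of crossings after the
  other by \<open>E_crossing_crossing\<close> and leaves at the two rightmost positions.\<close>

lemma E_two_rows_slide:
 "distinct (x # x' # ys) ==>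
  E x' x * (strand_row x ys * strand_row x' (butlast (x # ys)))
   = strand_row x ys * strand_row x' (butlast (x # ys)) * E (rev (x' # x # ys) ! 1) (rev (x' # x # ys) ! 0)"
proof (induction ys arbitrary: x x')
 case (Cons y ys)
 have d: "distinct [x', x, y]" "distinct (y # x # ys)" using Cons.prems by auto
 have c: "strand_row y ys * crossing x' x = crossing x' x * strand_row y ys"
  by (rule commute_crossing) (use Cons.prems in \<open>auto intro!: E_strand_row_commute[symmetric]\<close>)
 have 1: "E x' x * (crossing x y * crossing x' x) = crossing x y * (crossing x' x * E x y)"
  by (rule E_crossing_crossing[OF d(1)])
 have "strand_row x (y # ys) * strand_row x' (butlast (x # y # ys))
   = crossing x y * (crossing x' x * (strand_row y ys * strand_row x (butlast (y # ys))))"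
  by (simp add: mult.assoc push[OF c])
 moreover have "rev (x' # x # y # ys) ! j = rev (x # y # ys) ! j" if "j \<le> 1" for j
  using nth_append_left[of j "rev (x # y # ys)" "[x']"] that by simp
 ultimately show ?case
  using Cons.IH[OF d(2)]
  by (simp add: mult.assoc push2[OF 1] E_sym[of x y] del: rev.simps strand_row.simps butlast.simps)
qed simp

lemma E_cable_slide_left:
 "distinct (xs @ ys) ==> Suc i < length xs ==>
  E (xs ! i) (xs ! Suc i) * cable xs ys = cable xs ys * E ((rev ys @ xs) ! i) ((rev ys @ xs) ! Suc i)"
proof (induction xs arbitrary: ys i)
 case (Cons x xs)
 let ?zs = "butlast (x # ys)"
 have d: "distinct (xs @ ?zs)" using Cons.prems by (auto simp: distinct_butlast dest: in_set_butlastD)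
 show ?case
 proof (cases i)
  case 0
  then obtain x' xs' where xs: "xs = x' # xs'" using Cons.prems by (cases xs) auto
  let ?a = "rev (x' # x # ys) ! 1" and ?b = "rev (x' # x # ys) ! 0"
  obtain us p q where u: "x' # x # ys = us @ [p, q]"
   by (metis append_Cons append_Nil append_assoc list.exhaust rev_exhaust)
  then have ab: "?a = p" "?b = q" by simp_all
  have "butlast (x' # butlast (x # ys)) = butlast (butlast (x' # x # ys))" by simp
  then have bl: "butlast (x' # ?zs) = us" unfolding u by (simp add: butlast_append)
  have "distinct (xs' @ x' # x # ys)" using Cons.prems xs by auto
  then have "distinct (xs' @ us @ [p, q])" by (simp only: u)
  then    have "distinct (?a # ?b # xs' @ butlast (x' # ?zs))"
   unfolding ab bl by auto
  from E_cable_commute[OF this]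
  have "E ?a ?b * cable xs' (butlast (x' # ?zs)) = cable xs' (butlast (x' # ?zs)) * E ?a ?b" .
  moreover have "E x' x * (strand_row x ys * strand_row x' ?zs) = strand_row x ys * strand_row x' ?zs * E ?a ?b"
   using Cons.prems xs by (intro E_two_rows_slide) auto
  ultimately have "E x' x * cable (x # xs) ys = cable (x # xs) ys * E ?a ?b"
   using xs by (simp add: mult.assoc del: rev.simps butlast.simps) (metis mult.assoc)
  moreover have "rev (x' # x # ys) ! j = (rev ys @ x # xs) ! j" if "j \<le> 1" for j
   using nth_append_left[of j "rev (x' # x # ys)" xs'] that xs by simp
  ultimately have "E x' x * cable (x # xs) ys = cable (x # xs) ys * E ((rev ys @ x # xs) ! 1) ((rev ys @ x # xs) ! 0)"
   by (simp del: rev.simps cable.simps)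
  then show ?thesis using 0 xs E_sym by (simp del: cable.simps)
 next
  case (Suc j)
  then have j: "Suc j < length xs" using Cons.prems by simp
  then have "xs ! j \<in> set xs" "xs ! Suc j \<in> set xs" "xs ! j \<noteq> xs ! Suc j"
   using Cons.prems by (simp_all add: nth_eq_iff_index_eq)
  then have "distinct (xs ! j # xs ! Suc j # x # ys)" using Cons.prems by auto
  note 1 = E_strand_row_commute[OF this]
  have "rev ?zs @ xs = tl (rev ys @ (x # xs))"
   by (cases ys rule: rev_cases) (simp_all add: butlast_append)
  then have "(rev ?zs @ xs) ! m = (rev ys @ (x # xs)) ! Suc m" if "m \<le> Suc j" for m
   using that j by (simp add: nth_tl)
  then show ?thesis using Suc Cons.IH[OF d j] by (simp add: mult.assoc push[OF 1])
 qed
qed simp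

text \<open>The only property of Jones-Wenzl projectors that the expansion of crossings uses: a
  turnback between neighbouring strands vanishes against the part of the diagram above it
  (\<open>R\<close>) or below it (\<open>L\<close>).\<close>

abbreviation uncapped :: "lab list => op => bool" where
 "uncapped ps R \<equiv> successively (\<lambda>a b. E a b * R = 0) ps"

abbreviation uncupped :: "lab list => op => bool" where
 "uncupped ps L \<equiv> successively (\<lambda>a b. L * E a b = 0) ps"

lemma uncapped_rev: "uncapped (rev ps) R \<longleftrightarrow> uncapped ps R"
 by (simp add: E_sym)

lemma successively_nth: "successively P xs \<longleftrightarrow> (\<forall>i. Suc i < length xs \<longrightarrow> P (xs ! i) (xs ! Suc i))"
 by (simp add: successively_conv_nth)

lemma uncapped_cable_right:
 assumes "distinct (xs @ ys)" "uncapped (take (length ys) (rev xs @ ys)) R"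
 shows "uncapped ys (cable xs ys * R)"
 unfolding successively_nth
proof (intro allI impI)
 fix i assume i: "Suc i < length ys"
 then have "E ((rev xs @ ys) ! i) ((rev xs @ ys) ! Suc i) * R = 0"
  using assms(2) unfolding successively_nth by (auto simp del: take_append)
 then show "E (ys ! i) (ys ! Suc i) * (cable xs ys * R) = 0"
  using push[OF E_cable_slide_right[OF assms(1) i]] by (simp add: mult.assoc)
qed

lemma uncapped_cable_left:
 assumes "distinct (xs @ ys)" "uncapped (take (length xs) (rev ys @ xs)) R"
 shows "uncapped xs (cable xs ys * R)"
 unfolding successively_nth
proof (intro allI impI)
 fix i assume i: "Suc i < length xs"
 then have "E ((rev ys @ xs) ! i) ((rev ys @ xs) ! Suc i) * R = 0"
  using assms(2) unfolding successively_nth by (auto simp del: take_append)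
 then show "E (xs ! i) (xs ! Suc i) * (cable xs ys * R) = 0"
  using push[OF E_cable_slide_left[OF assms(1) i]] by (simp add: mult.assoc)
qed

text \<open>\<open>cable\<close> peels off strands of the left cable; this is the dual reading, in
  which the outermost strand of the right cable crosses last.\<close>

lemma cable_snoc:
 "distinct (xs @ zs @ [z]) ==>
  cable xs (zs @ [z]) = cable xs zs * strand_row z (take (length xs) (rev zs @ xs))"
proof (induction xs arbitrary: zs z)
 case (Cons x xs)
 show ?case
 proof (cases zs rule: rev_cases)
  case Nil
  then show ?thesis
   using Cons.IH[of "[]" x] Cons.prems by (simp add: crossing_sym[of z])
 next
  case (snoc vs w)
  have row: "strand_row x (zs @ [z]) = strand_row x zs * crossing w z" for x
   unfolding snoc by (induction vs arbitrary: x) (simp_all add: mult.assoc)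
  have c: "cable xs (x # vs) * crossing w z = crossing w z * cable xs (x # vs)"
   using Cons.prems snoc by (intro crossing_cable_commute) auto
  have "cable xs (x # zs) = cable xs (x # vs) * strand_row w (take (length xs) (rev (x # vs) @ xs))"
   using Cons.IH[of "x # vs" w] Cons.prems snoc by auto
  then have "cable (x # xs) (zs @ [z]) =
    strand_row x zs * (cable xs (x # vs) * (crossing w z * strand_row w (take (length xs) (rev (x # vs) @ xs))))"
   by (simp add: butlast_append row mult.assoc push[OF c])
  also have "cable (x # xs) zs = strand_row x zs * cable xs (x # vs)"
   using snoc by (simp add: butlast_append)
  ultimately show ?thesis
   using snoc by (simp add: mult.assoc crossing_sym[of w])
 qed
qed simp

lemma strand_row_uncupped: "uncupped (x # ys) L ==> L * strand_row x ys = sc (varA ^ length ys) * L"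
proof (induction ys arbitrary: x)
 case (Cons y ys)
 then have "L * crossing x y = sc varA * L"
  by (simp add: crossing_def sc_normal)
 then show ?case
  using Cons by (simp add: push[of L "crossing x y" "sc varA" L] sc_merge)
qed (simp add: sc_simps)

text \<open>At each crossing the A-smoothing would let the turnback \<open>E x y\<close> rise past
  the remaining crossings to \<open>R\<close>, where it vanishes. Hence every crossing takes the
  B-smoothing.\<close>

lemma E_strand_row:
 "distinct (x # y # ys) ==> uncapped (butlast (x # y # ys)) R ==>
  E x y * (strand_row y ys * R) = sc (varAinv ^ length ys) * (E x y * (chain y ys * R))"
proof (induction ys arbitrary: x y)
 case (Cons z zs)
 have d: "distinct (x # y # z # zs)" using Cons.prems by simp
 have 0: "E x y * R = 0" using Cons.prems(2) by simp
 have "uncapped (butlast (y # z # zs)) R" using Cons.prems(2) by (simp split: if_splits)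
 then have IH: "E y z * (strand_row z zs * R) = sc (varAinv ^ length zs) * (E y z * (chain z zs * R))"
  using Cons.IH d by simp
 have "E x y * (strand_row z zs * R) = 0"
  using push[OF E_strand_row_commute[OF d]] 0 by simp
 then show ?case
  using IH by (simp add: crossing_def sc_normal)
qed (simp add: sc_simps)

text \<open>Only the first crossing has a choice. If it is A-smoothed, \<open>L\<close> below forces
  A at all others; if it is B-smoothed, \<open>R\<close> above forces B.\<close>

lemma strand_row_expand:
 assumes "distinct (x # y # ys)" "uncupped (y # ys) L" "uncapped (butlast (x # y # ys)) R"
 shows "L * (strand_row x (y # ys) * R) =
  sc (varA ^ Suc (length ys)) * (L * R) + sc (varAinv ^ Suc (length ys)) * (L * (chain x (y # ys) * R))"
 using E_strand_row[OF assms(1,3)] push[OF strand_row_uncupped[OF assms(2)]]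
 by (simp add: crossing_def sc_normal)

section \<open>Chains of turnbacks and the shift of positions they cause\<close>

primrec links :: "lab list => op" where
 "links [] = 1"
| "links (x # xs) = chain x xs"

lemma links_Cons: "links (x # y # xs) = E x y * links (y # xs)"
 by simp

lemma links_append: "links (xs @ [x]) * links (x # ys) = links (xs @ x # ys)"
 by (induction xs rule: induct_list012) (simp_all add: mult.assoc)

lemma E_links_commute: "distinct (a # b # ps) ==> E a b * links ps = links ps * E a b"
 by (cases ps) (simp_all add: E_chain_commute)

text \<open>The last turnback of the chain meets its own copy and closes a loop; the others then
  straighten one after the other by \<open>E_E_E\<close>.\<close>

lemma links_rev:
 "distinct (a # b # ps) ==> links (a # b # ps) * links (rev (a # b # ps)) = sc loop_val * E a b"
proof (induction ps arbitrary: a b)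
 case Nil
 then show ?case using E_square[of a b] by (simp add: E_sym[of b a])
next
 case (Cons c ps)
 have "links (rev (a # b # c # ps)) = links (rev (b # c # ps)) * E a b"
  using links_append[of "rev (c # ps)" b "[a]"] by (simp add: E_sym[of b a])
 moreover have "links (b # c # ps) * links (rev (b # c # ps)) = sc loop_val * E b c"
  using Cons.IH[of b c] Cons.prems by simp
 ultimately have "links (a # b # c # ps) * links (rev (a # b # c # ps))
   = E a b * (sc loop_val * E b c * E a b)"
  unfolding links_Cons[of a b] by (simp add: mult.assoc[symmetric] del: links.simps rev.simps)
    (simp add: mult.assoc del: links.simps rev.simps)
 also have "... = sc loop_val * E a b"
  using E_E_E[of a b c] Cons.prems by (simp add: mult.assoc sc_front)
 finally show ?case .
qed

text \<open>A chain of turnbacks moves the strands by two positions, so a turnback pulled through it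
  reappears two places further.\<close>

lemma links_shift:
 "distinct ps ==> Suc (Suc (Suc i)) < length ps ==>
  links ps * E (ps ! i) (ps ! Suc i) = E (ps ! Suc (Suc i)) (ps ! Suc (Suc (Suc i))) * links ps"
proof (induction ps arbitrary: i)
 case (Cons a ps)
 show ?case
 proof (cases i)
  case 0
  then obtain b c d qs where ps: "ps = b # c # d # qs"
   using Cons.prems by (cases ps; cases "tl ps"; cases "tl (tl ps)") auto
  have dd: "distinct [a, b, c]" "distinct [d, c, b]" "distinct [a, b, c, d]" "distinct (a # b # d # qs)"
   using Cons.prems ps by auto
  note 1 = E_links_commute[OF dd(4), symmetric]
  have 2: "E a b * (E b c * (E c d * E a b)) = E a b * E c d"
   using E_E_E[OF dd(1)] E_comm[OF dd(3)] by (metis mult.assoc)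
  have 3: "E c d * (E a b * (E b c * E c d)) = E a b * E c d"
   using E_E_E[OF dd(2)] E_comm[OF dd(3)] E_sym[of d c] E_sym[of c b] by (metis mult.assoc)
  show ?thesis
   using 0 1 push2[of "E a b" "E b c" "E c d * E a b"] 2 3 unfolding ps
   by (simp add: mult.assoc) (metis mult.assoc)
 next
  case (Suc j)
  then have j: "Suc (Suc (Suc j)) < length ps" using Cons.prems by simp
  then obtain b qs where ps: "ps = b # qs" by (cases ps) auto
  have "qs ! Suc j \<in> set qs" "qs ! Suc (Suc j) \<in> set qs" "qs ! Suc j \<noteq> qs ! Suc (Suc j)"
   using Cons.prems j ps by (simp_all add: nth_eq_iff_index_eq)
  then have "distinct [a, b, qs ! Suc j, qs ! Suc (Suc j)]" using Cons.prems ps by auto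
  from E_comm[OF this] show ?thesis
   using Cons.IH[OF _ j] Cons.prems Suc unfolding ps links_Cons[of a b]
   by (simp add: mult.assoc push[OF E_comm[OF \<open>distinct [a, b, qs ! Suc j, qs ! Suc (Suc j)]\<close>, symmetric]] del: links.simps)
 qed
qed simp

text \<open>The same shift for a turnback with one end \<open>d\<close> outside the chain: only the
  end \<open>a\<close> moves, namely to \<open>c\<close>.\<close>

lemma links_shift_outer:
 "distinct (d # a # b # c # ps) ==>
  links (a # b # c # ps) * E d a = E d c * links (a # b # c # ps)"
proof -
 assume d: "distinct (d # a # b # c # ps)"
 then have d4: "distinct [a, b, c, d]" by auto
 have "links (c # ps) * E d a = E d a * links (c # ps)"
  using E_links_commute[of d a "c # ps"] d by simp
 then show ?thesis
  using E_E_E_slide[OF d4] E_sym[of c d] unfolding links_Cons by (metis mult.assoc)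
qed

text \<open>A strand turning back below a cable is pulled through it: it meets the cable in a
 strand that runs straight up to a turnback-free top.\<close>
lemma chain_cable:
 assumes d: "distinct (x # y # ys @ xs)" and l: "length xs = length ys"
  and R: "uncapped (y # ys) R"
 shows "chain x (y # ys) * (cable xs (butlast (x # y # ys)) * R)
  = sc (varAinv ^ length ys) * (E x y * (cable xs ys * R))"
proof (cases ys rule: rev_cases)
 case Nil
 then show ?thesis using l by (simp add: sc_simps)
next
 case (snoc us w)
 obtain zs z where z: "x # y # us = zs @ [z]" by (metis list.distinct(1) rev_exhaust)
 let ?ps = "x # y # ys"
 have ps: "?ps = zs @ [z, w]" using snoc z by simp
 have lz: "length zs = length ys" using arg_cong[OF ps, of length] by simp
 have "distinct ((zs @ [z, w]) @ xs)" using d unfolding ps[symmetric] by simp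
 then have dz: "distinct (z # w # xs @ zs)" by auto
 have bl: "butlast ?ps = zs @ [z]" unfolding ps by (simp add: butlast_append)
 have nth: "?ps ! i = zs ! i" "?ps ! Suc (Suc i) = ys ! i" if "i < length zs" for i
  using that nth_append_left[of i zs "[z, w]"] by (simp_all only: ps[symmetric]) simp
 \<comment> \<open>The renaming caused by the chain: \<open>zs\<close> moves by two positions onto
   \<open>ys\<close>, while the strands \<open>xs\<close> of the other cable stay.\<close>
 define f where "f a = (if a \<in> set xs then a else the (map_of (zip zs ys) a))" for a
 have fx: "map f xs = xs" by (rule map_idI) (simp add: f_def)
 have fzi: "f (zs ! i) = ys ! i" if "i < length zs" for i
  using that lz dz by (auto simp: f_def map_of_zip_nth dest: nth_mem)
 then have fz: "map f zs = ys" using lz by (auto intro: nth_equalityI)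
 have "successively (\<lambda>a b. links ?ps * E a b = E (f a) (f b) * links ?ps) zs"
  unfolding successively_nth
 proof (intro allI impI)
  fix i assume i: "Suc i < length zs"
  then show "links ?ps * E (zs ! i) (zs ! Suc i) = E (f (zs ! i)) (f (zs ! Suc i)) * links ?ps"
   using links_shift[of ?ps i] nth[of i] nth[of "Suc i"] fzi[of i] fzi[of "Suc i"] d lz
   by (simp del: links.simps)
 qed
 moreover have "successively (\<lambda>a b. links ?ps * E a b = E (f a) (f b) * links ?ps) (rev xs)"
 proof (rule successively_distinctI)
  fix a b assume "a \<in> set (rev xs)" "b \<in> set (rev xs)" "a \<noteq> b"
  then show "links ?ps * E a b = E (f a) (f b) * links ?ps"
   using d by (intro trans[OF E_links_commute[symmetric]]) (auto simp: f_def)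
 qed (use dz in simp)
 moreover have "links ?ps * E a b = E (f a) (f b) * links ?ps"
  if "a = last (rev xs)" "b = hd zs" for a b
 proof -
  obtain c cs where c: "ys = c # cs" using snoc by (metis append_is_Nil_conv neq_Nil_conv not_Cons_self2)
  obtain e es where e: "xs = e # es" using l c by (cases xs) auto
  have "zs \<noteq> []" using lz c by auto
  then have zh: "hd zs = x" using ps by (cases zs) auto
  then have "f x = c" using fzi[of 0] \<open>zs \<noteq> []\<close> c by (simp add: hd_conv_nth)
  moreover have "f e = e" using e by (simp add: f_def)
  ultimately show ?thesis
   using links_shift_outer[of e x y c cs] that e c zh d by (auto simp del: links.simps)
 qed
 ultimately have "successively (\<lambda>a b. links ?ps * E a b = E (f a) (f b) * links ?ps) (rev xs @ zs)"
  by (auto simp: successively_append_iff)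
 from intertwine_cable[OF this] have shift: "links ?ps * cable xs zs = cable xs ys * links ?ps"
  by (simp only: fx fz)
 have E_cab: "E z w * cable xs zs = cable xs zs * E z w"
  using dz by (intro E_cable_commute)
 have E_cab': "E x y * cable xs ys = cable xs ys * E x y"
  using d by (intro E_cable_commute) auto
 have split: "links ?ps = links (zs @ [z]) * E z w"
  using links_append[of zs z "[w]"] unfolding ps by simp
 define V where "V = E z w * chain z (rev zs)"
 have V: "V = links (rev ?ps)" unfolding ps V_def by (simp add: E_sym)
 have EV: "E z w * V = sc loop_val * V"
  using E_square[of z w] dz by (simp add: V_def mult.assoc[symmetric])
 \<comment> \<open>The chain is completed by the missing turnback \<open>E z w\<close> at the price
   of a loop; \<open>links_rev\<close> returns this loop, so that it cancels.\<close>
 have "sc loop_val * (links (zs @ [z]) * (cable xs zs * V)) = links (zs @ [z]) * (cable xs zs * (E z w * V))"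
  by (simp add: EV sc_front)
 also have "... = links ?ps * (cable xs zs * V)"
  by (simp only: split mult.assoc push[OF E_cab, symmetric])
 also have "... = cable xs ys * (links ?ps * V)"
  by (simp only: push[OF shift])
 also have "... = sc loop_val * (E x y * cable xs ys)"
  unfolding V using links_rev[of x y ys] d by (simp add: E_cab' sc_front del: links.simps rev.simps)
 finally have K: "links (zs @ [z]) * (cable xs zs * V) = E x y * cable xs ys"
  by (rule sc_cancel[OF loop_val_nz])
 have rp: "rev ?ps = w # z # rev zs" unfolding ps by simp
 have "butlast (rev ?ps) = rev (y # ys)" by (simp add: butlast_append)
 then have bR: "uncapped (butlast (w # z # rev zs)) R"
  unfolding rp[symmetric] using R uncapped_rev by metis
 have row: "E z w * (strand_row z (rev zs) * R) = sc (varAinv ^ length ys) * (V * R)"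
  using E_strand_row[OF _ bR] dz lz by (auto simp: V_def E_sym[of w z] mult.assoc)
 have "cable xs (butlast ?ps) = cable xs zs * strand_row z (rev zs)"
  unfolding bl using cable_snoc[of xs zs z] dz l lz by auto
 then have "chain x (y # ys) * (cable xs (butlast ?ps) * R)
   = links ?ps * (cable xs zs * (strand_row z (rev zs) * R))"
  by (simp add: mult.assoc)
 also have "... = links (zs @ [z]) * (cable xs zs * (E z w * (strand_row z (rev zs) * R)))"
  by (simp only: split mult.assoc push[OF E_cab])
 also have "... = sc (varAinv ^ length ys) * (links (zs @ [z]) * (cable xs zs * V) * R)"
  by (simp add: row sc_front mult.assoc)
 finally show ?thesis unfolding K by (simp add: mult.assoc)
qed

lemma uncapped_cable:
 assumes d: "distinct (x # y # xs @ ys)" and l: "length xs = length ys"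
  and R: "uncapped (x # xs) R"
 shows "uncapped (butlast (x # y # ys)) (cable xs (butlast (x # y # ys)) * R)"
proof (rule uncapped_cable_right)
 show "distinct (xs @ butlast (x # y # ys))"
  using d by (auto simp: distinct_butlast dest: in_set_butlastD)
 have "take (length (butlast (x # y # ys))) (rev xs @ butlast (x # y # ys)) = rev (x # xs)"
  using l by simp
 then show "uncapped (take (length (butlast (x # y # ys))) (rev xs @ butlast (x # y # ys))) R"
  using R uncapped_rev by metis
qed

text \<open>The innermost strands of both cables, joined below by a turnback, can be pulled out of
  the crossing. Their own crossing is a kink with factor \<open>- A^-3\<close>; freeing them from
  the two cables contributes \<open>A^-1\<close> for each of the \<open>2 * length ys\<close>
  crossings.\<close>

lemma E_cable:
 assumes d: "distinct (x # y # xs @ ys)" and l: "length xs = length ys"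
  and R: "uncapped (x # xs) R" "uncapped (y # ys) R"
 shows "E x y * (cable (x # xs) (y # ys) * R)
  = sc (- (varAinv ^ (3 + 2 * length ys))) * (E x y * (cable xs ys * R))"
proof -
 let ?R = "cable xs (butlast (x # y # ys)) * R"
 have ne: "x \<noteq> y" and d': "distinct (x # y # ys @ xs)" "distinct (x # y # ys)" using d by auto
 have "E x y * (cable (x # xs) (y # ys) * R) = sc (- (varAinv ^ 3)) * (E x y * (strand_row y ys * ?R))"
  using push[OF E_crossing[OF ne]] by (simp add: mult.assoc del: butlast.simps)
 also have "E x y * (strand_row y ys * ?R) = sc (varAinv ^ length ys) * (chain x (y # ys) * ?R)"
  using E_strand_row[OF d'(2) uncapped_cable[OF d l R(1)]] by (simp add: mult.assoc)
 also have "chain x (y # ys) * ?R = sc (varAinv ^ length ys) * (E x y * (cable xs ys * R))"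
  by (rule chain_cable[OF d'(1) l R(2)])
 also have "sc (- (varAinv ^ 3)) * (sc (varAinv ^ length ys) * (sc (varAinv ^ length ys) * (E x y * (cable xs ys * R))))
   = sc (- (varAinv ^ (3 + 2 * length ys))) * (E x y * (cable xs ys * R))"
  unfolding sc_merge by (simp add: mult_ac add_ac flip: power_add)
 finally show ?thesis .
qed

text \<open>The strand entering at \<open>x\<close> belongs to the right cable. Since
  \<open>L\<close> below admits no turnbacks among \<open>x # xs\<close>, all its crossings with the
  left strands take the A-smoothing.\<close>

lemma uncupped_cable:
 "distinct (x # xs @ vs) ==> uncupped (x # xs) L ==>
  L * cable xs (x # vs) = sc (varA ^ length xs) * (L * cable (butlast (x # xs)) vs)"
proof (induction xs arbitrary: x vs L)
 case (Cons x' xs)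
 let ?L = "L * strand_row x vs"
 have row: "strand_row x' (x # vs) = crossing x' x * strand_row x vs" by simp
 have c: "L * crossing x' x = sc varA * L"
  using Cons.prems(2) by (simp add: crossing_def sc_normal E_sym[of x' x])
 have "uncupped (x' # xs) ?L"
  unfolding successively_nth
 proof (intro allI impI)
  fix i assume i: "Suc i < length (x' # xs)"
  let ?a = "(x' # xs) ! i" and ?b = "(x' # xs) ! Suc i"
  have "?a \<in> set (x' # xs)" "?b \<in> set (x' # xs)" using i by (metis Suc_lessD nth_mem)+
  moreover have "?a \<noteq> ?b"
   using i Cons.prems(1) nth_eq_iff_index_eq[of "x' # xs" i "Suc i"] by auto
  ultimately have "distinct (?a # ?b # x # vs)" using Cons.prems(1) by auto
  from E_strand_row_commute[OF this]
  have "?L * E ?a ?b = L * E ?a ?b * strand_row x vs" by (simp add: mult.assoc)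
  also have "L * E ?a ?b = 0"
   using Cons.prems(2) i unfolding successively_nth by (metis length_Cons not_less_eq nth_Cons_Suc)
  finally show "?L * E ?a ?b = 0" by simp
 qed
 moreover have "distinct (x' # xs @ butlast (x # vs))"
  using Cons.prems(1) by (auto simp: distinct_butlast dest: in_set_butlastD)
 ultimately have IH: "?L * cable xs (x' # butlast (x # vs)) =
   sc (varA ^ length xs) * (?L * cable (butlast (x' # xs)) (butlast (x # vs)))"
  using Cons.IH by simp
 have "L * cable (x' # xs) (x # vs) = sc varA * (?L * cable xs (x' # butlast (x # vs)))"
  using push[OF c] by (simp add: mult.assoc)
 also have "... = sc (varA ^ length (x' # xs)) * (L * cable (butlast (x # x' # xs)) vs)"
  unfolding IH by (simp add: sc_merge mult.assoc)
 finally show ?case by simp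
qed (simp add: sc_simps)

text \<open>The row of the innermost left strand has two surviving smoothings. All A leaves a
  crossing of cables that are one strand thinner, all B a turnback joining the innermost strands. In
  either case the innermost right strand must then be straightened or freed, which adds
  \<open>length ys\<close> to the exponent \<open>length ys + 1\<close> of the row.\<close>

lemma cable_expand:
 assumes d: "distinct (x # y # xs @ ys)" and l: "length xs = length ys"
  and R: "uncapped (x # xs) R" "uncapped (y # ys) R"
  and L: "uncupped (x # xs) L" "uncupped (y # ys) L"
 shows "L * (cable (x # xs) (y # ys) * R) =
  sc (varA ^ (2 * length ys + 1)) * (L * (cable (butlast (x # xs)) (butlast (y # ys)) * R)) +
  sc (varAinv ^ (2 * length ys + 1)) * (L * (E x y * (cable xs ys * R)))"
proof -
 let ?R = "cable xs (butlast (x # y # ys)) * R"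
 have d': "distinct (x # y # ys @ xs)" "distinct (x # y # ys)" using d by auto
 have "L * (cable (x # xs) (y # ys) * R) = L * (strand_row x (y # ys) * ?R)"
  by (simp add: mult.assoc)
 also have "... = sc (varA ^ Suc (length ys)) * (L * ?R)
   + sc (varAinv ^ Suc (length ys)) * (L * (chain x (y # ys) * ?R))"
  by (rule strand_row_expand[OF d'(2) L(2) uncapped_cable[OF d l R(1)]])
 also have "chain x (y # ys) * ?R = sc (varAinv ^ length ys) * (E x y * (cable xs ys * R))"
  by (rule chain_cable[OF d'(1) l R(2)])
 also have "L * ?R = sc (varA ^ length ys) * (L * (cable (butlast (x # xs)) (butlast (y # ys)) * R))"
 proof -
  have dd: "distinct (x # xs @ butlast (y # ys))"
   using d by (auto simp: distinct_butlast dest: in_set_butlastD)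
  have "L * ?R = (L * cable xs (x # butlast (y # ys))) * R" by (simp add: mult.assoc)
  then show ?thesis unfolding uncupped_cable[OF dd L(1)] by (simp only: l mult.assoc)
 qed
 finally show ?thesis
  by (simp add: sc_merge sc_front mult_2 flip: power_add power_Suc del: butlast.simps)
qed

section \<open>Twist regions between turnback-free ends\<close>

text \<open>Gaussian binomials by the q-Pascal rule, the form in which \<open>cable_expand\<close>
  produces them. The ring is arbitrary because they occur both at \<open>A^4\<close> and as power
  series in q.\<close>

primrec gauss :: "'a::comm_ring_1 => nat => nat => 'a" where
 "gauss q 0 k = (if k = 0 then 1 else 0)"
| "gauss q (Suc n) k = (case k of 0 => 1 | Suc j => q ^ k * gauss q n k + gauss q n j)"

lemma gauss_0 [simp]: "gauss q n 0 = 1"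
 by (cases n) auto

lemma gauss_Suc: "gauss q (Suc n) (Suc k) = q ^ Suc k * gauss q n (Suc k) + gauss q n k"
 by simp

lemma gauss_eq_0: "n < k ==> gauss q n k = 0"
 by (induction n arbitrary: k) (auto split: nat.splits)

lemma gauss_self [simp]: "gauss q n n = 1"
 by (induction n) (auto simp: gauss_eq_0)

primrec arcs :: "(nat => lab) => (nat => lab) => nat => op" where
 "arcs l r 0 = 1"
| "arcs l r (Suc m) = arcs l r m * E (l m) (r m)"

abbreviation cable_from :: "(nat => lab) => (nat => lab) => nat => nat => op" where
 "cable_from l r a m \<equiv> cable (map l [a..<a + m]) (map r [a..<a + m])"

text \<open>Coefficient of \<open>k\<close> turnbacks in a crossing of two \<open>m\<close>-cables
  between projectors. The exponent is chosen so that \<open>cable_expand\<close> becomes the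
  q-Pascal rule for \<open>q = A^4\<close>; it is \<open>m^2\<close> for \<open>k = 0\<close>, where
  all crossings are A-smoothed, and \<open>- m^2\<close> for \<open>k = m\<close>.\<close>

definition crossing_coeff :: "nat => nat => lser" where
 "crossing_coeff m k = varA powi (2 * (int m - int k)\<^sup>2 - (int m)\<^sup>2) * gauss (varA ^ 4) m k"

lemma crossing_coeff_0: "crossing_coeff m 0 = varA ^ m\<^sup>2"
 by (simp add: crossing_coeff_def power_int_def nat_power_eq flip: of_nat_power)

lemma crossing_coeff_eq_0: "m < k ==> crossing_coeff m k = 0"
 by (simp add: crossing_coeff_def gauss_eq_0)

lemma crossing_coeff_Suc_0:
 "crossing_coeff (Suc m) 0 = varA ^ (2 * m + 1) * crossing_coeff m 0"
proof -
 have "(Suc m)\<^sup>2 = (2 * m + 1) + m\<^sup>2" by (simp add: power2_eq_square)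
 then show ?thesis unfolding crossing_coeff_0 by (simp only: power_add)
qed

lemma crossing_coeff_Suc_Suc:
 "crossing_coeff (Suc m) (Suc k) =
  varA ^ (2 * m + 1) * crossing_coeff m (Suc k) + varAinv ^ (2 * m + 1) * crossing_coeff m k"
proof -
 have 1: "varA ^ (2 * m + 1) = varA powi (2 * int m + 1)"
  "varAinv ^ (2 * m + 1) = varA powi (- (2 * int m + 1))"
  "(varA ^ 4) ^ Suc k = varA powi (4 * (int k + 1))"
  by (simp_all add: varAinv_eq power_int_def nat_add_distrib nat_mult_distrib power_inverse add.commute
    flip: power_mult power_add)
 have e: "2 * (int (Suc m) - int (Suc k))\<^sup>2 - (int (Suc m))\<^sup>2 + 4 * (int k + 1)
   = (2 * int m + 1) + (2 * (int m - int (Suc k))\<^sup>2 - (int m)\<^sup>2)"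
  "2 * (int (Suc m) - int (Suc k))\<^sup>2 - (int (Suc m))\<^sup>2
   = - (2 * int m + 1) + (2 * (int m - int k)\<^sup>2 - (int m)\<^sup>2)"
  by (simp_all add: power2_eq_square algebra_simps)
 have "crossing_coeff (Suc m) (Suc k) =
   varA powi (2 * (int (Suc m) - int (Suc k))\<^sup>2 - (int (Suc m))\<^sup>2 + 4 * (int k + 1)) * gauss (varA ^ 4) m (Suc k)
   + varA powi (2 * (int (Suc m) - int (Suc k))\<^sup>2 - (int (Suc m))\<^sup>2) * gauss (varA ^ 4) m k"
  unfolding crossing_coeff_def gauss_Suc 1(3) by (simp add: power_int_add distrib_left mult.assoc)
 also have "... = varA ^ (2 * m + 1) * crossing_coeff m (Suc k) + varAinv ^ (2 * m + 1) * crossing_coeff m k"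
  unfolding e(1) unfolding e(2) unfolding crossing_coeff_def 1
  by (simp only: power_int_add[OF disjI1[OF varA_nz]] mult.assoc)
 finally show ?thesis .
qed

text \<open>One application of \<open>E_cable\<close> for each turnback: with \<open>n - i\<close>
  strands left in each cable the exponent is \<open>3 + 2 * (n - i - 1)\<close>.\<close>

definition pull_coeff :: "nat => nat => lser" where
 "pull_coeff n k = (\<Prod>i<k. - (varAinv ^ (2 * (n - i) + 1)))"

text \<open>A twist that meets \<open>i\<close> turnbacks first lets them through, with the factor
  \<open>pull_coeff\<close>; the crossing of the remaining \<open>n - i\<close> strands then creates
  \<open>k - i\<close> new ones.\<close>

definition twist_coeff :: "nat => nat => nat => lser" where
 "twist_coeff n i k = (if i \<le> k then pull_coeff n i * crossing_coeff (n - i) (k - i) else 0)"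

fun twists_coeff :: "nat => nat => nat => lser" where
 "twists_coeff n 0 k = (if k = 0 then 1 else 0)"
| "twists_coeff n (Suc a) k = (\<Sum>i\<le>n. twists_coeff n a i * twist_coeff n i k)"

context
 fixes l r :: "nat => lab" and n :: nat
 assumes dist: "distinct (map l [0..<n] @ map r [0..<n])"
begin

lemma l_eq: "i < n ==> j < n ==> l i = l j \<longleftrightarrow> i = j"
 and r_eq: "i < n ==> j < n ==> r i = r j \<longleftrightarrow> i = j"
 and lr_neq: "i < n ==> j < n ==> l i \<noteq> r j"
proof -
 have "inj_on l {0..<n}" "inj_on r {0..<n}" "l ` {0..<n} \<inter> r ` {0..<n} = {}"
  using dist by (simp_all add: distinct_map)
 then show "i < n ==> j < n ==> l i = l j \<longleftrightarrow> i = j" "i < n ==> j < n ==> r i = r j \<longleftrightarrow> i = j"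
  "i < n ==> j < n ==> l i \<noteq> r j"
  by (simp_all add: inj_on_eq_iff disjoint_iff image_iff)
qed

lemma distinct_part:
 "a + m \<le> n ==> distinct (map l [a..<a + m] @ map r [a..<a + m])"
 by (auto simp: distinct_map inj_on_def l_eq r_eq lr_neq)

lemma arcs_commute:
 assumes "\<And>i. i < m ==> T * E (l i) (r i) = E (l i) (r i) * T"
 shows "T * arcs l r m = arcs l r m * T"
 using assms by (induction m) (simp_all add: mult.assoc push[of T "arcs l r _" "arcs l r _" T])

lemma E_l_arcs: "m \<le> i ==> Suc i < n ==> E (l i) (l (Suc i)) * arcs l r m = arcs l r m * E (l i) (l (Suc i))"
 by (intro arcs_commute E_comm) (auto simp: l_eq r_eq lr_neq lr_neq[symmetric])

lemma E_r_arcs: "m \<le> i ==> Suc i < n ==> E (r i) (r (Suc i)) * arcs l r m = arcs l r m * E (r i) (r (Suc i))"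
 by (intro arcs_commute E_comm) (auto simp: l_eq r_eq lr_neq lr_neq[symmetric])

lemma E_lr_arcs: "m \<le> i ==> i < n ==> E (l i) (r i) * arcs l r m = arcs l r m * E (l i) (r i)"
 by (intro arcs_commute E_comm) (auto simp: l_eq r_eq lr_neq lr_neq[symmetric])

lemma uncapped_part:
 assumes "uncapped (map f [0..<n]) R" "a + m \<le> n"
 shows "uncapped (map f [a..<a + m]) R"
 using assms unfolding successively_nth by auto

lemma uncupped_part:
 assumes "uncupped (map l [0..<n]) L" "uncupped (map r [0..<n]) L" "a + m \<le> n"
 shows "uncupped (map l [a..<a + m]) (L * arcs l r a)" "uncupped (map r [a..<a + m]) (L * arcs l r a)"
 using assms unfolding successively_nth
 by (auto simp: mult.assoc E_l_arcs[symmetric] E_r_arcs[symmetric]) (simp_all add: mult.assoc[symmetric])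

text \<open>Induction on the number \<open>m\<close> of strands that still cross. The thinner
  crossing keeps the \<open>a\<close> arcs and the turnback adds one, so the coefficients obey
  \<open>crossing_coeff_Suc_Suc\<close>.\<close>

lemma cable_arcs_expand:
 assumes L: "uncupped (map l [0..<n]) L" "uncupped (map r [0..<n]) L"
  and R: "uncapped (map l [0..<n]) R" "uncapped (map r [0..<n]) R"
 shows "a + m \<le> n ==> L * (arcs l r a * (cable_from l r a m * R)) =
  (\<Sum>k\<le>m. sc (crossing_coeff m k) * (L * (arcs l r (a + k) * R)))"
proof (induction m arbitrary: a)
 case 0
 then show ?case by (simp add: crossing_coeff_0 sc_simps)
next
 case (Suc m)
 let ?F = "\<lambda>a m. L * (arcs l r a * (cable_from l r a m * R))"
 let ?G = "\<lambda>k. L * (arcs l r (a + k) * R)"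
 let ?c = crossing_coeff
 have up: "[a..<a + Suc m] = a # [Suc a..<Suc a + m]" by (simp add: upt_rec)
 have up': "butlast (map f [a..<a + Suc m]) = map f [a..<a + m]" for f by simp
 note LA = uncupped_part[OF L Suc.prems]
 note RA = uncapped_part[OF R(1) Suc.prems] uncapped_part[OF R(2) Suc.prems]
 have d: "distinct (l a # r a # map l [Suc a..<Suc a + m] @ map r [Suc a..<Suc a + m])"
  using distinct_part[OF Suc.prems] unfolding up by auto
 have "?F a (Suc m) = sc (varA ^ (2 * m + 1)) * ?F a m + sc (varAinv ^ (2 * m + 1)) * ?F (Suc a) m"
 proof -
  let ?ls = "map l [Suc a..<Suc a + m]" and ?rs = "map r [Suc a..<Suc a + m]"
  have len: "length ?ls = length ?rs" "length ?rs = m" by simp_all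
  have lr: "l a # ?ls = map l [a..<a + Suc m]" "r a # ?rs = map r [a..<a + Suc m]" unfolding up by simp_all
  show ?thesis
   using cable_expand[of "l a" "r a" ?ls ?rs R "L * arcs l r a", OF d len(1)] LA RA
   unfolding lr up' len(2) arcs.simps(2) by (simp only: mult.assoc)
 qed
 also have "?F a m = (\<Sum>k\<le>m. sc (?c m k) * ?G k)"
  using Suc by simp
 also have "?F (Suc a) m = (\<Sum>k\<le>m. sc (?c m k) * ?G (Suc k))"
  using Suc.IH[of "Suc a"] Suc.prems by (simp only: add_Suc_right add_Suc)
 \<comment> \<open>The additional term for \<open>k = Suc m\<close> is zero; it aligns this sum with
   the shifted one.\<close>
 also have "(\<Sum>k\<le>m. sc (?c m k) * ?G k) = (\<Sum>k\<le>Suc m. sc (?c m k) * ?G k)"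
  by (simp add: crossing_coeff_eq_0 sc_simps)
 also have "... = sc (?c m 0) * ?G 0 + (\<Sum>k\<le>m. sc (?c m (Suc k)) * ?G (Suc k))"
  by (rule sum.atMost_Suc_shift)
 finally have "?F a (Suc m) = sc (?c (Suc m) 0) * ?G 0 + (\<Sum>k\<le>m. sc (?c (Suc m) (Suc k)) * ?G (Suc k))"
  unfolding crossing_coeff_Suc_0 crossing_coeff_Suc_Suc
  by (simp add: sc_simps distrib_left distrib_right sum.distrib sum_distrib_left mult.assoc add.assoc)
 then show ?case by (simp only: sum.atMost_Suc_shift)
qed

lemma arcs_cable:
 assumes R: "uncapped (map l [0..<n]) R" "uncapped (map r [0..<n]) R"
 shows "k \<le> n ==> arcs l r k * (cable_from l r 0 n * R) =
  sc (pull_coeff n k) * (arcs l r k * (cable_from l r k (n - k) * R))"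
proof (induction k)
 case 0
 then show ?case by (simp add: pull_coeff_def sc_simps)
next
 case (Suc k)
 then obtain m where m: "n = k + Suc m" by (metis Suc_le_D add_Suc add_Suc_right le_Suc_ex)
 have up: "[k..<k + Suc m] = k # [Suc k..<Suc k + m]" by (simp add: upt_rec)
 have km: "k + Suc m \<le> n" using m by simp
 have d: "distinct (l k # r k # map l [Suc k..<Suc k + m] @ map r [Suc k..<Suc k + m])"
  using distinct_part[OF km] unfolding up by auto
 have E: "E (l k) (r k) * (cable_from l r k (Suc m) * R) =
   sc (- (varAinv ^ (2 * Suc m + 1))) * (E (l k) (r k) * (cable_from l r (Suc k) m * R))"
 proof -
  let ?ls = "map l [Suc k..<Suc k + m]" and ?rs = "map r [Suc k..<Suc k + m]"
  have len: "length ?ls = length ?rs" "length ?rs = m" "3 + 2 * m = 2 * Suc m + 1" by simp_all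
  have lr: "l k # ?ls = map l [k..<k + Suc m]" "r k # ?rs = map r [k..<k + Suc m]" unfolding up by simp_all
  show ?thesis
   using E_cable[OF d len(1)] uncapped_part[OF R(1) km] uncapped_part[OF R(2) km]
   unfolding lr len(2,3) by simp
 qed
 have c: "arcs l r (Suc k) = E (l k) (r k) * arcs l r k"
  using E_lr_arcs[of k k] m by simp
 have "arcs l r (Suc k) * (cable_from l r 0 n * R) =
   sc (pull_coeff n k) * (E (l k) (r k) * (arcs l r k * (cable_from l r k (Suc m) * R)))"
  unfolding c using Suc m by (simp add: mult.assoc sc_front)
 also have "... = sc (pull_coeff n k) * (arcs l r k * (E (l k) (r k) * (cable_from l r k (Suc m) * R)))"
  using push[OF E_lr_arcs[of k k]] m by simp
 also have "... = sc (pull_coeff n (Suc k)) * (arcs l r (Suc k) * (cable_from l r (Suc k) m * R))"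
 proof -
  have "n - k = Suc m" using m by simp
  then have "pull_coeff n (Suc k) = pull_coeff n k * (- (varAinv ^ (2 * Suc m + 1)))"
   by (simp add: pull_coeff_def)
  then show ?thesis unfolding E arcs.simps(2)
   by (simp only: push[OF sc_central[of "arcs l r k"]] sc_merge mult.assoc)
 qed
 also have "m = n - Suc k" using m by simp
 finally show ?case .
qed

lemma twist_expand:
 assumes L: "uncupped (map l [0..<n]) L" "uncupped (map r [0..<n]) L"
  and R: "uncapped (map l [0..<n]) R" "uncapped (map r [0..<n]) R" and "i \<le> n"
 shows "L * (arcs l r i * (cable_from l r 0 n * R)) = (\<Sum>k\<le>n. sc (twist_coeff n i k) * (L * (arcs l r k * R)))"
proof -
 have "L * (arcs l r i * (cable_from l r 0 n * R)) =
   sc (pull_coeff n i) * (L * (arcs l r i * (cable_from l r i (n - i) * R)))"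
  using arcs_cable[OF R \<open>i \<le> n\<close>] by (simp add: sc_front)
 also have "L * (arcs l r i * (cable_from l r i (n - i) * R)) =
   (\<Sum>k\<le>n - i. sc (crossing_coeff (n - i) k) * (L * (arcs l r (i + k) * R)))"
  using \<open>i \<le> n\<close> by (intro cable_arcs_expand[OF L R]) simp
 also have "sc (pull_coeff n i) * ... = (\<Sum>k\<in>{i..n}. sc (twist_coeff n i k) * (L * (arcs l r k * R)))"
  unfolding sum_distrib_left
  by (rule sum.reindex_bij_witness[of _ "\<lambda>k. k - i" "\<lambda>k. i + k"])
    (use \<open>i \<le> n\<close> in \<open>auto simp: twist_coeff_def sc_merge\<close>)
 also have "... = (\<Sum>k\<le>n. sc (twist_coeff n i k) * (L * (arcs l r k * R)))"
  by (rule sum.mono_neutral_left) (auto simp: twist_coeff_def sc_simps)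
 finally show ?thesis .
qed

lemma uncapped_cable_power:
 assumes R: "uncapped (map l [0..<n]) R" "uncapped (map r [0..<n]) R"
 shows "uncapped (map l [0..<n]) (cable_from l r 0 n ^ a * R)"
  "uncapped (map r [0..<n]) (cable_from l r 0 n ^ a * R)"
proof (induction a)
 case (Suc a)
 let ?R = "cable_from l r 0 n ^ a * R"
 have "uncapped (map l [0..<n]) (cable_from l r 0 n * ?R)"
  using dist Suc(2) uncapped_rev[of ?R "map r [0..<n]"] unfolding add_0 by (intro uncapped_cable_left) auto
 moreover have "uncapped (map r [0..<n]) (cable_from l r 0 n * ?R)"
  using dist Suc(1) uncapped_rev[of ?R "map l [0..<n]"] unfolding add_0 by (intro uncapped_cable_right) auto
 ultimately show "uncapped (map l [0..<n]) (cable_from l r 0 n ^ Suc a * R)"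
  "uncapped (map r [0..<n]) (cable_from l r 0 n ^ Suc a * R)"
  by (simp_all add: mult.assoc)
qed (use R in simp_all)

text \<open>The last twist is moved into \<open>R\<close>. It carries turnback-freeness from each
  cable to the other, so the earlier twists can be expanded beneath it; its own expansion then
  multiplies by one more matrix \<open>twist_coeff\<close>.\<close>

lemma twists_expand:
 assumes L: "uncupped (map l [0..<n]) L" "uncupped (map r [0..<n]) L"
  and R: "uncapped (map l [0..<n]) R" "uncapped (map r [0..<n]) R"
 shows "L * (cable_from l r 0 n ^ a * R) = (\<Sum>k\<le>n. sc (twists_coeff n a k) * (L * (arcs l r k * R)))"
 using R
proof (induction a arbitrary: R)
 case 0
 have "(\<Sum>k\<le>n. sc (twists_coeff n 0 k) * (L * (arcs l r k * R))) = (\<Sum>k\<in>{0}. sc (twists_coeff n 0 k) * (L * (arcs l r k * R)))"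
  by (rule sum.mono_neutral_right) (auto simp: sc_simps)
 then show ?case by (simp add: sc_simps)
next
 case (Suc a)
 let ?X = "cable_from l r 0 n"
 have "L * (?X ^ Suc a * R) = L * (?X ^ a * (?X * R))"
  by (simp add: power_Suc2 mult.assoc del: power_Suc)
 also have "... = (\<Sum>i\<le>n. sc (twists_coeff n a i) * (L * (arcs l r i * (?X * R))))"
  using uncapped_cable_power[OF Suc.prems, of 1] by (intro Suc.IH) simp_all
 also have "... = (\<Sum>i\<le>n. \<Sum>k\<le>n. sc (twists_coeff n a i * twist_coeff n i k) * (L * (arcs l r k * R)))"
 proof (intro sum.cong refl)
  fix i assume "i \<in> {..n}"
  then have "L * (arcs l r i * (?X * R)) = (\<Sum>k\<le>n. sc (twist_coeff n i k) * (L * (arcs l r k * R)))"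
   by (intro twist_expand[OF L Suc.prems]) simp
  then show "sc (twists_coeff n a i) * (L * (arcs l r i * (?X * R))) =
    (\<Sum>k\<le>n. sc (twists_coeff n a i * twist_coeff n i k) * (L * (arcs l r k * R)))"
   by (simp only: sum_distrib_left sc_merge)
 qed
 also have "... = (\<Sum>k\<le>n. \<Sum>i\<le>n. sc (twists_coeff n a i * twist_coeff n i k) * (L * (arcs l r k * R)))"
  by (rule sum.swap)
 finally show ?case by (simp add: sc_sum sum_distrib_right)
qed

end

section \<open>Jones--Wenzl projectors\<close>

definition qint :: "nat => lser" where
 "qint m = (varA ^ (2 * m) - varAinv ^ (2 * m)) / (varA ^ 2 - varAinv ^ 2)"

lemma varA_power_eq_iff: "varA ^ m = varAinv ^ m \<longleftrightarrow> m = 0"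
proof
 assume "varA ^ m = varAinv ^ m"
 then have "fls_subdegree (varA ^ m) = fls_subdegree (varAinv ^ m)" by simp
 then show "m = 0" by (simp add: varA_def varAinv_def)
qed simp

lemma qint_simps [simp]: "qint 0 = 0" "qint 1 = 1" "qint (Suc 0) = 1"
 using varA_power_eq_iff[of 2] by (simp_all add: qint_def)

lemma qint_nz [simp]: "m > 0 ==> qint m \<noteq> 0"
 using varA_power_eq_iff[of "2 * m"] varA_power_eq_iff[of 2] by (simp add: qint_def)

lemma Delta_qint: "Delta m = (-1) ^ m * qint (Suc m)"
 by (simp add: Delta_def qint_def)

lemma Delta_nz [simp]: "Delta m \<noteq> 0"
 by (simp add: Delta_qint)

lemma Delta_0 [simp]: "Delta 0 = 1" and Delta_1 [simp]: "Delta (Suc 0) = loop_val"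
proof -
 have ne: "varA\<^sup>2 - varAinv\<^sup>2 \<noteq> 0" using varA_power_eq_iff[of 2] by simp
 then show "Delta 0 = 1" by (simp add: Delta_def)
 have "varA ^ 4 - varAinv ^ 4 = (varA\<^sup>2 + varAinv\<^sup>2) * (varA\<^sup>2 - varAinv\<^sup>2)"
  by (simp add: algebra_simps flip: power_add)
 then have "(varA ^ 4 - varAinv ^ 4) / (varA\<^sup>2 - varAinv\<^sup>2) = varA\<^sup>2 + varAinv\<^sup>2"
  using ne by (simp add: nonzero_divide_eq_eq)
 then show "Delta (Suc 0) = loop_val"
  using minus_divide_left[of "varA ^ 4 - varAinv ^ 4" "varA\<^sup>2 - varAinv\<^sup>2"]
  by (simp add: Delta_def loop_val_def)
qed

lemma Delta_rec: "loop_val * Delta (Suc m) = Delta (Suc (Suc m)) + Delta m"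
proof -
 have e: "varA\<^sup>2 * (varA ^ (2 * k) * z) = varA ^ (2 * Suc k) * z"
  "varAinv\<^sup>2 * (varAinv ^ (2 * k) * z) = varAinv ^ (2 * Suc k) * z"
  "varA\<^sup>2 * varAinv ^ (2 * Suc k) = varAinv ^ (2 * k)"
  "varAinv\<^sup>2 * varA ^ (2 * Suc k) = varA ^ (2 * k)" for k z
  by (simp_all add: power_mult power2_eq_square mult_ac)
    (metis mult.assoc mult.commute mult_1 varA_varAinv(1))+
 have gen: "d * (a / D) = - (b / D) - c / D" if "d * a = - b - c" for d a b c D :: lser
  using that by (simp add: diff_divide_distrib)
 have "loop_val * (varA ^ (2 * Suc (Suc m)) - varAinv ^ (2 * Suc (Suc m)))
   = - (varA ^ (2 * Suc (Suc (Suc m))) - varAinv ^ (2 * Suc (Suc (Suc m))))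
    - (varA ^ (2 * Suc m) - varAinv ^ (2 * Suc m))"
  unfolding loop_val_def using e(1)[of "Suc (Suc m)" 1] e(2)[of "Suc (Suc m)" 1] e(3,4)[of "Suc m"]
  by (simp add: left_diff_distrib right_diff_distrib del: mult_Suc_right power_Suc)
 then have "loop_val * qint (Suc (Suc m)) = - qint (Suc (Suc (Suc m))) - qint (Suc m)"
  unfolding qint_def using gen by blast
 then have "(- 1) ^ Suc m * (loop_val * qint (Suc (Suc m))) = (- 1) ^ Suc m * (- qint (Suc (Suc (Suc m))) - qint (Suc m))"
  by (rule arg_cong)
 then show ?thesis unfolding Delta_qint by (simp add: algebra_simps)
qed

lemma Delta_quotient: "loop_val - Delta m / Delta (Suc m) = Delta (Suc (Suc m)) / Delta (Suc m)"
 using Delta_rec[of m] by (simp add: field_simps)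

text \<open>Wenzl's recursion of \<open>jw\<close>, but in the ring of operators and along an
  arbitrary sequence of labels. The link with \<open>jw\<close> itself is made in
  \<open>represents_jw\<close>.\<close>

fun jw_op :: "(nat => lab) => nat => op" where
 "jw_op x 0 = 1"
| "jw_op x (Suc 0) = 1"
| "jw_op x (Suc (Suc m)) = jw_op x (Suc m)
   - sc (Delta m / Delta (Suc m)) * (jw_op x (Suc m) * (E (x m) (x (Suc m)) * jw_op x (Suc m)))"

lemma jw_op_intertwine:
 assumes "\<And>i. Suc i < n ==> T * E (x i) (x (Suc i)) = E (y i) (y (Suc i)) * T"
 shows "T * jw_op x n = jw_op y n * T"
 using assms
proof (induction n rule: induct_nat_012)
 case (ge2 m)
 note IH = ge2.IH(2)[OF ge2.prems]
 have e: "T * E (x m) (x (Suc m)) = E (y m) (y (Suc m)) * T" using ge2.prems by simp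
 show ?case
  using IH by (simp add: algebra_simps sc_front push[OF IH] push[OF e])
qed auto

lemma jw_op_commute:
 "(\<And>i. Suc i < n ==> T * E (x i) (x (Suc i)) = E (x i) (x (Suc i)) * T) ==> T * jw_op x n = jw_op x n * T"
 by (rule jw_op_intertwine)

lemma jw_op_absorb_left:
 assumes "\<And>i. Suc i < n ==> L * E (x i) (x (Suc i)) = 0"
 shows "L * jw_op x n = L"
 using assms
proof (induction n rule: induct_nat_012)
 case (ge2 m)
 then have "L * jw_op x (Suc m) = L" "L * E (x m) (x (Suc m)) = 0" by auto
 then show ?case
  by (simp add: algebra_simps sc_front) (simp add: mult.assoc[symmetric])
qed auto

lemma jw_op_absorb_right:
 assumes "\<And>i. Suc i < n ==> E (x i) (x (Suc i)) * R = 0"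
 shows "jw_op x n * R = R"
 using assms
proof (induction n rule: induct_nat_012)
 case (ge2 m)
 then have "jw_op x (Suc m) * R = R" "E (x m) (x (Suc m)) * R = 0" by auto
 then show ?case by (simp add: algebra_simps)
qed auto

lemma E_jw_op_commute:
 assumes "a \<noteq> b" "\<And>i. i < n ==> x i \<noteq> a \<and> x i \<noteq> b" "inj_on x {..<n}"
 shows "E a b * jw_op x n = jw_op x n * E a b"
proof (rule jw_op_commute)
 fix i assume i: "Suc i < n"
 then have "x i \<noteq> x (Suc i)" using assms(3) by (simp add: inj_on_eq_iff)
 then have "distinct [a, b, x i, x (Suc i)]" using assms(1) assms(2)[of i] assms(2)[of "Suc i"] i by auto
 then show "E a b * E (x i) (x (Suc i)) = E (x i) (x (Suc i)) * E a b" by (rule E_comm)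
qed

text \<open>Wenzl's simultaneous induction. The third clause, a partial trace, is what makes the
  next projector kill its last turnback, and it reproduces itself by the recursion of
  \<open>Delta\<close>.\<close>

lemma jw_op_properties:
 assumes "inj_on x {..n}"
 shows "jw_op x n * jw_op x n = jw_op x n \<and>
  (\<forall>i. Suc i < n \<longrightarrow> E (x i) (x (Suc i)) * jw_op x n = 0 \<and> jw_op x n * E (x i) (x (Suc i)) = 0) \<and>
  (\<forall>m. n = Suc m \<longrightarrow> E (x m) (x n) * (jw_op x n * E (x m) (x n)) = sc (Delta n / Delta m) * (jw_op x m * E (x m) (x n)))"
 using assms
proof (induction n rule: induct_nat_012)
 case 1
 then have "x 0 \<noteq> x (Suc 0)" by (auto simp: inj_on_def)
 then show ?case using E_square by simp
next
 case (ge2 k)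
 define f where "f = jw_op x (Suc k)"
 define h where "h = jw_op x k"
 define e where "e = E (x k) (x (Suc k))"
 define e' where "e' = E (x (Suc k)) (x (Suc (Suc k)))"
 define c where "c = Delta k / Delta (Suc k)"
 define g where "g = jw_op x (Suc (Suc k))"
 have g: "g = f - sc c * (f * (e * f))" by (simp add: g_def f_def e_def c_def)
 have inj: "inj_on x {..Suc k}" using ge2.prems by (rule inj_on_subset) auto
 have x_eq: "x i = x j \<longleftrightarrow> i = j" if "i \<le> Suc (Suc k)" "j \<le> Suc (Suc k)" for i j
  using ge2.prems that by (simp add: inj_on_eq_iff)
 have inj': "inj_on x {..<k}" "inj_on x {..<Suc k}" using ge2.prems by (auto elim: inj_on_subset)
 note IH = ge2.IH(2)[OF inj]
 have ff: "f * f = f" and e0: "\<And>i. i < k ==> E (x i) (x (Suc i)) * f = 0"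
  and e0': "\<And>i. i < k ==> f * E (x i) (x (Suc i)) = 0"
  and efe: "e * (f * e) = sc (1 / c) * (h * e)"
  using IH by (auto simp: f_def e_def h_def c_def)
 have c0: "c \<noteq> 0" by (simp add: c_def)
 have fh: "f * h = f" "h * f = f"
  using e0 e0' by (auto simp: h_def intro!: jw_op_absorb_left jw_op_absorb_right)
 have eh: "e * h = h * e"
  unfolding e_def h_def using inj' by (intro E_jw_op_commute) (simp_all add: x_eq)
 have e'f: "e' * f = f * e'"
  unfolding e'_def f_def using inj' by (intro E_jw_op_commute) (simp_all add: x_eq)
 have d: "distinct [x (Suc (Suc k)), x (Suc k), x k]" by (simp add: x_eq)
 have e'e: "e' * (e * e') = e'" using E_E_E[OF d] by (simp add: e'_def e_def E_sym)
 have e'e': "e' * e' = sc loop_val * e'" unfolding e'_def using d by (intro E_square) auto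
 have efef: "e * (f * (e * Z)) = sc (1 / c) * (h * (e * Z))" for Z
  using push2[of e f e] efe by (metis mult.assoc)
 have fhZ: "f * (h * Z) = f * Z" for Z by (simp add: mult.assoc[symmetric] fh)
 have "e * g = e * f - sc c * (e * (f * (e * f)))"
  unfolding g by (simp add: right_diff_distrib sc_front)
 also have "... = e * f - h * (e * f)"
  using c0 by (simp add: efef sc_merge sc_simps)
 also have "h * (e * f) = e * f" using push[OF eh, of f] by (simp add: fh)
 finally have eg: "e * g = 0" by simp
 have "g * e = f * e - sc c * (f * (e * (f * e)))"
  unfolding g by (simp add: left_diff_distrib mult.assoc)
 also have "... = 0"
  using c0 by (simp add: efe sc_front sc_merge sc_simps fhZ)
 finally have ge: "g * e = 0" .
 have gg: "g * g = g"
 proof -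
  have "f * (f * Z) = f * Z" for Z using ff by (simp add: mult.assoc[symmetric])
  then have fg: "f * g = g" unfolding g using ff by (simp add: right_diff_distrib sc_front)
  have "g * g = f * g - sc c * (f * (e * (f * g)))"
   by (subst g) (simp add: left_diff_distrib mult.assoc)
  then show ?thesis using eg fg by simp
 qed
 \<comment> \<open>The uncorrected term closes a loop and the correction straightens by
   \<open>e' * e * e' = e'\<close>; this leaves \<open>loop_val - c\<close>, the next quotient of
   \<open>Delta\<close>.\<close>
 have "e' * (g * e') = sc (loop_val - c) * (f * e')"
 proof -
  have "e' * (g * e') = e' * (f * e') - sc c * (e' * (f * (e * (f * e'))))"
   unfolding g by (simp add: left_diff_distrib right_diff_distrib mult.assoc sc_front)
  also have "e' * (f * e') = sc loop_val * (f * e')"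
   by (simp add: push[OF e'f] e'e' sc_front)
  also have "e' * (f * (e * (f * e'))) = f * (e' * (e * (e' * f)))"
   by (simp add: push[OF e'f] e'f[symmetric])
  also have "... = f * (e' * f)" using e'e by (metis mult.assoc)
  also have "... = f * e'" by (simp add: e'f mult.assoc[symmetric] ff)
  finally show ?thesis by (simp add: sc_simps left_diff_distrib)
 qed
 then have "e' * (g * e') = sc (Delta (Suc (Suc k)) / Delta (Suc k)) * (f * e')"
  by (simp add: c_def Delta_quotient)
 moreover have "E (x i) (x (Suc i)) * g = 0 \<and> g * E (x i) (x (Suc i)) = 0" if "Suc i < Suc (Suc k)" for i
 proof (cases "i = k")
  case True
  then show ?thesis using eg ge by (simp add: e_def)
 next
  case False
  then have "i < k" using that by simp
  from e0[OF this] e0'[OF this] show ?thesis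
   unfolding g by (simp add: left_diff_distrib right_diff_distrib mult.assoc sc_front)
    (simp add: mult.assoc[symmetric])
 qed
 ultimately show ?case using gg by (simp add: g_def f_def e'_def del: jw_op.simps)
qed auto

lemma jw_op_cong: "(\<And>i. i < n ==> x i = y i) ==> jw_op x n = jw_op y n"
 using jw_op_intertwine[of n 1 x y] by simp

context
 fixes x :: "nat => lab" and n :: nat
 assumes inj: "inj x"
begin

lemma jw_op_idem: "jw_op x n * jw_op x n = jw_op x n"
 and E_jw_op: "Suc i < n ==> E (x i) (x (Suc i)) * jw_op x n = 0"
 and jw_op_E: "Suc i < n ==> jw_op x n * E (x i) (x (Suc i)) = 0"
 using jw_op_properties[of x n] inj by (auto intro: inj_on_subset)

text \<open>Uniqueness of the projector: both versions kill the same turnbacks and absorb each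
  other, so their product equals either of them. It is needed because half twists and the cabling of
  an edge reverse the order of strands.\<close>

lemma jw_op_flip: "jw_op (\<lambda>i. x (n - 1 - i)) n = jw_op x n"
proof -
 define y where "y i = (if i < n then x (n - 1 - i) else x i)" for i
 have y: "jw_op (\<lambda>i. x (n - 1 - i)) n = jw_op y n" by (rule jw_op_cong) (simp add: y_def)
 have e: "E (y i) (y (Suc i)) = E (x (n - 2 - i)) (x (Suc (n - 2 - i)))"
  "E (x i) (x (Suc i)) = E (y (n - 2 - i)) (y (Suc (n - 2 - i)))" if lt: "Suc i < n" for i
 proof -
  obtain m where "n = Suc (Suc i + m)" using less_imp_Suc_add[OF lt] by blast
  then have m: "n = Suc (Suc (i + m))" by simp
  have "y i = x (Suc m)" "y (Suc i) = x m" "y m = x (Suc i)" "y (Suc m) = x i"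
   by (simp_all add: y_def m)
  then show "E (y i) (y (Suc i)) = E (x (n - 2 - i)) (x (Suc (n - 2 - i)))"
   "E (x i) (x (Suc i)) = E (y (n - 2 - i)) (y (Suc (n - 2 - i)))"
   by (simp_all add: m E_sym)
 qed
 have inj_y: "inj y"
 proof (rule injI)
  fix i j assume "y i = y j"
  then have "(if i < n then n - 1 - i else i) = (if j < n then n - 1 - j else j)"
   using inj unfolding y_def inj_def by (auto split: if_splits)
  then show "i = j" by (auto split: if_splits)
 qed
 have "jw_op y n * jw_op x n = jw_op x n"
  by (rule jw_op_absorb_right) (use E_jw_op e(1) in auto)
 moreover have "jw_op y n * jw_op x n = jw_op y n"
  using jw_op_properties[of y n] inj_y by (intro jw_op_absorb_left) (simp add: e(2) inj_on_subset)
 ultimately show ?thesis unfolding y by simp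
qed

end

text \<open>The projector is a palindromic expression in the generators, so a functional that identifies
 the generators on two families of strands at the end of a product identifies the projectors.\<close>
lemma jw_op_transfer_right:
 fixes v :: "op => lser"
 assumes add: "\<And>S T. v (S + T) = v S + v T" and scale: "\<And>c T. v (sc c * T) = c * v T"
  and E: "\<And>i M. Suc i < n ==> v (M * E (x i) (x (Suc i))) = v (M * E (y i) (y (Suc i)))"
  and inj: "inj x" "inj y" and disj: "\<And>i j. x i \<noteq> y j"
 shows "v (M * jw_op x n) = v (M * jw_op y n)"
 using E
proof (induction n arbitrary: M rule: induct_nat_012)
 case (ge2 k)
 let ?f = "jw_op x (Suc k)" and ?g = "jw_op y (Suc k)"
 let ?e = "E (x k) (x (Suc k))" and ?d = "E (y k) (y (Suc k))"
 have minus: "v (S - sc c * T) = v S - c * v T" for S T c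
  using add[of "S - sc c * T" "sc c * T"] scale by simp
 have IH: "v (M * ?f) = v (M * ?g)" for M using ge2 by simp
 have E: "v (M * ?e) = v (M * ?d)" for M using ge2.prems[of k] by simp
 have x: "x i \<noteq> x (Suc i)" "y i \<noteq> y (Suc i)" for i using inj by (auto simp: inj_eq)
 have c: "?e * ?g = ?g * ?e" "?d * ?f = ?f * ?d"
  using x disj inj by (auto intro!: E_jw_op_commute inj_on_subset[OF _ subset_UNIV] simp: disj[symmetric])
 have fg: "?f * ?g = ?g * ?f"
  by (rule jw_op_commute, rule E_jw_op_commute[symmetric])
    (use x disj inj in \<open>auto intro!: inj_on_subset[OF _ subset_UNIV] simp: disj[symmetric]\<close>)
 \<comment> \<open>The factors of the two families commute. Therefore one factor at a time is
   brought to the end of the product, exchanged there, and brought back.\<close>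
 have "v (M * (?f * (?e * ?f))) = v (M * ?f * ?e * ?g)" using IH[of "M * ?f * ?e"] by (simp add: mult.assoc)
 also have "... = v (M * ?g * ?f * ?e)" using c(1) push[OF fg] by (simp add: mult.assoc)
 also have "... = v (M * ?g * ?f * ?d)" by (rule E)
 also have "... = v (M * ?g * ?d * ?f)" using c(2) by (simp add: mult.assoc)
 also have "... = v (M * (?g * (?d * ?g)))" using IH[of "M * ?g * ?d"] by (simp add: mult.assoc)
 finally show ?case
  using IH[of M] by (simp add: right_diff_distrib sc_left_commute minus)
qed simp_all

text \<open>The mirror image, for generators that are identified at the beginning of a
  product.\<close>

lemma jw_op_transfer_left:
 fixes v :: "op => lser"
 assumes add: "\<And>S T. v (S + T) = v S + v T" and scale: "\<And>c T. v (sc c * T) = c * v T"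
  and E: "\<And>i M. Suc i < n ==> v (E (x i) (x (Suc i)) * M) = v (E (y i) (y (Suc i)) * M)"
  and inj: "inj x" "inj y" and disj: "\<And>i j. x i \<noteq> y j"
 shows "v (jw_op x n * M) = v (jw_op y n * M)"
 using E
proof (induction n arbitrary: M rule: induct_nat_012)
 case (ge2 k)
 let ?f = "jw_op x (Suc k)" and ?g = "jw_op y (Suc k)"
 let ?e = "E (x k) (x (Suc k))" and ?d = "E (y k) (y (Suc k))"
 have minus: "v (S - sc c * T) = v S - c * v T" for S T c
  using add[of "S - sc c * T" "sc c * T"] scale by simp
 have IH: "v (?f * M) = v (?g * M)" for M using ge2 by simp
 have E: "v (?e * M) = v (?d * M)" for M using ge2.prems[of k] by simp
 have x: "x i \<noteq> x (Suc i)" "y i \<noteq> y (Suc i)" for i using inj by (auto simp: inj_eq)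
 have c: "?e * ?g = ?g * ?e" "?d * ?f = ?f * ?d"
  using x disj inj by (auto intro!: E_jw_op_commute inj_on_subset[OF _ subset_UNIV] simp: disj[symmetric])
 have fg: "?f * ?g = ?g * ?f"
  by (rule jw_op_commute, rule E_jw_op_commute[symmetric])
    (use x disj inj in \<open>auto intro!: inj_on_subset[OF _ subset_UNIV] simp: disj[symmetric]\<close>)
 have "v (?f * (?e * (?f * M))) = v (?g * (?e * (?f * M)))" by (rule IH)
 also have "... = v (?e * (?f * (?g * M)))" by (simp add: push[OF c(1)] push[OF fg])
 also have "... = v (?d * (?f * (?g * M)))" by (rule E)
 also have "... = v (?f * (?d * (?g * M)))" by (simp add: push[OF c(2)])
 also have "... = v (?g * (?d * (?g * M)))" by (rule IH)
 finally show ?case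
  using IH[of M] by (simp add: left_diff_distrib mult.assoc minus)
qed simp_all

section \<open>Closing up three twist regions\<close>

text \<open>A substitute for saying that the support of \<open>S\<close> avoids \<open>B\<close>;
  only this consequence of disjointness enters the arguments.\<close>

definition commutes_on :: "lab set => op => bool" where
 "commutes_on B S \<longleftrightarrow> (\<forall>x\<in>B. \<forall>y\<in>B. x \<noteq> y \<longrightarrow> E x y * S = S * E x y)"

lemma commutes_onD: "commutes_on B S ==> x \<in> B ==> y \<in> B ==> x \<noteq> y ==> E x y * S = S * E x y"
 by (simp add: commutes_on_def)

lemma commutes_on_mult: "commutes_on B S ==> commutes_on B T ==> commutes_on B (S * T)"
 unfolding commutes_on_def by (metis mult.assoc)

lemma commutes_on_1: "commutes_on B 1"
 by (simp add: commutes_on_def)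

lemma commutes_on_power: "commutes_on B S ==> commutes_on B (S ^ a)"
 by (induction a) (simp_all add: commutes_on_1 commutes_on_mult)

lemma commutes_on_E: "a \<noteq> b ==> a \<notin> B ==> b \<notin> B ==> commutes_on B (E a b)"
 unfolding commutes_on_def by (auto intro!: E_comm)

lemma commutes_on_arcs:
 "(\<And>i j. l i \<noteq> r j) ==> (\<And>i. i < k ==> l i \<notin> B \<and> r i \<notin> B) ==> commutes_on B (arcs l r k)"
 by (induction k) (simp_all add: commutes_on_1 commutes_on_mult commutes_on_E)

lemma commutes_on_jw_op:
 assumes "inj x" "\<And>i. i < k ==> x i \<notin> B"
 shows "commutes_on B (jw_op x k)"
 unfolding commutes_on_def
 using assms by (auto intro!: E_jw_op_commute inj_on_subset[OF _ subset_UNIV])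

lemma commutes_on_cable:
 assumes "distinct (xs @ ys)" "set (xs @ ys) \<inter> B = {}"
 shows "commutes_on B (cable xs ys)"
 unfolding commutes_on_def using assms by (auto intro!: E_cable_commute)

lemma jw_op_commutes:
 assumes "commutes_on B S" "inj x" "\<And>i. i < k ==> x i \<in> B"
 shows "S * jw_op x k = jw_op x k * S"
 using assms by (intro jw_op_commute) (auto simp: commutes_on_def inj_eq)

lemma arcs_commutes:
 assumes "commutes_on B S" "\<And>i j. l i \<noteq> r j" "\<And>i. i < k ==> l i \<in> B \<and> r i \<in> B"
 shows "S * arcs l r k = arcs l r k * S"
 using assms(3)
 by (induction k) (simp_all add: commutes_onD[OF assms(1), symmetric] assms(2) mult.assoc push[of S "arcs l r _" "arcs l r _" S])

text \<open>The arcs outside the twist regions: the right side of a region is joined to the left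
  side of the next one, at the top and at the bottom. \<open>r + 2\<close> stands for
  \<open>r - 1\<close> modulo 3.\<close>

fun frame :: "lab => lab" where
 "frame (Lab r t s i) = (if s then Lab ((r + 1) mod 3) t False i else Lab ((r + 2) mod 3) t True i)"

definition labels :: "nat => lab set" where
 "labels n = {x. column x < 3 \<and> strand x < n}"

lemma inj_Lab: "inj (Lab r t s)"
 by (simp add: inj_def)

text \<open>What is used about evaluating a diagram closed by the frame. The leftmost factor meets
  the initial state, in which every top label is joined to the bottom label beneath it; this gives
  \<open>left_flip\<close> and \<open>left_loop\<close>. The rightmost factor meets the frame, which
  gives \<open>right_flip\<close> and \<open>right_loop\<close>. Without any crossings there is one
  loop for each face between two regions and each strand.\<close>

locale closure_functional =
 fixes v :: "op => lser" and n :: nat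
 assumes v_add: "v (S + T) = v S + v T"
  and v_scale: "v (sc c * T) = c * v T"
  and left_flip: "(r, s, i) \<noteq> (r', s', j) ==>
   v (E (Lab r True s i) (Lab r' True s' j) * M) = v (E (Lab r False s i) (Lab r' False s' j) * M)"
  and left_loop: "v (E (Lab r True s i) (Lab r False s i) * M) = loop_val * v M"
  and right_flip: "x \<in> labels n ==> y \<in> labels n ==> x \<noteq> y ==> v (M * E x y) = v (M * E (frame x) (frame y))"
  and right_loop: "x \<in> labels n ==> v (M * E x (frame x)) = loop_val * v M"
  and v_one: "v 1 = loop_val ^ (3 * n)"
begin

lemma v_sum: "v (sum f I) = (\<Sum>i\<in>I. v (f i))"
proof -
 have "v 0 = 0" using v_scale[of 0 0] by (simp add: sc_simps)
 then show ?thesis by (induction I rule: infinite_finite_induct) (simp_all add: v_add)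
qed

definition proj :: "nat \<times> bool \<times> bool => op" where
 "proj e = (case e of (r, t, s) => jw_op (Lab r t s) n)"

definition col :: "nat => op" where
 "col r = cable (map (Lab r True False) [0..<n]) (map (Lab r True True) [0..<n])"

lemma distinct_col: "distinct (map (Lab r t False) [0..<n] @ map (Lab r t True) [0..<n])"
 by (auto simp: distinct_map inj_on_def)

lemma proj_idem: "proj e * proj e = proj e"
 by (cases e) (simp add: proj_def jw_op_idem inj_Lab)

lemma commutes_on_proj:
 "e = (r, t, s) ==> (\<And>i. i < n ==> Lab r t s i \<notin> B) ==> commutes_on B (proj e)"
 by (simp add: proj_def commutes_on_jw_op inj_Lab)

lemma proj_commutes:
 assumes "commutes_on B S" "\<And>i. i < n ==> Lab r t s i \<in> B"
 shows "proj (r, t, s) * S = S * proj (r, t, s)"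
 unfolding proj_def using jw_op_commutes[OF assms(1) inj_Lab assms(2)] by simp

lemma proj_proj: "proj e * proj e' = proj e' * proj e"
proof (cases "e = e'")
 case False
 obtain r t s where e: "e = (r, t, s)" by (cases e) auto
 obtain r' t' s' where e': "e' = (r', t', s')" by (cases e') auto
 have "commutes_on (range (Lab r t s)) (proj e')"
  using False by (intro commutes_on_proj[OF e']) (auto simp: e e')
 then show ?thesis unfolding e by (rule proj_commutes) simp
qed simp

lemma v_proj_right:
 assumes "r < 3"
 shows "v (M * proj (r, t, True)) = v (M * proj ((r + 1) mod 3, t, False))"
 unfolding proj_def prod.case
proof (rule jw_op_transfer_right[OF v_add v_scale])
 fix i M assume "Suc i < n"
 then show "v (M * E (Lab r t True i) (Lab r t True (Suc i)))
   = v (M * E (Lab ((r + 1) mod 3) t False i) (Lab ((r + 1) mod 3) t False (Suc i)))"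
  using assms right_flip[of "Lab r t True i" "Lab r t True (Suc i)"] by (simp add: labels_def)
qed (simp_all add: inj_Lab)

lemma v_proj_left: "v (proj (r, True, s) * M) = v (proj (r, False, s) * M)"
 unfolding proj_def prod.case
 by (rule jw_op_transfer_left[OF v_add v_scale]) (simp_all add: inj_Lab left_flip)

text \<open>A half twist exchanges the two sides of a region and reverses the order of the strands
  in each cable. The projector is insensitive to the reversal by \<open>jw_op_flip\<close>, so only
  its side changes.\<close>

lemma proj_col: "proj (r, True, s) * col r = col r * proj (r, True, \<not> s)"
proof -
 let ?l = "Lab r True False" and ?r = "Lab r True True"
 let ?ls = "map ?l [0..<n]" and ?rs = "map ?r [0..<n]"
 have d: "distinct (?ls @ ?rs)" by (rule distinct_col)
 have rev: "rev (map f [0..<n]) ! i = f (n - 1 - i)" if "i < n" for f :: "nat => lab" and i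
  using that by (simp add: rev_nth)
 show ?thesis
 proof (cases s)
  case True
  have "col r * jw_op (\<lambda>i. ?l (n - 1 - i)) n = jw_op ?r n * col r"
  proof (rule jw_op_intertwine)
   fix i assume i: "Suc i < n"
   then show "col r * E (?l (n - 1 - i)) (?l (n - 1 - Suc i)) = E (?r i) (?r (Suc i)) * col r"
    using E_cable_slide_right[OF d, of i] rev[of i ?l] rev[of "Suc i" ?l] by (simp add: col_def nth_append)
  qed
  with True show ?thesis by (simp add: proj_def jw_op_flip[OF inj_Lab, simplified])
 next
  case False
  have "col r * jw_op (\<lambda>i. ?r (n - 1 - i)) n = jw_op ?l n * col r"
  proof (rule jw_op_intertwine)
   fix i assume i: "Suc i < n"
   then show "col r * E (?r (n - 1 - i)) (?r (n - 1 - Suc i)) = E (?l i) (?l (Suc i)) * col r"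
    using E_cable_slide_left[OF d, of i] rev[of i ?r] rev[of "Suc i" ?r] by (simp add: col_def nth_append)
  qed
  with False show ?thesis by (simp add: proj_def jw_op_flip[OF inj_Lab, simplified])
 qed
qed

lemma proj_col_power: "proj (r, True, s) * col r ^ a = col r ^ a * proj (r, True, s = even a)"
proof (induction a arbitrary: s)
 case (Suc a)
 have "proj (r, True, s) * col r ^ Suc a = col r * (proj (r, True, \<not> s) * col r ^ a)"
  using push[OF proj_col] by simp
 moreover have "((\<not> s) = even a) = (s = even (Suc a))" by auto
 ultimately show ?case by (simp only: Suc power_Suc mult.assoc)
qed simp

lemma commutes_on_col: "(\<And>s i. i < n ==> Lab r True s i \<notin> B) ==> commutes_on B (col r)"
 unfolding col_def by (rule commutes_on_cable[OF distinct_col]) auto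

definition projs :: "(nat \<times> bool \<times> bool) list => op" where
 "projs es = prod_list (map proj es)"

lemma projs_simps [simp]: "projs [] = 1" "projs (e # es) = proj e * projs es"
 by (simp_all add: projs_def)

lemma proj_projs: "proj e * projs es = projs es * proj e"
 by (induction es) (simp_all add: push[OF proj_proj[of e]] mult.assoc)

lemma projs_absorb: "e \<in> set es ==> proj e * projs es = projs es" "e \<in> set es ==> projs es * proj e = projs es"
proof -
 show *: "proj e * projs es = projs es" if "e \<in> set es"
  using that
 proof (induction es)
  case (Cons a es)
  show ?case
  proof (cases "e = a")
   case True
   then show ?thesis by (simp add: proj_idem mult.assoc[symmetric])
  next
   case False
   then show ?thesis using Cons push[OF proj_proj[of e a], of "projs es"] by simp
  qed
 qed simp
 show "projs es * proj e = projs es" if "e \<in> set es"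
  using *[OF that] by (simp add: proj_projs)
qed

lemma projs_removeAll: "e \<in> set es ==> projs es = projs (removeAll e es) * proj e"
proof (induction es)
 case (Cons a es)
 show ?case
 proof (cases "e \<in> set es")
  case True
  then have es: "projs es = projs (removeAll e es) * proj e" by (rule Cons.IH)
  show ?thesis
  proof (cases "e = a")
   case True
   then show ?thesis
    by (simp add: es) (metis mult.assoc proj_idem proj_projs)
  qed (simp add: es mult.assoc)
 next
  case False
  then show ?thesis using Cons.prems by (auto simp: proj_projs)
 qed
qed simp

definition twisted :: "(nat => nat) => op" where
 "twisted a = col 0 ^ a 0 * col 1 ^ a 1 * col 2 ^ a 2"

lemma proj_bottom_twisted: "proj (r, False, s) * twisted a = twisted a * proj (r, False, s)"
 unfolding twisted_def
 by (rule proj_commutes[where B = "{x. \<not> is_top x}"])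
   (auto intro!: commutes_on_mult commutes_on_power commutes_on_col)

lemma proj_col_commute: "r' \<noteq> r ==> proj (r, t, s) * col r' ^ k = col r' ^ k * proj (r, t, s)"
 by (rule proj_commutes[where B = "{x. column x = r}"])
   (auto intro!: commutes_on_power commutes_on_col)

lemma proj_top_twisted:
 assumes "r < 3"
 shows "proj (r, True, s) * twisted a = twisted a * proj (r, True, s = even (a r))"
proof -
 consider "r = 0" | "r = 1" | "r = 2" using assms by linarith
 then show ?thesis
 proof cases
  case 1
  then show ?thesis
   by (simp add: twisted_def mult.assoc push[OF proj_col_power] push[OF proj_col_commute] proj_col_commute)
 next
  case 2
  then show ?thesis
   by (simp add: twisted_def mult.assoc push[OF proj_col_power] push[OF proj_col_commute] proj_col_commute)
 next
  case 3
  then show ?thesis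
   by (simp add: twisted_def mult.assoc proj_col_power push[OF proj_col_commute] proj_col_commute)
 qed
qed

lemma insert_frame:
 assumes "r < 3"
 shows "(r, t, True) \<in> set es ==> v (M * projs es) = v (M * projs (((r + 1) mod 3, t, False) # es))"
  and "((r + 1) mod 3, t, False) \<in> set es ==> v (M * projs es) = v (M * projs ((r, t, True) # es))"
proof -
 have *: "v (M * projs es * proj (r, t, True)) = v (M * projs es * proj ((r + 1) mod 3, t, False))"
  by (rule v_proj_right[OF assms])
 show "v (M * projs es) = v (M * projs (((r + 1) mod 3, t, False) # es))" if "(r, t, True) \<in> set es"
  using * projs_absorb(2)[OF that] by (simp add: mult.assoc proj_projs)
 show "v (M * projs es) = v (M * projs ((r, t, True) # es))" if "((r + 1) mod 3, t, False) \<in> set es"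
  using * projs_absorb(2)[OF that] by (simp add: mult.assoc proj_projs)
qed

text \<open>Together with \<open>insert_frame\<close> these are the steps of the walk along the
  knot: a projector is copied to the other end of a cable, through a frame edge or through a twist
  region, whose parity decides on which side the cable emerges.\<close>

lemma insert_column:
 assumes "r < 3" "s' \<longleftrightarrow> s = even (a r)"
 shows "(r, True, s) \<in> set es ==> v (twisted a * projs es) = v (twisted a * projs ((r, False, s') # es))"
  and "(r, False, s) \<in> set es ==> v (twisted a * projs es) = v (twisted a * projs ((r, True, s') # es))"
proof -
 have ss: "s \<longleftrightarrow> s' = even (a r)" using assms(2) by auto
 have *: "v (twisted a * (proj (r, True, s) * projs es)) = v (twisted a * (proj (r, False, s') * projs es))"
  using v_proj_left[of r s' "twisted a * projs es"] push[OF proj_top_twisted[OF assms(1), of s' a]] ss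
   push[OF proj_bottom_twisted[of r s' a]] by simp
 have **: "v (twisted a * (proj (r, True, s') * projs es)) = v (twisted a * (proj (r, False, s) * projs es))"
  using v_proj_left[of r s "twisted a * projs es"] push[OF proj_top_twisted[OF assms(1), of s a]] assms(2)
   push[OF proj_bottom_twisted[of r s a]] by simp
 show "v (twisted a * projs es) = v (twisted a * projs ((r, False, s') # es))" if "(r, True, s) \<in> set es"
  using * projs_absorb(1)[OF that] by simp
 show "v (twisted a * projs es) = v (twisted a * projs ((r, True, s') # es))" if "(r, False, s) \<in> set es"
  using ** projs_absorb(1)[OF that] by simp
qed

text \<open>Listed against the direction of the walk along the knot, so that the suffixes are the
  sets of projectors reached so far.\<close>

definition ends :: "(nat \<times> bool \<times> bool) list" where
 "ends = [(0, False, False), (2, False, True), (2, True, False), (1, True, True), (1, False, True), (2, False, False),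
  (2, True, True), (0, True, False), (0, False, True), (1, False, False), (1, True, False), (0, True, True)]"

abbreviation "Psi \<equiv> projs ends"

lemma in_ends: "r < 3 ==> (r, t, s) \<in> set ends"
proof -
 assume "r < 3"
 then consider "r = 0" | "r = 1" | "r = 2" by linarith
 then show ?thesis by cases (cases t; cases s; simp add: ends_def)+
qed

text \<open>The diagram is a knot: its single strand runs through all six edges joining the twist regions.\<close>
lemma insert_all_projs:
 assumes "odd (a 0)" "even (a 1)" "odd (a 2)"
 shows "v (twisted a * proj (0, True, True)) = v (twisted a * Psi)"
proof -
 let ?p = "\<lambda>es. v (twisted a * projs es)"
 have "v (twisted a * proj (0, True, True)) = ?p [(0, True, True)]" by simp
 also have "... = ?p (drop 10 ends)"
  using insert_frame(1)[of 0 True "[(0, True, True)]" "twisted a"] by (simp add: ends_def numeral_2_eq_2)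
 also have "... = ?p (drop 9 ends)"
  using insert_column(1)[of 1 False False a "drop 10 ends"] assms by (simp add: ends_def numeral_2_eq_2)
 also have "... = ?p (drop 8 ends)"
  using insert_frame(2)[of 0 False "drop 9 ends" "twisted a"] by (simp add: ends_def numeral_2_eq_2)
 also have "... = ?p (drop 7 ends)"
  using insert_column(2)[of 0 False True a "drop 8 ends"] assms by (simp add: ends_def numeral_2_eq_2)
 also have "... = ?p (drop 6 ends)"
  using insert_frame(2)[of 2 True "drop 7 ends" "twisted a"] by (simp add: ends_def numeral_2_eq_2)
 also have "... = ?p (drop 5 ends)"
  using insert_column(1)[of 2 False True a "drop 6 ends"] assms by (simp add: ends_def numeral_2_eq_2)
 also have "... = ?p (drop 4 ends)"
  using insert_frame(2)[of 1 False "drop 5 ends" "twisted a"] by (simp add: ends_def numeral_2_eq_2)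
 also have "... = ?p (drop 3 ends)"
  using insert_column(2)[of 1 True True a "drop 4 ends"] assms by (simp add: ends_def numeral_2_eq_2)
 also have "... = ?p (drop 2 ends)"
  using insert_frame(1)[of 1 True "drop 3 ends" "twisted a"] by (simp add: ends_def numeral_2_eq_2)
 also have "... = ?p (drop 1 ends)"
  using insert_column(1)[of 2 True False a "drop 2 ends"] assms by (simp add: ends_def numeral_2_eq_2)
 also have "... = ?p (drop 0 ends)"
  using insert_frame(1)[of 2 False "drop 1 ends" "twisted a"] by (simp add: ends_def numeral_2_eq_2)
 finally show ?thesis by simp
qed

lemma Psi_absorb: "r < 3 ==> proj (r, t, s) * Psi = Psi" "r < 3 ==> Psi * proj (r, t, s) = Psi"
 by (simp_all add: projs_absorb in_ends)

lemma E_Psi: "r < 3 ==> Suc i < n ==> E (Lab r t s i) (Lab r t s (Suc i)) * Psi = 0"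
 by (subst Psi_absorb(1)[of r t s, symmetric])
   (simp_all add: proj_def mult.assoc[symmetric] E_jw_op inj_Lab)

lemma Psi_E: "r < 3 ==> Suc i < n ==> Psi * E (Lab r t s i) (Lab r t s (Suc i)) = 0"
 by (subst Psi_absorb(2)[of r t s, symmetric])
   (simp_all add: proj_def mult.assoc jw_op_E inj_Lab)

lemma uncupped_Psi: "r < 3 ==> uncupped (map (Lab r t s) [0..<n]) Psi"
 unfolding successively_nth using Psi_E by simp

lemma uncapped_Psi:
 assumes "r < 3" "commutes_on {x. column x = r} S"
 shows "uncapped (map (Lab r t s) [0..<n]) (S * Psi)"
 unfolding successively_nth
proof (intro allI impI)
 fix i assume i: "Suc i < length (map (Lab r t s) [0..<n])"
 have "E (Lab r t s i) (Lab r t s (Suc i)) * S = S * E (Lab r t s i) (Lab r t s (Suc i))"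
  by (rule commutes_onD[OF assms(2)]) auto
 with i show "E (map (Lab r t s) [0..<n] ! i) (map (Lab r t s) [0..<n] ! Suc i) * (S * Psi) = 0"
  using E_Psi[OF assms(1), of i t s] by (simp add: push)
qed

abbreviation col_arcs :: "nat => nat => op" where
 "col_arcs r k \<equiv> arcs (Lab r True False) (Lab r True True) k"

lemma commutes_on_col_arcs: "(\<And>s i. Lab r True s i \<notin> B) ==> commutes_on B (col_arcs r k)"
 by (rule commutes_on_arcs) auto

text \<open>At the beginning of a product a projector may be taken at the bottom end of its strand;
  from there it passes \<open>M\<close> and is absorbed by the final \<open>Psi\<close>. Read
  backwards, this supplies the lower projectors that \<open>twists_expand\<close> requires.\<close>

lemma v_Psi_left:
 assumes "commutes_on {x. \<not> is_top x} M"
 shows "v (Psi * (M * Psi)) = v (M * Psi)"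
proof -
 have bot: "v (proj (r, False, s) * (M * Psi)) = v (M * Psi)" if "r < 3" for r s
  using push[OF proj_commutes[OF assms, of r False s]] Psi_absorb(1)[OF that] by simp
 have *: "v (projs es * (M * Psi)) = v (M * Psi)" if "set es \<subseteq> {e. fst e < 3}" for es
  using that
 proof (induction es)
  case (Cons e es)
  obtain r t s where e: "e = (r, t, s)" by (cases e) auto
  then have r: "r < 3" using Cons.prems by simp
  have "v (proj e * (projs es * (M * Psi))) = v (proj (r, False, s) * (projs es * (M * Psi)))"
   unfolding e by (cases t) (simp_all add: v_proj_left)
  also have "... = v (projs es * (M * Psi))"
   using push[OF proj_commutes[OF assms, of r False s]] Psi_absorb(1)[OF r] push[OF proj_projs] by simp
  finally show ?case using Cons by (simp add: mult.assoc)
 qed simp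
 have "set ends \<subseteq> {e. fst e < 3}" by (simp add: ends_def)
 then show ?thesis by (rule *)
qed

lemma twists_expand_Psi:
 assumes "r < 3" "commutes_on {x. column x = r} S"
 shows "Psi * (col r ^ a * (S * Psi)) = (\<Sum>k\<le>n. sc (twists_coeff n a k) * (Psi * (col_arcs r k * (S * Psi))))"
 using twists_expand[OF distinct_col[of r True] uncupped_Psi[OF assms(1)] uncupped_Psi[OF assms(1)]
   uncapped_Psi[OF assms, of True] uncapped_Psi[OF assms, of True], of a]
  unfolding col_def by simp

definition theta :: "nat => nat => nat => lser" where
 "theta k0 k1 k2 = v (col_arcs 0 k0 * (col_arcs 1 k1 * (col_arcs 2 k2 * Psi)))"

lemma twisted_Psi:
 "v (twisted a * Psi) = (\<Sum>k0\<le>n. \<Sum>k1\<le>n. \<Sum>k2\<le>n.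
  twists_coeff n (a 0) k0 * (twists_coeff n (a 1) k1 * (twists_coeff n (a 2) k2 * theta k0 k1 k2)))"
proof -
 note co = commutes_on_mult commutes_on_power commutes_on_col commutes_on_col_arcs
 let ?A = "\<lambda>r k. col_arcs r k"
 have comm: "?A r k * col r' ^ b = col r' ^ b * ?A r k" if "r \<noteq> r'" for r r' k b
  using arcs_commutes[of "{x. column x = r}" "col r' ^ b" "Lab r True False" "Lab r True True" k] that
  by (simp add: commutes_on_power commutes_on_col)
 have "v (twisted a * Psi) = v (Psi * (twisted a * Psi))"
  by (rule v_Psi_left[symmetric]) (auto simp: twisted_def intro!: co)
 also have "... = v (Psi * (col 0 ^ a 0 * ((col 1 ^ a 1 * col 2 ^ a 2) * Psi)))"
  by (simp add: twisted_def mult.assoc)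
 also have "... = (\<Sum>k0\<le>n. twists_coeff n (a 0) k0 * v (Psi * (?A 0 k0 * ((col 1 ^ a 1 * col 2 ^ a 2) * Psi))))"
  by (subst twists_expand_Psi) (auto simp: v_sum v_scale intro!: co)
 \<comment> \<open>The regions commute, so the expanded one is moved behind the remaining twists,
   next to \<open>Psi\<close>, before the next region is expanded.\<close>
 also have "... = (\<Sum>k0\<le>n. twists_coeff n (a 0) k0 * v (Psi * (col 1 ^ a 1 * ((col 2 ^ a 2 * ?A 0 k0) * Psi))))"
  by (simp add: mult.assoc comm push[OF comm])
 also have "... = (\<Sum>k0\<le>n. twists_coeff n (a 0) k0 * (\<Sum>k1\<le>n. twists_coeff n (a 1) k1 *
   v (Psi * (?A 1 k1 * ((col 2 ^ a 2 * ?A 0 k0) * Psi)))))"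
  by (subst twists_expand_Psi) (auto simp: v_sum v_scale intro!: co)
 also have "... = (\<Sum>k0\<le>n. twists_coeff n (a 0) k0 * (\<Sum>k1\<le>n. twists_coeff n (a 1) k1 *
   v (Psi * (col 2 ^ a 2 * ((?A 1 k1 * ?A 0 k0) * Psi)))))"
  by (simp add: mult.assoc push[OF comm])
 also have "... = (\<Sum>k0\<le>n. twists_coeff n (a 0) k0 * (\<Sum>k1\<le>n. twists_coeff n (a 1) k1 *
   (\<Sum>k2\<le>n. twists_coeff n (a 2) k2 * v (Psi * (?A 2 k2 * ((?A 1 k1 * ?A 0 k0) * Psi))))))"
  by (subst twists_expand_Psi) (auto simp: v_sum v_scale intro!: co)
 finally have main: "v (twisted a * Psi) = (\<Sum>k0\<le>n. twists_coeff n (a 0) k0 * (\<Sum>k1\<le>n. twists_coeff n (a 1) k1 *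
   (\<Sum>k2\<le>n. twists_coeff n (a 2) k2 * v (Psi * (?A 2 k2 * ((?A 1 k1 * ?A 0 k0) * Psi))))))" .
 have th: "v (Psi * (?A 2 k2 * ((?A 1 k1 * ?A 0 k0) * Psi))) = theta k0 k1 k2" for k0 k1 k2
 proof -
  have "commutes_on {x. \<not> is_top x} (?A 2 k2 * (?A 1 k1 * ?A 0 k0))" by (auto intro!: co)
  from v_Psi_left[OF this] have "v (Psi * (?A 2 k2 * ((?A 1 k1 * ?A 0 k0) * Psi)))
    = v (?A 2 k2 * (?A 1 k1 * (?A 0 k0 * Psi)))" by (simp add: mult.assoc)
  also have "?A 2 k2 * (?A 1 k1 * (?A 0 k0 * Psi)) = ?A 0 k0 * (?A 1 k1 * (?A 2 k2 * Psi))"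
  proof -
   have c: "?A r k * ?A r' k' = ?A r' k' * ?A r k" if "r \<noteq> r'" for r r' k k'
    using that by (intro arcs_commutes[of "{x. column x = r'}"] commutes_on_col_arcs) auto
   have c': "?A 2 k2 * ?A 1 k1 = ?A 1 k1 * ?A 2 k2" "?A 2 k2 * ?A 0 k0 = ?A 0 k0 * ?A 2 k2"
    "?A 1 k1 * ?A 0 k0 = ?A 0 k0 * ?A 1 k1" by (rule c, simp)+
   show ?thesis by (simp only: push[OF c'(1)] push[OF c'(2)] push[OF c'(3)])
  qed
  finally show ?thesis by (simp add: theta_def)
 qed
 show ?thesis unfolding main th by (simp add: sum_distrib_left)
qed

end

section \<open>Sliding turnbacks along parallel arcs\<close>

lemma E_E_Sw_left: "distinct [a, b, c] ==> E a b * E b c = Sw a c * E b c"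
 by (simp add: E_E_Sw) (auto simp: Sw_E transp_def E_sym[of b a])

lemma Sw_sym: "Sw a b = Sw b a"
proof -
 have t: "transp a b = transp b a" for a b :: lab by (auto simp: transp_def fun_eq_iff)
 have "swap a b s = swap b a s" for s by (rule state_eqI) (simp add: partner_swap t[of a b])
 then show ?thesis by (intro op_eqI) simp
qed

text \<open>Two parallel arcs \<open>a a'\<close> and \<open>b b'\<close> form a band, and a
  turnback across one end of it equals the turnback across the other end: both act as the same
  transposition.\<close>

lemma arc_pair_right:
 assumes "distinct [a, a', b, b']"
 shows "E a a' * (E b b' * E a b) = E a a' * (E b b' * E a' b')"
proof -
 have "E b b' * E a b = E b b' * Sw b' a"
  using E_E_Sw[of b' b a] assms by (auto simp: E_sym[of b' b] E_sym[of b a])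
 then have 1: "E a a' * (E b b' * E a b) = E a a' * (E b b' * Sw b' a)" by simp
 have c: "E a a' * E b b' = E b b' * E a a'" using assms by (intro E_comm) auto
 have "E a a' * (E b b' * E a' b') = E b b' * (E a a' * E a' b')" by (rule push[OF c])
 also have "... = E b b' * (E a a' * Sw a b')" using E_E_Sw[of a a' b'] assms by auto
 also have "... = E a a' * (E b b' * Sw a b')" by (rule push[OF c[symmetric]])
 also have "Sw a b' = Sw b' a"
  by (rule Sw_sym)
 finally show ?thesis using 1 by simp
qed

lemma arc_pair_left:
 assumes "distinct [a, a', b, b']"
 shows "E a b * (E a a' * E b b') = E a' b' * (E a a' * E b b')"
proof -
 have "E a b * E a a' = Sw b a' * E a a'"
  using E_E_Sw_left[of b a a'] assms by (auto simp: E_sym[of b a])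
 then have 1: "E a b * (E a a' * E b b') = Sw b a' * (E a a' * E b b')" by (rule push)
 have c: "E a a' * E b b' = E b b' * E a a'" using assms by (intro E_comm) auto
 have "E a' b' * E b b' = Sw a' b * E b b'"
  using E_E_Sw_left[of a' b' b] assms by (auto simp: E_sym[of b' b])
 then have "E a' b' * (E a a' * E b b') = Sw a' b * (E b b' * E a a')" unfolding c by (rule push)
 also have "Sw a' b = Sw b a'"
  by (rule Sw_sym)
 finally show ?thesis using 1 c by simp
qed

lemma arcs_sym: "arcs l r k = arcs r l k"
 by (induction k) (simp_all add: E_sym)

context
 fixes x y :: "nat => lab"
 assumes inj: "inj x" "inj y" and disj: "\<And>i j. x i \<noteq> y j"
begin

lemma arc_arcs_commute: "E (x i) (y i) * arcs x y k = arcs x y k * E (x i) (y i)"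
proof (induction k)
 case (Suc k)
 have "E (x i) (y i) * E (x k) (y k) = E (x k) (y k) * E (x i) (y i)"
  by (cases "i = k") (auto intro!: E_comm simp: disj disj[symmetric] inj_eq[OF inj(1)] inj_eq[OF inj(2)])
 then show ?case using push[OF Suc.IH] by (simp add: mult.assoc)
qed simp

lemma arc_arcs: "i < k ==> E (x i) (y i) * arcs x y k = sc loop_val * arcs x y k"
proof (induction k)
 case (Suc k)
 show ?case
 proof (cases "i = k")
  case True
  then show ?thesis
   using push[OF arc_arcs_commute[of k k]] E_square[OF disj, of k k] by (simp add: sc_front)
 next
  case False
  then show ?thesis using Suc push[OF Suc.IH] by (simp add: mult.assoc)
 qed
qed simp

text \<open>Two of the arcs are doubled at the cost of two loops, which brings them into the
  position that \<open>arc_pair_left\<close> and \<open>arc_pair_right\<close> require.\<close>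

lemma arcs_two_arcs:
 assumes "i < k" "j < k"
 shows "arcs x y k = sc (1 / loop_val\<^sup>2) * (E (x i) (y i) * (E (x j) (y j) * arcs x y k))"
 using assms by (simp add: arc_arcs sc_front sc_merge power2_eq_square sc_simps(2))

lemma arcs_flip_left:
 assumes "i < k" "j < k" "i \<noteq> j"
 shows "E (x i) (x j) * arcs x y k = E (y i) (y j) * arcs x y k"
proof -
 have d: "distinct [x i, y i, x j, y j]"
  using assms(3) disj by (auto simp: disj[symmetric] inj_eq[OF inj(1)] inj_eq[OF inj(2)])
 have e: "E (x i) (x j) * (E (x i) (y i) * (E (x j) (y j) * Z)) = E (y i) (y j) * (E (x i) (y i) * (E (x j) (y j) * Z))" for Z
  using arc_pair_left[OF d] by (metis mult.assoc)
 have "T * arcs x y k = sc (1 / loop_val\<^sup>2) * (T * (E (x i) (y i) * (E (x j) (y j) * arcs x y k)))" for T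
  by (subst arcs_two_arcs[OF assms(1,2)]) (rule push[OF sc_central])
 then show ?thesis using e by metis
qed

lemma arcs_flip_right:
 assumes "i < k" "j < k" "i \<noteq> j"
 shows "arcs x y k * E (x i) (x j) = arcs x y k * E (y i) (y j)"
proof -
 have d: "distinct [x i, y i, x j, y j]"
  using assms(3) disj by (auto simp: disj[symmetric] inj_eq[OF inj(1)] inj_eq[OF inj(2)])
 have "arcs x y k = sc (1 / loop_val\<^sup>2) * (arcs x y k * (E (x i) (y i) * E (x j) (y j)))"
  using arcs_two_arcs[OF assms(1,2)] arc_arcs_commute push[OF arc_arcs_commute] by simp
 then show ?thesis
  using arc_pair_right[OF d] by (metis mult.assoc)
qed

end

section \<open>Quantum integers and the coefficients of the bubble relation\<close>

lemma qint_2: "qint (Suc (Suc 0)) = - loop_val"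
proof -
 have "loop_val = - qint (Suc (Suc 0))" using Delta_qint[of "Suc 0"] by simp
 then show ?thesis by (metis minus_minus)
qed

text \<open>Quantum integers are quotients of hyperbolic sines, and by the product formula
  \<open>qint_mult\<close> their products are linear in this even function. Quadratic identities
  among them thus reduce to arithmetic of the arguments.\<close>

definition cosh_q :: "int => lser" where
 "cosh_q k = (varA powi (2 * k) + varA powi (- (2 * k))) / (varA ^ 2 - varAinv ^ 2)\<^sup>2"

lemma cosh_q_minus: "cosh_q (- k) = cosh_q k"
 by (simp add: cosh_q_def add.commute)

lemma qint_mult: "qint a * qint b = cosh_q (int a + int b) - cosh_q (int a - int b)"
proof -
 have q: "qint m = (varA powi (2 * int m) - varA powi (- (2 * int m))) / (varA ^ 2 - varAinv ^ 2)" for m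
  by (simp add: qint_def varAinv_eq power_int_def nat_mult_distrib power_inverse)
 have p: "varA powi i * varA powi j = varA powi (i + j)" for i j by (simp add: power_int_add)
 have "(varA powi (2 * int a) - varA powi (- (2 * int a))) * (varA powi (2 * int b) - varA powi (- (2 * int b)))
  = varA powi (2 * (int a + int b)) + varA powi (- (2 * (int a + int b)))
   - (varA powi (2 * (int a - int b)) + varA powi (- (2 * (int a - int b))))"
  by (simp add: left_diff_distrib right_diff_distrib p algebra_simps)
 then show ?thesis
  unfolding q cosh_q_def by (simp only: times_divide_times_eq power2_eq_square diff_divide_distrib[symmetric])
qed

text \<open>The bubble relation for \<open>m\<close> strands on each side of a region,
  \<open>t\<close> of which pass through: closing the outermost strand either keeps the number of
  arcs or removes one, with coefficient \<open>bubble_keep\<close> or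
  \<open>bubble_lose\<close>.\<close>

definition bubble_keep :: "nat => nat => lser" where
 "bubble_keep m t = - (qint t * qint (2 * m + 1 - t)) / (qint m)\<^sup>2"

definition bubble_lose :: "nat => nat => lser" where
 "bubble_lose m t = (qint (m - t) / qint m)\<^sup>2"

lemma qint_mult_Suc: "loop_val * qint (Suc m) = - qint (Suc (Suc m)) - qint m"
proof -
 have "qint (Suc (Suc 0)) * qint (Suc m) = qint (Suc (Suc m)) * qint (Suc 0) + qint m * qint (Suc 0)"
  unfolding qint_mult using cosh_q_minus[of "int m - 1"] by (simp add: algebra_simps)
 then have "- (loop_val * qint (Suc m)) = qint (Suc (Suc m)) + qint m" by (simp add: qint_2)
 then have "loop_val * qint (Suc m) = - (qint (Suc (Suc m)) + qint m)" by (metis minus_minus)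
 then show ?thesis by simp
qed

text \<open>The recursion that Wenzl's formula produces. Its summands come from the direct closure,
  from the two terms with one correction, and from the term with both corrections, which contains
  the smaller bubble.\<close>

lemma bubble_keep_Suc:
 assumes "t \<le> m" "0 < m"
 shows "bubble_keep (Suc m) (Suc t) = loop_val + 2 * (qint m / qint (Suc m)) + (qint m / qint (Suc m))\<^sup>2 * bubble_keep m t"
proof -
 have i: "int (2 * Suc m + 1 - Suc t) = 2 * int m + 2 - int t" "int (2 * m + 1 - t) = 2 * int m + 1 - int t"
  using assms by auto
 have C: "cosh_q (2 * int t - (2 * int m + 1)) = cosh_q (2 * int m + 1 - 2 * int t)"
  using cosh_q_minus[of "2 * int m + 1 - 2 * int t"] by simp
 have "qint (Suc t) * qint (2 * Suc m + 1 - Suc t) - qint t * qint (2 * m + 1 - t)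
   = qint (Suc m) * qint (Suc (Suc m)) - qint (Suc m) * qint m"
  unfolding qint_mult i using cosh_q_minus[of "2 * int m + 1 - 2 * int t"] cosh_q_minus[of 1]
  by (simp add: algebra_simps)
 moreover have q2: "qint (Suc (Suc m)) = - loop_val * qint (Suc m) - qint m"
  by (simp add: qint_mult_Suc)
 ultimately have P: "qint (Suc t) * qint (2 * Suc m + 1 - Suc t) =
   qint t * qint (2 * m + 1 - t) - loop_val * (qint (Suc m))\<^sup>2 - 2 * (qint m * qint (Suc m))"
  unfolding q2 by (simp add: power2_eq_square algebra_simps)
 have field: "- (R - d * y\<^sup>2 - 2 * (x * y)) / y\<^sup>2 = d + 2 * (x / y) + (x / y)\<^sup>2 * (- R / x\<^sup>2)"
  if "x \<noteq> 0" "y \<noteq> 0" for R d x y :: lser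
  using that by (simp add: power_divide diff_divide_distrib power2_eq_square)
 show ?thesis unfolding bubble_keep_def P by (rule field) (use assms in simp_all)
qed

context closure_functional
begin

text \<open>By \<open>left_loop\<close> another vertical arc may be put in front for a factor
  \<open>loop_val\<close>; then \<open>E_E_E\<close> straightens the strand.\<close>

lemma vertical_cancel:
 assumes "b \<noteq> Lab r True s i" "b \<noteq> Lab r False s i"
 shows "v (E b (Lab r True s i) * (E (Lab r True s i) (Lab r False s i) * T)) = v T"
proof -
 let ?a = "Lab r True s i" and ?a' = "Lab r False s i"
 have d: "distinct [?a', ?a, b]" using assms by auto
 have "loop_val * v (E b ?a * (E ?a ?a' * T)) = v (E ?a ?a' * (E b ?a * (E ?a ?a' * T)))"
  by (simp add: left_loop)
 also have "E ?a ?a' * (E b ?a * (E ?a ?a' * T)) = E ?a ?a' * T"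
  using E_E_E[OF d] by (simp add: E_sym mult.assoc[symmetric])
 finally show ?thesis by (simp add: left_loop)
qed

lemma jw_op_Psi:
 assumes "r < 3" "k \<le> n"
 shows "jw_op (Lab r t s) k * Psi = Psi"
 using assms by (intro jw_op_absorb_right E_Psi) auto

lemma col_arcs_side: "col_arcs r k = arcs (Lab r True s) (Lab r True (\<not> s)) k"
 by (cases s) (simp_all add: arcs_sym)

text \<open>Joining the outermost strands at the two ends of a region with \<open>k\<close> arcs, from one side.\<close>
lemma bubble:
 fixes c :: nat and s :: bool and Q :: op
 defines "x \<equiv> Lab c True s" and "x' \<equiv> Lab c False s"
 assumes c: "c < 3" and Q: "commutes_on {x. column x = c} Q"
 defines "Z \<equiv> \<lambda>k. v (col_arcs c k * (Q * Psi))"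
 shows "k \<le> Suc m ==> Suc m \<le> n ==>
  v (col_arcs c k * (Q * (jw_op x (Suc m) * (jw_op x' (Suc m) * (E (x m) (x' m) * Psi)))))
   = bubble_keep (Suc m) (Suc m - k) * Z k + bubble_lose (Suc m) (Suc m - k) * Z (k - 1)"
proof -
 define y where "y = Lab c True (\<not> s)"
 define y' where "y' = Lab c False (\<not> s)"
 define w where "w k T = v (col_arcs c k * (Q * T))" for k T
 have inj: "inj x" "inj x'" "inj y" "inj y'" by (simp_all add: x_def x'_def y_def y'_def inj_Lab)
 have ne: "x i \<noteq> x' j" "x i \<noteq> y j" "x i \<noteq> y' j" "x' i \<noteq> y j" "x' i \<noteq> y' j" "y i \<noteq> y' j"
  "x i = x j \<longleftrightarrow> i = j" "x' i = x' j \<longleftrightarrow> i = j" "y i = y j \<longleftrightarrow> i = j" "y' i = y' j \<longleftrightarrow> i = j" for i j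
  by (auto simp: x_def x'_def y_def y'_def)
 note ne = ne ne(1-6)[symmetric]
 have A: "col_arcs c k = arcs x y k" for k by (simp add: x_def y_def col_arcs_side[of c k s])
 have EQ: "E a b * Q = Q * E a b" if "column a = c" "column b = c" "a \<noteq> b" for a b
  using commutes_onD[OF Q, of a b] that by simp
 have cx: "column (x i) = c" "column (x' i) = c" "column (y i) = c" "column (y' i) = c" for i
  by (simp_all add: x_def x'_def y_def y'_def)
 have w_add: "w k (S + T) = w k S + w k T" and w_scale: "w k (sc d * T) = d * w k T" for k S T d
  by (simp_all add: w_def distrib_left v_add v_scale sc_front)
 have w_minus: "w k (S - sc d * T) = w k S - d * w k T" for k S T d
  using w_add[of k "S - sc d * T" "sc d * T"] w_scale by simp
 have arcs_E: "E a b * arcs x y k = arcs x y k * E a b"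
  if "a \<noteq> b" "\<And>i. i < k ==> x i \<noteq> a \<and> x i \<noteq> b \<and> y i \<noteq> a \<and> y i \<noteq> b" for a b k
  using commutes_onD[OF commutes_on_arcs[of x y k "{a, b}"], of a b] that ne by auto
 have w_E: "w k (E a b * T) = v (E a b * (arcs x y k * (Q * T)))"
  if "a \<noteq> b" "\<And>i. i < k ==> x i \<noteq> a \<and> x i \<noteq> b \<and> y i \<noteq> a \<and> y i \<noteq> b" "column a = c" "column b = c" for a b k T
  using push[OF EQ[of a b], of T] push[OF arcs_E[of a b k], of "Q * T"] that by (simp add: w_def A)
 have w_loop: "w k (E (x i) (x' i) * T) = loop_val * w k T" if "k \<le> i" for k i T
 proof -
  have "w k (E (x i) (x' i) * T) = v (E (x i) (x' i) * (arcs x y k * (Q * T)))"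
   using that by (intro w_E) (auto simp: ne cx)
  then show ?thesis unfolding x_def x'_def left_loop by (simp add: w_def A x_def)
 qed
 have flip: "w k (E (x i) (x (Suc i)) * T) = w k (E (y i) (y (Suc i)) * T)" if "Suc i < k" for k i T
 proof -
  have "arcs x y k * E (x i) (x (Suc i)) = arcs x y k * E (y i) (y (Suc i))"
   using that ne by (intro arcs_flip_right inj) auto
  then show ?thesis
   using push[OF EQ[of "x i" "x (Suc i)"], of T] push[OF EQ[of "y i" "y (Suc i)"], of T]
   by (simp add: w_def A cx ne) (metis mult.assoc)
 qed
 have flip': "w k (E (x' i) (x' (Suc i)) * T) = w k (E (y' i) (y' (Suc i)) * T)" if "Suc i < k" for k i T
 proof -
  have "w k (E (x' i) (x' (Suc i)) * T) = v (E (x' i) (x' (Suc i)) * (arcs x y k * (Q * T)))"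
   by (intro w_E) (auto simp: ne cx)
  also have "... = v (E (x i) (x (Suc i)) * (arcs x y k * (Q * T)))"
   by (simp add: x_def x'_def left_flip)
  also have "... = v (E (y i) (y (Suc i)) * (arcs x y k * (Q * T)))"
   using arcs_flip_left[of x y i k "Suc i"] that inj ne by (simp add: mult.assoc[symmetric])
  also have "... = v (E (y' i) (y' (Suc i)) * (arcs x y k * (Q * T)))"
   by (simp add: y_def y'_def left_flip)
  also have "... = w k (E (y' i) (y' (Suc i)) * T)"
   by (intro w_E[symmetric]) (auto simp: ne cx)
  finally show ?thesis .
 qed
 have jE: "jw_op z j * E a b = E a b * jw_op z j"
  if "inj z" "a \<noteq> b" "\<And>i. i < j ==> z i \<noteq> a \<and> z i \<noteq> b" for z j a b
  using that by (intro E_jw_op_commute[symmetric]) (auto intro: inj_on_subset)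
 have jPsi: "jw_op z j * Psi = Psi" if "j \<le> n" "z = x \<or> z = x' \<or> z = y \<or> z = y'" for z j
  using that c by (auto simp: x_def x'_def y_def y'_def jw_op_Psi)
 have jj: "jw_op x i * jw_op x' j = jw_op x' j * jw_op x i" for i j
  using jE[OF inj(1)] ne by (intro jw_op_commute) auto
 have jyx': "jw_op y i * jw_op x' j = jw_op x' j * jw_op y i" for i j
  using jE[OF inj(3)] ne by (intro jw_op_commute) auto
 \<comment> \<open>If all strands are turned back, both projectors slide through the arcs to the
   other side of the region, where the projectors in \<open>Psi\<close> absorb them. The closing arc
   then undoes the outermost turnback.\<close>
 have base: "w k (jw_op x k * (jw_op x' k * (E (x m) (x' m) * Psi))) = Z m" if k: "k = Suc m" "k \<le> n" for k m
 proof -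
  let ?N = "E (x m) (x' m) * Psi"
  have yN: "jw_op y k * ?N = ?N" "jw_op y' k * ?N = ?N"
   using push[OF jE[OF inj(3), of "x m" "x' m" k]] push[OF jE[OF inj(4), of "x m" "x' m" k]] jPsi k ne by auto
  have "w k (jw_op x k * (jw_op x' k * ?N)) = w k (jw_op y k * (jw_op x' k * ?N))"
   using flip inj ne by (intro jw_op_transfer_left w_add w_scale) auto
  also have "... = w k (jw_op x' k * ?N)" by (simp add: push[OF jyx'] yN)
  also have "... = w k (jw_op y' k * ?N)"
   using flip' inj ne by (intro jw_op_transfer_left w_add w_scale) auto
  also have "... = w k ?N" by (simp add: yN)
  also have "... = v (E (x m) (y m) * (E (x m) (x' m) * (arcs x y m * (Q * Psi))))"
  proof -
   have "arcs x y k = E (x m) (y m) * arcs x y m"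
    using arc_arcs_commute[of x y m m] inj ne k by simp
   then show ?thesis
    using push[OF EQ[of "x m" "x' m"], of Psi] push[OF arcs_E[of "x m" "x' m" m], of "Q * Psi"] ne cx
    by (simp add: w_def A mult.assoc)
  qed
  also have "... = Z m"
   using vertical_cancel[of "y m" c s m] by (simp add: x_def x'_def y_def E_sym Z_def A[symmetric] A)
  finally show ?thesis .
 qed
 have "w k (jw_op x (Suc m) * (jw_op x' (Suc m) * (E (x m) (x' m) * Psi)))
   = bubble_keep (Suc m) (Suc m - k) * Z k + bubble_lose (Suc m) (Suc m - k) * Z (k - 1)"
  if "k \<le> Suc m" "Suc m \<le> n" for k m
  using that
 proof (induction m)
  case 0
  show ?case
  proof (cases k)
   case 0
   then show ?thesis
    using w_loop[of 0 0 Psi] qint_2 by (simp add: bubble_keep_def bubble_lose_def w_def Z_def numeral_2_eq_2)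
  next
   case (Suc k')
   then have "k = Suc 0" using "0.prems" by simp
   then show ?thesis using base[of k 0] "0.prems" by (simp add: bubble_keep_def bubble_lose_def)
  qed
 next
  case (Suc j)
  show ?case
  proof (cases "k = Suc (Suc j)")
   case True
   then show ?thesis using base[of k "Suc j"] Suc.prems by (simp add: bubble_keep_def bubble_lose_def)
  next
   case False
   then have k: "k \<le> Suc j" using Suc.prems by simp
   define f f' where "f = jw_op x (Suc j)" and "f' = jw_op x' (Suc j)"
   define e where "e = E (x (Suc j)) (x' (Suc j))"
   define d d' where "d = E (x j) (x (Suc j))" and "d' = E (x' j) (x' (Suc j))"
   define b where "b = E (x j) (x' j)"
   define q where "q = Delta j / Delta (Suc j)"
   have ff': "f * f' = f' * f" unfolding f_def f'_def by (rule jj)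
   have fe: "f * e = e * f" and f'e: "f' * e = e * f'" and fd': "f * d' = d' * f"
    unfolding f_def f'_def e_def d'_def by (rule jE; auto simp: inj ne)+
   have fPsi: "f * Psi = Psi" "f' * Psi = Psi"
    unfolding f_def f'_def using jPsi Suc.prems by auto
   have fZ: "f' * (e * Psi) = e * Psi" "f * (e * Psi) = e * Psi"
    by (simp_all add: push[OF f'e] push[OF fe] fPsi)
   have J': "jw_op x' (Suc (Suc j)) * (e * Psi) = e * Psi - sc q * (f' * (d' * (e * Psi)))"
    by (simp add: f'_def[symmetric] d'_def[symmetric] q_def[symmetric] left_diff_distrib mult.assoc fZ)
   have fJ': "f * (jw_op x' (Suc (Suc j)) * (e * Psi)) = jw_op x' (Suc (Suc j)) * (e * Psi)"
    unfolding J' by (simp add: right_diff_distrib sc_front fZ push[OF ff'] push[OF fd'])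
   have J: "jw_op x (Suc (Suc j)) * T = f * T - sc q * (f * (d * (f * T)))" for T
    by (simp add: f_def[symmetric] d_def[symmetric] q_def[symmetric] left_diff_distrib mult.assoc)
   \<comment> \<open>Both projectors are expanded by Wenzl's recursion; the four terms contain none,
     one or both of the corrections \<open>d\<close> and \<open>d'\<close>.\<close>
   have main: "jw_op x (Suc (Suc j)) * (jw_op x' (Suc (Suc j)) * (e * Psi))
     = e * Psi - sc q * (f' * (d' * (e * Psi))) - sc q * (f * (d * (e * Psi)))
      + sc (q\<^sup>2) * (f * (d * (f' * (d' * (e * Psi)))))"
    unfolding J fJ' unfolding J'
    by (simp add: right_diff_distrib sc_front sc_merge power2_eq_square)
   have we: "w k (e * T) = loop_val * w k T" for T
    unfolding e_def using k by (intro w_loop) simp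
   \<comment> \<open>Strand \<open>Suc j\<close> carries no arc here, so a further closing arc
     \<open>e\<close> can be inserted in front for one loop. It contracts the corrections by
     \<open>ede\<close> and \<open>edde\<close>.\<close>
   have ew: "w k T = w k (e * T) / loop_val" for T by (simp add: we)
   have ede: "e * (d * (e * T)) = e * T" "e * (d' * (e * T)) = e * T" for T
   proof -
    have "distinct [x' (Suc j), x (Suc j), x j]" "distinct [x (Suc j), x' (Suc j), x' j]" by (auto simp: ne)
    from E_E_E[OF this(1)] E_E_E[OF this(2)] have "e * (d * e) = e" "e * (d' * e) = e"
     by (simp_all add: e_def d_def d'_def E_sym)
    then show "e * (d * (e * T)) = e * T" "e * (d' * (e * T)) = e * T" by (metis mult.assoc)+
   qed
   have edde: "e * (d * (d' * (e * T))) = e * (b * T)" for T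
   proof -
    have "distinct [x (Suc j), x' (Suc j), x j, x' j]" by (auto simp: ne)
    from E_E_E_E[OF this] have "e * (d * (d' * e)) = e * b"
     by (simp add: e_def d_def d'_def b_def)
    then show ?thesis by (metis mult.assoc)
   qed
   have dd: "d * f' = f' * d"
    unfolding d_def f'_def by (rule jE[symmetric]) (auto simp: inj ne)
   have t2: "w k (f' * (d' * (e * Psi))) = Z k"
    by (subst ew) (simp add: push[OF f'e[symmetric]] ede fZ we, simp add: w_def Z_def)
   have t3: "w k (f * (d * (e * Psi))) = Z k"
    by (subst ew) (simp add: push[OF fe[symmetric]] ede fZ we, simp add: w_def Z_def)
   have t4: "w k (f * (d * (f' * (d' * (e * Psi))))) = w k (f * (f' * (b * Psi)))"
    by (subst ew) (simp add: push[OF dd] push[OF fe[symmetric]] push[OF f'e[symmetric]] edde,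
     simp add: push[OF fe] push[OF f'e] we)
   have "w k (jw_op x (Suc (Suc j)) * (jw_op x' (Suc (Suc j)) * (e * Psi)))
     = loop_val * Z k - q * Z k - q * Z k + q\<^sup>2 * w k (f * (f' * (b * Psi)))"
    unfolding main by (simp add: w_add w_minus w_scale t2 t3 t4 we) (simp add: w_def Z_def)
   also have "w k (f * (f' * (b * Psi))) =
     bubble_keep (Suc j) (Suc j - k) * Z k + bubble_lose (Suc j) (Suc j - k) * Z (k - 1)"
    using Suc k by (simp add: f_def f'_def b_def)
   finally have 1: "w k (jw_op x (Suc (Suc j)) * (jw_op x' (Suc (Suc j)) * (e * Psi))) =
     (loop_val - 2 * q + q\<^sup>2 * bubble_keep (Suc j) (Suc j - k)) * Z k
     + q\<^sup>2 * bubble_lose (Suc j) (Suc j - k) * Z (k - 1)"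
    by (simp add: algebra_simps)
   have q: "q = - (qint (Suc j) / qint (Suc (Suc j)))"
    by (simp add: q_def Delta_qint)
   have K: "loop_val - 2 * q + q\<^sup>2 * bubble_keep (Suc j) (Suc j - k) = bubble_keep (Suc (Suc j)) (Suc (Suc j) - k)"
    using bubble_keep_Suc[of "Suc j - k" "Suc j"] k by (simp add: q Suc_diff_le)
   have "qint (Suc j) \<noteq> 0" by simp
   then have L: "q\<^sup>2 * bubble_lose (Suc j) (Suc j - k) = bubble_lose (Suc (Suc j)) (Suc (Suc j) - k)"
    using k by (simp add: q bubble_lose_def power_divide)
   show ?thesis using 1 unfolding K L e_def by simp
  qed
 qed
 then show "k \<le> Suc m ==> Suc m \<le> n ==>
  v (col_arcs c k * (Q * (jw_op x (Suc m) * (jw_op x' (Suc m) * (E (x m) (x' m) * Psi)))))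
   = bubble_keep (Suc m) (Suc m - k) * Z k + bubble_lose (Suc m) (Suc m - k) * Z (k - 1)"
  by (simp only: w_def)
qed

end

section \<open>Relations between theta networks\<close>

context closure_functional
begin

lemma v_proj_frame:
 assumes "r < 3"
 shows "v (M * proj (r, t, s)) = v (M * proj (column (frame (Lab r t s 0)), t, \<not> s))"
proof (cases s)
 case False
 have "(r + 2) mod 3 < 3" "((r + 2) mod 3 + 1) mod 3 = r" using assms by (auto simp: mod_Suc)
 then show ?thesis using v_proj_right[of "(r + 2) mod 3" M t] False by simp
qed (use v_proj_right[OF assms, of M t] in simp)

lemma commutes_on_projs:
 "(\<And>r t s i. (r, t, s) \<in> set es ==> Lab r t s i \<notin> B) ==> commutes_on B (projs es)"
proof (induction es)
 case (Cons e es)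
 obtain r t s where e: "e = (r, t, s)" by (cases e) auto
 have "commutes_on B (proj e)" using Cons.prems e by (intro commutes_on_proj[OF e]) auto
 moreover have "commutes_on B (projs es)" by (rule Cons.IH) (use Cons.prems in auto)
 ultimately show ?case by (simp add: commutes_on_mult)
qed (simp add: commutes_on_1)

text \<open>An edge of the frame carries the projectors of both its ends. Those of the neighbouring
  region are taken out of \<open>Psi\<close>, passed across the closing arc and brought back along
  the frame. The arc then lies between two copies of the projectors, as \<open>bubble\<close>
  requires.\<close>

lemma face:
 assumes "c < 3" "n = Suc m"
 shows "v (L * (proj (c, True, s) * (proj (c, False, s) * (E (Lab c True s m) (Lab c False s m) * Psi))))
  = v (L * (Psi * E (Lab c True s m) (Lab c False s m)))"
proof -
 define c' where "c' = column (frame (Lab c True s 0))"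
 have c': "c' < 3" "c' \<noteq> c" using assms(1) by (auto simp: c'_def mod_Suc)
 have fr: "frame (Lab c t s i) = Lab c' t (\<not> s) i" for t i by (simp add: c'_def)
 let ?e = "E (Lab c True s m) (Lab c False s m)" and ?e' = "E (Lab c' True (\<not> s) m) (Lab c' False (\<not> s) m)"
 let ?g = "\<lambda>t. proj (c, t, s)" and ?h = "\<lambda>t. proj (c', t, \<not> s)"
 have flip: "v (M * ?e) = v (M * ?e')" for M
  using right_flip[of "Lab c True s m" "Lab c False s m" M] assms by (simp add: labels_def fr del: frame.simps)
 have he: "?h t * ?e = ?e * ?h t" for t
  using c'(2) by (intro proj_commutes[of "range (Lab c' t (\<not> s))"] commutes_on_E) auto
 have gh: "v (M * ?h t) = v (M * ?g t)" for M t
  using v_proj_frame[OF assms(1), of M t s] by (simp add: c'_def)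
 define P where "P = projs (removeAll (c, True, s) (removeAll (c, False, s) ends))"
 have P: "Psi = P * (?g True * ?g False)"
  using projs_removeAll[of "(c, False, s)" ends] projs_removeAll[of "(c, True, s)" "removeAll (c, False, s) ends"]
   in_ends[OF assms(1)] by (simp add: P_def mult.assoc)
 have Pe: "P * ?e = ?e * P"
 proof -
  have "commutes_on {Lab c True s m, Lab c False s m} P"
   unfolding P_def by (rule commutes_on_projs) auto
  from commutes_onD[OF this] show ?thesis by simp
 qed
 have Pg: "P * ?g t = ?g t * P" for t unfolding P_def by (rule proj_projs[symmetric])
 have "v (L * (Psi * ?e)) = v (L * (Psi * ?e'))"
  using flip[of "L * Psi"] by (simp add: mult.assoc)
 also have "... = v (L * (Psi * (?h True * (?h False * ?e'))))"
  using Psi_absorb(2)[OF c'(1)] by (simp add: mult.assoc[symmetric])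
 also have "... = v (L * (Psi * (?h True * (?h False * ?e))))"
  using flip[of "L * Psi * ?h True * ?h False"] by (simp add: mult.assoc)
 also have "... = v (L * Psi * ?e * ?h True * ?h False)"
  by (simp add: he push[OF he] mult.assoc)
 also have "... = v (L * Psi * ?e * ?g False * ?h True)"
  using gh[of "L * Psi * ?e * ?h True" False]
  by (simp add: mult.assoc proj_proj[of "(c', True, \<not> s)" "(c, False, s)"])
 also have "... = v (L * (Psi * (?e * (?g False * ?g True))))"
  using gh[of "L * Psi * ?e * ?g False" True] by (simp add: mult.assoc)
 also have "Psi * (?e * (?g False * ?g True)) = ?g True * (?g False * (?e * Psi))"
  unfolding P by (simp add: mult.assoc push[OF Pg] push[OF Pe] proj_proj[of "(c, False, s)"] Pg)
 finally show ?thesis by simp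
qed

lemma bubble_face:
 assumes "c < 3" "commutes_on {x. column x = c} Q" "n = Suc m" "k \<le> n"
 shows "v (col_arcs c k * (Q * (Psi * E (Lab c True s m) (Lab c False s m)))) =
  bubble_keep n (n - k) * v (col_arcs c k * (Q * Psi)) + bubble_lose n (n - k) * v (col_arcs c (k - 1) * (Q * Psi))"
 using bubble[OF assms(1,2), of k m s, unfolded assms(3)[symmetric]]
  face[OF assms(1,3), of "col_arcs c k * Q" s] assms(4)
 by (simp add: proj_def mult.assoc)

lemma col_arcs_commute: "r \<noteq> r' ==> col_arcs r k * col_arcs r' k' = col_arcs r' k' * col_arcs r k"
 by (intro arcs_commutes[of "{x. column x = r'}"] commutes_on_col_arcs) auto

text \<open>A closing arc at the face between regions 0 and 1 can be pushed along the frame, hence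
  it can be evaluated by \<open>bubble_face\<close> in either region.\<close>

lemma theta_relation_01:
 assumes "n = Suc m" "k0 \<le> n" "k1 \<le> n"
 shows "bubble_keep n (n - k0) * theta k0 k1 k2 + bubble_lose n (n - k0) * theta (k0 - 1) k1 k2
  = bubble_keep n (n - k1) * theta k0 k1 k2 + bubble_lose n (n - k1) * theta k0 (k1 - 1) k2"
proof -
 let ?A = col_arcs
 have c: "?A 1 i * ?A 0 j = ?A 0 j * ?A 1 i" for i j by (rule col_arcs_commute) simp
 have Q: "commutes_on {x. column x = 0} (?A 1 k1 * ?A 2 k2)" "commutes_on {x. column x = 1} (?A 0 k0 * ?A 2 k2)"
  by (auto intro!: commutes_on_mult commutes_on_col_arcs)
 have f: "v (M * E (Lab 0 True True m) (Lab 0 False True m)) = v (M * E (Lab 1 True False m) (Lab 1 False False m))" for M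
  using right_flip[of "Lab 0 True True m" "Lab 0 False True m" M] assms(1) by (simp add: labels_def)
 have "bubble_keep n (n - k0) * theta k0 k1 k2 + bubble_lose n (n - k0) * theta (k0 - 1) k1 k2
  = v (?A 0 k0 * ((?A 1 k1 * ?A 2 k2) * (Psi * E (Lab 0 True True m) (Lab 0 False True m))))"
  using bubble_face[OF _ Q(1) assms(1,2), of True] by (simp add: theta_def mult.assoc)
 also have "... = v (?A 1 k1 * ((?A 0 k0 * ?A 2 k2) * (Psi * E (Lab 1 True False m) (Lab 1 False False m))))"
  using f[of "?A 0 k0 * (?A 1 k1 * ?A 2 k2) * Psi"] by (simp only: mult.assoc push[OF c])
 also have "... = bubble_keep n (n - k1) * theta k0 k1 k2 + bubble_lose n (n - k1) * theta k0 (k1 - 1) k2"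
  using bubble_face[OF _ Q(2) assms(1,3), of False] by (simp add: theta_def mult.assoc push[OF c, simplified])
 finally show ?thesis .
qed

lemma theta_relation_12:
 assumes "n = Suc m" "k1 \<le> n" "k2 \<le> n"
 shows "bubble_keep n (n - k1) * theta k0 k1 k2 + bubble_lose n (n - k1) * theta k0 (k1 - 1) k2
  = bubble_keep n (n - k2) * theta k0 k1 k2 + bubble_lose n (n - k2) * theta k0 k1 (k2 - 1)"
proof -
 let ?A = col_arcs
 have c: "?A 1 i * ?A 0 j = ?A 0 j * ?A 1 i" "?A 2 i * ?A 0 j = ?A 0 j * ?A 2 i" "?A 2 i * ?A 1 j = ?A 1 j * ?A 2 i"
  for i j by (rule col_arcs_commute, simp)+
 have Q: "commutes_on {x. column x = 1} (?A 0 k0 * ?A 2 k2)" "commutes_on {x. column x = 2} (?A 0 k0 * ?A 1 k1)"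
  by (auto intro!: commutes_on_mult commutes_on_col_arcs)
 have f: "v (M * E (Lab 1 True True m) (Lab 1 False True m)) = v (M * E (Lab 2 True False m) (Lab 2 False False m))" for M
  using right_flip[of "Lab 1 True True m" "Lab 1 False True m" M] assms(1) by (simp add: labels_def numeral_2_eq_2)
 have "bubble_keep n (n - k1) * theta k0 k1 k2 + bubble_lose n (n - k1) * theta k0 (k1 - 1) k2
  = v (?A 1 k1 * ((?A 0 k0 * ?A 2 k2) * (Psi * E (Lab 1 True True m) (Lab 1 False True m))))"
  using bubble_face[OF _ Q(1) assms(1,2), of True] by (simp add: theta_def mult.assoc push[OF c(1), simplified])
 also have "... = v (?A 2 k2 * ((?A 0 k0 * ?A 1 k1) * (Psi * E (Lab 2 True False m) (Lab 2 False False m))))"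
  using f[of "?A 0 k0 * (?A 1 k1 * ?A 2 k2) * Psi"] by (simp only: mult.assoc push[OF c(1)] push[OF c(2)] push[OF c(3)])
 also have "... = bubble_keep n (n - k2) * theta k0 k1 k2 + bubble_lose n (n - k2) * theta k0 k1 (k2 - 1)"
  using bubble_face[OF _ Q(2) assms(1,3), of False]
  by (simp add: theta_def mult.assoc push[OF c(2), simplified] push[OF c(3), simplified])
 finally show ?thesis .
qed

end

text \<open>The solution with value 1 at \<open>t = 0\<close> of the recursion in
  \<open>bubble_eta\<close>: the factor for \<open>r\<close> is the eigenvalue of \<open>s\<close>
  minus \<open>bubble_keep n r\<close>, divided by \<open>bubble_lose n r\<close>. It is a product
  because \<open>[s][2n+1-s] - [r][2n+1-r] = [s-r][2n+1-s-r]\<close>.\<close>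

definition eta :: "nat => nat => nat => lser" where
 "eta n s t = (\<Prod>r<t. - (qint (s - r) * qint (2 * n + 1 - s - r)) / (qint (n - r))\<^sup>2)"

lemma eta_0 [simp]: "eta n s 0 = 1"
 by (simp add: eta_def)

lemma eta_eq_0: "s < t ==> eta n s t = 0"
 unfolding eta_def by (rule prod_zero) (auto intro!: bexI[of _ s])

text \<open>Any weights would satisfy the bubble relations. These are the values of the unknot in
  the colours \<open>2 (n - s)\<close> into which two strands of colour \<open>n\<close> fuse; the
  networks with two regions turned back determine them.\<close>

definition theta_sum :: "nat => nat => nat => nat => lser" where
 "theta_sum n t0 t1 t2 = (\<Sum>s\<le>n. Delta (2 * (n - s)) * (eta n s t0 * eta n s t1 * eta n s t2))"

text \<open>Each \<open>eta n s\<close> is an eigenvector of the bubble recursion.\<close>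
lemma bubble_eta:
 assumes "s \<le> n" "t \<le> n" "0 < n"
 shows "bubble_keep n t * eta n s t + bubble_lose n t * eta n s (Suc t)
  = - (qint s * qint (2 * n + 1 - s)) / (qint n)\<^sup>2 * eta n s t"
proof (cases "t \<le> s")
 case False
 then show ?thesis by (simp add: eta_eq_0)
next
 case True
 have i: "int (s - t) = int s - int t" "int (2 * n + 1 - s - t) = 2 * int n + 1 - int s - int t"
  "int (2 * n + 1 - t) = 2 * int n + 1 - int t" "int (2 * n + 1 - s) = 2 * int n + 1 - int s"
  using True assms by auto
 have "qint (s - t) * qint (2 * n + 1 - s - t) + qint t * qint (2 * n + 1 - t) = qint s * qint (2 * n + 1 - s)"
  unfolding qint_mult i using cosh_q_minus[of "2 * int n + 1 - 2 * int t"] by (simp add: algebra_simps)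
 then have key: "qint s * qint (2 * n + 1 - s) = qint t * qint (2 * n + 1 - t) + qint (s - t) * qint (2 * n + 1 - s - t)"
  by (simp only: add.commute)
 have lose: "bubble_lose n t * eta n s (Suc t) = - (qint (s - t) * qint (2 * n + 1 - s - t)) / (qint n)\<^sup>2 * eta n s t"
 proof (cases "t = n")
  case True
  then show ?thesis using \<open>t \<le> s\<close> assms by (simp add: bubble_lose_def)
 next
  case False
  then have "qint (n - t) \<noteq> 0" using assms by simp
  then show ?thesis by (simp add: eta_def bubble_lose_def power_divide)
 qed
 show ?thesis unfolding lose bubble_keep_def key by (simp add: add_divide_distrib diff_divide_distrib algebra_simps)
qed

lemma theta_sum_relation_1:
 assumes "t0 \<le> n" "t1 \<le> n" "0 < n"
 shows "bubble_keep n t0 * theta_sum n t0 t1 t2 + bubble_lose n t0 * theta_sum n (Suc t0) t1 t2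
  = bubble_keep n t1 * theta_sum n t0 t1 t2 + bubble_lose n t1 * theta_sum n t0 (Suc t1) t2"
proof -
 have "bubble_keep n t0 * (D * (eta n s t0 * eta n s t1 * e)) + bubble_lose n t0 * (D * (eta n s (Suc t0) * eta n s t1 * e))
  = bubble_keep n t1 * (D * (eta n s t0 * eta n s t1 * e)) + bubble_lose n t1 * (D * (eta n s t0 * eta n s (Suc t1) * e))"
  if "s \<le> n" for s D e
 proof -
  have "bubble_keep n t0 * (D * (eta n s t0 * eta n s t1 * e)) + bubble_lose n t0 * (D * (eta n s (Suc t0) * eta n s t1 * e))
   = (bubble_keep n t0 * eta n s t0 + bubble_lose n t0 * eta n s (Suc t0)) * (D * eta n s t1 * e)"
   by (simp add: algebra_simps)
  also have "... = (bubble_keep n t1 * eta n s t1 + bubble_lose n t1 * eta n s (Suc t1)) * (D * eta n s t0 * e)"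
   unfolding bubble_eta[OF that assms(1,3)] bubble_eta[OF that assms(2,3)] by (simp only: mult_ac)
  finally show ?thesis by (simp add: algebra_simps)
 qed
 then show ?thesis
  unfolding theta_sum_def sum_distrib_left sum.distrib[symmetric] by (intro sum.cong refl) simp
qed

lemma theta_sum_perm: "theta_sum n t0 t1 t2 = theta_sum n t1 t2 t0"
 by (simp add: theta_sum_def mult_ac)

text \<open>After multiplication by \<open>[t+1]\<close> the summand is a difference of consecutive
  values of \<open>F\<close>. The telescoping sum leaves \<open>F (Suc n)\<close>, a perfect square,
  because at this argument both quantum integers of each factor are \<open>[n+1-r]\<close>.\<close>

lemma theta_sum_base:
 assumes "t \<le> n"
 shows "theta_sum n 0 0 t = (Delta n)\<^sup>2 / Delta t"
proof -
 define P where "P s = (\<Prod>r<t. qint (s - r) * qint (2 * n + 1 - s - r))" for s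
 define F where "F s = (\<Prod>r<Suc t. qint (s - r) * qint (2 * n + 2 - s - r))" for s
 have F_Suc: "F (Suc s) = qint (Suc s) * qint (2 * n + 1 - s - t) * P s" for s
  unfolding F_def P_def prod.distrib prod.lessThan_Suc_shift[of "\<lambda>r. qint (Suc s - r)"] prod.lessThan_Suc[of "\<lambda>r. qint (2 * n + 2 - Suc s - r)"]
  by (simp add: mult_ac)
 have F_s: "F s = qint (s - t) * qint (2 * n + 2 - s) * P s" for s
  unfolding F_def P_def prod.distrib prod.lessThan_Suc_shift[of "\<lambda>r. qint (2 * n + 2 - s - r)"] prod.lessThan_Suc[of "\<lambda>r. qint (s - r)"]
  by (simp add: mult_ac)
 have step: "F (Suc s) - F s = qint (Suc t) * (qint (2 * (n - s) + 1) * P s)" if "s \<le> n" for s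
 proof (cases "t \<le> s")
  case False
  have "P s = 0" unfolding P_def using False by (intro prod_zero) (auto intro!: bexI[of _ s])
  then show ?thesis by (simp add: F_Suc F_s[of s])
 next
  case True
  have i: "int (s - t) = int s - int t" "int (2 * n + 1 - s - t) = 2 * int n + 1 - int s - int t"
   "int (2 * n + 2 - s) = 2 * int n + 2 - int s" "int (2 * (n - s) + 1) = 2 * int n + 1 - 2 * int s"
   using True that assms by auto
  have "qint (Suc s) * qint (2 * n + 1 - s - t) - qint (s - t) * qint (2 * n + 2 - s) = qint (Suc t) * qint (2 * (n - s) + 1)"
   unfolding qint_mult i using cosh_q_minus[of "2 * int n - 2 * int s - int t"] cosh_q_minus[of "2 * int n + 2 - 2 * int s + int t"]
   by (simp add: algebra_simps)
  then show ?thesis unfolding F_Suc F_s[of s] by (simp only: mult.assoc[symmetric] left_diff_distrib[symmetric])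
 qed
 define N where "N = (\<Prod>r<t. (qint (n - r))\<^sup>2)"
 have N: "N \<noteq> 0" using assms by (auto simp: N_def)
 have eta: "eta n s t = (- 1) ^ t * P s / N" for s
  unfolding eta_def P_def N_def prod_dividef by (simp add: prod_uminus)
 have "qint (Suc t) * (\<Sum>s<Suc n. qint (2 * (n - s) + 1) * P s) = (\<Sum>s<Suc n. F (Suc s) - F s)"
  unfolding sum_distrib_left by (intro sum.cong refl) (simp add: step)
 also have "... = F (Suc n) - F 0" by (rule sum_lessThan_telescope)
 also have "F 0 = 0" by (simp add: F_s[of 0])
 also have "F (Suc n) = (qint (Suc n))\<^sup>2 * N"
  unfolding F_def N_def prod.lessThan_Suc_shift by (simp add: power2_eq_square)
 finally have S: "qint (Suc t) * (\<Sum>s\<le>n. qint (2 * (n - s) + 1) * P s) = (qint (Suc n))\<^sup>2 * N"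
  by (simp add: lessThan_Suc_atMost)
 have "theta_sum n 0 0 t = (\<Sum>s\<le>n. (- 1) ^ t / N * (qint (2 * (n - s) + 1) * P s))"
  unfolding theta_sum_def by (intro sum.cong refl) (simp add: eta Delta_qint)
 also have "... = (- 1) ^ t / N * ((qint (Suc n))\<^sup>2 * N / qint (Suc t))"
  unfolding sum_distrib_left[symmetric] S[symmetric] by simp
 also have "... = (Delta n)\<^sup>2 / Delta t"
  using N by (cases "even t"; cases "even n") (simp_all add: Delta_qint)
 finally show ?thesis .
qed

section \<open>Theta networks with two regions turned back completely\<close>

context closure_functional
begin

lemma arc_commute: "E (Lab r True False i) (Lab r True True i) * col_arcs r k = col_arcs r k * E (Lab r True False i) (Lab r True True i)"
 by (rule arc_arcs_commute) (simp_all add: inj_Lab)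

text \<open>A vertical arc is inserted at the left side of the region together with the turnback.
  Carried along the frame to the preceding region, it commutes with everything and closes a loop
  there, so each turnback reduces the number of loops by one.\<close>

lemma v_col_arcs:
 assumes M: "commutes_on {x. column x = r} M" "commutes_on {x. column x = (r + 2) mod 3} M" and r: "r < 3"
 shows "k \<le> n ==> loop_val ^ k * v (col_arcs r k * M) = v M"
proof (induction k)
 case (Suc k)
 define a where "a t = Lab r t False k" for t
 define d where "d t = Lab ((r + 2) mod 3) t True k" for t
 let ?b = "Lab r True True k"
 let ?M = "col_arcs r k * M"
 have r': "(r + 2) mod 3 \<noteq> r" using r by (auto simp: mod_Suc)
 have "E (a True) (a False) * col_arcs r k = col_arcs r k * E (a True) (a False)"
  by (rule commutes_onD[OF commutes_on_arcs[of _ _ _ "{a True, a False}"]]) (auto simp: a_def)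
 moreover have "E (a True) (a False) * M = M * E (a True) (a False)"
  by (rule commutes_onD[OF M(1)]) (auto simp: a_def)
 ultimately have Ma: "E (a True) (a False) * ?M = ?M * E (a True) (a False)"
  by (metis mult.assoc)
 have "E (d True) (d False) * col_arcs r k = col_arcs r k * E (d True) (d False)"
  by (rule commutes_onD[OF commutes_on_arcs[of _ _ _ "{d True, d False}"]]) (use r' in \<open>auto simp: d_def\<close>)
 moreover have "E (d True) (d False) * M = M * E (d True) (d False)"
  by (rule commutes_onD[OF M(2)]) (auto simp: d_def)
 ultimately have Md: "E (d True) (d False) * ?M = ?M * E (d True) (d False)"
  by (metis mult.assoc)
 have db: "E (d True) (d False) * E ?b (a True) = E ?b (a True) * E (d True) (d False)"
  by (rule E_comm) (use r' in \<open>auto simp: d_def a_def\<close>)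
 have "v ?M = v (E ?b (a True) * (E (a True) (a False) * ?M))"
  using vertical_cancel[of ?b r False k ?M] by (simp add: a_def)
 also have "... = v (E ?b (a True) * ?M * E (a True) (a False))"
  by (simp add: Ma mult.assoc)
 also have "... = v (E ?b (a True) * ?M * E (d True) (d False))"
  using right_flip[of "a True" "a False" "E ?b (a True) * ?M"] r Suc.prems by (simp add: labels_def a_def d_def)
 also have "... = v (E (d True) (d False) * (E ?b (a True) * ?M))"
  by (simp only: mult.assoc Md[symmetric, simplified mult.assoc] push[OF db])
 also have "... = loop_val * v (E ?b (a True) * ?M)"
  by (simp add: d_def left_loop)
 also have "E ?b (a True) * ?M = col_arcs r (Suc k) * M"
  using arc_commute[of r k k] by (simp add: a_def E_sym[of ?b] mult.assoc[symmetric])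
 finally show ?case using Suc by (simp add: mult_ac)
qed simp

definition A01 :: op where
 "A01 = col_arcs 0 n * col_arcs 1 n"

lemma v_A01: "v A01 = loop_val ^ n"
proof -
 have 1: "loop_val ^ n * v (col_arcs 0 n * col_arcs 1 n) = v (col_arcs 1 n)"
  by (rule v_col_arcs) (auto intro!: commutes_on_col_arcs)
 have 2: "loop_val ^ n * v (col_arcs 1 n * 1) = v 1"
  by (rule v_col_arcs) (auto intro!: commutes_on_1)
 have "loop_val ^ n * (loop_val ^ n * v A01) = loop_val ^ n * (loop_val ^ n * loop_val ^ n)"
 proof -
  have "loop_val ^ (3 * n) = loop_val ^ n * (loop_val ^ n * loop_val ^ n)" by (simp add: eval_nat_numeral flip: power_add)
  then show ?thesis using 1 2 by (simp add: A01_def v_one)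
 qed
 then show ?thesis by simp
qed

lemma commutes_on_A01: "(\<And>r s i. r < 2 ==> Lab r True s i \<notin> B) ==> commutes_on B A01"
 unfolding A01_def by (intro commutes_on_mult commutes_on_col_arcs) auto

lemma A01_arcs:
 assumes "r < 2" "i < n"
 shows "E (Lab r True False i) (Lab r True True i) * A01 = sc loop_val * A01"
  "E (Lab r True False i) (Lab r True True i) * A01 = A01 * E (Lab r True False i) (Lab r True True i)"
proof -
 consider "r = 0" | "r = 1" using assms by linarith
 then show "E (Lab r True False i) (Lab r True True i) * A01 = A01 * E (Lab r True False i) (Lab r True True i)"
 proof cases
  case 1
  have "E (Lab 0 True False i) (Lab 0 True True i) * col_arcs 1 n = col_arcs 1 n * E (Lab 0 True False i) (Lab 0 True True i)"
   by (rule commutes_onD[of "{x. column x = 0}"]) (auto intro!: commutes_on_col_arcs)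
  then show ?thesis using arc_commute[of 0 i n] 1 by (simp add: A01_def) (metis mult.assoc)
 next
  case 2
  have "E (Lab 1 True False i) (Lab 1 True True i) * col_arcs 0 n = col_arcs 0 n * E (Lab 1 True False i) (Lab 1 True True i)"
   by (rule commutes_onD[of "{x. column x = 1}"]) (auto intro!: commutes_on_col_arcs)
  then show ?thesis using arc_commute[of 1 i n] 2 by (simp add: A01_def) (metis mult.assoc)
 qed
 have arcs: "E (Lab r True False i) (Lab r True True i) * col_arcs r n = sc loop_val * col_arcs r n" for r
  using assms by (intro arc_arcs) (simp_all add: inj_Lab)
 show "E (Lab r True False i) (Lab r True True i) * A01 = sc loop_val * A01"
 proof (cases "r = 0")
  case True
  then show ?thesis using push[OF arcs[of 0], of "col_arcs 1 n"] by (simp add: A01_def)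
 next
  case False
  then have "r = 1" using assms by simp
  moreover have "A01 = col_arcs 1 n * col_arcs 0 n"
   unfolding A01_def by (rule col_arcs_commute) simp
  ultimately show ?thesis using push[OF arcs[of 1], of "col_arcs 0 n"] by simp
 qed
qed

lemma A01_pair:
 assumes "r < 2" "r' < 2" "i < n" "j < n" "(r, i) \<noteq> (r', j)"
 shows "E (Lab r True s i) (Lab r' True s' j) * A01 = E (Lab r True (\<not> s) i) (Lab r' True (\<not> s') j) * A01"
  "A01 * E (Lab r True s i) (Lab r' True s' j) = A01 * E (Lab r True (\<not> s) i) (Lab r' True (\<not> s') j)"
proof -
 let ?a = "Lab r True s i" and ?a' = "Lab r True (\<not> s) i" and ?b = "Lab r' True s' j" and ?b' = "Lab r' True (\<not> s') j"
 have d: "distinct [?a, ?a', ?b, ?b']" using assms(5) by auto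
 have arc: "E ?a ?a' * A01 = sc loop_val * A01" "E ?b ?b' * A01 = sc loop_val * A01"
  "E ?a ?a' * A01 = A01 * E ?a ?a'" "E ?b ?b' * A01 = A01 * E ?b ?b'"
  using A01_arcs[OF assms(1,3)] A01_arcs[OF assms(2,4)] by (cases s; cases s'; simp add: E_sym)+
 have l: "sc (loop_val\<^sup>2) * A01 = E ?a ?a' * (E ?b ?b' * A01)"
  by (simp add: arc(1,2) sc_front sc_merge power2_eq_square)
 also have "... = A01 * (E ?a ?a' * E ?b ?b')"
  using arc(3,4) by (metis mult.assoc)
 finally have r: "sc (loop_val\<^sup>2) * A01 = A01 * (E ?a ?a' * E ?b ?b')" .
 have "sc (loop_val\<^sup>2) * (E ?a ?b * A01) = E ?a ?b * (E ?a ?a' * (E ?b ?b' * A01))"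
  using push[OF sc_central[of "E ?a ?b"]] l by metis
 also have "... = E ?a' ?b' * (E ?a ?a' * (E ?b ?b' * A01))"
  using arc_pair_left[OF d] by (metis mult.assoc)
 also have "... = sc (loop_val\<^sup>2) * (E ?a' ?b' * A01)"
  using push[OF sc_central[of "E ?a' ?b'"]] l by metis
 finally show "E ?a ?b * A01 = E ?a' ?b' * A01"
  by (rule sc_cancel[rotated]) simp
 have "sc (loop_val\<^sup>2) * (A01 * E ?a ?b) = A01 * (E ?a ?a' * (E ?b ?b' * E ?a ?b))"
  using r by (metis mult.assoc)
 also have "... = sc (loop_val\<^sup>2) * (A01 * E ?a' ?b')"
  unfolding arc_pair_right[OF d] using r by (metis mult.assoc)
 finally show "A01 * E ?a ?b = A01 * E ?a' ?b'"
  by (rule sc_cancel[rotated]) simp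
qed

text \<open>The full set of turnbacks lets generators slide from one side of the region to the
  other. At the bottom the slide is made through the lower turnbacks: the generator is moved to the
  beginning, up its strand by \<open>left_flip\<close>, and across.\<close>

lemma v_A01_proj:
 assumes "r < 2"
 shows "v (A01 * (proj (r, t, s) * M)) = v (A01 * (proj (r, t, \<not> s) * M))"
 unfolding proj_def prod.case
proof (rule jw_op_transfer_left[where v = "\<lambda>T. v (A01 * T)"])
 fix i M assume i: "Suc i < n"
 show "v (A01 * (E (Lab r t s i) (Lab r t s (Suc i)) * M)) = v (A01 * (E (Lab r t (\<not> s) i) (Lab r t (\<not> s) (Suc i)) * M))"
 proof (cases t)
  case True
  then show ?thesis using A01_pair(2)[of r r i "Suc i" s s] i assms by (simp add: mult.assoc[symmetric])
 next
  case False
  have c: "A01 * E (Lab r False s i) (Lab r False s (Suc i)) = E (Lab r False s i) (Lab r False s (Suc i)) * A01" for s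
   by (rule commutes_onD[OF commutes_on_A01[of "{x. \<not> is_top x}"], symmetric]) auto
  have bot: "v (A01 * (E (Lab r False s i) (Lab r False s (Suc i)) * M)) = v (E (Lab r True s i) (Lab r True s (Suc i)) * A01 * M)" for s
   by (simp add: push[OF c] left_flip mult.assoc)
  show ?thesis
   using False A01_pair(1)[of r r i "Suc i" s s] i assms by (simp add: bot)
 qed
qed (simp_all add: distrib_left v_add v_scale sc_front inj_Lab)

lemma projs_subset: "set es \<subseteq> set es' ==> projs es * projs es' = projs es'"
 by (induction es) (simp_all add: mult.assoc projs_absorb)

lemma projs_cong: "set es = set es' ==> projs es = projs es'"
proof -
 assume s: "set es = set es'"
 have "projs es * projs es' = projs es' * projs es"
  by (induction es) (simp_all add: mult.assoc push[OF proj_projs] proj_projs[symmetric])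
 then show ?thesis using projs_subset[of es es'] projs_subset[of es' es] s by simp
qed

text \<open>With regions 0 and 1 turned back, the three top edges of the frame form a single cable
  and so do the three bottom edges. One projector on each suffices, taken on the right side of
  region 2.\<close>

lemma v_A01_Psi:
 assumes S: "commutes_on {x. column x < 2} S"
 shows "v (A01 * (S * Psi)) = v (A01 * (S * (proj (2, True, True) * proj (2, False, True))))"
proof -
 let ?p = "\<lambda>es. v (A01 * (S * projs es))"
 have fr: "?p es = ?p ((r', t, False) # es)" if "(r, t, True) \<in> set es" "r < 3" "r' = (r + 1) mod 3" for r r' t es
  using insert_frame(1)[OF that(2,1), of "A01 * S"] unfolding that(3) by (simp add: mult.assoc)
 have arc: "?p es = ?p ((r, t, True) # es)" if "(r, t, False) \<in> set es" "r < 2" for r t es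
 proof -
  have c: "S * proj (r, t, s) = proj (r, t, s) * S" for s
   using that(2) by (intro proj_commutes[symmetric, OF S]) simp
  have "v (A01 * (S * (proj (r, t, True) * projs es))) = v (A01 * (S * (proj (r, t, False) * projs es)))"
   using v_A01_proj[OF that(2), of t True "S * projs es"] by (simp add: push[OF c])
  then show ?thesis using projs_absorb(1)[OF that(1)] by simp
 qed
 define es where "es = [(2, True, True), (2, False, True) :: nat \<times> bool \<times> bool]"
 define es2 where "es2 = (0, True, True) # (0, True, False) # es"
 define es4 where "es4 = (1, True, True) # (1, True, False) # es2"
 define es5 where "es5 = (2, True, False) # es4"
 define es7 where "es7 = (0, False, True) # (0, False, False) # es5"
 define es9 where "es9 = (1, False, True) # (1, False, False) # es7"
 note defs = es_def es2_def es4_def es5_def es7_def es9_def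
 have "?p es = ?p ((0, True, False) # es)" by (rule fr[of 2 True es 0]) (simp_all add: defs)
 also have "... = ?p es2" unfolding es2_def by (rule arc) simp_all
 also have "... = ?p ((1, True, False) # es2)" by (rule fr[of 0 True es2 1]) (simp_all add: defs)
 also have "... = ?p es4" unfolding es4_def by (rule arc) simp_all
 also have "... = ?p es5" unfolding es5_def by (rule fr[of 1 True es4 2]) (simp_all add: defs)
 also have "... = ?p ((0, False, False) # es5)" by (rule fr[of 2 False es5 0]) (simp_all add: defs)
 also have "... = ?p es7" unfolding es7_def by (rule arc) simp_all
 also have "... = ?p ((1, False, False) # es7)" by (rule fr[of 0 False es7 1]) (simp_all add: defs)
 also have "... = ?p es9" unfolding es9_def by (rule arc) simp_all
 also have "... = ?p ((2, False, False) # es9)" by (rule fr[of 1 False es9 2]) (simp_all add: defs)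
 also have "projs ((2, False, False) # es9) = Psi" by (rule projs_cong) (auto simp: defs ends_def)
 finally show ?thesis by (simp add: es_def)
qed

end

context closure_functional
begin

text \<open>The two sides of region 2 are joined through the frame and the turnbacks of regions 0
  and 1. The generator is pushed along the frame to the far sides of these regions and along their
  turnbacks to the near sides, which face each other in the frame.\<close>

lemma v_A01_loop:
 assumes N: "commutes_on {x. column x < 2} N" and i: "i < n"
 shows "v (A01 * (N * E (Lab 2 t True i) (Lab 2 t False i))) = loop_val * v (A01 * N)"
proof -
 have c: "N * col_arcs r n = col_arcs r n * N" if "r < 2" for r
  using that by (intro arcs_commutes[OF N]) auto
 have AN: "A01 * N = N * A01"
 proof -
  have "N * col_arcs 0 n = col_arcs 0 n * N" "N * col_arcs 1 n = col_arcs 1 n * N"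
   by (rule c, simp)+
  then show ?thesis unfolding A01_def by (metis mult.assoc)
 qed
 have "v (A01 * N * E (Lab 2 t True i) (Lab 2 t False i)) = v (A01 * N * E (Lab 0 t False i) (Lab 1 t True i))"
 proof -
  have fr: "frame (Lab 2 t True i) = Lab 0 t False i" "frame (Lab 2 t False i) = Lab 1 t True i" by simp_all
  show ?thesis
   using right_flip[of "Lab 2 t True i" "Lab 2 t False i" "A01 * N"] i
   unfolding fr by (simp add: labels_def)
 qed
 also have "... = v (A01 * N * E (Lab 0 t True i) (Lab 1 t False i))"
 proof (cases t)
  case True
  then show ?thesis using A01_pair(2)[of 0 1 i i False True] i by (simp add: AN mult.assoc)
 next
  case False
  have c: "A01 * N * E (Lab 0 False s i) (Lab 1 False s' i) = E (Lab 0 False s i) (Lab 1 False s' i) * (A01 * N)" for s s'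
  proof -
   have 1: "E (Lab 0 False s i) (Lab 1 False s' i) * N = N * E (Lab 0 False s i) (Lab 1 False s' i)"
    by (rule commutes_onD[OF N]) auto
   have 2: "E (Lab 0 False s i) (Lab 1 False s' i) * A01 = A01 * E (Lab 0 False s i) (Lab 1 False s' i)"
    by (rule commutes_onD[OF commutes_on_A01[of "{x. \<not> is_top x}"]]) auto
   show ?thesis by (simp only: mult.assoc push[OF 2] 1)
  qed
  show ?thesis
   using False c[of False True] c[of True False] A01_pair(1)[of 0 1 i i False True] i
    left_flip[of 0 False i 1 True i "A01 * N"] left_flip[of 0 True i 1 False i "A01 * N"]
   by (simp add: mult.assoc[symmetric])
 qed
 also have "... = loop_val * v (A01 * N)"
  using right_loop[of "Lab 0 t True i" "A01 * N"] i by (simp add: labels_def)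
 finally show ?thesis by (simp add: mult.assoc)
qed

text \<open>The projector on the strands \<open>j, ..., n - 1\<close>, built up from the outermost strand.\<close>
definition outer_proj :: "bool => nat => op" where
 "outer_proj t j = jw_op (\<lambda>i. Lab 2 t True (n - 1 - i)) (n - j)"

lemma outer_proj_eq:
 "outer_proj t j = jw_op (\<lambda>i. if i < n then Lab 2 t True (n - 1 - i) else Lab 2 t True i) (n - j)"
 unfolding outer_proj_def by (rule jw_op_cong) auto

lemma inj_outer: "inj (\<lambda>i. if i < n then Lab 2 t True (n - 1 - i) else Lab 2 t True i)"
proof (rule injI)
 fix i j assume "(if i < n then Lab 2 t True (n - 1 - i) else Lab 2 t True i) = (if j < n then Lab 2 t True (n - 1 - j) else Lab 2 t True j)"
 then have "(if i < n then n - 1 - i else i) = (if j < n then n - 1 - j else j)"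
  by (auto split: if_splits)
 then show "i = j" by (auto split: if_splits)
qed

lemma commutes_on_outer:
 assumes "\<And>i. j \<le> i ==> i < n ==> Lab 2 t True i \<notin> B"
 shows "commutes_on B (outer_proj t j)"
 unfolding outer_proj_eq using assms by (intro commutes_on_jw_op inj_outer) auto

lemma outer_proj_0: "outer_proj t 0 = proj (2, t, True)"
 unfolding outer_proj_def proj_def using jw_op_flip[OF inj_Lab[of 2 t True], of n] by simp

lemma outer_proj_n: "outer_proj t n = 1"
 by (simp add: outer_proj_def)

lemma outer_proj_idem: "outer_proj t j * outer_proj t j = outer_proj t j"
 unfolding outer_proj_eq by (rule jw_op_idem[OF inj_outer])

text \<open>The partial trace of a projector over strand \<open>j\<close>, the last one in its
  construction. In Wenzl's recursion the uncorrected term gives a loop and the correction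
  straightens, so the factor is that of \<open>Delta_quotient\<close>.\<close>

lemma close_outer:
 assumes N: "commutes_on {x. column x < 2} N" and j: "j < n"
 shows "v (A01 * (N * (E (Lab 2 t True j) (Lab 2 t False j) * outer_proj t j)))
  = Delta (n - j) / Delta (n - Suc j) * v (A01 * (N * outer_proj t (Suc j)))"
proof -
 let ?e = "E (Lab 2 t True j) (Lab 2 t False j)"
 obtain m where m: "n = Suc (j + m)" using less_imp_Suc_add[OF j] by blast
 have nj: "n - j = Suc m" "n - Suc j = m" using m by simp_all
 show ?thesis
 proof (cases m)
  case 0
  then have "outer_proj t j = 1" "outer_proj t (Suc j) = 1" by (simp_all add: outer_proj_def nj)
  then show ?thesis using v_A01_loop[OF N j] 0 by (simp add: nj)
 next
  case (Suc k)
  let ?F = "outer_proj t (Suc j)"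
  let ?d = "E (Lab 2 t True (Suc j)) (Lab 2 t True j)"
  let ?c = "Delta k / Delta (Suc k)"
  have F: "outer_proj t j = ?F - sc ?c * (?F * (?d * ?F))"
  proof -
   have z: "n - 1 - k = Suc j" "n - 1 - Suc k = j" using m Suc by simp_all
   show ?thesis unfolding outer_proj_def nj Suc jw_op.simps z ..
  qed
  have eF: "?e * ?F = ?F * ?e"
   by (rule commutes_onD[OF commutes_on_outer[of "Suc j" t "{Lab 2 t True j, Lab 2 t False j}"]]) auto
  have d: "distinct [Lab 2 t False j, Lab 2 t True j, Lab 2 t True (Suc j)]" by simp
  have ede: "?e * (?d * ?e) = ?e" using E_E_E[OF d] by (simp add: E_sym)
  have cF: "commutes_on {x. column x < 2} (N * ?F)" "commutes_on {x. column x < 2} (N * ?F * ?e * ?d * ?F)"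
   "commutes_on {x. column x < 2} (N * ?F * ?F)"
   using N by (auto intro!: commutes_on_mult commutes_on_outer commutes_on_E)
  have 1: "v (A01 * (N * (?e * ?F))) = loop_val * v (A01 * (N * ?F))"
   using v_A01_loop[OF cF(1) j, of t] by (simp add: eF mult.assoc)
  have "loop_val * v (A01 * (N * ?F * ?e * ?d * ?F)) = v (A01 * (N * ?F * ?e * ?d * ?F * ?e))"
   using v_A01_loop[OF cF(2) j, of t] by simp
  also have "N * ?F * ?e * ?d * ?F * ?e = N * ?F * (?e * (?d * ?e)) * ?F"
   by (simp add: mult.assoc eF)
  also have "... = N * ?F * ?F * ?e"
   by (simp add: ede mult.assoc eF)
  also have "v (A01 * (N * ?F * ?F * ?e)) = loop_val * v (A01 * (N * ?F * ?F))"
   by (rule v_A01_loop[OF cF(3) j])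
  also have "N * ?F * ?F = N * ?F" by (simp add: mult.assoc outer_proj_idem)
  finally have 2: "v (A01 * (N * ?F * ?e * ?d * ?F)) = v (A01 * (N * ?F))" by simp
  have "A01 * (N * (?e * outer_proj t j)) = A01 * (N * (?e * ?F)) - sc ?c * (A01 * (N * ?F * ?e * ?d * ?F))"
   unfolding F by (simp add: right_diff_distrib sc_front push[OF eF] mult.assoc)
  then have "v (A01 * (N * (?e * outer_proj t j))) = v (A01 * (N * (?e * ?F))) - ?c * v (A01 * (N * ?F * ?e * ?d * ?F))"
   using v_add[of "A01 * (N * (?e * outer_proj t j))" "sc ?c * (A01 * (N * ?F * ?e * ?d * ?F))"]
   by (simp add: v_scale)
  also have "... = (loop_val - ?c) * v (A01 * (N * ?F))"
   unfolding 1 2 by (simp add: left_diff_distrib)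
  also have "loop_val - ?c = Delta (n - j) / Delta (n - Suc j)"
   using Delta_quotient[of k] by (simp add: nj Suc)
  finally show ?thesis .
 qed
qed

lemma v_A01_bottom_arc:
 assumes "commutes_on {x. \<not> is_top x} S"
 shows "v (A01 * (S * (E (Lab 2 False True j) (Lab 2 False False j) * M)))
  = v (E (Lab 2 True True j) (Lab 2 True False j) * (A01 * (S * M)))"
proof -
 let ?e = "E (Lab 2 False True j) (Lab 2 False False j)"
 have "?e * S = S * ?e" by (rule commutes_onD[OF assms]) auto
 moreover have "?e * A01 = A01 * ?e"
  by (rule commutes_onD[OF commutes_on_A01[of "{x. \<not> is_top x}"]]) auto
 ultimately have "A01 * (S * (?e * M)) = ?e * (A01 * (S * M))" by (metis mult.assoc)
 then show ?thesis by (simp add: left_flip)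
qed

text \<open>Each turnback of region 2 closes one strand of the top cable and one of the bottom
  cable, from the innermost strand outwards. Both partial traces give the same quotient of
  \<open>Delta\<close>, and the quotients telescope to the square of
  \<open>Delta n / Delta (n - k)\<close>. The remaining \<open>n - k\<close> strands close up
  through a single projector and give \<open>Delta (n - k)\<close>.\<close>

lemma theta_closed:
 assumes k: "k \<le> n"
 shows "theta n n k = (Delta n)\<^sup>2 / Delta (n - k)"
proof -
 let ?S = "col_arcs 2 k"
 define e e' where "e j = E (Lab 2 True True j) (Lab 2 True False j)"
  and "e' j = E (Lab 2 False True j) (Lab 2 False False j)" for j
 define F F' where "F j = outer_proj True j" and "F' j = outer_proj False j" for j
 define X where "X j = v (A01 * (?S * (F j * F' j)))" for j
 have eS: "e j * col_arcs 2 i = col_arcs 2 i * e j" for i j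
  using arc_commute[of 2 j i] by (simp add: e_def E_sym)
 have eS': "e j * ?S = sc loop_val * ?S" if "j < k" for j
  using arc_arcs[of "Lab 2 True False" "Lab 2 True True" j k] that by (simp add: e_def E_sym inj_Lab)
 have eA: "e j * A01 = A01 * e j" for j
  unfolding e_def by (rule commutes_onD[OF commutes_on_A01[of "{x. column x = 2}"]]) auto
 have top: "commutes_on {x. \<not> is_top x} (F j)" "commutes_on {x. \<not> is_top x} (col_arcs 2 i)"
  "commutes_on {x. is_top x} (F' j)" for i j
  unfolding F_def F'_def by (auto intro!: commutes_on_outer commutes_on_col_arcs)
 have col: "commutes_on {x. column x < 2} (F j)" "commutes_on {x. column x < 2} (F' j)"
  "commutes_on {x. column x < 2} (col_arcs 2 i)" for i j
  unfolding F_def F'_def by (auto intro!: commutes_on_outer commutes_on_col_arcs)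
 have F'e: "F' j * e i = e i * F' j" and Fe': "F j * e' i = e' i * F j" for i j
  using commutes_onD[OF top(3), of "Lab 2 True True i" "Lab 2 True False i" j]
   commutes_onD[OF top(1), of "Lab 2 False True i" "Lab 2 False False i" j] by (simp_all add: e_def e'_def)
 have FF': "F i * F' j = F' j * F i" for i j
  unfolding F_def outer_proj_eq by (rule jw_op_commutes[OF top(3) inj_outer, symmetric]) auto
 have F'A: "A01 * F' j = F' j * A01" for j
  unfolding F'_def outer_proj_eq
  by (rule jw_op_commutes[of "{x. \<not> is_top x}", OF commutes_on_A01 inj_outer]) auto
 have Xstep: "loop_val\<^sup>2 * X j = (Delta (n - j) / Delta (n - Suc j))\<^sup>2 * X (Suc j)" if j: "j < k" for j
 proof -
  have jn: "j < n" using j k by simp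
  let ?r = "Delta (n - j) / Delta (n - Suc j)"
  have "loop_val * X j = v (A01 * (sc loop_val * ?S * (F j * F' j)))"
   by (simp add: X_def mult.assoc sc_front v_scale)
  also have "... = v (A01 * (?S * (e j * (F j * F' j))))"
   by (simp add: eS'[OF j, symmetric] eS mult.assoc)
  also have "... = v (A01 * (?S * F' j * (e j * F j)))"
   by (simp add: FF' push[OF F'e, symmetric] mult.assoc)
  also have "... = ?r * v (A01 * (?S * F' j * F (Suc j)))"
   unfolding e_def F_def by (rule close_outer[OF commutes_on_mult[OF col(3,2)] jn])
  finally have 1: "loop_val * X j = ?r * v (A01 * (?S * (F' j * F (Suc j))))" by (simp add: mult.assoc)
  have "loop_val * v (A01 * (?S * (F' j * F (Suc j)))) = v (A01 * (sc loop_val * ?S * (F' j * F (Suc j))))"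
   by (simp add: mult.assoc sc_front v_scale)
  also have "... = v (e j * (A01 * (?S * (F' j * F (Suc j)))))"
   by (simp add: push[OF eA] eS'[OF j, symmetric] mult.assoc)
  also have "... = v (A01 * (?S * (e' j * (F' j * F (Suc j)))))"
   unfolding e_def e'_def by (rule v_A01_bottom_arc[OF top(2), symmetric])
  also have "... = v (A01 * (?S * F (Suc j) * (e' j * F' j)))"
   by (simp add: FF'[symmetric] push[OF Fe', symmetric] mult.assoc)
  also have "... = ?r * v (A01 * (?S * F (Suc j) * F' (Suc j)))"
   unfolding e'_def F'_def by (rule close_outer[OF commutes_on_mult[OF col(3,1)] jn])
  finally have 2: "loop_val * v (A01 * (?S * (F' j * F (Suc j)))) = ?r * X (Suc j)"
   by (simp add: X_def mult.assoc)
  have "loop_val\<^sup>2 * X j = loop_val * (loop_val * X j)" by (simp add: power2_eq_square)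
  also have "... = ?r * (loop_val * v (A01 * (?S * (F' j * F (Suc j)))))" unfolding 1 by (simp only: mult_ac)
  finally show ?thesis unfolding 2 by (simp only: power2_eq_square mult.assoc)
 qed
 have X: "loop_val ^ (2 * j) * X 0 = (Delta n / Delta (n - j))\<^sup>2 * X j" if "j \<le> k" for j
  using that
 proof (induction j)
  case (Suc j)
  have "loop_val ^ (2 * Suc j) * X 0 = loop_val\<^sup>2 * (loop_val ^ (2 * j) * X 0)"
   by (simp add: power2_eq_square mult.assoc)
  also have "... = (Delta n / Delta (n - j))\<^sup>2 * (loop_val\<^sup>2 * X j)"
   using Suc by simp
  also have "... = (Delta n / Delta (n - j) * (Delta (n - j) / Delta (n - Suc j)))\<^sup>2 * X (Suc j)"
   using Suc.prems by (simp only: Xstep Suc_le_eq power_mult_distrib mult.assoc)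
  finally show ?case by simp
 qed simp
 have arcs: "v (A01 * (col_arcs 2 i * (F k * F' k))) = loop_val ^ i * v (A01 * (F k * F' k))" if "i \<le> k" for i
  using that
 proof (induction i)
  case (Suc i)
  have eF: "e i * F k = F k * e i"
   unfolding e_def F_def using Suc.prems
   by (intro commutes_onD[OF commutes_on_outer[of k True "{Lab 2 True True i, Lab 2 True False i}"]]) auto
  have "v (A01 * (col_arcs 2 (Suc i) * (F k * F' k))) = v (A01 * (col_arcs 2 i * (F k * F' k) * e i))"
  proof -
   have "col_arcs 2 (Suc i) = col_arcs 2 i * e i" by (simp add: e_def E_sym)
   then show ?thesis by (simp only: F'e push[OF eF] mult.assoc)
  qed
  also have "... = loop_val * v (A01 * (col_arcs 2 i * (F k * F' k)))"
   unfolding e_def using Suc.prems k by (intro v_A01_loop commutes_on_mult col) auto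
  finally show ?case using Suc by simp
 qed simp
 \<comment> \<open>The remaining projectors of the top and the bottom cable lie on the same strands;
   joined by \<open>left_flip\<close>, they merge into one.\<close>
 have "v (A01 * (F k * F' k)) = v (F' k * (A01 * F k))"
  by (simp add: FF' push[OF F'A])
 also have "... = v (F k * (A01 * F k))"
  unfolding F'_def F_def outer_proj_eq
  by (rule jw_op_transfer_left[OF v_add v_scale _ inj_outer inj_outer]) (auto simp: left_flip)
 also have "F k * (A01 * F k) = A01 * F k"
 proof -
  have "A01 * F k = F k * A01"
   unfolding F_def outer_proj_eq
   by (rule jw_op_commutes[of "{x. column x = 2}", OF commutes_on_A01 inj_outer]) auto
  then show ?thesis using outer_proj_idem[of True k] by (simp add: F_def) (metis mult.assoc)
 qed
 finally have FF: "v (A01 * (F k * F' k)) = v (A01 * F k)" .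
 have "loop_val ^ d * v (A01 * F (n - d)) = Delta d * v A01" if "d \<le> n" for d
  using that
 proof (induction d)
  case 0
  then show ?case by (simp add: F_def outer_proj_n)
 next
  case (Suc d)
  define j where "j = n - Suc d"
  have j: "j < n" "n - j = Suc d" "n - d = Suc j" "n - Suc j = d" using Suc.prems by (auto simp: j_def)
  have "loop_val * v (A01 * F j) = v (A01 * (F j * e' j))"
   unfolding e'_def by (rule v_A01_loop[OF col(1) j(1), symmetric])
  also have "... = v (e j * (A01 * F j))"
   using v_A01_bottom_arc[OF top(1), of j j 1] by (simp add: e_def e'_def)
  also have "... = v (A01 * (1 * (e j * F j)))" by (simp add: push[OF eA])
  also have "... = Delta (n - j) / Delta (n - Suc j) * v (A01 * (1 * F (Suc j)))"
   unfolding e_def F_def by (rule close_outer[OF commutes_on_1 j(1)])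
  finally have "loop_val * v (A01 * F j) = Delta (Suc d) / Delta d * v (A01 * F (n - d))"
   using j by simp
  moreover have "loop_val ^ Suc d * v (A01 * F j) = loop_val ^ d * (loop_val * v (A01 * F j))" by simp
  ultimately have "loop_val ^ Suc d * v (A01 * F j) = Delta (Suc d) / Delta d * (loop_val ^ d * v (A01 * F (n - d)))"
   by (simp only: mult_ac)
  then show ?case using Suc by (simp add: j_def)
 qed
 from this[of "n - k"] have Fk: "loop_val ^ (n - k) * v (A01 * F k) = Delta (n - k) * loop_val ^ n"
  using k by (simp add: v_A01)
 have th: "theta n n k = X 0"
  using v_A01_Psi[OF col(3), of k] by (simp add: theta_def X_def A01_def F_def F'_def outer_proj_0 mult.assoc)
 have "loop_val ^ (n - k) * (loop_val ^ (2 * k) * X 0)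
   = (Delta n / Delta (n - k))\<^sup>2 * (loop_val ^ k * (loop_val ^ (n - k) * v (A01 * F k)))"
  unfolding X[OF order_refl] by (simp add: X_def arcs FF mult_ac)
 also have "... = (Delta n)\<^sup>2 / Delta (n - k) * (loop_val ^ k * loop_val ^ n)"
  unfolding Fk by (simp add: power_divide power2_eq_square)
 finally have "(loop_val ^ (n - k) * loop_val ^ (2 * k)) * X 0 = (Delta n)\<^sup>2 / Delta (n - k) * (loop_val ^ k * loop_val ^ n)"
  by (simp add: mult.assoc)
 moreover have "loop_val ^ (n - k) * loop_val ^ (2 * k) = loop_val ^ k * loop_val ^ n"
  using k by (simp flip: power_add)
 ultimately have "loop_val ^ k * loop_val ^ n * X 0 = loop_val ^ k * loop_val ^ n * ((Delta n)\<^sup>2 / Delta (n - k))"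
  by (simp add: mult_ac)
 moreover have "loop_val ^ k * loop_val ^ n \<noteq> 0" by simp
 ultimately show ?thesis unfolding th using mult_left_cancel by blast
qed

text \<open>Both sides satisfy the same relations and agree where \<open>t0 = t1 = 0\<close>. Since
  \<open>bubble_lose n t\<close> is nonzero for \<open>t < n\<close>, the relations allow the first
  two indices to be raised one at a time.\<close>

lemma theta_eq:
 assumes "t0 \<le> n" "t1 \<le> n" "t2 \<le> n"
 shows "theta (n - t0) (n - t1) (n - t2) = theta_sum n t0 t1 t2"
proof (cases n)
 case 0
 then show ?thesis using assms theta_closed[of 0] theta_sum_base[of 0 n] by simp
next
 case (Suc m)
 then have n: "0 < n" by simp
 have lose_nz: "bubble_lose n t \<noteq> 0" if "t < n" for t using that by (simp add: bubble_lose_def)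
 \<comment> \<open>For \<open>t = n\<close> there is no arc left to remove; the truncated index
   \<open>k - 1\<close> then stands beside a zero coefficient.\<close>
 have lose_n: "bubble_lose n n = 0" by (simp add: bubble_lose_def)
 have base: "theta n (n - t1) (n - t2) = theta_sum n 0 t1 t2" if "t1 \<le> n" "t2 \<le> n" for t1 t2
  using that
 proof (induction t1 arbitrary: t2)
  case 0
  then show ?case using theta_closed[of "n - t2"] theta_sum_base[of t2 n] by simp
 next
  case (Suc t)
  have IH: "theta n (n - t) (n - t2) = theta_sum n 0 t t2" "t2 < n ==> theta n (n - t) (n - Suc t2) = theta_sum n 0 t (Suc t2)"
   using Suc by auto
  have 1: "bubble_keep n t * theta_sum n 0 t t2 + bubble_lose n t * theta n (n - t - 1) (n - t2)
    = bubble_keep n t2 * theta_sum n 0 t t2 + bubble_lose n t2 * theta_sum n 0 t (Suc t2)"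
   using theta_relation_12[OF \<open>n = Suc m\<close>, of "n - t" "n - t2" n] Suc.prems IH lose_n by (cases "t2 = n") auto
  have 2: "bubble_keep n t * theta_sum n 0 t t2 + bubble_lose n t * theta_sum n 0 (Suc t) t2
    = bubble_keep n t2 * theta_sum n 0 t t2 + bubble_lose n t2 * theta_sum n 0 t (Suc t2)"
   using theta_sum_relation_1[of t n t2 0] Suc.prems n by (simp add: theta_sum_perm[of n 0, symmetric])
  have "bubble_lose n t * theta n (n - t - 1) (n - t2) = bubble_lose n t * theta_sum n 0 (Suc t) t2"
   using 1 2 by (metis add_left_cancel)
  then show ?case using lose_nz[of t] Suc.prems by simp
 qed
 show ?thesis
  using assms
 proof (induction t0 arbitrary: t1 t2)
  case 0
  then show ?case using base by simp
 next
  case (Suc t)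
  have IH: "theta (n - t) (n - t1) (n - t2) = theta_sum n t t1 t2"
   "t1 < n ==> theta (n - t) (n - Suc t1) (n - t2) = theta_sum n t (Suc t1) t2"
   using Suc by auto
  have 1: "bubble_keep n t * theta_sum n t t1 t2 + bubble_lose n t * theta (n - t - 1) (n - t1) (n - t2)
    = bubble_keep n t1 * theta_sum n t t1 t2 + bubble_lose n t1 * theta_sum n t (Suc t1) t2"
   using theta_relation_01[OF \<open>n = Suc m\<close>, of "n - t" "n - t1" "n - t2"] Suc.prems IH lose_n by (cases "t1 = n") auto
  have "bubble_lose n t * theta (n - t - 1) (n - t1) (n - t2) = bubble_lose n t * theta_sum n (Suc t) t1 t2"
   using 1 theta_sum_relation_1[of t n t1 t2] Suc.prems n by (metis Suc_leD add_left_cancel)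
  then show ?case using lose_nz[of t] Suc.prems by simp
 qed
qed

theorem v_twisted:
 assumes "odd (a 0)" "even (a 1)" "odd (a 2)"
 shows "v (twisted a * proj (0, True, True)) = (\<Sum>s\<le>n. Delta (2 * (n - s)) *
  (\<Prod>r<3. \<Sum>k\<le>n. twists_coeff n (a r) k * eta n s (n - k)))"
proof -
 have th: "theta k0 k1 k2 = (\<Sum>s\<le>n. Delta (2 * (n - s)) * (eta n s (n - k0) * eta n s (n - k1) * eta n s (n - k2)))"
  if "k0 \<le> n" "k1 \<le> n" "k2 \<le> n" for k0 k1 k2
  using theta_eq[of "n - k0" "n - k1" "n - k2"] that by (simp add: theta_sum_def)
 let ?c = "\<lambda>r k. twists_coeff n (a r) k"
 have "v (twisted a * proj (0, True, True)) = (\<Sum>k0\<le>n. \<Sum>k1\<le>n. \<Sum>k2\<le>n. \<Sum>s\<le>n. Delta (2 * (n - s)) *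
   ((?c 0 k0 * eta n s (n - k0)) * (?c 1 k1 * eta n s (n - k1)) * (?c 2 k2 * eta n s (n - k2))))"
  unfolding insert_all_projs[of a, OF assms] twisted_Psi
  by (intro sum.cong refl) (simp add: th sum_distrib_left mult_ac)
 also have "... = (\<Sum>s\<le>n. \<Sum>k0\<le>n. \<Sum>k1\<le>n. \<Sum>k2\<le>n. Delta (2 * (n - s)) *
   ((?c 0 k0 * eta n s (n - k0)) * (?c 1 k1 * eta n s (n - k1)) * (?c 2 k2 * eta n s (n - k2))))"
  by (subst (4) sum.swap, subst (2) sum.swap, subst sum.swap) (rule refl)
 also have "... = (\<Sum>s\<le>n. Delta (2 * (n - s)) * (\<Prod>r<3. \<Sum>k\<le>n. twists_coeff n (a r) k * eta n s (n - k)))"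
 proof (intro sum.cong refl)
  fix s
  have *: "(\<Sum>i\<le>n. \<Sum>j\<le>n. \<Sum>k\<le>n. d * (f i * g j * h k)) = d * (sum f {..n} * sum g {..n} * sum h {..n})"
   for d :: lser and f g h
   by (simp only: sum_distrib_left[symmetric] sum_distrib_right[symmetric] mult.assoc)
  show "(\<Sum>k0\<le>n. \<Sum>k1\<le>n. \<Sum>k2\<le>n. Delta (2 * (n - s)) *
   ((?c 0 k0 * eta n s (n - k0)) * (?c 1 k1 * eta n s (n - k1)) * (?c 2 k2 * eta n s (n - k2))))
   = Delta (2 * (n - s)) * (\<Prod>r<3. \<Sum>k\<le>n. twists_coeff n (a r) k * eta n s (n - k))"
   unfolding * by (simp add: numeral_3_eq_3 numeral_2_eq_2)
 qed
 finally show ?thesis .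
qed

end

section \<open>Counting components of graphs\<close>

abbreviation nc :: "('p \<times> 'p) set => nat" where
 "nc \<equiv> n_components"

definition conn :: "('p \<times> 'p) set => ('p \<times> 'p) set" where
 "conn G = (G \<union> G\<inverse>)\<^sup>*"

lemma conn_refl [simp]: "(x, x) \<in> conn G"
 by (simp add: conn_def)

lemma conn_sym: "(x, y) \<in> conn G ==> (y, x) \<in> conn G"
 unfolding conn_def by (rule symD[OF sym_rtrancl[OF sym_Un_converse]])

lemma conn_trans: "(x, y) \<in> conn G ==> (y, z) \<in> conn G ==> (x, z) \<in> conn G"
 unfolding conn_def by (rule rtrancl_trans)

lemma conn_edge: "(x, y) \<in> G ==> (x, y) \<in> conn G" "(x, y) \<in> G ==> (y, x) \<in> conn G"
 unfolding conn_def by auto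

lemma conn_mono: "G \<subseteq> H ==> conn G \<subseteq> conn H"
 unfolding conn_def by (rule rtrancl_mono) (rule Un_mono, simp, simp add: converse_mono)

lemma conn_map:
 assumes "\<And>x y. (x, y) \<in> G ==> (f x, f y) \<in> conn H" "(x, y) \<in> conn G"
 shows "(f x, f y) \<in> conn H"
 using assms(2) unfolding conn_def[of G]
proof (induction rule: rtrancl_induct)
 case (step y z)
 have "(y, z) \<in> G \<or> (z, y) \<in> G" using step.hyps(2) by auto
 then have "(f y, f z) \<in> conn H" using assms(1) conn_sym[of "f z" "f y"] by auto
 with step.IH show ?case by (rule conn_trans)
qed simp

lemma conn_Field: "(x, y) \<in> conn G ==> x \<noteq> y ==> x \<in> Field G \<and> y \<in> Field G"
proof -
 assume "(x, y) \<in> conn G" "x \<noteq> y"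
 then have "(x, y) \<in> (G \<union> G\<inverse>)\<^sup>+" unfolding conn_def by (metis rtranclD)
 then have "x \<in> Domain (G \<union> G\<inverse>)" "y \<in> Range (G \<union> G\<inverse>)"
  by (metis Domain.DomainI trancl_domain, metis Range.intros trancl_range)
 then show ?thesis by (auto simp: Field_def)
qed

lemma n_components_conn: "nc G = card ((\<lambda>x. conn G `` {x}) ` Field G)"
 by (simp add: n_components_def conn_def)

lemma conn_class_eq: "conn G `` {x} = conn G `` {y} \<longleftrightarrow> (x, y) \<in> conn G"
proof
 assume "conn G `` {x} = conn G `` {y}"
 moreover have "y \<in> conn G `` {y}" by simp
 ultimately show "(x, y) \<in> conn G" by blast
next
 assume xy: "(x, y) \<in> conn G"
 have "(x, z) \<in> conn G \<longleftrightarrow> (y, z) \<in> conn G" for z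
  using conn_trans[OF xy, of z] conn_trans[OF conn_sym[OF xy], of z] by blast
 then show "conn G `` {x} = conn G `` {y}" by auto
qed

lemma conn_UnI: "(x, y) \<in> conn G ==> (x, y) \<in> conn (G \<union> H)" "(x, y) \<in> conn H ==> (x, y) \<in> conn (G \<union> H)"
 using conn_mono[of G "G \<union> H"] conn_mono[of H "G \<union> H"] by auto

text \<open>Maps in both directions that preserve connectedness and are mutually inverse up to
  connectedness identify the sets of components. Subdivisions, contractions and renamings of
  networks are all treated in this way.\<close>

lemma n_components_retract:
 assumes f: "\<And>x. x \<in> Field H ==> f x \<in> Field G" "\<And>x y. (x, y) \<in> H ==> (f x, f y) \<in> conn G"
  and g: "\<And>x. x \<in> Field G ==> g x \<in> Field H" "\<And>x y. (x, y) \<in> G ==> (g x, g y) \<in> conn H"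
  and gf: "\<And>x. x \<in> Field H ==> (g (f x), x) \<in> conn H"
  and fg: "\<And>x. x \<in> Field G ==> (f (g x), x) \<in> conn G"
 shows "nc G = nc H"
proof -
 have gi: "(x, y) \<in> conn G \<longleftrightarrow> (g x, g y) \<in> conn H" if "x \<in> Field G" "y \<in> Field G" for x y
 proof
  show "(g x, g y) \<in> conn H" if "(x, y) \<in> conn G" using conn_map[where f = g, OF g(2) that] .
  assume "(g x, g y) \<in> conn H"
  from conn_map[where f = f, OF f(2) this] have "(f (g x), f (g y)) \<in> conn G" .
  then have "(x, f (g y)) \<in> conn G" using conn_trans[OF conn_sym[OF fg[OF that(1)]]] by blast
  then show "(x, y) \<in> conn G" using conn_trans[OF _ fg[OF that(2)]] by blast
 qed
 define h where "h C = conn H `` (g ` C)" for C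
 have h: "h (conn G `` {x}) = conn H `` {g x}" if "x \<in> Field G" for x
 proof -
  have "conn G `` {x} \<subseteq> Field G" using conn_Field that by fastforce
  then have sub: "\<And>y. (x, y) \<in> conn G ==> (g x, g y) \<in> conn H" using gi[OF that] by blast
  show ?thesis
  proof
   show "h (conn G `` {x}) \<subseteq> conn H `` {g x}"
   proof
    fix z assume "z \<in> h (conn G `` {x})"
    then obtain y where y: "(x, y) \<in> conn G" "(g y, z) \<in> conn H" unfolding h_def by auto
    from conn_trans[OF sub[OF y(1)] y(2)] show "z \<in> conn H `` {g x}" by simp
   qed
   show "conn H `` {g x} \<subseteq> h (conn G `` {x})" unfolding h_def by auto
  qed
 qed
 have "bij_betw h ((\<lambda>x. conn G `` {x}) ` Field G) ((\<lambda>x. conn H `` {x}) ` Field H)"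
  unfolding bij_betw_def
 proof
  show "inj_on h ((\<lambda>x. conn G `` {x}) ` Field G)"
  proof (rule inj_onI)
   fix C C' assume "C \<in> (\<lambda>x. conn G `` {x}) ` Field G" "C' \<in> (\<lambda>x. conn G `` {x}) ` Field G" "h C = h C'"
   then obtain x y where "x \<in> Field G" "y \<in> Field G" "C = conn G `` {x}" "C' = conn G `` {y}"
    "conn H `` {g x} = conn H `` {g y}" using h by auto
   then show "C = C'" using gi by (simp add: conn_class_eq)
  qed
  have "(\<lambda>x. conn H `` {g x}) ` Field G = (\<lambda>x. conn H `` {x}) ` Field H"
  proof
   show "(\<lambda>x. conn H `` {g x}) ` Field G \<subseteq> (\<lambda>x. conn H `` {x}) ` Field H" using g(1) by auto
   show "(\<lambda>x. conn H `` {x}) ` Field H \<subseteq> (\<lambda>x. conn H `` {g x}) ` Field G"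
   proof
    fix C assume "C \<in> (\<lambda>x. conn H `` {x}) ` Field H"
    then obtain x where x: "x \<in> Field H" "C = conn H `` {x}" by auto
    then have "C = conn H `` {g (f x)}" using gf[OF x(1)] by (simp add: conn_class_eq conn_sym)
    then show "C \<in> (\<lambda>x. conn H `` {g x}) ` Field G" using f(1)[OF x(1)] by auto
   qed
  qed
  then show "h ` (\<lambda>x. conn G `` {x}) ` Field G = (\<lambda>x. conn H `` {x}) ` Field H"
   by (simp add: image_image h cong: image_cong)
 qed
 then show ?thesis unfolding n_components_conn by (rule bij_betw_same_card)
qed

lemma n_components_cong_conn: "Field G = Field H ==> conn G = conn H ==> nc G = nc H"
 by (simp add: n_components_conn)

lemma n_components_disjoint:
 assumes "finite G" "finite H" "Field G \<inter> Field H = {}"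
 shows "nc (G \<union> H) = nc G + nc H"
proof -
 have *: "conn (G \<union> H) `` {x} = conn G `` {x}" if "x \<in> Field G" "Field G \<inter> Field H = {}" for x :: 'a and G H
 proof -
  have "y \<in> Field G \<and> (x, y) \<in> conn G" if "(x, y) \<in> conn (G \<union> H)" for y
   using that unfolding conn_def[of "G \<union> H"]
  proof (induction rule: rtrancl_induct)
   case base
   then show ?case using \<open>x \<in> Field G\<close> by simp
  next
   case (step y z)
   then have "y \<notin> Field H" using \<open>Field G \<inter> Field H = {}\<close> by auto
   then have "(y, z) \<in> G \<or> (z, y) \<in> G" using step.hyps(2) by (auto simp: Field_def)
   then show ?case using step.IH conn_edge conn_trans by (metis FieldI1 FieldI2)
  qed
  then show ?thesis using conn_UnI(1) by auto
 qed
 have "(\<lambda>x. conn (G \<union> H) `` {x}) ` Field (G \<union> H) = (\<lambda>x. conn G `` {x}) ` Field G \<union> (\<lambda>x. conn H `` {x}) ` Field H"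
  using *[OF _ assms(3)] *[of _ H G] assms(3)
  by (simp add: Field_Un image_Un Int_commute Un_commute[of G H] cong: image_cong) (rule Un_commute)
 moreover have "(\<lambda>x. conn G `` {x}) ` Field G \<inter> (\<lambda>x. conn H `` {x}) ` Field H = {}"
 proof -
  have "conn K `` {x} \<subseteq> Field K" if "x \<in> Field K" for x :: 'a and K using conn_Field that by fastforce
  then show ?thesis using assms(3) conn_refl by (fastforce simp: disjoint_iff)
 qed
 ultimately show ?thesis
  using assms by (simp add: n_components_conn card_Un_disjoint finite_Field)
qed

definition match :: "('p \<times> 'p) set => 'p set => ('p \<times> 'p) set" where
 "match G B = {(x, y). x \<in> B \<and> y \<in> B \<and> x \<noteq> y \<and> (x, y) \<in> conn G}"

definition loops :: "('p \<times> 'p) set => 'p set => nat" where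
 "loops G B = card {conn G `` {x} | x. x \<in> Field G \<and> conn G `` {x} \<inter> B = {}}"

text \<open>In a larger network \<open>G\<close> counts only through the connections it makes on
  \<open>B\<close> and through its components that miss \<open>B\<close>. The latter are split off;
  every other point of \<open>G\<close> is contracted to some point of \<open>B\<close> in its
  component.\<close>

lemma n_components_glue:
 assumes fin: "finite G" "finite H" and B: "Field G \<inter> Field H \<subseteq> B" "B \<subseteq> Field H"
 shows "nc (G \<union> H) = loops G B + nc (match G B \<union> H)"
proof -
 define D where "D = {x \<in> Field G. conn G `` {x} \<inter> B = {}}"
 define G1 where "G1 = {(x, y) \<in> G. x \<notin> D}"
 define G2 where "G2 = {(x, y) \<in> G. x \<in> D}"
 have D: "y \<in> D" if "x \<in> D" "(x, y) \<in> conn G" for x y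
 proof -
  have "conn G `` {x} = conn G `` {y}" using that(2) by (simp add: conn_class_eq)
  moreover have "y \<in> Field G" using that conn_Field[OF that(2)] by (cases "x = y") (auto simp: D_def)
  ultimately show ?thesis using that(1) by (simp add: D_def)
 qed
 have G12: "G = G1 \<union> G2" by (auto simp: G1_def G2_def)
 have F2: "Field G2 \<subseteq> D" using D conn_edge by (fastforce simp: G2_def Field_def)
 have F1: "Field G1 \<inter> D = {}" using D conn_edge by (fastforce simp: G1_def Field_def)
 have DB: "D \<inter> Field H = {}"
 proof -
  have "x \<notin> B" if "x \<in> D" for x
  proof -
   have "x \<in> conn G `` {x}" by simp
   then show ?thesis using that unfolding D_def by blast
  qed
  moreover have "D \<subseteq> Field G" by (auto simp: D_def)
  ultimately show ?thesis using B(1) by blast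
 qed
 have "nc (G \<union> H) = nc (G2 \<union> (G1 \<union> H))"
  by (simp add: G12 Un_ac)
 also have "... = nc G2 + nc (G1 \<union> H)"
 proof (rule n_components_disjoint)
  show "finite G2" "finite (G1 \<union> H)" using fin G12 by auto
  show "Field G2 \<inter> Field (G1 \<union> H) = {}" using F1 F2 DB by (auto simp: Field_Un)
 qed
 also have "nc G2 = loops G B"
 proof -
  have c: "conn G `` {x} = conn G2 `` {x}" if "x \<in> D" for x
  proof -
   have "y \<in> D \<and> (x, y) \<in> conn G2" if "(x, y) \<in> conn G" for y
    using that unfolding conn_def[of G]
   proof (induction rule: rtrancl_induct)
    case base
    then show ?case using \<open>x \<in> D\<close> by simp
   next
    case (step y z)
    have yz: "(y, z) \<in> G \<or> (z, y) \<in> G" using step.hyps(2) by auto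
    then have "(y, z) \<in> conn G" using conn_edge[of y z G] conn_edge[of z y G] by auto
    with step.IH D[of y z] have z: "z \<in> D" by simp
    then have "(y, z) \<in> G2 \<or> (z, y) \<in> G2" using yz step.IH by (auto simp: G2_def)
    then have "(y, z) \<in> conn G2" using conn_edge[of y z G2] conn_edge[of z y G2] by auto
    with step.IH conn_trans[of x y G2 z] z show ?case by simp
   qed
   moreover have "conn G2 \<subseteq> conn G" by (rule conn_mono) (simp add: G12)
   ultimately show ?thesis by auto
  qed
  have "Field G2 = D"
  proof
   show "D \<subseteq> Field G2"
   proof
    fix x assume x: "x \<in> D"
    then obtain y where y: "(x, y) \<in> G \<or> (y, x) \<in> G" by (auto simp: D_def Field_def)
    then have "(x, y) \<in> conn G" using conn_edge[of x y G] conn_edge[of y x G] by auto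
    with D[OF x] have "y \<in> D" by simp
    with y show "x \<in> Field G2" using x by (auto simp: G2_def Field_def)
   qed
  qed (rule F2)
  then have "(\<lambda>x. conn G2 `` {x}) ` Field G2 = {conn G `` {x} | x. x \<in> Field G \<and> conn G `` {x} \<inter> B = {}}"
  proof -
   assume F: "Field G2 = D"
   have "{conn G `` {x} | x. x \<in> Field G \<and> conn G `` {x} \<inter> B = {}} = (\<lambda>x. conn G `` {x}) ` D"
    unfolding D_def by (simp add: setcompr_eq_image)
   then show ?thesis using c by (simp add: F cong: image_cong)
  qed
  then show ?thesis by (simp add: n_components_conn loops_def)
 qed
 also have "nc (G1 \<union> H) = nc (match G B \<union> H)"
 proof -
  define g where "g x = (if x \<in> Field H then x else SOME y. y \<in> B \<and> (x, y) \<in> conn G)" for x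
  have F1G: "Field G1 \<subseteq> Field G" by (auto simp: G12 Field_Un)
  have g1: "g x \<in> B \<and> (x, g x) \<in> conn G" if "x \<in> Field G1" for x
  proof (cases "x \<in> Field H")
   case True
   then show ?thesis using that F1G B(1) by (auto simp: g_def)
  next
   case False
   have "\<exists>y. y \<in> B \<and> (x, y) \<in> conn G" using that F1 F1G by (auto simp: D_def)
   from someI_ex[OF this] show ?thesis using False by (simp add: g_def)
  qed
  have G1_conn: "(x, y) \<in> conn G1" if "(x, y) \<in> conn G" "x \<notin> D" for x y
  proof -
   have "y \<notin> D \<and> (x, y) \<in> conn G1"
    using that(1) unfolding conn_def[of G]
   proof (induction rule: rtrancl_induct)
    case (step y z)
    have yz: "(y, z) \<in> G \<or> (z, y) \<in> G" using step.hyps(2) by auto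
    then have "(z, y) \<in> conn G" using conn_edge[of y z G] conn_edge[of z y G] by auto
    with step.IH D[of z y] have z: "z \<notin> D" by auto
    then have "(y, z) \<in> G1 \<or> (z, y) \<in> G1" using yz step.IH by (auto simp: G1_def)
    then have "(y, z) \<in> conn G1" using conn_edge[of y z G1] conn_edge[of z y G1] by auto
    with step.IH conn_trans[of x y G1 z] z show ?case by simp
   qed (use that in simp)
   then show ?thesis by simp
  qed
  have mB: "Field (match G B) \<subseteq> B" by (auto simp: match_def Field_def)
  have BD: "B \<inter> D = {}" using DB B(2) by auto
  show ?thesis
  proof (rule n_components_retract[of _ "\<lambda>x. x" _ g])
   show "x \<in> Field (G1 \<union> H)" if "x \<in> Field (match G B \<union> H)" for x
    using that mB B(2) by (auto simp: Field_Un)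
   show "(x, y) \<in> conn (G1 \<union> H)" if "(x, y) \<in> match G B \<union> H" for x y
    using that
   proof
    assume "(x, y) \<in> match G B"
    then have "(x, y) \<in> conn G1" using G1_conn BD by (auto simp: match_def)
    then show ?thesis by (rule conn_UnI)
   qed (simp add: conn_UnI conn_edge)
   show "g x \<in> Field (match G B \<union> H)" if "x \<in> Field (G1 \<union> H)" for x
    using that g1[of x] B(2) by (cases "x \<in> Field H") (auto simp: Field_Un g_def[of x])
   show "(g x, g y) \<in> conn (match G B \<union> H)" if "(x, y) \<in> G1 \<union> H" for x y
    using that
   proof
    assume xy: "(x, y) \<in> G1"
    then have "x \<in> Field G1" "y \<in> Field G1" by (auto simp: Field_def)
    then have g: "g x \<in> B" "g y \<in> B" "(x, g x) \<in> conn G" "(y, g y) \<in> conn G" using g1 by auto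
    have "(x, y) \<in> conn G" using xy by (intro conn_edge) (simp add: G12)
    with conn_trans[OF conn_sym[OF g(3)]] conn_trans[OF _ g(4)] have "(g x, g y) \<in> conn G" by simp
    then have "g x \<noteq> g y ==> (g x, g y) \<in> match G B" using g by (simp add: match_def)
    then show ?thesis using conn_UnI(1)[OF conn_edge(1)] by (cases "g x = g y") auto
   next
    assume "(x, y) \<in> H"
    then show ?thesis using conn_UnI(2)[OF conn_edge(1)] by (auto simp: g_def Field_def)
   qed
   show "(g x, x) \<in> conn (match G B \<union> H)" if "x \<in> Field (match G B \<union> H)" for x
    using that mB B(2) by (auto simp: Field_Un g_def)
   show "(g x, x) \<in> conn (G1 \<union> H)" if "x \<in> Field (G1 \<union> H)" for x
   proof (cases "x \<in> Field H")
    case False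
    then have "x \<in> Field G1" using that by (auto simp: Field_Un)
    then have "x \<notin> D" using F1 by auto
    with G1_conn[of x "g x"] g1[OF \<open>x \<in> Field G1\<close>] have "(x, g x) \<in> conn G1" by simp
    then show ?thesis by (rule conn_UnI(1)[OF conn_sym])
   qed (simp add: g_def)
  qed
 qed
 finally show ?thesis .
qed

lemma n_components_sym: "G \<union> G\<inverse> = H \<union> H\<inverse> ==> nc G = nc H"
proof -
 assume e: "G \<union> G\<inverse> = H \<union> H\<inverse>"
 have "Field K = Domain (K \<union> K\<inverse>)" for K :: "('a \<times> 'a) set" by (auto simp: Field_def)
 then have "Field G = Field H" using e by simp
 then show ?thesis using e by (intro n_components_cong_conn) (simp_all add: conn_def)
qed

lemma n_components_edge: "nc {(a, b), (b, a)} = 1"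
proof -
 have "conn {(a, b), (b, a)} `` {x} = {a, b}" if "x = a \<or> x = b" for x
 proof
  show "conn {(a, b), (b, a)} `` {x} \<subseteq> {a, b}"
   using conn_Field[of x _ "{(a, b), (b, a)}"] that by (auto simp: Field_def)
  show "{a, b} \<subseteq> conn {(a, b), (b, a)} `` {x}"
   using that conn_edge(1)[of a b "{(a, b), (b, a)}"] conn_edge(1)[of b a "{(a, b), (b, a)}"] by auto
 qed
 moreover have "Field {(a, b), (b, a)} = {a, b}" by (auto simp: Field_def)
 ultimately have "(\<lambda>x. conn {(a, b), (b, a)} `` {x}) ` Field {(a, b), (b, a)} = {{a, b}}" by auto
 then show ?thesis by (simp add: n_components_conn)
qed

section \<open>Graphs of matchings\<close>

lemma finite_labels: "finite (labels n)"
proof -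
 have "labels n \<subseteq> (\<lambda>(r, t, s, i). Lab r t s i) ` ({..<3} \<times> UNIV \<times> UNIV \<times> {..<n})"
 proof
  fix x assume "x \<in> labels n"
  then show "x \<in> (\<lambda>(r, t, s, i). Lab r t s i) ` ({..<3} \<times> UNIV \<times> UNIV \<times> {..<n})"
   by (cases x) (auto simp: labels_def intro!: image_eqI[of _ _ "(column x, is_top x, is_right x, strand x)"])
 qed
 then show ?thesis by (rule finite_subset) simp
qed

text \<open>The network that stands for the processed part of the diagram; \<open>c x\<close> is the
  point at which the strand end \<open>x\<close> currently sits. Every arc occurs in both
  orientations.\<close>

definition st :: "lab set => (lab => 'p) => state => ('p \<times> 'p) set" where
 "st V c s = (\<lambda>x. (c x, c (partner s x))) ` V"

definition closed_state :: "lab set => state => bool" where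
 "closed_state V s \<longleftrightarrow> (\<forall>x\<in>V. partner s x \<in> V)"

lemma closed_cup: "closed_state V s ==> x \<in> V ==> y \<in> V ==> closed_state V (cup x y s)"
 by (cases "x = y") (auto simp: closed_state_def partner_cup cup.rep_eq)

lemma finite_st: "finite V ==> finite (st V c s)"
 by (simp add: st_def)

lemma Field_st: "closed_state V s ==> Field (st V c s) = c ` V"
 unfolding st_def Field_def closed_state_def by (auto simp: Domain.simps Range.simps image_iff)

lemma st_edge: "x \<in> V ==> (c x, c (partner s x)) \<in> st V c s"
 by (simp add: st_def)

lemma st_extend:
 assumes s: "closed_state V s" and c: "inj_on c V" and x: "x \<in> V"
  and z: "z \<notin> c ` V" and H: "c x \<notin> Field H"
 shows "nc (st V c s \<union> {(c x, z)} \<union> H) = nc (st V (c(x := z)) s \<union> H)"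
proof -
 let ?c = "c(x := z)" and ?G = "st V c s \<union> {(c x, z)} \<union> H"
 let ?g = "\<lambda>p. if p = c x then z else p"
 have F: "Field ?G = c ` V \<union> {z} \<union> Field H"
  using s x by (auto simp: Field_Un Field_st)
 have F': "Field (st V ?c s \<union> H) = ?c ` V \<union> Field H"
  using s by (simp add: Field_Un Field_st)
 have ceq: "c y = c x \<longleftrightarrow> y = x" if "y \<in> V" for y using c x that by (simp add: inj_on_eq_iff)
 have g: "?g (c y) = ?c y" if "y \<in> V" for y using ceq[OF that] by auto
 have zx: "z \<noteq> c x" using z x by auto
 have e: "(c x, z) \<in> conn ?G" by (rule conn_edge) simp
 show ?thesis
 proof (rule n_components_retract[of _ "\<lambda>p. p" _ ?g])
  show "p \<in> Field ?G" if "p \<in> Field (st V ?c s \<union> H)" for p using that unfolding F F' by auto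
  show "(p, q) \<in> conn ?G" if "(p, q) \<in> st V ?c s \<union> H" for p q
   using that
  proof
   assume "(p, q) \<in> st V ?c s"
   then obtain y where y: "y \<in> V" "p = ?c y" "q = ?c (partner s y)" by (auto simp: st_def)
   have 1: "(c y, ?c y) \<in> conn ?G" "(c (partner s y), ?c (partner s y)) \<in> conn ?G" using e by auto
   have 2: "(c y, c (partner s y)) \<in> conn ?G" using st_edge[OF y(1), of c s] by (intro conn_edge(1)) simp
   show ?thesis unfolding y(2,3) by (rule conn_trans[OF conn_trans[OF conn_sym[OF 1(1)] 2] 1(2)])
  qed (simp add: conn_edge)
  show "?g p \<in> Field (st V ?c s \<union> H)" if "p \<in> Field ?G" for p
   using that x unfolding F F' by auto
  show "(?g p, ?g q) \<in> conn (st V ?c s \<union> H)" if "(p, q) \<in> ?G" for p q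
  proof -
   consider "(p, q) \<in> st V c s" | "p = c x" "q = z" | "(p, q) \<in> H" using \<open>(p, q) \<in> ?G\<close> by auto
   then show ?thesis
   proof cases
    case 1
    then obtain y where y: "y \<in> V" "p = c y" "q = c (partner s y)" by (auto simp: st_def)
    then have "?g p = ?c y" "?g q = ?c (partner s y)" using g[of y] g[of "partner s y"] s by (auto simp: closed_state_def)
    then show ?thesis using st_edge[OF y(1), of ?c s] by (simp only:) (rule conn_edge, simp)
   next
    case 3
    then have "p \<noteq> c x" "q \<noteq> c x" using H by (auto simp: Field_def)
    then show ?thesis using 3 by (simp add: conn_edge)
   qed (use zx in simp)
  qed
  show "(?g p, p) \<in> conn (st V ?c s \<union> H)" if "p \<in> Field (st V ?c s \<union> H)" for p
  proof -
   have "p \<noteq> c x" using that H zx ceq unfolding F' by (auto split: if_splits) (metis)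
   then show ?thesis by simp
  qed
  show "(?g p, p) \<in> conn ?G" if "p \<in> Field ?G" for p
   using conn_sym[OF e] by simp
 qed
qed

text \<open>The graph-theoretic content of \<open>E\<close>: an arc from \<open>c x\<close> to
  \<open>c y\<close> together with a new arc from \<open>w\<close> to \<open>u\<close> acts on the
  state as \<open>cup\<close>. If the two ends were partners, they form a component of their own,
  the loop.\<close>

lemma st_cap:
 assumes s: "closed_state V s" and c: "inj_on c V" and x: "x \<in> V" "y \<in> V" "x \<noteq> y"
  and uw: "u \<notin> c ` V" "w \<notin> c ` V" "u \<noteq> w" and H: "c x \<notin> Field H" "c y \<notin> Field H" "finite H" and V: "finite V"
 shows "nc (st V c s \<union> {(c x, c y), (w, u)} \<union> H) =
  (if partner s x = y then 1 else 0) + nc (st V (c(x := u, y := w)) (cup x y s) \<union> H)"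
proof (cases "partner s x = y")
 case True
 then have py: "partner s y = x" by auto
 define R where "R = (\<lambda>l. (c l, c (partner s l))) ` (V - {x, y})"
 have lab: "V = insert x (insert y (V - {x, y}))" using x by auto
 have st1: "st V c s = {(c x, c y), (c y, c x)} \<union> R"
  unfolding st_def R_def by (subst lab) (auto simp: True py)
 have R': "(\<lambda>l. ((c(x := u, y := w)) l, (c(x := u, y := w)) (partner s l))) ` (V - {x, y}) = R"
  unfolding R_def using True py by (intro image_cong) auto
 have st2: "st V (c(x := u, y := w)) s = {(u, w), (w, u)} \<union> R"
  unfolding st_def by (subst lab, unfold image_insert R') (use x(3) in \<open>auto simp: True py\<close>)
 have FR: "Field R \<subseteq> c ` (V - {x, y})"
 proof -
  have "partner s l \<in> V - {x, y}" if "l \<in> V - {x, y}" for l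
   using that s True py by (auto simp: closed_state_def)
  then show ?thesis by (auto simp: R_def Field_def)
 qed
 have "nc (st V c s \<union> {(c x, c y), (w, u)} \<union> H) = nc ({(c x, c y), (c y, c x)} \<union> (R \<union> {(w, u)} \<union> H))"
  unfolding st1 by (rule arg_cong[where f = nc]) auto
 also have "... = nc {(c x, c y), (c y, c x)} + nc (R \<union> {(w, u)} \<union> H)"
 proof (rule n_components_disjoint)
  show "finite (R \<union> {(w, u)} \<union> H)" using H by (simp add: R_def V)
  have "Field {(c x, c y), (c y, c x)} = {c x, c y}" by (auto simp: Field_def)
  moreover have "c x \<notin> Field R" "c y \<notin> Field R" using FR c x by (auto simp: inj_on_def)
  moreover have "u \<noteq> c x" "u \<noteq> c y" "w \<noteq> c x" "w \<noteq> c y" using uw x by auto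
  ultimately show "Field {(c x, c y), (c y, c x)} \<inter> Field (R \<union> {(w, u)} \<union> H) = {}"
   using H by (auto simp: Field_Un)
 qed simp
 also have "nc (R \<union> {(w, u)} \<union> H) = nc (st V (c(x := u, y := w)) s \<union> H)"
  unfolding st2 by (rule n_components_sym) auto
 finally show ?thesis using True by (simp add: n_components_edge cup_same[OF True])
next
 case False
 define a where "a = partner s x"
 define b where "b = partner s y"
 have pa: "partner s a = x" "partner s b = y" by (simp_all add: a_def b_def)
 have ab: "a \<in> V" "b \<in> V" using s x by (auto simp: a_def b_def closed_state_def)
 have ne: "a \<noteq> x" "b \<noteq> y" "a \<noteq> y" "b \<noteq> x" "a \<noteq> b"
  using False x(3) pa by (auto simp: a_def b_def)
 let ?c = "c(x := u, y := w)" and ?s = "cup x y s"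
 let ?G = "st V c s \<union> {(c x, c y), (w, u)} \<union> H" and ?H = "st V ?c ?s \<union> H"
 \<comment> \<open>\<open>c x\<close> and \<open>c y\<close> do not occur in the new network, so
   they are contracted to the points of their former partners.\<close>
 let ?g = "\<lambda>p. if p = c x then c a else if p = c y then c b else p"
 have s': "closed_state V ?s" by (rule closed_cup[OF s x(1,2)])
 have F: "Field ?G = c ` V \<union> {u, w} \<union> Field H"
  using s x by (auto simp: Field_Un Field_st)
 have F': "Field ?H = ?c ` V \<union> Field H"
  using s' by (simp add: Field_Un Field_st)
 have ceq: "c l = c l' \<longleftrightarrow> l = l'" if "l \<in> V" "l' \<in> V" for l l'
  using c that by (simp add: inj_on_eq_iff)
 have sp: "partner ?s l = (if l = x then y else if l = y then x else if l = a then b else if l = b then a else partner s l)" for l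
  using x(3) ne pa by (simp add: partner_cup a_def[symmetric] b_def[symmetric])
 have uwc: "u \<noteq> c l" "w \<noteq> c l" if "l \<in> V" for l using uw that by auto
 have uw_H: "(u, w) \<in> conn ?H"
  using st_edge[OF x(1), of ?c ?s] x(3) by (intro conn_edge(1)) (simp add: sp)
 have ab_H: "(c a, c b) \<in> conn ?H"
  using st_edge[OF ab(1), of ?c ?s] ne by (intro conn_edge(1)) (simp add: sp)
 have ax: "(c a, c x) \<in> conn ?G" using st_edge[OF ab(1), of c s] pa by (intro conn_edge(1)) simp
 have by': "(c b, c y) \<in> conn ?G" using st_edge[OF ab(2), of c s] pa by (intro conn_edge(1)) simp
 have xy: "(c x, c y) \<in> conn ?G" by (intro conn_edge(1)) simp
 have uw_G: "(w, u) \<in> conn ?G" by (intro conn_edge(1)) simp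
 have ab_G: "(c a, c b) \<in> conn ?G" by (rule conn_trans[OF conn_trans[OF ax xy] conn_sym[OF by']])
 have "nc ?G = nc ?H"
 proof (rule n_components_retract[of _ "\<lambda>p. p" _ ?g])
  show "p \<in> Field ?G" if "p \<in> Field ?H" for p using that unfolding F F' by auto
  show "(p, q) \<in> conn ?G" if "(p, q) \<in> ?H" for p q
   using that
  proof
   assume "(p, q) \<in> st V ?c ?s"
   then obtain l where l: "l \<in> V" "p = ?c l" "q = ?c (partner ?s l)" by (auto simp: st_def)
   consider "l = x" | "l = y" | "l = a" | "l = b" | "l \<noteq> x" "l \<noteq> y" "l \<noteq> a" "l \<noteq> b" by blast
   then show ?thesis
   proof cases
    case 1
    then show ?thesis using l x(3) conn_sym[OF uw_G] by (simp add: sp)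
   next
    case 2
    then show ?thesis using l x(3) uw_G by (simp add: sp)
   next
    case 3
    then show ?thesis using l ne ab_G by (simp add: sp)
   next
    case 4
    then show ?thesis using l ne conn_sym[OF ab_G] by (simp add: sp)
   next
    case 5
    then have "partner s l \<noteq> x" "partner s l \<noteq> y" using pa by (metis partner_partner)+
    then show ?thesis using 5 l st_edge[OF l(1), of c s] by (intro conn_edge(1)) (simp add: sp)
   qed
  qed (simp add: conn_edge)
  show "?g p \<in> Field ?H" if "p \<in> Field ?G" for p
  proof -
   have "c l \<in> ?c ` V" if "l \<in> V" "l \<noteq> x" "l \<noteq> y" for l
    using that by (intro image_eqI[of _ _ l]) auto
   moreover have "u \<in> ?c ` V" "w \<in> ?c ` V"
    using x by (auto intro!: image_eqI[of _ _ x] image_eqI[of _ _ y])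
   ultimately show ?thesis using that ab ne unfolding F F' by auto
  qed
  show "(?g p, ?g q) \<in> conn ?H" if pq: "(p, q) \<in> ?G" for p q
  proof -
   consider "(p, q) \<in> st V c s" | "p = c x" "q = c y" | "p = w" "q = u" | "(p, q) \<in> H" using pq by auto
   then show ?thesis
   proof cases
    case 1
    then obtain l where l: "l \<in> V" "p = c l" "q = c (partner s l)" by (auto simp: st_def)
    consider "l = x" | "l = y" | "l = a" | "l = b" | "l \<noteq> x" "l \<noteq> y" "l \<noteq> a" "l \<noteq> b" by blast
    then show ?thesis
    proof cases
     case 5
     then have "partner s l \<noteq> x" "partner s l \<noteq> y" using pa by (metis partner_partner)+
     moreover have "partner s l \<in> V" using s l by (simp add: closed_state_def)
     moreover have "(c l, c (partner s l)) \<in> conn ?H"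
      using st_edge[OF l(1), of ?c ?s] 5 calculation by (intro conn_edge(1)) (simp add: sp)
     ultimately show ?thesis using l 5 ceq x by simp
    qed (use l ceq x ab ne pa in \<open>auto simp: a_def[symmetric] b_def[symmetric]\<close>)
   next
    case 2
    then show ?thesis using ab_H ceq x by auto
   next
    case 3
    then show ?thesis using uwc x conn_sym[OF uw_H] by simp
   next
    case 4
    then have "p \<noteq> c x" "q \<noteq> c x" "p \<noteq> c y" "q \<noteq> c y" using H by (auto simp: Field_def)
    then show ?thesis using 4 by (simp add: conn_edge)
   qed
  qed
  show "(?g p, p) \<in> conn ?H" if "p \<in> Field ?H" for p
  proof -
   have "p \<noteq> c x \<and> p \<noteq> c y" using that H uwc x ceq unfolding F' by (auto split: if_splits)
   then show ?thesis by simp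
  qed
  show "(?g p, p) \<in> conn ?G" if "p \<in> Field ?G" for p using ax by' by simp
 qed
 then show ?thesis using False by simp
qed

lemma not_Field_insert: "p \<notin> Field (insert (a, b) H) \<longleftrightarrow> p \<noteq> a \<and> p \<noteq> b \<and> p \<notin> Field H"
 by (auto simp: Field_def)

lemma st_extend2:
 assumes s: "closed_state V s" and c: "inj_on c V" and x: "x \<in> V"
  and p: "p \<notin> c ` V" "p \<noteq> u" "p \<notin> Field H" and u: "u \<notin> c ` (V - {x})" "u \<noteq> c x" and H: "c x \<notin> Field H"
 shows "nc (st V c s \<union> {(c x, p), (p, u)} \<union> H) = nc (st V (c(x := u)) s \<union> H)"
proof -
 have cxp: "c x \<noteq> p" using p x by auto
 have "nc (st V c s \<union> {(c x, p)} \<union> insert (p, u) H) = nc (st V (c(x := p)) s \<union> insert (p, u) H)"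
  by (rule st_extend[OF s c x p(1)]) (use H cxp u(2) in \<open>auto simp: not_Field_insert\<close>)
 also have "... = nc (st V (c(x := p)) s \<union> {((c(x := p)) x, u)} \<union> H)"
  by simp
 also have "... = nc (st V ((c(x := p))(x := u)) s \<union> H)"
 proof (rule st_extend[OF s _ x])
  show "inj_on (c(x := p)) V" using c p(1) by (auto intro: inj_on_fun_updI)
  show "u \<notin> (c(x := p)) ` V" using u p(2) by auto
 qed (use p in simp)
 finally show ?thesis by (simp add: insert_commute)
qed

text \<open>Processing one crossing: its slots are \<open>p 0, p 1, p 2, p 3\<close> (SW, SE, NE, NW); the two strands
 continue to \<open>u\<close> and \<open>w\<close>.\<close>
context
 fixes V :: "lab set" and s :: state and c :: "lab => 'p" and x y :: lab and p :: "nat => 'p" and u w :: 'p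
  and H :: "('p \<times> 'p) set"
 assumes s: "closed_state V s" and c: "inj_on c V" and xy: "x \<in> V" "y \<in> V" "x \<noteq> y"
  and cx: "c x = p 0" "c y = p 1"
  and p: "p 0 \<noteq> p 1" "p 0 \<noteq> p 2" "p 0 \<noteq> p 3" "p 1 \<noteq> p 2" "p 1 \<noteq> p 3" "p 2 \<noteq> p 3"
  and pc: "p 2 \<notin> c ` V" "p 3 \<notin> c ` V"
  and uw: "u \<noteq> w" "u \<notin> {p 0, p 1, p 2, p 3}" "w \<notin> {p 0, p 1, p 2, p 3}"
   "u \<notin> c ` (V - {x, y})" "w \<notin> c ` (V - {x, y})"
  and V: "finite V" and H: "finite H" "p 0 \<notin> Field H" "p 1 \<notin> Field H" "p 2 \<notin> Field H" "p 3 \<notin> Field H"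
begin

lemma smoothing_vertical:
 "nc (st V c s \<union> {(p 3, u), (p 2, w)} \<union> {(p 0, p 3), (p 1, p 2)} \<union> H)
  = nc (st V (c(x := u, y := w)) s \<union> H)"
proof -
 have "nc (st V c s \<union> {(p 3, u), (p 2, w)} \<union> {(p 0, p 3), (p 1, p 2)} \<union> H)
   = nc (st V c s \<union> {(c x, p 3), (p 3, u)} \<union> insert (p 1, p 2) (insert (p 2, w) H))"
  by (rule arg_cong[where f = nc]) (auto simp: cx)
 also have "... = nc (st V (c(x := u)) s \<union> insert (p 1, p 2) (insert (p 2, w) H))"
  by (rule st_extend2[OF s c xy(1)]) (use p pc uw H cx xy in \<open>auto simp: not_Field_insert\<close>)
 also have "... = nc (st V (c(x := u)) s \<union> {((c(x := u)) y, p 2), (p 2, w)} \<union> H)"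
  using xy(3) by (intro arg_cong[where f = nc]) (auto simp: cx)
 also have "... = nc (st V ((c(x := u))(y := w)) s \<union> H)"
 proof (rule st_extend2[OF s _ xy(2)])
  show "inj_on (c(x := u)) V"
  proof (rule inj_on_fun_updI[OF c])
   show "u \<notin> c ` V" using uw cx by auto
  qed
 qed (use p pc uw H cx xy in auto)
 finally show ?thesis .
qed

lemma smoothing_horizontal:
 "nc (st V c s \<union> {(p 3, u), (p 2, w)} \<union> {(p 0, p 1), (p 2, p 3)} \<union> H)
  = (if partner s x = y then 1 else 0) + nc (st V (c(x := u, y := w)) (cup x y s) \<union> H)"
proof -
 let ?c = "c(x := p 3, y := p 2)" and ?s = "cup x y s"
 have s': "closed_state V ?s" by (rule closed_cup[OF s xy(1,2)])
 have c': "inj_on ?c V"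
  using c pc p by (intro inj_on_fun_updI) auto
 have "nc (st V c s \<union> {(p 3, u), (p 2, w)} \<union> {(p 0, p 1), (p 2, p 3)} \<union> H)
   = nc (st V c s \<union> {(c x, c y), (p 2, p 3)} \<union> insert (p 3, u) (insert (p 2, w) H))"
  by (rule arg_cong[where f = nc]) (auto simp: cx)
 also have "... = (if partner s x = y then 1 else 0) + nc (st V ?c ?s \<union> insert (p 3, u) (insert (p 2, w) H))"
  by (rule st_cap[OF s c xy]) (use p pc uw H cx V in \<open>auto simp: not_Field_insert\<close>)
 also have "nc (st V ?c ?s \<union> insert (p 3, u) (insert (p 2, w) H))
   = nc (st V ?c ?s \<union> {(?c x, u)} \<union> insert (p 2, w) H)"
  using xy(3) by (intro arg_cong[where f = nc]) auto
 also have "... = nc (st V (?c(x := u)) ?s \<union> insert (p 2, w) H)"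
  by (rule st_extend[OF s' c' xy(1)]) (use p uw H xy in \<open>auto simp: not_Field_insert\<close>)
 also have "... = nc (st V (?c(x := u)) ?s \<union> {((?c(x := u)) y, w)} \<union> H)"
  using xy(3) by (intro arg_cong[where f = nc]) auto
 also have "... = nc (st V ((?c(x := u))(y := w)) ?s \<union> H)"
 proof (rule st_extend[OF s' _ xy(2)])
  show "inj_on (?c(x := u)) V"
   by (rule inj_on_fun_updI[OF c']) (use uw in auto)
 qed (use p uw H xy in auto)
 also have "(?c(x := u))(y := w) = c(x := u, y := w)" by (auto simp: fun_eq_iff)
 finally show ?thesis .
qed

end

section \<open>State sums evaluated one box at a time\<close>

primrec seval :: "(lser \<times> ('p \<times> 'p) set) list list => ('p \<times> 'p) set => lser" where
 "seval [] G = loop_val ^ nc G"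
| "seval (B # Bs) G = (\<Sum>(c, M)\<leftarrow>B. c * seval Bs (G \<union> M))"

text \<open>A local change of the network may be made under the state sum if it is valid together
  with all arcs that the remaining boxes can add; these have their ends in \<open>P\<close>.\<close>

lemma seval_cong:
 assumes "\<And>H. finite H ==> Field H \<subseteq> P ==> nc (G \<union> H) = e + nc (G' \<union> H)"
  and "\<And>B c M. B \<in> set Bs ==> (c, M) \<in> set B ==> finite M \<and> Field M \<subseteq> P"
 shows "seval Bs G = loop_val ^ e * seval Bs G'"
 using assms
proof (induction Bs arbitrary: G G')
 case Nil
 from Nil.prems(1)[of "{}"] show ?case by (simp add: power_add)
next
 case (Cons B Bs)
 have "seval Bs (G \<union> M) = loop_val ^ e * seval Bs (G' \<union> M)" if "(c, M) \<in> set B" for c M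
 proof (rule Cons.IH)
  fix H assume H: "finite H" "Field H \<subseteq> P"
  show "nc (G \<union> M \<union> H) = e + nc (G' \<union> M \<union> H)"
   using Cons.prems(1)[of "M \<union> H"] Cons.prems(2)[of B c M] that H by (simp add: Un_assoc Field_Un)
 qed (use Cons.prems(2) in auto)
 then have m: "map (\<lambda>(c, M). c * seval Bs (G \<union> M)) B = map (\<lambda>(c, M). loop_val ^ e * (c * seval Bs (G' \<union> M))) B"
  by (intro map_cong refl) (auto simp: mult_ac)
 have "seval (B # Bs) G = (\<Sum>(c, M)\<leftarrow>B. loop_val ^ e * (c * seval Bs (G' \<union> M)))"
  by (simp only: seval.simps m)
 also have "... = loop_val ^ e * seval (B # Bs) G'"
  by (simp add: sum_list_const_mult split_def)
 finally show ?case .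
qed

type_synonym 'p placed = "lab \<times> lab \<times> (nat => 'p)"

text \<open>Lists are in the order of processing. If \<open>c\<close> gives the points where the
  strands leave the crossings \<open>bs\<close>, then \<open>nxt bs c\<close> gives those where they
  enter: slots 0 and 1 are the lower ends of a crossing, while \<open>wires\<close> continues its
  upper ends 3 and 2.\<close>

primrec nxt :: "'p placed list => (lab => 'p) => lab => 'p" where
 "nxt [] c = c"
| "nxt (b # bs) c = (case b of (x, y, p) => (nxt bs c)(x := p 0, y := p 1))"

primrec wires :: "'p placed list => (lab => 'p) => ('p \<times> 'p) set" where
 "wires [] c = {}"
| "wires (b # bs) c = (case b of (x, y, p) => {(p 3, nxt bs c x), (p 2, nxt bs c y)} \<union> wires bs c)"

fun placed_box :: "'p placed => (lser \<times> ('p \<times> 'p) set) list" where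
 "placed_box (x, y, p) = crossing_box (p 0) (p 1) (p 2) (p 3)"

fun placed_op :: "'p placed => op" where
 "placed_op (x, y, p) = crossing x y"

fun slots :: "'p placed => 'p set" where
 "slots (x, y, p) = {p 0, p 1, p 2, p 3}"

fun proper :: "lab set => 'p placed => bool" where
 "proper V (x, y, p) \<longleftrightarrow> x \<in> V \<and> y \<in> V \<and> x \<noteq> y \<and> distinct [p 0, p 1, p 2, p 3]"

definition placed_ops :: "'p placed list => op" where
 "placed_ops bs = prod_list (map placed_op bs)"

lemma nxt_append: "nxt (bs @ bs') c = nxt bs (nxt bs' c)"
 by (induction bs) (auto split: prod.splits)

lemma wires_append: "wires (bs @ bs') c = wires bs (nxt bs' c) \<union> wires bs' c"
 by (induction bs) (auto simp: nxt_append split: prod.splits)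

lemma placed_ops_append: "placed_ops (bs @ bs') = placed_ops bs * placed_ops bs'"
 by (simp add: placed_ops_def)

definition all_slots :: "'p placed list => 'p set" where
 "all_slots bs = (\<Union>b\<in>set bs. slots b)"

lemma all_slots_simps [simp]: "all_slots [] = {}" "all_slots (b # bs) = slots b \<union> all_slots bs"
 "all_slots (bs @ bs') = all_slots bs \<union> all_slots bs'"
 by (auto simp: all_slots_def)

primrec separated :: "'p placed list => bool" where
 "separated [] \<longleftrightarrow> True"
| "separated (b # bs) \<longleftrightarrow> slots b \<inter> all_slots bs = {} \<and> separated bs"

lemma nxt_range: "nxt bs c ` A \<subseteq> c ` A \<union> all_slots bs"
 by (induction bs) (auto split: prod.splits)

lemma finite_wires: "finite (wires bs c)"
 by (induction bs) (auto split: prod.splits)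

lemma inj_on_upd2:
 assumes "inj_on c A" "u \<notin> c ` A" "w \<notin> c ` A" "u \<noteq> w"
 shows "inj_on (c(x := u, y := w)) A"
proof (rule inj_on_fun_updI)
 show "inj_on (c(x := u)) A" using assms(1,2) by (rule inj_on_fun_updI)
 show "w \<notin> (c(x := u)) ` A" using assms(3,4) by auto
qed

lemma nxt_inj:
 assumes "inj_on c V" "list_all (proper V) bs" "all_slots bs \<inter> c ` V = {}" "separated bs"
 shows "inj_on (nxt bs c) V"
 using assms(2-)
proof (induction bs)
 case (Cons b bs)
 obtain x y p where b: "b = (x, y, p)" by (cases b) auto
 have IH: "inj_on (nxt bs c) V" using Cons.prems by (intro Cons.IH) auto
 have "slots b \<inter> (c ` V \<union> all_slots bs) = {}" using Cons.prems by auto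
 then have "slots b \<inter> nxt bs c ` V = {}" using nxt_range[of bs c "V"] by blast
 then have "inj_on ((nxt bs c)(x := p 0, y := p 1)) V"
  using Cons.prems(1) by (intro inj_on_upd2[OF IH]) (auto simp: b)
 then show ?case by (simp only: b nxt.simps prod.case)
qed (use assms(1) in simp)

lemma wires_Field:
 assumes "list_all (proper V) bs"
 shows "Field (wires bs c) \<subseteq> c ` V \<union> all_slots bs"
 using assms
proof (induction bs)
 case (Cons b bs)
 obtain x y p where b: "b = (x, y, p)" by (cases b) auto
 have "nxt bs c x \<in> c ` V \<union> all_slots bs" "nxt bs c y \<in> c ` V \<union> all_slots bs"
  using nxt_range[of bs c "V"] Cons.prems by (auto simp: b)
 then show ?case using Cons by (auto simp: b Field_Un)
qed simp

lemma placed_box_Field: "(d, M) \<in> set (placed_box b) ==> finite M \<and> Field M \<subseteq> slots b"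
 by (cases b) (auto simp: crossing_box_def Field_def)

text \<open>The vertical smoothing of a crossing only moves the ends of two strands, the horizontal
  one also applies \<open>cup\<close> and may close a loop. These are the two terms of the operator
  \<open>crossing\<close>.\<close>

lemma seval_crossings:
 assumes V: "finite V" and c: "inj_on c V" and K: "finite K"
  and bs: "list_all (proper V) bs" "all_slots bs \<inter> (c ` V \<union> Field K) = {}" "separated bs"
  and rest: "\<And>B d M. B \<in> set rest ==> (d, M) \<in> set B ==> finite M \<and> Field M \<inter> all_slots bs = {}"
  and s: "closed_state V s"
 shows "seval (map placed_box bs @ rest) (st V (nxt bs c) s \<union> wires bs c \<union> K) =
  ap (placed_ops bs) (\<lambda>s. seval rest (st V c s \<union> K)) s"
 using bs rest s
proof (induction bs arbitrary: s)
 case Nil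
 then show ?case by (simp add: placed_ops_def)
next
 case (Cons b bs)
 obtain x y p where b: "b = (x, y, p)" by (cases b) auto
 let ?c = "nxt bs c"
 let ?cb = "?c(x := p 0, y := p 1)"
 let ?Bs = "map placed_box bs @ rest"
 have p: "x \<in> V" "y \<in> V" "x \<noteq> y" "distinct [p 0, p 1, p 2, p 3]"
  using Cons.prems(1) by (auto simp: b)
 have inj: "inj_on ?c V" by (rule nxt_inj[OF c]) (use Cons.prems in auto)
 have sb: "slots b \<inter> (c ` V \<union> all_slots bs) = {}" using Cons.prems by auto
 then have fresh: "slots b \<inter> ?c ` V = {}"
  using nxt_range[of bs c "V"] by blast
 have inj0: "inj_on ?cb V"
  by (rule inj_on_upd2[OF inj]) (use fresh p(4) in \<open>auto simp: b\<close>)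
 have wf: "slots b \<inter> Field (wires bs c) = {}"
  using wires_Field[of V bs c] Cons.prems(1) sb by auto
 have Kb: "slots b \<inter> Field K = {}" using Cons.prems(2) by auto
 have later: "finite M \<and> Field M \<subseteq> - slots b" if Bin: "B \<in> set ?Bs" and dM: "(d, M) \<in> set B" for B d M
 proof -
  consider b' where "b' \<in> set bs" "B = placed_box b'" | "B \<in> set rest" using Bin unfolding set_append set_map by blast
  then show ?thesis
  proof cases
   case 1
   then have "slots b' \<subseteq> all_slots bs" by (auto simp: all_slots_def)
   then show ?thesis using placed_box_Field[of d M b'] dM 1 sb by blast
  next
   case 2
   then show ?thesis using Cons.prems(4)[OF 2 dM] by auto
  qed
 qed
 have q: "p 0 \<noteq> p 1" "p 0 \<noteq> p 2" "p 0 \<noteq> p 3" "p 1 \<noteq> p 2" "p 1 \<noteq> p 3" "p 2 \<noteq> p 3" using p(4) by auto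
 have c0c: "?cb(x := ?c x, y := ?c y) = ?c" using p(3) by auto
 have cxy: "?c x \<noteq> ?c y" using inj p by (auto simp: inj_on_eq_iff)
 have cp: "?c x \<notin> {p 0, p 1, p 2, p 3}" "?c y \<notin> {p 0, p 1, p 2, p 3}"
  using fresh imageI[OF p(1), of ?c] imageI[OF p(2), of ?c] unfolding b slots.simps by blast+
 have cl: "?c x \<notin> ?cb ` (V - {x, y})" "?c y \<notin> ?cb ` (V - {x, y})"
  using inj p by (auto simp: inj_on_eq_iff)
 have pf: "p 2 \<notin> ?cb ` V" "p 3 \<notin> ?cb ` V" using fresh q by (auto simp: b)
 have IH: "seval ?Bs (st V ?c s' \<union> wires bs c \<union> K) = ap (placed_ops bs) (\<lambda>s. seval rest (st V c s \<union> K)) s'"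
  if "closed_state V s'" for s'
 proof (rule Cons.IH)
  show "finite M \<and> Field M \<inter> all_slots bs = {}" if "B \<in> set rest" "(d, M) \<in> set B" for B d M
   using Cons.prems(4)[OF that] by auto
 qed (use Cons.prems that in auto)
 let ?W = "{(p 3, ?c x), (p 2, ?c y)}"
 have fin: "finite (wires bs c \<union> K \<union> H)" "p i \<notin> Field (wires bs c \<union> K \<union> H)"
  if "finite H" "Field H \<subseteq> - slots b" "i \<in> {0, 1, 2, 3}" for H i
  using K finite_wires[of bs c] that wf Kb by (auto simp: b Field_Un)
 have A: "seval ?Bs (st V ?cb s \<union> (?W \<union> wires bs c) \<union> K \<union> {(p 0, p 3), (p 1, p 2)})
   = loop_val ^ 0 * seval ?Bs (st V ?c s \<union> wires bs c \<union> K)"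
 proof (rule seval_cong[of "- slots b", OF _ later])
  fix H assume H: "finite H" "Field H \<subseteq> - slots b"
  have fin: "finite (wires bs c \<union> K \<union> H)" "p 0 \<notin> Field (wires bs c \<union> K \<union> H)" "p 1 \<notin> Field (wires bs c \<union> K \<union> H)"
   "p 2 \<notin> Field (wires bs c \<union> K \<union> H)" "p 3 \<notin> Field (wires bs c \<union> K \<union> H)"
   using fin(1)[OF H, of 0] fin(2)[OF H, of 0] fin(2)[OF H, of 1] fin(2)[OF H, of 2] fin(2)[OF H, of 3] by simp_all
  have "nc (st V ?cb s \<union> ?W \<union> {(p 0, p 3), (p 1, p 2)} \<union> (wires bs c \<union> K \<union> H))
    = nc (st V (?cb(x := ?c x, y := ?c y)) s \<union> (wires bs c \<union> K \<union> H))"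
   by (rule smoothing_vertical[OF Cons.prems(5) inj0 p(1,2,3)]) (use p(3) q pf cxy cp cl fin V in simp_all)
  then show "nc (st V ?cb s \<union> (?W \<union> wires bs c) \<union> K \<union> {(p 0, p 3), (p 1, p 2)} \<union> H)
    = 0 + nc (st V ?c s \<union> wires bs c \<union> K \<union> H)"
   unfolding c0c by (simp add: Un_ac)
 qed
 have B: "seval ?Bs (st V ?cb s \<union> (?W \<union> wires bs c) \<union> K \<union> {(p 0, p 1), (p 2, p 3)})
   = loop_val ^ (if partner s x = y then 1 else 0) * seval ?Bs (st V ?c (cup x y s) \<union> wires bs c \<union> K)"
 proof (rule seval_cong[of "- slots b", OF _ later])
  fix H assume H: "finite H" "Field H \<subseteq> - slots b"
  have fin: "finite (wires bs c \<union> K \<union> H)" "p 0 \<notin> Field (wires bs c \<union> K \<union> H)" "p 1 \<notin> Field (wires bs c \<union> K \<union> H)"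
   "p 2 \<notin> Field (wires bs c \<union> K \<union> H)" "p 3 \<notin> Field (wires bs c \<union> K \<union> H)"
   using fin(1)[OF H, of 0] fin(2)[OF H, of 0] fin(2)[OF H, of 1] fin(2)[OF H, of 2] fin(2)[OF H, of 3] by simp_all
  have "nc (st V ?cb s \<union> ?W \<union> {(p 0, p 1), (p 2, p 3)} \<union> (wires bs c \<union> K \<union> H))
    = (if partner s x = y then 1 else 0)
     + nc (st V (?cb(x := ?c x, y := ?c y)) (cup x y s) \<union> (wires bs c \<union> K \<union> H))"
   by (rule smoothing_horizontal[OF Cons.prems(5) inj0 p(1,2,3)]) (use p(3) q pf cxy cp cl fin V in simp_all)
  then show "nc (st V ?cb s \<union> (?W \<union> wires bs c) \<union> K \<union> {(p 0, p 1), (p 2, p 3)} \<union> H)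
    = (if partner s x = y then 1 else 0) + nc (st V ?c (cup x y s) \<union> wires bs c \<union> K \<union> H)"
   unfolding c0c by (simp add: Un_ac)
 qed
 have "seval (map placed_box (b # bs) @ rest) (st V (nxt (b # bs) c) s \<union> wires (b # bs) c \<union> K) =
  varA * seval ?Bs (st V ?cb s \<union> (?W \<union> wires bs c) \<union> K \<union> {(p 0, p 3), (p 1, p 2)})
  + varAinv * seval ?Bs (st V ?cb s \<union> (?W \<union> wires bs c) \<union> K \<union> {(p 0, p 1), (p 2, p 3)})"
  by (simp only: b crossing_box_def list.map append.simps seval.simps nxt.simps wires.simps placed_box.simps
    prod.case sum_list.Cons sum_list.Nil add_0_right)
 also have "... = ap (placed_ops (b # bs)) (\<lambda>s. seval rest (st V c s \<union> K)) s"
  unfolding A B using IH[OF Cons.prems(5)] IH[OF closed_cup[OF Cons.prems(5) p(1,2)]]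
  by (simp add: b placed_ops_def crossing_def)
 finally show ?case .
qed

lemma n_components_image:
 assumes "inj_on c (Field G)"
 shows "nc (map_prod c c ` G) = nc G"
proof -
 let ?g = "inv_into (Field G) c"
 have F: "Field (map_prod c c ` G) = c ` Field G"
  by (auto simp: Field_def Domain_fst Range_snd image_image image_Un)
 have g: "x \<in> Field G ==> ?g (c x) = x" for x by (rule inv_into_f_f[OF assms])
 have FG: "(x, y) \<in> G ==> x \<in> Field G" "(x, y) \<in> G ==> y \<in> Field G" for x y by (auto simp: Field_def)
 have cG: "(c x, c y) \<in> conn (map_prod c c ` G)" if "(x, y) \<in> G" for x y
  using imageI[OF that, of "map_prod c c"] conn_edge(1)[of "c x" "c y" "map_prod c c ` G"] by simp
 show ?thesis
  by (rule n_components_retract[where f = c and g = ?g]) (auto simp: F g FG intro: conn_edge(1) cG)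
qed

section \<open>The closure by the frame as a functional\<close>

definition frame_edges :: "nat => (lab \<times> lab) set" where
 "frame_edges n = (\<lambda>x. (x, frame x)) ` labels n"

definition reach :: "nat => state => lab set" where
 "reach n s = labels n \<union> partner s ` labels n"

text \<open>The state is closed up by the frame. It may match points of the frame with other points; the
 division removes the resulting open paths from the count.\<close>
definition closure :: "nat => state => lser" where
 "closure n s = loop_val ^ nc (st (reach n s) id s \<union> frame_edges n)
   / loop_val ^ (card (reach n s - labels n) div 2)"

lemma frame_labels [simp]: "x \<in> labels n ==> frame x \<in> labels n"
 by (cases x) (auto simp: labels_def)

lemma frame_frame [simp]: "x \<in> labels n ==> frame (frame x) = x"
proof -
 have "r < 3 ==> ((r + 1) mod 3 + 2) mod 3 = r" "r < 3 ==> ((r + 2) mod 3 + 1) mod 3 = r" for r :: nat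
  by presburger+
 then show "x \<in> labels n ==> frame (frame x) = x" by (cases x) (auto simp: labels_def)
qed

lemma frame_neq [simp]: "frame x \<noteq> x" "x \<noteq> frame x"
 by (cases x; auto)+

lemma Field_frame_edges: "Field (frame_edges n) = labels n"
 by (auto simp: frame_edges_def Field_def)

lemma finite_frame_edges: "finite (frame_edges n)"
 by (simp add: frame_edges_def finite_labels)

lemma finite_reach: "finite (reach n s)"
 by (simp add: reach_def finite_labels)

lemma closed_reach: "closed_state (reach n s) s"
 by (auto simp: reach_def closed_state_def)

lemma st_Un: "st (V \<union> W) c s = st V c s \<union> st W c s"
 by (auto simp: st_def)

lemma n_components_pairs:
 assumes "finite W" "closed_state W s"
 shows "2 * nc (st W id s) = card W"
 using assms
proof (induction "card W" arbitrary: W rule: less_induct)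
 case less
 show ?case
 proof (cases "W = {}")
  case True
  then show ?thesis by (simp add: st_def n_components_def)
 next
  case False
  then obtain x where x: "x \<in> W" by auto
  let ?U = "W - {x, partner s x}"
  have px: "partner s x \<in> W" using x less.prems by (auto simp: closed_state_def)
  have cl: "closed_state ?U s" using less.prems(2) by (auto simp: closed_state_def partner_flip)
  have cl2: "closed_state {x, partner s x} s" by (auto simp: closed_state_def)
  have W: "W = {x, partner s x} \<union> ?U" using x px by auto
  have c: "card W = 2 + card ?U"
   using x px less.prems(1) by (subst W, subst card_Un_disjoint) auto
  have "nc (st W id s) = nc (st {x, partner s x} id s \<union> st ?U id s)"
   by (subst W) (simp only: st_Un)
  also have "... = nc (st {x, partner s x} id s) + nc (st ?U id s)"
   by (rule n_components_disjoint) (use less.prems(1) cl cl2 in \<open>auto simp: finite_st Field_st\<close>)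
  also have "nc (st {x, partner s x} id s) = 1"
   using n_components_edge[of x "partner s x"] by (simp add: st_def)
  finally have "nc (st W id s) = 1 + nc (st ?U id s)" .
  moreover have "2 * nc (st ?U id s) = card ?U"
   using less.prems(1) cl c by (intro less.hyps) auto
  ultimately show ?thesis using c by linarith
 qed
qed

lemma n_components_enlarge:
 assumes "finite V" "closed_state V s" "V' \<subseteq> V" "closed_state V' s" "labels n \<subseteq> V'"
 shows "nc (st V id s \<union> frame_edges n) = nc (st V' id s \<union> frame_edges n) + card (V - V') div 2"
proof -
 have cl: "closed_state (V - V') s" using assms(2,4) by (auto simp: closed_state_def)
 have V: "V = V' \<union> (V - V')" using assms(3) by auto
 have "nc (st V id s \<union> frame_edges n) = nc ((st V' id s \<union> frame_edges n) \<union> st (V - V') id s)"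
  by (subst V) (simp only: st_Un Un_ac)
 also have "... = nc (st V' id s \<union> frame_edges n) + nc (st (V - V') id s)"
  by (rule n_components_disjoint)
   (use assms cl in \<open>auto simp: finite_st finite_frame_edges Field_Un Field_st Field_frame_edges rev_finite_subset\<close>)
 also have "nc (st (V - V') id s) = card (V - V') div 2"
  using n_components_pairs[OF _ cl] assms(1) by simp
 finally show ?thesis .
qed

text \<open>Enlarging the set of labels adds only components consisting of a single pair, and the
  division removes them again. This gives a common set of labels for a state and its image under
  \<open>cup\<close>.\<close>

lemma closure_eq:
 assumes V: "finite V" "closed_state V s" "labels n \<subseteq> V"
 shows "closure n s = loop_val ^ nc (st V id s \<union> frame_edges n) / loop_val ^ (card (V - labels n) div 2)"
proof -
 let ?S = "reach n s"
 have sub: "?S \<subseteq> V" using V by (auto simp: reach_def closed_state_def)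
 have cl: "closed_state (V - ?S) s" using V(2) closed_reach[of n s] by (auto simp: closed_state_def)
 have ev: "even (card (V - ?S))" using n_components_pairs[OF _ cl] V(1) by (metis dvd_triv_left finite_Diff)
 have L: "labels n \<subseteq> ?S" by (auto simp: reach_def)
 have split: "V - labels n = (?S - labels n) \<union> (V - ?S)" using sub L by auto
 have "card (V - labels n) = card (?S - labels n) + card (V - ?S)"
  unfolding split by (rule card_Un_disjoint) (use V(1) finite_reach in auto)
 then have "card (V - labels n) div 2 = card (?S - labels n) div 2 + card (V - ?S) div 2"
  using ev by (simp add: div_plus_div_distrib_dvd_right)
 then show ?thesis
  unfolding closure_def n_components_enlarge[OF V(1,2) sub closed_reach L] by (simp add: power_add)
qed

text \<open>A point under the cap and the point of the frame with the same label must be kept apart.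
  The boolean distinguishes them: \<open>True\<close> marks \<open>x\<close> and \<open>y\<close>
  below the cap, \<open>False\<close> the points at the frame.\<close>

lemma E_closure:
 assumes xy: "x \<in> labels n" "y \<in> labels n" "x \<noteq> y"
 shows "ap (E x y) (closure n) s = loop_val ^ nc (st (reach n s) (\<lambda>z. (z, z \<in> {x, y})) s
   \<union> {((x, True), (y, True)), ((y, False), (x, False))} \<union> map_prod (\<lambda>z. (z, False)) (\<lambda>z. (z, False)) ` frame_edges n)
  / loop_val ^ (card (reach n s - labels n) div 2)"
proof -
 let ?V = "reach n s" and ?s = "cup x y s" and ?c = "\<lambda>z. (z, z \<in> {x, y})" and ?j = "\<lambda>z::lab. (z, False)"
 let ?F = "map_prod ?j ?j ` frame_edges n"
 have V: "finite ?V" "closed_state ?V s" "labels n \<subseteq> ?V" by (rule finite_reach, rule closed_reach, simp add: reach_def)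
 have xV: "x \<in> ?V" "y \<in> ?V" using xy V(3) by auto
 have V': "closed_state ?V ?s" by (rule closed_cup[OF V(2) xV])
 have FF: "Field ?F = ?j ` labels n"
  by (auto simp: Field_def frame_edges_def map_prod_def image_iff intro!: bexI)
 have "nc (st ?V ?c s \<union> {(?c x, ?c y), ((y, False), (x, False))} \<union> ?F)
   = (if partner s x = y then 1 else 0) + nc (st ?V (?c(x := (x, False), y := (y, False))) ?s \<union> ?F)"
  by (rule st_cap[OF V(2) _ xV xy(3)]) (use xy V in \<open>auto simp: inj_on_def FF finite_frame_edges\<close>)
 also have "?c(x := (x, False), y := (y, False)) = ?j" by (auto simp: fun_eq_iff)
 also have "nc (st ?V ?j ?s \<union> ?F) = nc (st ?V id ?s \<union> frame_edges n)"
 proof -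
  have e: "st ?V ?j ?s \<union> ?F = map_prod ?j ?j ` (st ?V id ?s \<union> frame_edges n)"
   by (auto simp: st_def image_image image_Un)
  show ?thesis
   unfolding e by (rule n_components_image) (auto simp: inj_on_def)
 qed
 finally show ?thesis
  using xy by (simp add: closure_eq[OF V(1) V' V(3)] power_add)
qed

text \<open>The frame arcs from \<open>x\<close> and \<open>y\<close> form a band, along which the
  cap and the cup slide to \<open>frame x\<close> and \<open>frame y\<close>. If
  \<open>y = frame x\<close>, the two generators coincide; otherwise the four labels are
  distinct.\<close>

lemma closure_flip:
 assumes x: "x \<in> labels n" and y: "y \<in> labels n" and xy: "x \<noteq> y"
 shows "ap (E x y) (closure n) = ap (E (frame x) (frame y)) (closure n)"
proof (cases "y = frame x")
 case True
 then show ?thesis using x by (simp add: E_sym)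
next
 case False
 let ?G = "\<lambda>x y s. st (reach n s) (\<lambda>z. (z, z \<in> {x, y})) s
   \<union> {((x, True), (y, True)), ((y, False), (x, False))} \<union> map_prod (\<lambda>z. (z, False)) (\<lambda>z. (z, False)) ` frame_edges n"
 \<comment> \<open>The end below the cap at \<open>x\<close> now reaches the frame directly, and the
   cup above it becomes the cap under \<open>frame x\<close> and \<open>frame y\<close>.\<close>
 let ?g = "\<lambda>x y p. if fst p \<in> {x, y} then (if snd p then (fst p, False) else (frame (fst p), True))
   else (fst p, fst p \<in> {frame x, frame y})"
 have FG: "Field (?G x y s) = (\<lambda>z. (z, z \<in> {x, y})) ` reach n s \<union> (\<lambda>z. (z, False)) ` labels n"
  if "x \<in> labels n" "y \<in> labels n" for x y s
 proof -
  have "Field (map_prod (\<lambda>z. (z, False)) (\<lambda>z. (z, False)) ` frame_edges n) = (\<lambda>z. (z, False)) ` labels n"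
   by (auto simp: Field_def frame_edges_def map_prod_def image_iff intro!: bexI)
  then show ?thesis using that Field_st[OF closed_reach, of n s "\<lambda>z. (z, z \<in> {x, y})"]
   by (auto simp: Field_Un Field_insert reach_def)
 qed
 have hom: "(?g x y p, ?g x y q) \<in> conn (?G (frame x) (frame y) s)"
  if x: "x \<in> labels n" and y: "y \<in> labels n" and d: "x \<noteq> y" "y \<noteq> frame x" and pq: "(p, q) \<in> ?G x y s" for x y s p q
 proof -
  have d': "frame x \<noteq> y" "frame y \<noteq> x" "frame x \<noteq> frame y" "x \<noteq> frame y" using d x y by (metis frame_frame)+
  have fe: "((z, False), (frame z, False)) \<in> ?G (frame x) (frame y) s" if "z \<in> labels n" for z
   using that by (auto simp: frame_edges_def image_iff)
  consider z where "z \<in> reach n s" "p = (z, z \<in> {x, y})" "q = (partner s z, partner s z \<in> {x, y})"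
   | "p = (x, True)" "q = (y, True)" | "p = (y, False)" "q = (x, False)"
   | z where "z \<in> labels n" "p = (z, False)" "q = (frame z, False)"
   using pq by (auto simp: st_def frame_edges_def)
  then show ?thesis
  proof cases
   case (1 z)
   have "?g x y (w, w \<in> {x, y}) = (w, w \<in> {frame x, frame y})" for w
    using d d' by auto
   then show ?thesis unfolding 1(2,3) using 1(1) by (auto intro!: conn_edge(1) simp: st_def)
  next
   case p: 2
   have 1: "((x, False), (frame x, False)) \<in> conn (?G (frame x) (frame y) s)"
    and 2: "((frame y, False), (y, False)) \<in> conn (?G (frame x) (frame y) s)"
    using fe[OF x] fe[OF y] by (auto intro: conn_edge)
   have 3: "((frame x, False), (frame y, False)) \<in> conn (?G (frame x) (frame y) s)"
    by (rule conn_edge(2)) simp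
   have "((x, False), (y, False)) \<in> conn (?G (frame x) (frame y) s)"
    by (rule conn_trans[OF conn_trans[OF 1 3] 2])
   then show ?thesis using p d by simp
  next
   case 3
   then show ?thesis by (auto intro!: conn_edge(2))
  next
   case (4 z)
   show ?thesis
   proof (cases "z \<in> {x, y} \<or> frame z \<in> {x, y}")
    case True
    then consider "z = x" | "z = y" | "z = frame x" | "z = frame y" using 4(1) by (auto dest: frame_frame)
    then show ?thesis using 4 d d' x y by cases auto
   next
    case False
    then have "z \<notin> {frame x, frame y}" "frame z \<notin> {frame x, frame y}"
     using x y 4(1) by (auto dest: arg_cong[where f = frame])
    then show ?thesis using 4 False conn_edge(1)[OF fe[OF 4(1)]] by simp
   qed
  qed
 qed
 have undo: "(?g (frame x) (frame y) (?g x y p), p) \<in> conn (?G x y s)"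
  if x: "x \<in> labels n" and y: "y \<in> labels n" and d: "x \<noteq> y" "y \<noteq> frame x" and p: "p \<in> Field (?G x y s)" for x y s p
 proof -
  have d': "frame x \<noteq> y" "frame y \<noteq> x" "frame x \<noteq> frame y" "x \<noteq> frame y" using d x y by (metis frame_frame)+
  have fe: "((z, False), (frame z, False)) \<in> ?G x y s" if "z \<in> labels n" for z
   using that by (auto simp: frame_edges_def image_iff)
  obtain z b where p': "p = (z, b)" by (cases p)
  have zb: "b ==> z \<in> {x, y}" using p unfolding FG[OF x y] p' by auto
  define C where "C = conn (?G x y s)"
  have C: "(p, p) \<in> C" "((frame x, False), (x, False)) \<in> C" "((frame y, False), (y, False)) \<in> C" for p
   using conn_edge(2)[OF fe[OF x]] conn_edge(2)[OF fe[OF y]] by (auto simp: C_def)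
  consider "z = x" | "z = y" | "z = frame x" | "z = frame y" | "z \<notin> {x, y, frame x, frame y}" by auto
  then show ?thesis
   unfolding C_def[symmetric] p' by cases (use x y d d' zb C in \<open>cases b; simp\<close>)+
 qed
 have into: "?g x y p \<in> Field (?G (frame x) (frame y) s)"
  if x: "x \<in> labels n" and y: "y \<in> labels n" and p: "p \<in> Field (?G x y s)" for x y s p
  using p x y unfolding FG[OF x y] FG[OF frame_labels[OF x] frame_labels[OF y]]
  by (auto simp: image_iff reach_def)
 have "nc (?G x y s) = nc (?G (frame x) (frame y) s)" for s
 proof (rule n_components_retract[where g = "?g x y" and f = "?g (frame x) (frame y)"])
  have fx: "frame x \<in> labels n" "frame y \<in> labels n" "frame x \<noteq> frame y" "frame y \<noteq> frame (frame x)"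
   using x y xy False by (auto dest: arg_cong[where f = frame])
  show "?g (frame x) (frame y) p \<in> Field (?G x y s)" if "p \<in> Field (?G (frame x) (frame y) s)" for p
   using into[OF fx(1,2) that] by (simp only: frame_frame[OF x] frame_frame[OF y])
  show "(?g (frame x) (frame y) p, ?g (frame x) (frame y) q) \<in> conn (?G x y s)" if "(p, q) \<in> ?G (frame x) (frame y) s" for p q
   using hom[OF fx that] by (simp only: frame_frame[OF x] frame_frame[OF y])
  show "(?g x y (?g (frame x) (frame y) p), p) \<in> conn (?G (frame x) (frame y) s)" if "p \<in> Field (?G (frame x) (frame y) s)" for p
   using undo[OF fx that] by (simp only: frame_frame[OF x] frame_frame[OF y])
 qed (use into[OF x y] hom[OF x y xy False] undo[OF x y xy False] in auto)
 then show ?thesis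
  using x y xy by (intro ext) (subst (1 2) E_closure, auto dest: arg_cong[where f = frame])
qed

text \<open>The cup above and the frame arc form a circle, while the cap below takes over the place
  of the frame arc.\<close>

lemma closure_loop:
 assumes x: "x \<in> labels n"
 shows "ap (E x (frame x)) (closure n) = (\<lambda>s. loop_val * closure n s)"
proof
 fix s
 let ?y = "frame x" and ?V = "reach n s"
 let ?c = "\<lambda>z. (z, z \<in> {x, ?y})" and ?j = "\<lambda>z::lab. (z, False)"
 let ?F = "map_prod ?j ?j ` frame_edges n"
 let ?F' = "map_prod ?c ?c ` frame_edges n"
 have cl: "closed_state ?V s" by (rule closed_reach)
 have e: "st ?V ?c s \<union> {((x, True), (?y, True)), ((?y, False), (x, False))} \<union> ?F
   = {((x, False), (?y, False)), ((?y, False), (x, False))} \<union> (st ?V ?c s \<union> ({((x, True), (?y, True))} \<union> map_prod ?j ?j ` {(z, w) \<in> frame_edges n. z \<notin> {x, ?y}}))"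
  using x by (auto simp: frame_edges_def image_iff)
 have inj: "z \<in> labels n ==> frame z = frame x \<longleftrightarrow> z = x" for z
  using x by (metis frame_frame)
 have "nc (st ?V ?c s \<union> {((x, True), (?y, True)), ((?y, False), (x, False))} \<union> ?F)
   = 1 + nc (st ?V ?c s \<union> ({((x, True), (?y, True))} \<union> map_prod ?j ?j ` {(z, w) \<in> frame_edges n. z \<notin> {x, ?y}}))"
  unfolding e
 proof (subst n_components_disjoint)
  let ?B = "{(z, w) \<in> frame_edges n. z \<notin> {x, ?y}}"
  have fB: "finite ?B" by (rule finite_subset[OF _ finite_frame_edges[of n]]) auto
  have FB: "Field (map_prod ?j ?j ` ?B) \<subseteq> ?j ` (labels n - {x, ?y})"
  proof
   fix p assume "p \<in> Field (map_prod ?j ?j ` ?B)"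
   then obtain z where z: "z \<in> labels n" "z \<noteq> x" "z \<noteq> ?y" "p = (z, False) \<or> p = (frame z, False)"
    by (auto simp: Field_def frame_edges_def)
   then have "frame z \<noteq> x" "frame z \<noteq> ?y" using inj[of z] by auto
   with z show "p \<in> ?j ` (labels n - {x, ?y})" by auto
  qed
  show "finite (st ?V ?c s \<union> ({((x, True), (?y, True))} \<union> map_prod ?j ?j ` ?B))"
   using fB by (simp add: finite_st finite_reach)
  show "Field {((x, False), (?y, False)), ((?y, False), (x, False))} \<inter> Field (st ?V ?c s \<union> ({((x, True), (?y, True))} \<union> map_prod ?j ?j ` ?B)) = {}"
   using FB by (auto simp: Field_Un Field_st[OF cl] Field_insert)
 qed (simp_all add: n_components_edge)
 also have "nc (st ?V ?c s \<union> ({((x, True), (?y, True))} \<union> map_prod ?j ?j ` {(z, w) \<in> frame_edges n. z \<notin> {x, ?y}}))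
   = nc (st ?V ?c s \<union> ?F')"
 proof (rule n_components_sym)
  let ?B = "{(z, w) \<in> frame_edges n. z \<notin> {x, ?y}}"
  have B: "frame_edges n = {(x, ?y), (?y, x)} \<union> ?B"
   using x by (auto simp: frame_edges_def image_iff)
  have "map_prod ?c ?c ` ?B = map_prod ?j ?j ` ?B"
  proof (rule image_cong[OF refl])
   fix e assume "e \<in> ?B"
   then obtain z where "z \<in> labels n" "e = (z, frame z)" "z \<noteq> x" "z \<noteq> ?y"
    by (auto simp: frame_edges_def)
   then show "map_prod ?c ?c e = map_prod ?j ?j e"
    using inj[of z] x by (auto dest: arg_cong[where f = frame])
  qed
  then have F': "?F' = {((x, True), (?y, True)), ((?y, True), (x, True))} \<union> map_prod ?j ?j ` ?B"
   by (subst B) (simp add: image_Un)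
  show "st ?V ?c s \<union> ({((x, True), (?y, True))} \<union> map_prod ?j ?j ` {(z, w) \<in> frame_edges n. z \<notin> {x, ?y}}) \<union>
   (st ?V ?c s \<union> ({((x, True), (?y, True))} \<union> map_prod ?j ?j ` {(z, w) \<in> frame_edges n. z \<notin> {x, ?y}}))\<inverse>
   = st ?V ?c s \<union> ?F' \<union> (st ?V ?c s \<union> ?F')\<inverse>"
   unfolding F' converse_Un by blast
 qed
 also have "st ?V ?c s \<union> ?F' = map_prod ?c ?c ` (st ?V id s \<union> frame_edges n)"
  by (auto simp: st_def image_image image_Un)
 also have "nc ... = nc (st ?V id s \<union> frame_edges n)"
  by (rule n_components_image) (auto simp: inj_on_def)
 finally show "ap (E x ?y) (closure n) s = loop_val * closure n s"
  using x by (subst E_closure) (simp_all add: closure_def)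
qed

lift_definition initial :: state is "\<lambda>x. case x of Lab r t s i => Lab r (\<not> t) s i"
 by (auto split: lab.splits)

lemma partner_initial [simp]: "partner initial (Lab r t s i) = Lab r (\<not> t) s i"
 by transfer simp

lemma n_components_Id_on: "nc (Id_on A) = card A"
proof -
 have "conn (Id_on A) = Id"
 proof -
  have "(x, y) \<in> conn (Id_on A) ==> x = y" for x y
   unfolding conn_def by (induction rule: rtrancl_induct) auto
  then show ?thesis by auto
 qed
 then show ?thesis
  unfolding n_components_conn by (simp add: Field_def card_image)
qed

lemma closed_initial: "closed_state (labels n) initial"
 unfolding closed_state_def
proof
 fix x assume "x \<in> labels n"
 then show "partner initial x \<in> labels n" by (cases x) (auto simp: labels_def)
qed

text \<open>The components are indexed by a face and a strand number. Face \<open>r\<close> lies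
  between the right side of region \<open>r\<close> and the left side of the next region, which
  explains the column computed by \<open>?g\<close>.\<close>

lemma closure_initial: "closure n initial = loop_val ^ (3 * n)"
proof -
 let ?A = "{..<3::nat} \<times> {..<n}"
 let ?f = "\<lambda>(r, i). Lab r True True i" and ?g = "\<lambda>x. (if is_right x then column x else (column x + 2) mod 3, strand x)"
 let ?G = "st (labels n) id initial \<union> frame_edges n"
 have FG: "Field ?G = labels n"
  using Field_st[OF closed_initial, of n id] by (simp add: Field_Un Field_frame_edges)
 have inv: "?g (partner initial x) = ?g x" "x \<in> labels n ==> ?g (frame x) = ?g x" for x
 proof -
  have "r < 3 ==> ((r + 1) mod 3 + 2) mod 3 = r" for r :: nat by presburger
  then show "?g (partner initial x) = ?g x" "x \<in> labels n ==> ?g (frame x) = ?g x"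
   by (cases x; auto simp: labels_def)+
 qed
 have "nc ?G = nc (Id_on ?A)"
 proof (rule n_components_retract[where f = ?f and g = ?g])
  show "?f p \<in> Field ?G" if "p \<in> Field (Id_on ?A)" for p
   using that unfolding FG by (auto simp: Field_def labels_def)
  show "?g x \<in> Field (Id_on ?A)" if "x \<in> Field ?G" for x
   using that unfolding FG by (auto simp: Field_def labels_def)
  show "(?g x, ?g y) \<in> conn (Id_on ?A)" if "(x, y) \<in> ?G" for x y
  proof -
   have "y = partner initial x \<or> y = frame x \<and> x \<in> labels n" using that by (auto simp: st_def frame_edges_def)
   then have "?g y = ?g x" by (elim disjE conjE) (simp_all only: inv)
   then show ?thesis by simp
  qed
  show "(?f (?g x), x) \<in> conn ?G" if "x \<in> Field ?G" for x
  proof -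
   have x: "x \<in> labels n" using that unfolding FG .
   have 1: "(z, partner initial z) \<in> conn ?G" "(frame z, z) \<in> conn ?G" if "z \<in> labels n" for z
   proof -
    have "(z, partner initial z) \<in> ?G" "(z, frame z) \<in> ?G" using that by (auto simp: st_def frame_edges_def)
    then show "(z, partner initial z) \<in> conn ?G" "(frame z, z) \<in> conn ?G"
     by (blast intro: conn_edge)+
   qed
   obtain r t s i where x': "x = Lab r t s i" by (cases x)
   have *: "(Lab r True s i, x) \<in> conn ?G"
    using 1(1)[of "Lab r True s i"] x by (cases t) (auto simp: x' labels_def)
   show ?thesis
   proof (cases s)
    case True
    then show ?thesis using * by (simp add: x')
   next
    case False
    have "(frame (Lab r True s i), Lab r True s i) \<in> conn ?G"
     using x by (intro 1(2)) (auto simp: x' labels_def)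
    with * False show ?thesis using conn_trans by (auto simp: x')
   qed
  qed
 qed (auto simp: Field_def)
 then show ?thesis
  by (subst closure_eq[OF finite_labels closed_initial order_refl]) (simp add: n_components_Id_on)
qed

definition bracket :: "nat => op => lser" where
 "bracket n T = ap T (closure n) initial"

interpretation closure_functional "bracket n" n
proof
 show "bracket n (S + T) = bracket n S + bracket n T" for S T by (simp add: bracket_def)
 show "bracket n (sc c * T) = c * bracket n T" for c T by (simp add: bracket_def)
 show "bracket n (E (Lab r True s i) (Lab r' True s' j) * M) = bracket n (E (Lab r False s i) (Lab r' False s' j) * M)"
  if "(r, s, i) \<noteq> (r', s', j)" for r s i r' s' j M
 proof -
  have "cup (Lab r True s i) (Lab r' True s' j) initial = cup (Lab r False s i) (Lab r' False s' j) initial"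
   using that by (intro state_eqI) (auto simp: partner_cup)
  then show ?thesis by (simp add: bracket_def)
 qed
 show "bracket n (E (Lab r True s i) (Lab r False s i) * M) = loop_val * bracket n M" for r s i M
  by (simp add: bracket_def cup_same)
 show "bracket n (M * E x y) = bracket n (M * E (frame x) (frame y))" if "x \<in> labels n" "y \<in> labels n" "x \<noteq> y" for x y M
  unfolding bracket_def ap_simps closure_flip[OF that] ..
 show "bracket n (M * E x (frame x)) = loop_val * bracket n M" if "x \<in> labels n" for x M
  unfolding bracket_def ap_simps closure_loop[OF that] ap_scale ..
 show "bracket n 1 = loop_val ^ (3 * n)" by (simp add: bracket_def closure_initial)
qed

text \<open>A cabled crossing is processed row by row, starting with the bottom row; the crossing in row \<open>h\<close> and
 column \<open>v\<close> acts on the strands at positions \<open>h + v\<close> and \<open>h + v + 1\<close>.\<close>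

definition row :: "(nat => lab) => (nat => nat => nat => 'p) => nat => nat => nat => 'p placed list" where
 "row L P n h k = map (\<lambda>v. (L (h + v), L (Suc (h + v)), P h v)) [k..<n]"

primrec block :: "(nat => lab) => (nat => nat => nat => 'p) => nat => nat => 'p placed list" where
 "block L P n 0 = []"
| "block L P n (Suc h) = row L P n h 0 @ block L P n h"

primrec tower :: "(nat => lab) => (nat => nat => nat => nat => 'p) => nat => nat => 'p placed list" where
 "tower L Q n 0 = []"
| "tower L Q n (Suc t) = block L (Q t) n n @ tower L Q n t"

text \<open>The grid is seen rotated by 45 degrees. Its upper boundary, from left to right, is the
  north side followed by the east side; its lower boundary, in \<open>bot_end\<close>, is the west
  side followed by the south side.\<close>

definition top_end :: "nat => (nat => nat => nat => 'p) => nat => 'p" where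
 "top_end n P q = (if q < n then P 0 q 3 else P (q - n) (n - 1) 2)"

definition bot_end :: "nat => (nat => nat => nat => 'p) => nat => 'p" where
 "bot_end n P q = (if q < n then P q 0 0 else P (n - 1) (q - n) 1)"

definition inner_arcs :: "nat => (nat => nat => nat => 'p) => ('p \<times> 'p) set" where
 "inner_arcs n P = {(P h v 2, P h (Suc v) 0) | h v. h < n \<and> Suc v < n}
  \<union> {(P (Suc h) v 3, P h v 1) | h v. Suc h < n \<and> v < n}"

lemma row_Cons: "k < n ==> row L P n h k = (L (h + k), L (Suc (h + k)), P h k) # row L P n h (Suc k)"
 by (simp add: row_def upt_conv_Cons)

lemma row_Nil: "row L P n h n = []"
 by (simp add: row_def)

lemma nxt_row:
 assumes "inj L" "k \<le> n"
 shows "nxt (row L P n h k) c (L q) = (if k < n \<and> q = h + k then P h k 0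
  else if h + k < q \<and> q \<le> h + n then P h (q - h - 1) 1 else c (L q))"
 using assms(2)
proof (induction k rule: inc_induct)
 case (step k)
 note IH = step.IH
 consider "q = h + k" | "q = Suc (h + k)" | "q \<noteq> h + k" "q \<noteq> Suc (h + k)" by blast
 then show ?case
 proof cases
  case 3
  then have "L q \<noteq> L (h + k)" "L q \<noteq> L (Suc (h + k))" using assms(1) by (auto simp: inj_eq)
  then have "nxt (row L P n h k) c (L q) = nxt (row L P n h (Suc k)) c (L q)"
   by (simp add: row_Cons[OF step.hyps(2)])
  with 3 show ?thesis unfolding IH by auto
 qed (use step.hyps assms(1) in \<open>simp_all add: row_Cons inj_eq\<close>)
qed (auto simp: row_Nil)

lemma nxt_row_outside: "z \<notin> range L ==> nxt (row L P n h k) c z = c z"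
proof (induction "n - k" arbitrary: k)
 case (Suc m)
 then have "k < n" "nxt (row L P n h (Suc k)) c z = c z" by (auto intro: Suc.hyps)
 with Suc.prems show ?case by (auto simp: row_Cons)
qed (simp add: row_def)

lemma wires_row:
 assumes "inj L" "k \<le> n"
 shows "wires (row L P n h k) c = {(P h v 3, c (L (h + v))) | v. k \<le> v \<and> v < n}
  \<union> {(P h v 2, P h (Suc v) 0) | v. k \<le> v \<and> Suc v < n} \<union> {(P h v 2, c (L (h + n))) | v. k \<le> v \<and> Suc v = n}"
 using assms(2)
proof (induction k rule: inc_induct)
 case (step k)
 have A: "{(P h v 3, c (L (h + v))) | v. k \<le> v \<and> v < n} = insert (P h k 3, c (L (h + k))) {(P h v 3, c (L (h + v))) | v. Suc k \<le> v \<and> v < n}"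
  using step.hyps by (auto simp: Suc_le_eq le_less)
 have B: "{(P h v 2, P h (Suc v) 0) | v. k \<le> v \<and> Suc v < n} \<union> {(P h v 2, c (L (h + n))) | v. k \<le> v \<and> Suc v = n}
   = insert (P h k 2, if Suc k < n then P h (Suc k) 0 else c (L (h + n)))
    ({(P h v 2, P h (Suc v) 0) | v. Suc k \<le> v \<and> Suc v < n} \<union> {(P h v 2, c (L (h + n))) | v. Suc k \<le> v \<and> Suc v = n})"
  using step.hyps by (auto simp: Suc_le_eq le_less)
 have C: "nxt (row L P n h (Suc k)) c (L (h + k)) = c (L (h + k))"
  using nxt_row[OF assms(1), of "Suc k" n P h c "h + k"] step.hyps by simp
 have D: "nxt (row L P n h (Suc k)) c (L (Suc (h + k))) = (if Suc k < n then P h (Suc k) 0 else c (L (h + n)))"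
 proof (cases "Suc k < n")
  case True
  then show ?thesis using nxt_row[OF assms(1), of "Suc k" n P h c "Suc (h + k)"] by simp
 next
  case False
  then have "n = Suc k" using step.hyps by simp
  then show ?thesis by (simp add: row_Nil)
 qed
 have regroup: "{a, b} \<union> (X \<union> W) = insert a X \<union> insert b W" for a b :: "'a \<times> 'a" and X W by blast
 show ?case
  unfolding row_Cons[OF step.hyps(2)] wires.simps prod.case step.IH C D Un_assoc A B by (rule regroup)
qed (auto simp: row_Nil)

lemma nxt_block:
 assumes "inj L" "h > 0"
 shows "nxt (block L P n h) c (L q) = (if n = 0 then c (L q) else if q < h then P q 0 0
  else if q < h + n then P (h - 1) (q - h) 1 else c (L q))"
 using assms(2)
proof (induction h rule: nat_induct_non_zero)
 case 1
 then show ?case using nxt_row[OF assms(1), of 0 n P 0 c q] by (auto simp: Suc_le_eq)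
next
 case (Suc h)
 then show ?case
  using nxt_row[OF assms(1), of 0 n P h "nxt (block L P n h) c" q] by (auto simp: nxt_append)
qed

lemma nxt_block_outside: "z \<notin> range L ==> nxt (block L P n h) c z = c z"
 by (induction h) (simp_all add: nxt_append nxt_row_outside)

lemma wires_block:
 assumes "inj L"
 shows "wires (block L P n h) c = {(P 0 v 3, c (L v)) | v. v < n \<and> 0 < h}
  \<union> {(P i (n - 1) 2, c (L (i + n))) | i. i < h \<and> 0 < n}
  \<union> {(P i v 2, P i (Suc v) 0) | i v. i < h \<and> Suc v < n}
  \<union> {(P (Suc i) v 3, P i v 1) | i v. Suc i < h \<and> v < n}"
proof (induction h)
 case (Suc h)
 have regroup: "X \<union> S1 \<union> S4 = A \<union> D ==> B = R2 \<union> S2 ==> C = R3 \<union> S3 ==>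
  (X \<union> R3 \<union> R2) \<union> (S1 \<union> S2 \<union> S3 \<union> S4) = A \<union> B \<union> C \<union> D" for X S1 S2 S3 S4 A B C D R2 R3 :: "('a \<times> 'a) set"
  by blast
 let ?c = "nxt (block L P n h) c"
 have "?c (L (h + v)) = (if h = 0 then c (L v) else P (h - 1) v 1)" if "v < n" for v
  using that nxt_block[OF assms, of h P n c "h + v"] by (cases "h = 0") auto
 then have 1: "{(P h v 3, ?c (L (h + v))) | v. 0 \<le> v \<and> v < n} =
   {(P h v 3, if h = 0 then c (L v) else P (h - 1) v 1) | v. v < n}"
  by (intro Collect_cong ex_cong1) auto
 have 2: "?c (L (h + n)) = c (L (h + n))"
  using nxt_block[OF assms, of h P n c "h + n"] by (cases "h = 0") auto
 have 3: "{(P h v 2, c (L (h + n))) | v. 0 \<le> v \<and> Suc v = n} = {(P i (n - 1) 2, c (L (i + n))) | i. i = h \<and> 0 < n}"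
  by (auto intro!: exI[of _ "n - 1"])
 show ?case
  unfolding block.simps wires_append Suc.IH wires_row[OF assms le0] 1 2 3
 proof (rule regroup)
  show "{(P h v 3, if h = 0 then c (L v) else P (h - 1) v 1) | v. v < n} \<union> {(P 0 v 3, c (L v)) | v. v < n \<and> 0 < h}
    \<union> {(P (Suc i) v 3, P i v 1) | i v. Suc i < h \<and> v < n}
   = {(P 0 v 3, c (L v)) | v. v < n \<and> 0 < Suc h} \<union> {(P (Suc i) v 3, P i v 1) | i v. Suc i < Suc h \<and> v < n}"
   by (cases h) (auto simp: less_Suc_eq)
 qed (auto simp: less_Suc_eq)
qed simp

lemma nxt_full_block:
 assumes "inj L" "q < 2 * n"
 shows "nxt (block L P n n) c (L q) = bot_end n P q"
 using assms(2) nxt_block[OF assms(1), of n P n c q] by (auto simp: bot_end_def)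

lemma wires_full_block:
 assumes "inj L"
 shows "wires (block L P n n) c = {(top_end n P q, c (L q)) | q. q < 2 * n} \<union> inner_arcs n P"
proof -
 have "{(top_end n P q, c (L q)) | q. q < 2 * n} =
  {(P 0 v 3, c (L v)) | v. v < n \<and> 0 < n} \<union> {(P i (n - 1) 2, c (L (i + n))) | i. i < n \<and> 0 < n}" (is "?A = ?B \<union> ?C")
 proof
  show "?A \<subseteq> ?B \<union> ?C"
  proof
   fix e assume "e \<in> ?A"
   then obtain q where q: "q < 2 * n" "e = (top_end n P q, c (L q))" by auto
   show "e \<in> ?B \<union> ?C"
   proof (cases "q < n")
    case True
    with q show ?thesis by (auto simp: top_end_def)
   next
    case False
    then have "e = (P (q - n) (n - 1) 2, c (L ((q - n) + n)))" "q - n < n" "0 < n" using q by (auto simp: top_end_def)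
    then show ?thesis by blast
   qed
  qed
  show "?B \<union> ?C \<subseteq> ?A"
  proof
   fix e assume "e \<in> ?B \<union> ?C"
   then consider v where "v < n" "e = (P 0 v 3, c (L v))" | i where "i < n" "e = (P i (n - 1) 2, c (L (i + n)))" by blast
   then show "e \<in> ?A"
   proof cases
    case (1 v)
    then show ?thesis by (auto simp: top_end_def intro!: exI[of _ v])
   next
    case (2 i)
    then show ?thesis by (auto simp: top_end_def intro!: exI[of _ "i + n"])
   qed
  qed
 qed
 then show ?thesis
  unfolding wires_block[OF assms] inner_arcs_def by (simp add: Un_assoc)
qed

lemma nxt_tower:
 assumes "inj L" "q < 2 * n"
 shows "nxt (tower L Q n T) c (L q) = (if T = 0 then c (L q) else bot_end n (Q (T - 1)) q)"
 by (cases T) (simp_all add: nxt_append nxt_full_block assms)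

lemma nxt_tower_outside: "z \<notin> range L ==> nxt (tower L Q n T) c z = c z"
 by (induction T) (simp_all add: nxt_append nxt_block_outside)

lemma wires_tower:
 assumes "inj L"
 shows "wires (tower L Q n T) c = {(top_end n (Q 0) q, c (L q)) | q. q < 2 * n \<and> 0 < T}
  \<union> {(top_end n (Q (Suc t)) q, bot_end n (Q t) q) | t q. Suc t < T \<and> q < 2 * n} \<union> (\<Union>t<T. inner_arcs n (Q t))"
proof (induction T)
 case (Suc T)
 have 1: "{(top_end n (Q T) q, nxt (tower L Q n T) c (L q)) | q. q < 2 * n}
   = {(top_end n (Q T) q, if T = 0 then c (L q) else bot_end n (Q (T - 1)) q) | q. q < 2 * n}"
  using nxt_tower[OF assms, of _ n Q T c] by (intro Collect_cong ex_cong1) auto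
 have regroup: "X \<union> S1 \<union> S2 = A \<union> B ==> C = R \<union> S3 ==> (X \<union> R) \<union> (S1 \<union> S2 \<union> S3) = A \<union> B \<union> C"
  for X S1 S2 S3 A B C R :: "('a \<times> 'a) set"
  by blast
 show ?case
  unfolding tower.simps wires_append Suc.IH wires_full_block[OF assms] 1
 proof (rule regroup)
  show "{(top_end n (Q T) q, if T = 0 then c (L q) else bot_end n (Q (T - 1)) q) | q. q < 2 * n}
    \<union> {(top_end n (Q 0) q, c (L q)) | q. q < 2 * n \<and> 0 < T}
    \<union> {(top_end n (Q (Suc t)) q, bot_end n (Q t) q) | t q. Suc t < T \<and> q < 2 * n}
   = {(top_end n (Q 0) q, c (L q)) | q. q < 2 * n \<and> 0 < Suc T}
    \<union> {(top_end n (Q (Suc t)) q, bot_end n (Q t) q) | t q. Suc t < Suc T \<and> q < 2 * n}"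
   by (cases T) (auto simp: less_Suc_eq)
  show "(\<Union>t<Suc T. inner_arcs n (Q t)) = inner_arcs n (Q T) \<union> (\<Union>t<T. inner_arcs n (Q t))"
   by (simp add: lessThan_Suc)
 qed
qed simp

lemma strand_row_row: "placed_ops (row L P n h k) = strand_row (L (h + k)) (map (\<lambda>v. L (Suc (h + v))) [k..<n])"
proof (induction "n - k" arbitrary: k)
 case (Suc m)
 then have "k < n" "placed_ops (row L P n h (Suc k)) = strand_row (L (h + Suc k)) (map (\<lambda>v. L (Suc (h + v))) [Suc k..<n])" by auto
 then show ?case by (simp add: row_Cons placed_ops_def upt_conv_Cons)
qed (simp add: row_def placed_ops_def)

text \<open>The first \<open>h\<close> rows form a crossing of only \<open>h\<close> left strands,
  so their right-hand positions begin at \<open>h\<close>. At full height the positions split in the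
  middle and the bottom row belongs to the innermost strand, which \<open>cable\<close> also treats
  first.\<close>

lemma cable_block:
 "placed_ops (block L P n h) = cable (map (\<lambda>i. L (h - Suc i)) [0..<h]) (map (\<lambda>v. L (h + v)) [0..<n])"
proof (induction h)
 case (Suc h)
 have 1: "map (\<lambda>i. L (Suc h - Suc i)) [0..<Suc h] = L h # map (\<lambda>i. L (h - Suc i)) [0..<h]"
  by (subst upt_conv_Cons) (simp_all add: map_Suc_upt[symmetric] del: upt_Suc)
 have 2: "butlast (L h # map (\<lambda>v. L (Suc (h + v))) [0..<n]) = map (\<lambda>v. L (h + v)) [0..<n]"
  by (intro nth_equalityI) (auto simp: nth_butlast nth_Cons split: nat.splits)
 show ?case
  unfolding block.simps placed_ops_append strand_row_row Suc.IH 1 cable.simps 2[symmetric] by simp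
qed (simp add: placed_ops_def)

lemma placed_ops_tower: "placed_ops (tower L Q n T) = cable (map (\<lambda>i. L (n - Suc i)) [0..<n]) (map (\<lambda>v. L (n + v)) [0..<n]) ^ T"
 by (induction T) (simp_all add: placed_ops_append cable_block, simp add: placed_ops_def)

lemma skein_eval_seval: "distinct is ==> skein_eval (set is) B W = seval (map B is) W"
proof (induction "is" arbitrary: W)
 case Nil
 then show ?case by (simp add: skein_eval_def)
next
 case (Cons i js)
 let ?D = "\<lambda>i. {..<length (B i)}" and ?S = "set js"
 let ?h = "\<lambda>I W \<sigma>. (\<Prod>i\<in>I. fst (B i ! \<sigma> i)) * loop_val ^ nc (W \<union> (\<Union>i\<in>I. snd (B i ! \<sigma> i)))"
 have i: "i \<notin> ?S" using Cons.prems by simp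
 have "skein_eval (set (i # js)) B W = (\<Sum>\<sigma>\<in>PiE (insert i ?S) ?D. ?h (insert i ?S) W \<sigma>)"
  by (simp add: skein_eval_def)
 also have "... = (\<Sum>(j, \<sigma>)\<in>?D i \<times> PiE ?S ?D. ?h (insert i ?S) W (\<sigma>(i := j)))"
  unfolding PiE_insert_eq by (subst sum.reindex[OF inj_combinator[OF i]]) (simp add: split_def)
 also have "... = (\<Sum>j<length (B i). \<Sum>\<sigma>\<in>PiE ?S ?D. ?h (insert i ?S) W (\<sigma>(i := j)))"
  by (rule sum.cartesian_product[symmetric])
 also have "... = (\<Sum>j<length (B i). fst (B i ! j) * skein_eval ?S B (W \<union> snd (B i ! j)))"
 proof (rule sum.cong[OF refl])
  fix j
  have "?h (insert i ?S) W (\<sigma>(i := j)) = fst (B i ! j) * ?h ?S (W \<union> snd (B i ! j)) \<sigma>" for \<sigma>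
  proof -
   have "(\<Prod>k\<in>?S. fst (B k ! (\<sigma>(i := j)) k)) = (\<Prod>k\<in>?S. fst (B k ! \<sigma> k))"
    using i by (intro prod.cong) auto
   moreover have "(\<Union>k\<in>?S. snd (B k ! (\<sigma>(i := j)) k)) = (\<Union>k\<in>?S. snd (B k ! \<sigma> k))"
    using i by (intro SUP_cong) auto
   ultimately show ?thesis
    using i by (simp only: UN_insert prod.insert[OF finite_set i] fun_upd_same Un_assoc mult.assoc)
  qed
  then show "(\<Sum>\<sigma>\<in>PiE ?S ?D. ?h (insert i ?S) W (\<sigma>(i := j))) = fst (B i ! j) * skein_eval ?S B (W \<union> snd (B i ! j))"
   by (simp only: skein_eval_def sum_distrib_left)
 qed
 also have "... = (\<Sum>j<length (B i). fst (B i ! j) * seval (map B js) (W \<union> snd (B i ! j)))"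
  using Cons by simp
 also have "... = seval (map B (i # js)) W"
  by (simp add: sum_list_sum_nth atLeast0LessThan split_def)
 finally show ?case .
qed

section \<open>The Jones--Wenzl idempotent as an operator\<close>

text \<open>Identities between networks hold only for states under which \<open>V\<close> is closed,
  whereas operators act on functionals of all states. Locality permits such identities to be used
  under an operator.\<close>

definition local_op :: "lab set => op => bool" where
 "local_op V T \<longleftrightarrow> (\<forall>F G. (\<forall>s. closed_state V s \<longrightarrow> F s = G s) \<longrightarrow> (\<forall>s. closed_state V s \<longrightarrow> ap T F s = ap T G s))"

lemma local_opD: "local_op V T ==> \<forall>s. closed_state V s \<longrightarrow> F s = G s ==> closed_state V s ==> ap T F s = ap T G s"
 unfolding local_op_def by blast

lemma local_op_1: "local_op V 1"
 by (simp add: local_op_def)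

lemma local_op_E: "x \<in> V ==> y \<in> V ==> local_op V (E x y)"
 by (simp add: local_op_def closed_cup)

lemma local_op_mult: "local_op V S ==> local_op V T ==> local_op V (S * T)"
 by (simp add: local_op_def)

lemma local_op_add:
 assumes "local_op V S" "local_op V T"
 shows "local_op V (S + T)"
 unfolding local_op_def
proof (intro allI impI)
 fix F G :: "state => lser" and s assume e: "\<forall>s. closed_state V s \<longrightarrow> F s = G s" and s: "closed_state V s"
 from local_opD[OF assms(1) e s] local_opD[OF assms(2) e s] show "ap (S + T) F s = ap (S + T) G s" by simp
qed

lemma local_op_sc: "local_op V (sc c)"
 by (simp add: local_op_def)

lemma local_placed_ops: "list_all (proper V) bs ==> local_op V (placed_ops bs)"
proof (induction bs)
 case (Cons b bs)
 obtain x y p where b: "b = (x, y, p)" by (cases b) auto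
 show ?case
  using Cons by (auto simp: placed_ops_def b crossing_def intro!: local_op_mult local_op_add local_op_sc local_op_E)
qed (simp add: placed_ops_def local_op_1)

lemma ap_sum_list: "ap T (\<lambda>s. \<Sum>x\<leftarrow>xs. k x * F x s) s = (\<Sum>x\<leftarrow>xs. k x * ap T (F x) s)"
proof (induction xs)
 case Nil
 then show ?case using ap_scale[of T 0 "\<lambda>s. 0"] by simp
next
 case (Cons x xs)
 then show ?case
  using ap_add[of T "\<lambda>s. k x * F x s" "\<lambda>s. \<Sum>x\<leftarrow>xs. k x * F x s"] by (simp add: ap_scale)
qed

lemma sum_list_swap: "(\<Sum>x\<leftarrow>xs. \<Sum>y\<leftarrow>ys. f x y) = (\<Sum>y\<leftarrow>ys. \<Sum>x\<leftarrow>xs. f x y :: 'a :: comm_monoid_add)"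
 by (induction xs) (simp_all add: sum_list_addf)

lemma st_extend_set:
 assumes s: "closed_state V s" and J: "finite J" "J \<subseteq> V" and c: "inj_on c V" and c': "inj_on c' V"
  and out: "\<And>z. z \<in> V - J ==> c' z = c z" and fresh: "\<And>z. z \<in> J ==> c' z \<notin> c ` V \<and> c z \<notin> Field H"
 shows "nc (st V c s \<union> (\<lambda>z. (c z, c' z)) ` J \<union> H) = nc (st V c' s \<union> H)"
 using J c out fresh
proof (induction J arbitrary: c rule: finite_induct)
 case empty
 then have "st V c s = st V c' s"
  using s unfolding st_def by (intro image_cong) (auto simp: closed_state_def)
 then show ?case by simp
next
 case (insert z J)
 let ?c = "c(z := c' z)"
 have z: "z \<in> V" using insert.prems by auto
 have arcs: "(\<lambda>z. (c z, c' z)) ` J = (\<lambda>z. (?c z, c' z)) ` J" using insert.hyps by (intro image_cong) auto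
 have "nc (st V c s \<union> (\<lambda>z. (c z, c' z)) ` insert z J \<union> H)
   = nc (st V c s \<union> {(c z, c' z)} \<union> ((\<lambda>z. (c z, c' z)) ` J \<union> H))"
  by (simp add: Un_ac)
 also have "... = nc (st V ?c s \<union> ((\<lambda>z. (c z, c' z)) ` J \<union> H))"
 proof (rule st_extend[OF s insert.prems(2) z])
  show "c' z \<notin> c ` V" using insert.prems(4) by blast
  have "c z \<noteq> c w" if "w \<in> J" for w
   using that insert.hyps insert.prems(1,2) z by (auto dest: inj_onD)
  moreover have "c z \<noteq> c' w" if "w \<in> J" for w
   using that insert.prems(4)[of w] imageI[OF z, of c] by auto
  ultimately show "c z \<notin> Field ((\<lambda>z. (c z, c' z)) ` J \<union> H)"
   using insert.prems(4)[of z] by (auto simp: Field_Un) (auto simp: Field_def)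
 qed
 also have "... = nc (st V ?c s \<union> (\<lambda>z. (?c z, c' z)) ` J \<union> H)"
  unfolding arcs by (simp add: Un_ac)
 also have "... = nc (st V c' s \<union> H)"
 proof (rule insert.IH)
  show "J \<subseteq> V" using insert.prems by auto
  show "inj_on ?c V" using insert.prems(2,4) by (intro inj_on_fun_updI) auto
  show "c' w = ?c w" if "w \<in> V - J" for w using that insert.prems(3) by (cases "w = z") auto
  show "c' w \<notin> ?c ` V \<and> ?c w \<notin> Field H" if "w \<in> J" for w
  proof -
   have "w \<noteq> z" "w \<in> V" using that insert.hyps insert.prems(1) by auto
   then show ?thesis
    using that insert.prems(4)[of w] z inj_onD[OF c', of w z] by auto
  qed
 qed
 finally show ?case .
qed

definition strand_pts :: "nat => tlpos set" where
 "strand_pts m = Bot ` {..<m} \<union> Top ` {..<m}"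

text \<open>The network of the state \<open>s\<close>, with points \<open>c\<close>, can be continued by an element of the
 Temperley-Lieb algebra with points \<open>e\<close> on the strands \<open>x\<close>; afterwards the points are \<open>c'\<close>.\<close>
definition attachable :: "(nat => lab) => nat => lab set => state => (lab => 'p) => (lab => 'p) => (tlpos => 'p)
  => ('p \<times> 'p) set => bool" where
 "attachable x m V s c c' e H \<longleftrightarrow> finite V \<and> closed_state V s \<and> inj_on c V \<and> x ` {..<m} \<subseteq> V \<and>
  (\<forall>j<m. c (x j) = e (Bot j) \<and> c' (x j) = e (Top j)) \<and> (\<forall>z\<in>V - x ` {..<m}. c' z = c z) \<and>
  inj_on e (strand_pts m) \<and> (\<forall>j<m. e (Top j) \<notin> c ` V \<and> e (Bot j) \<notin> Field H \<and> e (Top j) \<in> Field H) \<and> finite H"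

lemma attachableD:
 assumes "attachable x m V s c c' e H"
 shows "finite V" "closed_state V s" "inj_on c V" "x ` {..<m} \<subseteq> V" "inj_on e (strand_pts m)" "finite H"
  "\<And>j. j < m ==> c (x j) = e (Bot j)" "\<And>j. j < m ==> c' (x j) = e (Top j)" "\<And>z. z \<in> V - x ` {..<m} ==> c' z = c z"
  "\<And>j. j < m ==> e (Top j) \<notin> c ` V" "\<And>j. j < m ==> e (Bot j) \<notin> Field H" "\<And>j. j < m ==> e (Top j) \<in> Field H"
 using assms by (auto simp: attachable_def)

type_synonym pt = "(nat \<times> nat) cpt"

text \<open>Inserted into any network, the list of matchings \<open>t\<close> acts as
  \<open>T\<close>. The point type is fixed because a predicate cannot quantify over types; it is
  infinite, which provides fresh points for compositions.\<close>

definition represents :: "(nat => lab) => nat => tl => op => bool" where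
 "represents x m t T \<longleftrightarrow> (\<forall>(a, M)\<in>set t. Field M \<subseteq> strand_pts m) \<and> (\<forall>V. x ` {..<m} \<subseteq> V \<longrightarrow> local_op V T) \<and>
  (\<forall>V s c c' (e :: tlpos => pt) H. attachable x m V s c c' e H \<longrightarrow>
   (\<Sum>(a, M)\<leftarrow>t. a * loop_val ^ nc (st V c s \<union> map_prod e e ` M \<union> H))
   = ap T (\<lambda>s. loop_val ^ nc (st V c' s \<union> H)) s)"

lemma representsD:
 "represents x m t T ==> attachable x m V s c c' (e :: tlpos => pt) H ==>
  (\<Sum>(a, M)\<leftarrow>t. a * loop_val ^ nc (st V c s \<union> map_prod e e ` M \<union> H))
   = ap T (\<lambda>s. loop_val ^ nc (st V c' s \<union> H)) s"
 unfolding represents_def by blast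

lemma strand_pts_simps [simp]: "Bot j \<in> strand_pts m \<longleftrightarrow> j < m" "Top j \<in> strand_pts m \<longleftrightarrow> j < m"
 by (auto simp: strand_pts_def)

lemma finite_strand_pts: "finite (strand_pts m)"
 by (simp add: strand_pts_def)

lemma attachable_inj:
 assumes "attachable x m V s c c' e H"
 shows "inj_on c' V"
proof -
 have out: "e (Top j) \<noteq> c z" if "j < m" "z \<in> V" for j z
  using assms that by (auto simp: attachable_def)
 have top: "e (Top j) = e (Top k) \<longleftrightarrow> j = k" if "j < m" "k < m" for j k
  using assms that by (auto simp: attachable_def inj_on_eq_iff)
 have *: "(\<exists>j<m. z = x j \<and> c' z = e (Top j)) \<or> c' z = c z" if "z \<in> V" for z
  using assms that by (cases "z \<in> x ` {..<m}") (auto simp: attachable_def)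
 have inj: "inj_on c V" using assms by (simp add: attachable_def)
 show ?thesis
 proof (rule inj_onI)
  fix y z assume yz: "y \<in> V" "z \<in> V" "c' y = c' z"
  show "y = z"
   using *[OF yz(1)] *[OF yz(2)]
  proof (elim disjE exE conjE)
   assume "c' y = c y" "c' z = c z"
   then show ?thesis using yz inj by (auto dest: inj_onD)
  next
   fix j k assume "j < m" "y = x j" "c' y = e (Top j)" "k < m" "z = x k" "c' z = e (Top k)"
   then show ?thesis using yz(3) top[of j k] by simp
  qed (use out yz in metis)+
 qed
qed

lemma represents_id:
 shows "represents x m (tl_id m) 1"
proof -
 have F: "Field {(Bot i, Top i) | i. i < m} \<subseteq> strand_pts m" by (auto simp: Field_def)
 have "nc (st V c s \<union> map_prod e e ` {(Bot i, Top i) | i. i < m} \<union> H) = nc (st V c' s \<union> H)"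
  if a: "attachable x m V s c c' e H" for V s c c' and e :: "tlpos => pt" and H
 proof -
  have "map_prod e e ` {(Bot i, Top i) | i. i < m} = (\<lambda>z. (c z, c' z)) ` x ` {..<m}"
  proof -
   have "map_prod e e ` {(Bot i, Top i) | i. i < m} = (\<lambda>j. (e (Bot j), e (Top j))) ` {..<m}"
    by (auto simp: image_iff)
   also have "... = (\<lambda>j. (c (x j), c' (x j))) ` {..<m}"
    by (rule image_cong) (use a in \<open>auto simp: attachable_def\<close>)
   finally show ?thesis by (simp only: image_image)
  qed
  moreover have "nc (st V c s \<union> (\<lambda>z. (c z, c' z)) ` x ` {..<m} \<union> H) = nc (st V c' s \<union> H)"
   by (rule st_extend_set[OF _ _ _ _ attachable_inj[OF a]]) (use a in \<open>auto simp: attachable_def\<close>)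
  ultimately show ?thesis by simp
 qed
 then show ?thesis
  using F by (auto simp: represents_def tl_id_def local_op_1)
qed

lemma represents_E:
 assumes x: "inj x" and i: "Suc i < m"
 shows "represents x m (tl_e m i) (E (x i) (x (Suc i)))"
proof -
 let ?M = "{(Bot i, Bot (Suc i)), (Top i, Top (Suc i))} \<union> {(Bot j, Top j) | j. j < m \<and> j \<noteq> i \<and> j \<noteq> Suc i}"
 have F: "Field ?M \<subseteq> strand_pts m" using i by (auto simp: Field_def)
 have "nc (st V c s \<union> map_prod e e ` ?M \<union> H) = (if partner s (x i) = x (Suc i) then 1 else 0)
   + nc (st V c' (cup (x i) (x (Suc i)) s) \<union> H)"
  if a: "attachable x m V s c c' e H" for V s c c' and e :: "tlpos => pt" and H
 proof -
  let ?J = "x ` ({..<m} - {i, Suc i})"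
  let ?A = "(\<lambda>z. (c z, c' z)) ` ?J"
  let ?c = "c(x i := e (Top i), x (Suc i) := e (Top (Suc i)))"
  note aD = attachableD[OF a]
  have eq: "e p = e q \<longleftrightarrow> p = q" if "p \<in> strand_pts m" "q \<in> strand_pts m" for p q
   using inj_on_eq_iff[OF aD(5) that] .
  have xV: "x i \<in> V" "x (Suc i) \<in> V" "x i \<noteq> x (Suc i)" using i aD(4) x by (auto simp: inj_eq)
  have A: "?A = {(e (Bot j), e (Top j)) | j. j < m \<and> j \<noteq> i \<and> j \<noteq> Suc i}"
   using aD(7,8) by (force simp: image_iff)
  have FA: "p \<in> Field ?A ==> \<exists>j<m. j \<noteq> i \<and> j \<noteq> Suc i \<and> (p = e (Bot j) \<or> p = e (Top j))" for p
   unfolding A by (auto simp: Field_def)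
  have "nc (st V c s \<union> map_prod e e ` ?M \<union> H)
    = nc (st V c s \<union> {(c (x i), c (x (Suc i))), (e (Top (Suc i)), e (Top i))} \<union> (?A \<union> H))"
  proof (rule n_components_sym)
   have M: "map_prod e e ` ?M = {(e (Bot i), e (Bot (Suc i))), (e (Top i), e (Top (Suc i)))} \<union> ?A"
    unfolding A by (auto simp: image_Un)
   show "st V c s \<union> map_prod e e ` ?M \<union> H \<union> (st V c s \<union> map_prod e e ` ?M \<union> H)\<inverse>
    = st V c s \<union> {(c (x i), c (x (Suc i))), (e (Top (Suc i)), e (Top i))} \<union> (?A \<union> H)
     \<union> (st V c s \<union> {(c (x i), c (x (Suc i))), (e (Top (Suc i)), e (Top i))} \<union> (?A \<union> H))\<inverse>"
    unfolding M converse_Un using i aD(7) by auto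
  qed
  also have "... = (if partner s (x i) = x (Suc i) then 1 else 0)
    + nc (st V ?c (cup (x i) (x (Suc i)) s) \<union> (?A \<union> H))"
  proof (rule st_cap[OF aD(2,3) xV])
   have "e (Bot j) \<notin> Field ?A" if j: "j \<in> {i, Suc i}" for j
   proof
    assume "e (Bot j) \<in> Field ?A"
    then obtain k where "k < m" "k \<noteq> i" "k \<noteq> Suc i" "e (Bot j) = e (Bot k) \<or> e (Bot j) = e (Top k)"
     using FA by blast
    then show False using i j by (auto simp: eq)
   qed
   then show "c (x i) \<notin> Field (?A \<union> H)" "c (x (Suc i)) \<notin> Field (?A \<union> H)"
    using aD(7,11) i by (auto simp: Field_Un)
  qed (use i aD in \<open>auto simp: eq\<close>)
  also have "st V ?c (cup (x i) (x (Suc i)) s) \<union> (?A \<union> H) = st V ?c (cup (x i) (x (Suc i)) s) \<union> (\<lambda>z. (?c z, c' z)) ` ?J \<union> H"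
   using x by (auto simp: inj_eq image_iff)
  also have "nc ... = nc (st V c' (cup (x i) (x (Suc i)) s) \<union> H)"
  proof (rule st_extend_set)
   show "closed_state V (cup (x i) (x (Suc i)) s)" by (rule closed_cup[OF aD(2) xV(1,2)])
   show "finite ?J" "?J \<subseteq> V" using aD(4) by auto
   show "inj_on ?c V" using aD i by (intro inj_on_upd2) (auto simp: eq)
   show "inj_on c' V" by (rule attachable_inj[OF a])
   show "c' z = ?c z" if "z \<in> V - ?J" for z
    using that aD(8,9) i by (cases "z \<in> x ` {..<m}") auto
   show "c' z \<notin> ?c ` V \<and> ?c z \<notin> Field H" if z: "z \<in> ?J" for z
   proof -
    obtain j where j: "z = x j" "j < m" "j \<noteq> i" "j \<noteq> Suc i" using z by auto
    then have "e (Top j) \<noteq> e (Top i)" "e (Top j) \<noteq> e (Top (Suc i))" using i by (auto simp: eq)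
    then show ?thesis using j x aD(7,8,10,11) by (auto simp: inj_eq)
   qed
  qed
  finally show ?thesis .
 qed
 then show ?thesis
  using F i unfolding represents_def tl_e_def by (auto intro!: local_op_E simp: power_add)
qed

text \<open>The added vertical strand merely moves the end of strand \<open>m\<close>, as in
  \<open>st_extend\<close>; the smaller element is then attached to the rest.\<close>

lemma represents_tensor1:
 assumes x: "inj x" and r: "represents x m t T"
 shows "represents x (Suc m) (tl_tensor1 m t) T"
 unfolding represents_def
proof (intro conjI allI impI)
 have wf: "Field M \<subseteq> strand_pts m" if "(a, M) \<in> set t" for a M using r that by (auto simp: represents_def)
 show "\<forall>(a, M)\<in>set (tl_tensor1 m t). Field M \<subseteq> strand_pts (Suc m)"
  using wf by (fastforce simp: tl_tensor1_def Field_insert strand_pts_def)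
 show "local_op V T" if "x ` {..<Suc m} \<subseteq> V" for V
  using r that by (auto simp: represents_def lessThan_Suc)
 fix V s c c' and e :: "tlpos => pt" and H assume a: "attachable x (Suc m) V s c c' e H"
 let ?c = "c(x m := e (Top m))"
 note aD = attachableD[OF a]
 have eq: "e p = e q \<longleftrightarrow> p = q" if "p \<in> strand_pts (Suc m)" "q \<in> strand_pts (Suc m)" for p q
  using inj_on_eq_iff[OF aD(5) that] .
 have sub: "strand_pts m \<subseteq> strand_pts (Suc m)" by (auto simp: strand_pts_def)
 have step: "nc (st V c s \<union> map_prod e e ` insert (Bot m, Top m) M \<union> H)
   = nc (st V ?c s \<union> map_prod e e ` M \<union> H)" if M: "Field M \<subseteq> strand_pts m" for M
 proof -
  have "e (Bot m) \<notin> Field (map_prod e e ` M)"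
  proof
   assume "e (Bot m) \<in> Field (map_prod e e ` M)"
   then obtain p where "p \<in> Field M" "e (Bot m) = e p" by (auto simp: Field_def)
   with M sub show False by (subst (asm) eq) auto
  qed
  then show ?thesis
   using st_extend[OF aD(2,3), of "x m" "e (Top m)" "map_prod e e ` M \<union> H"] aD(4,7,10,11)
   by (simp add: Field_Un insert_commute lessThan_Suc Un_assoc)
 qed
 have at: "attachable x m V s ?c c' e H"
  unfolding attachable_def
 proof (intro conjI allI impI ballI)
  show "inj_on ?c V" using aD(3) aD(10)[of m] by (intro inj_on_fun_updI) auto
  show "inj_on e (strand_pts m)" by (rule inj_on_subset[OF aD(5) sub])
  show "e (Top j) \<notin> ?c ` V" if "j < m" for j
   using that aD(10)[of j] by (auto simp: eq)
  show "c' z = ?c z" if "z \<in> V - x ` {..<m}" for z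
   using that aD(8,9) by (cases "z = x m") (auto simp: lessThan_Suc)
 qed (use aD x in \<open>auto simp: inj_eq\<close>)
 have "(\<Sum>(a, M)\<leftarrow>tl_tensor1 m t. a * loop_val ^ nc (st V c s \<union> map_prod e e ` M \<union> H))
   = (\<Sum>(a, M)\<leftarrow>t. a * loop_val ^ nc (st V ?c s \<union> map_prod e e ` M \<union> H))"
  unfolding tl_tensor1_def map_map
 proof (intro arg_cong[where f = sum_list] map_cong refl)
  fix b assume b: "b \<in> set t"
  obtain a M where "b = (a, M)" by (cases b)
  then show "((\<lambda>(a, M). a * loop_val ^ nc (st V c s \<union> map_prod e e ` M \<union> H)) \<circ> (\<lambda>(c, M). (c, insert (Bot m, Top m) M))) b
   = (case b of (a, M) => a * loop_val ^ nc (st V ?c s \<union> map_prod e e ` M \<union> H))"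
   using b step[OF wf] by simp
 qed
 also have "... = ap T (\<lambda>s. loop_val ^ nc (st V c' s \<union> H)) s"
  by (rule representsD[OF r at])
 finally show "(\<Sum>(a, M)\<leftarrow>tl_tensor1 m t. a * loop_val ^ nc (st V c s \<union> map_prod e e ` M \<union> H))
   = ap T (\<lambda>s. loop_val ^ nc (st V c' s \<union> H)) s" .
qed

lemma represents_smult: "represents x m t T ==> represents x m (tl_smult k t) (sc k * T)"
proof -
 assume r: "represents x m t T"
 have "(\<Sum>(a, M)\<leftarrow>tl_smult k t. a * f M) = k * (\<Sum>(a, M)\<leftarrow>t. a * f M)" for f :: "(tlpos \<times> tlpos) set => lser"
  unfolding tl_smult_def map_map sum_list_const_mult[symmetric]
  by (intro arg_cong[where f = sum_list] map_cong refl) auto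
 then show ?thesis
  using r unfolding represents_def by (auto simp: tl_smult_def intro!: local_op_mult local_op_sc)
qed

lemma represents_minus: "represents x m t T ==> represents x m t' T' ==> represents x m (tl_minus t t') (T - T')"
proof -
 assume r: "represents x m t T" and "represents x m t' T'"
 then have r': "represents x m (tl_smult (-1) t') (sc (-1) * T')" by (intro represents_smult)
 have "sc (-1) * T' = - T'" by (rule op_eqI) simp
 then have "represents x m (tl_smult (-1) t') (- T')" using r' by simp
 with r show ?thesis
  unfolding represents_def tl_minus_def
  by (auto simp: local_op_add[of _ T "- T'", simplified])
qed

section \<open>Transport of matchings and loops along injections\<close>

lemma conn_image:
 assumes "inj_on e S" "Field G \<subseteq> S" "x \<in> S" "y \<in> S"
 shows "(e x, e y) \<in> conn (map_prod e e ` G) \<longleftrightarrow> (x, y) \<in> conn G"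
proof
 let ?g = "inv_into S e"
 assume "(e x, e y) \<in> conn (map_prod e e ` G)"
 then have "(?g (e x), ?g (e y)) \<in> conn G"
 proof (rule conn_map[rotated])
  fix p q assume "(p, q) \<in> map_prod e e ` G"
  then obtain a b where ab: "(a, b) \<in> G" "p = e a" "q = e b" by auto
  moreover have "a \<in> S" "b \<in> S" using ab(1) assms(2) by (auto simp: Field_def)
  ultimately show "(?g p, ?g q) \<in> conn G" using assms(1) by (auto intro: conn_edge(1))
 qed
 then show "(x, y) \<in> conn G" using assms by simp
next
 assume "(x, y) \<in> conn G"
 then show "(e x, e y) \<in> conn (map_prod e e ` G)"
 proof (rule conn_map[rotated])
  fix a b assume "(a, b) \<in> G"
  from imageI[OF this, of "map_prod e e"] show "(e a, e b) \<in> conn (map_prod e e ` G)"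
   using conn_edge(1)[of "e a" "e b" "map_prod e e ` G"] by simp
 qed
qed

lemma Field_image: "Field (map_prod e e ` G) = e ` Field G"
 by (auto simp: Field_def Domain_fst Range_snd image_image image_Un)

lemma match_image:
 assumes e: "inj_on e S" "Field G \<subseteq> S" and B: "B \<subseteq> S"
 shows "match (map_prod e e ` G) (e ` B) = map_prod e e ` match G B"
proof -
 have "x \<in> B ==> y \<in> B ==> (e x, e y) \<in> match (map_prod e e ` G) (e ` B) \<longleftrightarrow> (x, y) \<in> match G B" for x y
  using conn_image[OF e, of x y] B inj_on_eq_iff[OF e(1), of x y] by (auto simp: match_def)
 then show ?thesis
  by (auto simp: match_def image_iff)
qed

lemma loops_image:
 assumes e: "inj_on e S" "Field G \<subseteq> S" and B: "B \<subseteq> S"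
 shows "loops (map_prod e e ` G) (e ` B) = loops G B"
proof -
 let ?C = "{conn G `` {x} | x. x \<in> Field G \<and> conn G `` {x} \<inter> B = {}}"
 have cls: "conn (map_prod e e ` G) `` {e x} = e ` (conn G `` {x})" "conn G `` {x} \<subseteq> S" if x: "x \<in> Field G" for x
 proof -
  have S: "y \<in> S" if "(x, y) \<in> conn G" for y using conn_Field[OF that] x e(2) by (cases "x = y") auto
  then show "conn G `` {x} \<subseteq> S" by auto
  show "conn (map_prod e e ` G) `` {e x} = e ` (conn G `` {x})"
  proof
   show "e ` (conn G `` {x}) \<subseteq> conn (map_prod e e ` G) `` {e x}"
    using conn_image[OF e] S x e(2) by auto
   show "conn (map_prod e e ` G) `` {e x} \<subseteq> e ` (conn G `` {x})"
   proof
    fix p assume "p \<in> conn (map_prod e e ` G) `` {e x}"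
    then have p: "(e x, p) \<in> conn (map_prod e e ` G)" by simp
    then have "p \<in> e ` Field G"
     using conn_Field[OF p] x by (cases "p = e x") (auto simp: Field_image)
    then obtain y where "y \<in> Field G" "p = e y" by auto
    then show "p \<in> e ` (conn G `` {x})"
     using p conn_image[OF e, of x y] x e(2) by auto
   qed
  qed
 qed
 have disj: "e ` (conn G `` {x}) \<inter> e ` B = {} \<longleftrightarrow> conn G `` {x} \<inter> B = {}" if "x \<in> Field G" for x
  using cls(2)[OF that] B e(1) by (auto dest: inj_onD)
 have "{conn (map_prod e e ` G) `` {p} | p. p \<in> Field (map_prod e e ` G) \<and> conn (map_prod e e ` G) `` {p} \<inter> e ` B = {}}
   = {conn (map_prod e e ` G) `` {e x} | x. x \<in> Field G \<and> conn (map_prod e e ` G) `` {e x} \<inter> e ` B = {}}"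
  unfolding Field_image by blast
 also have "... = {e ` (conn G `` {x}) | x. x \<in> Field G \<and> conn G `` {x} \<inter> B = {}}"
 proof (intro Collect_cong ex_cong1)
  fix p x
  show "(p = conn (map_prod e e ` G) `` {e x} \<and> x \<in> Field G \<and> conn (map_prod e e ` G) `` {e x} \<inter> e ` B = {})
   \<longleftrightarrow> (p = e ` (conn G `` {x}) \<and> x \<in> Field G \<and> conn G `` {x} \<inter> B = {})"
  proof (cases "x \<in> Field G")
   case True
   show ?thesis unfolding cls(1)[OF True] disj[OF True] by simp
  qed simp
 qed
 also have "... = (`) e ` ?C" by blast
 finally have "loops (map_prod e e ` G) (e ` B) = card ((`) e ` ?C)" by (simp only: loops_def)
 also have "... = card ?C"
 proof (rule card_image, rule inj_on_subset[OF inj_on_image_Pow[OF e(1)]])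
  show "?C \<subseteq> Pow S" using cls(2) by auto
 qed
 finally show ?thesis by (simp only: loops_def)
qed

lemma stack_match_match: "stack_match n M N = map_prod snd snd ` match (stack_graph n M N) (stack_boundary n)"
proof -
 have "{(snd x, snd y) | x y. P x y} = map_prod snd snd ` {(x, y). P x y}" for P :: "bool \<times> tlpos => bool \<times> tlpos => bool"
  by force
 then show ?thesis unfolding stack_match_def match_def conn_def Let_def .
qed

lemma stack_loops_loops: "stack_loops n M N = loops (stack_graph n M N) (stack_boundary n)"
 by (simp add: stack_loops_def loops_def Let_def conn_def)

lemma Field_stack_graph:
 assumes "Field M \<subseteq> strand_pts n" "Field N \<subseteq> strand_pts n"
 shows "Field (stack_graph n M N) \<subseteq> UNIV \<times> strand_pts n"
proof -
 have "p \<in> strand_pts n \<and> q \<in> strand_pts n" if "(p, q) \<in> M \<union> N" for p q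
  using that assms by (auto simp: Field_def)
 then show ?thesis by (auto simp: stack_graph_def Field_def)
qed

lemma Field_finite: "Field M \<subseteq> strand_pts n ==> finite M"
 by (rule finite_subset[of _ "strand_pts n \<times> strand_pts n"]) (auto simp: Field_def finite_strand_pts)

lemma infinite_compl_pt: "infinite (UNIV :: 'a set) ==> finite A ==> infinite (- A :: 'a set)"
 by (metis Diff_infinite_finite Compl_eq_Diff_UNIV)

lemma infinite_pt: "infinite (UNIV :: pt set)"
proof
 assume "finite (UNIV :: pt set)"
 from finite_imageD[OF finite_subset[OF subset_UNIV this], of "\<lambda>h. Grid (0, 0) h 0 0" UNIV]
 show False by (auto simp: inj_on_def)
qed

text \<open>The intermediate points \<open>f\<close>, \<open>g\<close> of the stacking have to be chosen away from the rest of the network.\<close>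
lemma represents_comp:
 assumes x: "inj x" and r1: "represents x m t1 T1" and r2: "represents x m t2 T2"
 shows "represents x m (tl_comp m t1 t2) (T1 * T2)"
 unfolding represents_def
proof (intro conjI allI impI)
 have wf: "Field M \<subseteq> strand_pts m" if "(a, M) \<in> set t1 \<union> set t2" for a M
  using r1 r2 that by (auto simp: represents_def)
 have "Field (stack_match m M N) \<subseteq> strand_pts m" for M N
  by (auto simp: stack_match_match match_def Field_def stack_boundary_def)
 then show "\<forall>(a, M)\<in>set (tl_comp m t1 t2). Field M \<subseteq> strand_pts m"
  by (auto simp: tl_comp_def)
 show "local_op V (T1 * T2)" if "x ` {..<m} \<subseteq> V" for V
  using r1 r2 that by (auto simp: represents_def intro!: local_op_mult)
 fix V s c c' and e :: "tlpos => pt" and H assume a: "attachable x m V s c c' e H"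
 note aD = attachableD[OF a]
 let ?A = "c ` V \<union> e ` strand_pts m \<union> Field H"
 have "infinite (- ?A)"
  using infinite_pt aD(1,6) by (intro infinite_compl_pt) (auto simp: finite_strand_pts finite_Field)
 then obtain h :: "nat => pt" where h: "inj h" "range h \<subseteq> - ?A"
  using infinite_countable_subset by blast
 have hA: "h i \<notin> c ` V" "h i \<notin> e ` strand_pts m" "h i \<notin> Field H" for i using h(2) rangeI[of h i] by blast+
 \<comment> \<open>The even and the odd members of one injective sequence are the upper points of
   the first factor and the lower points of the second.\<close>
 let ?f = "\<lambda>i. h (2 * i)" and ?g = "\<lambda>i. h (2 * i + 1)"
 define E1 where "E1 p = (case p of Bot j => e (Bot j) | Top j => ?f j)" for p
 define E2 where "E2 p = (case p of Bot j => ?g j | Top j => e (Top j))" for p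
 define E' where "E' p = (if fst p then E2 (snd p) else E1 (snd p))" for p
 let ?i = "inv_into {..<m} x"
 have inv: "j < m ==> ?i (x j) = j" for j using x by (auto simp: inv_into_f_f inj_on_def)
 define cf where "cf z = (if z \<in> x ` {..<m} then ?f (?i z) else c z)" for z
 define cg where "cg z = (if z \<in> x ` {..<m} then ?g (?i z) else c z)" for z
 have cfx: "j < m ==> cf (x j) = ?f j" and cgx: "j < m ==> cg (x j) = ?g j" for j
  by (auto simp: cf_def cg_def inv)
 have cfg: "z \<notin> x ` {..<m} ==> cf z = c z" "z \<notin> x ` {..<m} ==> cg z = c z" for z by (auto simp: cf_def cg_def)
 have hi: "h i = h j \<longleftrightarrow> i = j" for i j using h(1) by (simp add: inj_eq)
 have odd: "2 * i \<noteq> Suc (2 * j)" "Suc (2 * j) \<noteq> 2 * i" for i j :: nat by presburger+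
 have ee: "e p = e q \<longleftrightarrow> p = q" if "p \<in> strand_pts m" "q \<in> strand_pts m" for p q
  using inj_on_eq_iff[OF aD(5) that] .
 have he: "h i \<noteq> e p" "e p \<noteq> h i" if "p \<in> strand_pts m" for i p using hA(2)[of i] imageI[OF that, of e] by metis+
 have injE': "inj_on E' (UNIV \<times> strand_pts m)"
 proof (rule inj_onI)
  fix p q assume "p \<in> UNIV \<times> strand_pts m" "q \<in> UNIV \<times> strand_pts m" "E' p = E' q"
  then show "p = q"
   by (cases p; cases q; cases "fst p"; cases "fst q"; cases "snd p"; cases "snd q")
    (auto simp: E'_def E1_def E2_def hi odd ee he)
 qed
 have inj12: "inj_on E1 (strand_pts m)" "inj_on E2 (strand_pts m)"
 proof -
  have "E1 p = E' (False, p)" "E2 p = E' (True, p)" for p by (simp_all add: E'_def)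
  then show "inj_on E1 (strand_pts m)" "inj_on E2 (strand_pts m)"
   using inj_onD[OF injE', of "(False, _)" "(False, _)"] inj_onD[OF injE', of "(True, _)" "(True, _)"]
   by (auto intro!: inj_onI)
 qed
 let ?mid = "{(?f i, ?g i) | i. i < m}"
 let ?HN = "\<lambda>N. ?mid \<union> (map_prod E2 E2 ` N \<union> H)"
 \<comment> \<open>The stacking graph, embedded by \<open>E'\<close>, is contracted to its boundary;
   \<open>n_components_glue\<close> separates it into \<open>stack_loops\<close> and
   \<open>stack_match\<close>.\<close>
 have glue: "loop_val ^ stack_loops m M N * loop_val ^ nc (st V c s \<union> map_prod e e ` stack_match m M N \<union> H)
   = loop_val ^ nc (st V c s \<union> map_prod E1 E1 ` M \<union> ?HN N)"
  if M: "Field M \<subseteq> strand_pts m" and N: "Field N \<subseteq> strand_pts m" for M N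
 proof -
  let ?G = "stack_graph m M N" and ?B = "stack_boundary m"
  have FG: "Field ?G \<subseteq> UNIV \<times> strand_pts m" by (rule Field_stack_graph[OF M N])
  have BS: "?B \<subseteq> UNIV \<times> strand_pts m" by (auto simp: stack_boundary_def)
  have G: "map_prod E' E' ` ?G = map_prod E1 E1 ` M \<union> map_prod E2 E2 ` N \<union> ?mid"
  proof -
   have "map_prod E' E' ` {((False, Top i), (True, Bot i)) | i. i < m} = ?mid"
    by (simp add: setcompr_eq_image image_image E'_def E1_def E2_def)
   then show ?thesis
    unfolding stack_graph_def image_Un image_image by (simp add: split_def E'_def map_prod_def)
  qed
  have EB: "E' ` ?B = e ` strand_pts m"
  proof -
   have "?B = (\<lambda>i. (False, Bot i)) ` {..<m} \<union> (\<lambda>i. (True, Top i)) ` {..<m}" by (auto simp: stack_boundary_def)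
   then show ?thesis by (simp only: image_Un image_image strand_pts_def) (simp add: E'_def E1_def E2_def)
  qed
  have mm: "map_prod e e ` stack_match m M N = match (map_prod E' E' ` ?G) (E' ` ?B)"
  proof -
   have "E' p = e (snd p)" if "p \<in> ?B" for p using that by (auto simp: stack_boundary_def E'_def E1_def E2_def)
   then have "map_prod e e (map_prod snd snd q) = map_prod E' E' q" if "q \<in> match ?G ?B" for q
    using that by (auto simp: match_def)
   then show ?thesis
    unfolding match_image[OF injE' FG BS] stack_match_match image_image by (intro image_cong) auto
  qed
  have FEG: "Field (map_prod E' E' ` ?G) \<subseteq> e ` strand_pts m \<union> range h"
  proof -
   have "E' p \<in> e ` strand_pts m \<union> range h" if "p \<in> UNIV \<times> strand_pts m" for p
    using that by (cases p; cases "snd p") (auto simp: E'_def E1_def E2_def)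
   with FG show ?thesis unfolding Field_image by blast
  qed
  have FS: "Field (st V c s \<union> H) = c ` V \<union> Field H" by (simp add: Field_Un Field_st[OF aD(2)])
  have "nc (map_prod E' E' ` ?G \<union> (st V c s \<union> H))
    = loops (map_prod E' E' ` ?G) (E' ` ?B) + nc (match (map_prod E' E' ` ?G) (E' ` ?B) \<union> (st V c s \<union> H))"
  proof (rule n_components_glue)
   have "finite ?mid" by (simp add: setcompr_eq_image)
   then show "finite (map_prod E' E' ` ?G)"
    unfolding G using Field_finite[OF M] Field_finite[OF N] by simp
   show "finite (st V c s \<union> H)" using aD by (simp add: finite_st)
   show "Field (map_prod E' E' ` ?G) \<inter> Field (st V c s \<union> H) \<subseteq> E' ` ?B"
   proof
    fix p assume p: "p \<in> Field (map_prod E' E' ` ?G) \<inter> Field (st V c s \<union> H)"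
    then have "p \<in> c ` V \<union> Field H" unfolding FS by simp
    then have "p \<notin> range h" using hA by auto
    then show "p \<in> E' ` ?B" unfolding EB using p FEG by blast
   qed
   have "e p \<in> c ` V \<union> Field H" if p: "p \<in> strand_pts m" for p
   proof (cases p)
    case (Bot j)
    then have "e p = c (x j)" "x j \<in> V" using p aD(4,7) by auto
    then show ?thesis by simp
   qed (use p aD(12) in auto)
   then show "E' ` ?B \<subseteq> Field (st V c s \<union> H)" unfolding EB FS by auto
  qed
  moreover have "map_prod E' E' ` ?G \<union> (st V c s \<union> H) = st V c s \<union> map_prod E1 E1 ` M \<union> ?HN N"
   unfolding G by (simp only: Un_ac)
  moreover have "match (map_prod E' E' ` ?G) (E' ` ?B) \<union> (st V c s \<union> H) = st V c s \<union> map_prod e e ` stack_match m M N \<union> H"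
   unfolding mm by (simp only: Un_ac)
  ultimately show ?thesis
   by (simp add: loops_image[OF injE' FG BS] stack_loops_loops power_add)
 qed
 have FN: "h (2 * i) \<notin> Field (map_prod E2 E2 ` N \<union> H)" "j < m ==> e (Bot j) \<notin> Field (map_prod E2 E2 ` N \<union> H)"
  if N: "Field N \<subseteq> strand_pts m" for N i j
 proof -
  have "h (2 * i) \<noteq> E2 p" "j < m ==> e (Bot j) \<noteq> E2 p" if "p \<in> strand_pts m" for p
   using that by (cases p; simp add: E2_def hi odd ee he)+
  then show "h (2 * i) \<notin> Field (map_prod E2 E2 ` N \<union> H)" "j < m ==> e (Bot j) \<notin> Field (map_prod E2 E2 ` N \<union> H)"
   using N hA(3) aD(11) unfolding Field_Un Field_image by blast+
 qed
 have at1: "attachable x m V s c cf E1 (?HN N)" if N: "Field N \<subseteq> strand_pts m" for N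
  unfolding attachable_def
 proof (intro conjI allI impI ballI)
  fix j assume j: "j < m"
  show "E1 (Bot j) \<notin> Field (?HN N)"
  proof -
   have "e (Bot j) \<notin> Field ?mid" using j by (auto simp: Field_def he)
   then show ?thesis using FN(2)[OF N j] by (simp add: Field_Un E1_def)
  qed
  have "(?f j, ?g j) \<in> ?HN N" using j by blast
  then have "?f j \<in> Field (?HN N)" by (rule FieldI1)
  then show "E1 (Top j) \<in> Field (?HN N)" by (simp add: E1_def)
 next
  have "finite ?mid" by (simp add: setcompr_eq_image)
  then show "finite (?HN N)" using Field_finite[OF N] aD(6) by simp
 qed (use aD cfx cfg inj12 hA in \<open>auto simp: E1_def\<close>)
 have at2: "attachable x m V s cg c' E2 H" if s: "closed_state V s" for s
  unfolding attachable_def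
 proof (intro conjI allI impI ballI)
  show injg: "inj_on cg V"
  proof (rule inj_onI)
   fix y z assume yz: "y \<in> V" "z \<in> V" "cg y = cg z"
   show "y = z"
   proof (cases "y \<in> x ` {..<m}"; cases "z \<in> x ` {..<m}")
    assume "y \<notin> x ` {..<m}" "z \<notin> x ` {..<m}"
    then show ?thesis using yz cfg(2) aD(3) by (auto dest: inj_onD)
   next
    assume "y \<in> x ` {..<m}" "z \<notin> x ` {..<m}"
    then obtain j where "j < m" "y = x j" by auto
    then have "?g j = c z" using yz(3) cgx cfg(2)[OF \<open>z \<notin> x ` {..<m}\<close>] by simp
    then show ?thesis using hA(1)[of "2 * j + 1"] yz(2) by simp
   next
    assume "y \<notin> x ` {..<m}" "z \<in> x ` {..<m}"
    then obtain j where "j < m" "z = x j" by auto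
    then have "?g j = c y" using yz(3) cgx cfg(2)[OF \<open>y \<notin> x ` {..<m}\<close>] by simp
    then show ?thesis using hA(1)[of "2 * j + 1"] yz(1) by simp
   next
    assume "y \<in> x ` {..<m}" "z \<in> x ` {..<m}"
    then show ?thesis using yz cgx by (auto simp: hi)
   qed
  qed
  fix j assume j: "j < m"
  show "E2 (Top j) \<notin> cg ` V"
  proof
   assume "E2 (Top j) \<in> cg ` V"
   then obtain z where z: "z \<in> V" "e (Top j) = cg z" by (auto simp: E2_def)
   show False
   proof (cases "z \<in> x ` {..<m}")
    case True
    then show False using z j cgx by (auto simp: he)
   next
    case False
    then show False using z cfg(2) aD(10)[OF j] by auto
   qed
  qed
 qed (use aD s cgx cfg inj12 hA in \<open>auto simp: E2_def\<close>)
 let ?F = "\<lambda>s. loop_val ^ nc (st V c' s \<union> H)"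
 let ?F1 = "\<lambda>N s. loop_val ^ nc (st V cf s \<union> ?HN N)"
 have mid: "?F1 N s = loop_val ^ nc (st V cg s \<union> map_prod E2 E2 ` N \<union> H)"
  if s: "closed_state V s" and N: "Field N \<subseteq> strand_pts m" for s N
 proof -
  have mid: "?mid = (\<lambda>z. (cf z, cg z)) ` x ` {..<m}"
   using cfx cgx by (auto simp: image_iff)
  have "inj_on cg V" using at2[OF s] by (simp add: attachable_def)
  then have "nc (st V cf s \<union> (\<lambda>z. (cf z, cg z)) ` x ` {..<m} \<union> (map_prod E2 E2 ` N \<union> H))
    = nc (st V cg s \<union> (map_prod E2 E2 ` N \<union> H))"
  proof (intro st_extend_set[OF s _ aD(4) attachable_inj[OF at1[OF N]]])
   fix z assume "z \<in> x ` {..<m}"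
   then obtain j where j: "j < m" "z = x j" by auto
   have "?g j \<noteq> cf w" if "w \<in> V" for w
    using that cfx cfg(1)[of w] hA(1)[of "2 * j + 1"] by (cases "w \<in> x ` {..<m}") (auto simp: hi odd)
   then show "cg z \<notin> cf ` V \<and> cf z \<notin> Field (map_prod E2 E2 ` N \<union> H)"
    using j FN(1)[OF N] by (auto simp: cfx cgx)
  qed (auto simp: cfg)
  then show ?thesis unfolding mid by (simp only: Un_assoc)
 qed
 have "(\<Sum>(d, M)\<leftarrow>tl_comp m t1 t2. d * loop_val ^ nc (st V c s \<union> map_prod e e ` M \<union> H))
   = (\<Sum>(a, M)\<leftarrow>t1. \<Sum>(b, N)\<leftarrow>t2. a * b * (loop_val ^ stack_loops m M N *
     loop_val ^ nc (st V c s \<union> map_prod e e ` stack_match m M N \<union> H)))"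
 proof -
  have concat: "sum_list (concat xs) = (\<Sum>ys\<leftarrow>xs. sum_list ys)" for xs :: "lser list list"
   by (induction xs) simp_all
  show ?thesis
   unfolding tl_comp_def by (simp add: map_concat concat o_def split_def mult.assoc)
 qed
 also have "... = (\<Sum>(a, M)\<leftarrow>t1. \<Sum>(b, N)\<leftarrow>t2. b * (a * loop_val ^ nc (st V c s \<union> map_prod E1 E1 ` M \<union> ?HN N)))"
 proof (intro arg_cong[where f = sum_list] map_cong refl)
  fix p assume "p \<in> set t1"
  then obtain a M where p: "p = (a, M)" "(a, M) \<in> set t1" by (metis surj_pair)
  show "(case p of (a, M) => \<Sum>(b, N)\<leftarrow>t2. a * b * (loop_val ^ stack_loops m M N *
     loop_val ^ nc (st V c s \<union> map_prod e e ` stack_match m M N \<union> H)))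
   = (case p of (a, M) => \<Sum>(b, N)\<leftarrow>t2. b * (a * loop_val ^ nc (st V c s \<union> map_prod E1 E1 ` M \<union> ?HN N)))"
   unfolding p(1) prod.case
  proof (intro arg_cong[where f = sum_list] map_cong refl)
   fix q assume "q \<in> set t2"
   then obtain b N where q: "q = (b, N)" "(b, N) \<in> set t2" by (metis surj_pair)
   show "(case q of (b, N) => a * b * (loop_val ^ stack_loops m M N *
     loop_val ^ nc (st V c s \<union> map_prod e e ` stack_match m M N \<union> H)))
    = (case q of (b, N) => b * (a * loop_val ^ nc (st V c s \<union> map_prod E1 E1 ` M \<union> ?HN N)))"
    unfolding q(1) prod.case using glue[OF wf[of a M] wf[of b N]] p(2) q(2) by (simp add: mult_ac)
  qed
 qed
 \<comment> \<open>The sums are exchanged so that the first factor acts while the matching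
   \<open>N\<close> of the second is held fixed as part of the network.\<close>
 also have "... = (\<Sum>(b, N)\<leftarrow>t2. b * (\<Sum>(a, M)\<leftarrow>t1. a * loop_val ^ nc (st V c s \<union> map_prod E1 E1 ` M \<union> ?HN N)))"
  unfolding split_def by (subst sum_list_swap) (simp add: sum_list_const_mult)
 also have "... = (\<Sum>(b, N)\<leftarrow>t2. b * ap T1 (?F1 N) s)"
 proof (intro arg_cong[where f = sum_list] map_cong refl)
  fix q assume "q \<in> set t2"
  then obtain b N where q: "q = (b, N)" "(b, N) \<in> set t2" by (metis surj_pair)
  have "Field N \<subseteq> strand_pts m" using wf[of b N] q(2) by simp
  from representsD[OF r1 at1[OF this]]
  show "(case q of (b, N) => b * (\<Sum>(a, M)\<leftarrow>t1. a * loop_val ^ nc (st V c s \<union> map_prod E1 E1 ` M \<union> ?HN N)))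
   = (case q of (b, N) => b * ap T1 (?F1 N) s)"
   by (simp only: q(1) prod.case)
 qed
 also have "... = ap T1 (\<lambda>s. \<Sum>(b, N)\<leftarrow>t2. b * ?F1 N s) s"
  unfolding split_def by (rule ap_sum_list[symmetric])
 also have "... = ap T1 (ap T2 ?F) s"
 proof (rule local_opD[OF _ _ aD(2)])
  show "local_op V T1" using r1 aD(4) by (simp add: represents_def)
  show "\<forall>s. closed_state V s \<longrightarrow> (\<Sum>(b, N)\<leftarrow>t2. b * ?F1 N s) = ap T2 ?F s"
  proof (intro allI impI)
   fix s assume s: "closed_state V s"
   have "(\<Sum>(b, N)\<leftarrow>t2. b * ?F1 N s) = (\<Sum>(b, N)\<leftarrow>t2. b * loop_val ^ nc (st V cg s \<union> map_prod E2 E2 ` N \<union> H))"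
   proof (intro arg_cong[where f = sum_list] map_cong refl)
    fix p assume p: "p \<in> set t2"
    obtain b N where bN: "p = (b, N)" by (cases p)
    have "Field N \<subseteq> strand_pts m" using wf[of b N] p bN by simp
    from mid[OF s this] show "(case p of (b, N) => b * ?F1 N s) =
     (case p of (b, N) => b * loop_val ^ nc (st V cg s \<union> map_prod E2 E2 ` N \<union> H))"
     by (simp only: bN prod.case)
   qed
   also have "... = ap T2 ?F s" by (rule representsD[OF r2 at2[OF s]])
   finally show "(\<Sum>(b, N)\<leftarrow>t2. b * ?F1 N s) = ap T2 ?F s" .
  qed
 qed
 finally show "(\<Sum>(d, M)\<leftarrow>tl_comp m t1 t2. d * loop_val ^ nc (st V c s \<union> map_prod e e ` M \<union> H))
   = ap (T1 * T2) ?F s" by simp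
qed

lemma represents_jw:
 assumes x: "inj x"
 shows "represents x m (jw m) (jw_op x m)"
proof (induction m rule: jw.induct)
 case 1
 have "st V c s = st V c' s" if "attachable x 0 V s c c' e H" for V s c c' and e :: "tlpos => pt" and H
  using that unfolding st_def by (intro image_cong) (auto simp: attachable_def closed_state_def)
 then show ?case by (auto simp: represents_def local_op_1 Field_def)
next
 case 2
 then show ?case using represents_id[of x 1] by simp
next
 case (3 m)
 have F: "represents x (Suc (Suc m)) (tl_tensor1 (Suc m) (jw (Suc m))) (jw_op x (Suc m))"
  by (rule represents_tensor1[OF x 3])
 have E: "represents x (Suc (Suc m)) (tl_e (Suc (Suc m)) m) (E (x m) (x (Suc m)))"
  by (rule represents_E[OF x]) simp
 show ?case
  using represents_minus[OF F represents_smult[OF represents_comp[OF x represents_comp[OF x F E] F]]]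
  by (simp add: Let_def mult.assoc)
qed

section \<open>The pretzel diagram\<close>

text \<open>Positions count from left to right, strand numbers outwards from the middle of the
  region.\<close>

definition pos :: "nat => nat => nat => lab" where
 "pos n r q = (if q < n then Lab r True False (n - 1 - q) else Lab r True True (q - n))"

definition cell :: "nat => nat => nat => nat => nat => pt" where
 "cell r t h v i = Grid (r, t) h v i"

definition endpoint :: "nat => (nat => nat) => nat => bool => nat => pt" where
 "endpoint n a r b q = (if b then top_end n (cell r 0) q else bot_end n (cell r (a r - 1)) q)"

lemma inj_pos: "inj (pos n r)"
 by (rule injI) (auto simp: pos_def split: if_splits)

text \<open>The cabling numbers strands counterclockwise around a crossing, so at the two upper
  slots the numbers run against the positions.\<close>

lemma slot_pt_ends:
 assumes "j < n"
 shows "slot_pt n (r, t) 0 j = bot_end n (cell r t) j"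
  and "slot_pt n (r, t) 1 j = bot_end n (cell r t) (n + j)"
  and "slot_pt n (r, t) 2 j = top_end n (cell r t) (n + (n - 1 - j))"
  and "slot_pt n (r, t) 3 j = top_end n (cell r t) (n - 1 - j)"
 using assms by (simp_all add: slot_pt_def bot_end_def top_end_def cell_def)

text \<open>The cabled edges in terms of positions. Positions \<open>n + i\<close> and
  \<open>n - 1 - i\<close> have the same distance \<open>i\<close> from the middle of their regions,
  in agreement with \<open>frame\<close>, which preserves the strand number. The top edge from
  region 0 to region 1 is interrupted by the idempotent.\<close>

definition link_arcs :: "nat => (nat => nat) => (pt \<times> pt) set" where
 "link_arcs n a = {(bot_end n (cell r t) q, top_end n (cell r (Suc t)) q) | r t q. r < 3 \<and> Suc t < a r \<and> q < 2 * n}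
  \<union> {(endpoint n a r b (n + i), endpoint n a ((r + 1) mod 3) b (n - 1 - i)) | r b i. r < 3 \<and> i < n \<and> \<not> (r = 0 \<and> b)}
  \<union> {(endpoint n a 0 True (n + i), JWpt (Bot (n - 1 - i))) | i. i < n}
  \<union> {(JWpt (Top (n - 1 - i)), endpoint n a 1 True (n - 1 - i)) | i. i < n}"

lemma grid_arcs_eq: "grid_arcs n (pretzel_crossings a) = (\<Union>r<3. \<Union>t<a r. inner_arcs n (cell r t))"
 by (fastforce simp: grid_arcs_def pretzel_crossings_def inner_arcs_def cell_def)

lemma edge_arcs_sub: "edge_arcs n (pretzel_edges a) pretzel_jw_edge \<subseteq> link_arcs n a"
proof
 fix e assume "e \<in> edge_arcs n (pretzel_edges a) pretzel_jw_edge"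
 then have "e \<in> edge_arcs n (pretzel_edges a) pretzel_jw_edge" .
 consider c s c' s' j where "((c, s), (c', s')) \<in> pretzel_edges a" "((c, s), (c', s')) \<noteq> pretzel_jw_edge" "j < n"
   "e = (slot_pt n c s j, slot_pt n c' s' (n - 1 - j))"
  | j where "j < n" "e = (slot_pt n (0, 0) 2 j, JWpt (Bot j))"
  | j where "j < n" "e = (JWpt (Top j), slot_pt n (1, 0) 3 (n - 1 - j))"
 proof -
  have jw: "fst (fst pretzel_jw_edge) = (0, 0)" "snd (fst pretzel_jw_edge) = 2"
   "fst (snd pretzel_jw_edge) = (1, 0)" "snd (snd pretzel_jw_edge) = 3"
   by (simp_all add: pretzel_jw_edge_def)
  show ?thesis
   using \<open>e \<in> edge_arcs n (pretzel_edges a) pretzel_jw_edge\<close> that unfolding edge_arcs_def jw by blast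
 qed
 then show "e \<in> link_arcs n a"
 proof cases
  case (1 c s c' s' j)
  have j: "n - 1 - j < n" "n - 1 - (n - 1 - j) = j" using 1(3) by auto
  consider r t where "c = (r, t)" "s = 0" "c' = (r, Suc t)" "s' = 3" "r < 3" "Suc t < a r"
   | r t where "c = (r, t)" "s = 1" "c' = (r, Suc t)" "s' = 2" "r < 3" "Suc t < a r"
   | r where "c = (r, 0)" "s = 2" "c' = ((r + 1) mod 3, 0)" "s' = 3" "r < 3"
   | r where "c = (r, a r - 1)" "s = 1" "c' = ((r + 1) mod 3, a ((r + 1) mod 3) - 1)" "s' = 0" "r < 3"
   using 1(1) unfolding pretzel_edges_def by blast
  then show ?thesis
  proof cases
   case (1 r t)
   then have "e = (bot_end n (cell r t) j, top_end n (cell r (Suc t)) j)" "j < 2 * n"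
    using \<open>e = _\<close> \<open>j < n\<close> j by (simp_all add: slot_pt_ends)
   with 1 show ?thesis unfolding link_arcs_def by blast
  next
   case (2 r t)
   then have "e = (bot_end n (cell r t) (n + j), top_end n (cell r (Suc t)) (n + j))" "n + j < 2 * n"
    using \<open>e = _\<close> \<open>j < n\<close> j slot_pt_ends(2)[of j n r t] by (simp_all add: slot_pt_ends)
   with 2 show ?thesis unfolding link_arcs_def by blast
  next
   case (3 r)
   have "r \<noteq> 0" using 3 \<open>_ \<noteq> pretzel_jw_edge\<close> by (cases "r = 0") (auto simp: pretzel_jw_edge_def)
   moreover have "e = (endpoint n a r True (n + (n - 1 - j)), endpoint n a ((r + 1) mod 3) True (n - 1 - (n - 1 - j)))"
    using 3 \<open>e = _\<close> \<open>j < n\<close> j by (simp add: slot_pt_ends endpoint_def)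
   ultimately show ?thesis using 3 j unfolding link_arcs_def by blast
  next
   case (4 r)
   have "e = (endpoint n a r False (n + j), endpoint n a ((r + 1) mod 3) False (n - 1 - j))"
    using 4 \<open>e = _\<close> \<open>j < n\<close> j slot_pt_ends(2)[of j n r "a r - 1"] by (simp add: slot_pt_ends(1) endpoint_def)
   then show ?thesis using 4 \<open>j < n\<close> unfolding link_arcs_def by blast
  qed
 next
  case (2 j)
  then have "e = (endpoint n a 0 True (n + (n - 1 - j)), JWpt (Bot (n - 1 - (n - 1 - j))))" "n - 1 - j < n"
   by (auto simp: slot_pt_ends endpoint_def)
  then show ?thesis unfolding link_arcs_def by blast
 next
  case (3 j)
  then have "e = (JWpt (Top (n - 1 - (n - 1 - j))), endpoint n a 1 True (n - 1 - (n - 1 - j)))" "n - 1 - j < n"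
   by (auto simp: slot_pt_ends endpoint_def)
  then show ?thesis unfolding link_arcs_def by blast
 qed
qed

lemma edge_arcs_sup: "link_arcs n a \<subseteq> edge_arcs n (pretzel_edges a) pretzel_jw_edge"
proof
 fix e assume "e \<in> link_arcs n a"
 have main: "(slot_pt n c s j, slot_pt n c' s' (n - 1 - j)) \<in> edge_arcs n (pretzel_edges a) pretzel_jw_edge"
  if "((c, s), (c', s')) \<in> pretzel_edges a" "((c, s), (c', s')) \<noteq> pretzel_jw_edge" "j < n" for c s c' s' j
  using that unfolding edge_arcs_def by blast
 from \<open>e \<in> link_arcs n a\<close> consider
   r t q where "e = (bot_end n (cell r t) q, top_end n (cell r (Suc t)) q)" "r < 3" "Suc t < a r" "q < 2 * n"
  | r b i where "e = (endpoint n a r b (n + i), endpoint n a ((r + 1) mod 3) b (n - 1 - i))" "r < 3" "i < n" "\<not> (r = 0 \<and> b)"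
  | i where "e = (endpoint n a 0 True (n + i), JWpt (Bot (n - 1 - i)))" "i < n"
  | i where "e = (JWpt (Top (n - 1 - i)), endpoint n a 1 True (n - 1 - i))" "i < n"
  unfolding link_arcs_def by blast
 then show "e \<in> edge_arcs n (pretzel_edges a) pretzel_jw_edge"
 proof cases
  case (1 r t q)
  show ?thesis
  proof (cases "q < n")
   case True
   have "(slot_pt n (r, t) 0 q, slot_pt n (r, Suc t) 3 (n - 1 - q)) \<in> edge_arcs n (pretzel_edges a) pretzel_jw_edge"
    using 1 True by (intro main) (auto simp: pretzel_edges_def pretzel_jw_edge_def)
   then show ?thesis using 1 True by (simp add: slot_pt_ends)
  next
   case False
   define j where "j = q - n"
   have j: "q = n + j" "j < n" using False 1 by (auto simp: j_def)
   have "(slot_pt n (r, t) 1 j, slot_pt n (r, Suc t) 2 (n - 1 - j)) \<in> edge_arcs n (pretzel_edges a) pretzel_jw_edge"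
    using 1 j by (intro main) (auto simp: pretzel_edges_def pretzel_jw_edge_def)
   then show ?thesis using 1 j slot_pt_ends(2)[of j n r t] by (simp add: slot_pt_ends(3))
  qed
 next
  case (2 r b i)
  show ?thesis
  proof (cases b)
   case True
   have "(slot_pt n (r, 0) 2 (n - 1 - i), slot_pt n ((r + 1) mod 3, 0) 3 (n - 1 - (n - 1 - i))) \<in> edge_arcs n (pretzel_edges a) pretzel_jw_edge"
    using 2 True by (intro main) (auto simp: pretzel_edges_def pretzel_jw_edge_def)
   then show ?thesis using 2 True by (simp add: slot_pt_ends endpoint_def)
  next
   case False
   have "(slot_pt n (r, a r - 1) 1 i, slot_pt n ((r + 1) mod 3, a ((r + 1) mod 3) - 1) 0 (n - 1 - i)) \<in> edge_arcs n (pretzel_edges a) pretzel_jw_edge"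
    using 2 False by (intro main) (auto simp: pretzel_edges_def pretzel_jw_edge_def)
   then show ?thesis using 2 False slot_pt_ends(2)[of i n r "a r - 1"] by (simp add: slot_pt_ends(1) endpoint_def)
  qed
 next
  case (3 i)
  have "(slot_pt n (0, 0) 2 (n - 1 - i), JWpt (Bot (n - 1 - i))) \<in> edge_arcs n (pretzel_edges a) pretzel_jw_edge"
   using 3 unfolding edge_arcs_def by (auto simp: pretzel_jw_edge_def)
  then show ?thesis using 3 by (simp add: slot_pt_ends endpoint_def)
 next
  case (4 i)
  have "(JWpt (Top (n - 1 - i)), slot_pt n (1, 0) 3 (n - 1 - (n - 1 - i))) \<in> edge_arcs n (pretzel_edges a) pretzel_jw_edge"
   using 4 unfolding edge_arcs_def by (auto simp: pretzel_jw_edge_def)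
  then show ?thesis using 4 by (simp add: slot_pt_ends endpoint_def)
 qed
qed

definition diagram :: "nat => (nat => nat) => (pt \<times> pt) set" where
 "diagram n a = (\<Union>r<3. \<Union>t<a r. inner_arcs n (cell r t)) \<union> link_arcs n a"

lemma diagram_eq: "grid_arcs n (pretzel_crossings a) \<union> edge_arcs n (pretzel_edges a) pretzel_jw_edge = diagram n a"
 unfolding diagram_def grid_arcs_eq subset_antisym[OF edge_arcs_sub edge_arcs_sup] ..

text \<open>The points at the ends of the strands; those at the Jones-Wenzl idempotent are its bottom points, all
 others are extra points subdividing the arcs of the frame.\<close>
definition port :: "nat => lab => pt" where
 "port n x = (if column x = 0 \<and> is_top x \<and> is_right x then JWpt (Bot (n - 1 - strand x))
  else Grid (3 + column x, 0) (strand x) (of_bool (is_top x)) (of_bool (is_right x)))"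

definition port' :: "nat => lab => pt" where
 "port' n x = (if column x = 0 \<and> is_top x \<and> is_right x then JWpt (Top (n - 1 - strand x)) else port n x)"

definition half_frame :: "nat => (lab \<times> lab) set" where
 "half_frame n = {(Lab r b True i, Lab ((r + 1) mod 3) b False i) | r b i. r < 3 \<and> i < n}"

primrec block_ix :: "nat => nat \<times> nat => nat => ((nat \<times> nat) \<times> nat \<times> nat) list" where
 "block_ix n c 0 = []"
| "block_ix n c (Suc h) = map (\<lambda>v. (c, h, v)) [0..<n] @ block_ix n c h"

primrec tower_ix :: "nat => nat => nat => ((nat \<times> nat) \<times> nat \<times> nat) list" where
 "tower_ix n r 0 = []"
| "tower_ix n r (Suc t) = block_ix n (r, t) n @ tower_ix n r t"

fun place :: "nat => (nat \<times> nat) \<times> nat \<times> nat => pt placed" where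
 "place n ((r, t), h, v) = (pos n r (h + v), pos n r (Suc (h + v)), cell r t h v)"

lemma block_ix: "distinct (block_ix n c h)" "set (block_ix n c h) = {c} \<times> {..<h} \<times> {..<n}"
 "c = (r, t) ==> map (place n) (block_ix n c h) = block (pos n r) (cell r t) n h"
proof -
 show set: "set (block_ix n c h) = {c} \<times> {..<h} \<times> {..<n}" for h
  by (induction h) (auto simp: lessThan_Suc lessThan_atLeast0)
 show "distinct (block_ix n c h)" by (induction h) (auto simp: set distinct_map inj_on_def)
 show "c = (r, t) ==> map (place n) (block_ix n c h) = block (pos n r) (cell r t) n h"
  by (induction h) (auto simp: row_def)
qed

lemma tower_ix: "distinct (tower_ix n r T)" "set (tower_ix n r T) = ({r} \<times> {..<T}) \<times> {..<n} \<times> {..<n}"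
 "map (place n) (tower_ix n r T) = tower (pos n r) (cell r) n T"
proof -
 show set: "set (tower_ix n r T) = ({r} \<times> {..<T}) \<times> {..<n} \<times> {..<n}" for T
  by (induction T) (auto simp: block_ix(2) lessThan_Suc)
 show "distinct (tower_ix n r T)" by (induction T) (auto simp: set block_ix(1,2))
 show "map (place n) (tower_ix n r T) = tower (pos n r) (cell r) n T"
  by (induction T) (auto simp: block_ix(3))
qed

definition crossing_ix :: "nat => (nat => nat) => ((nat \<times> nat) \<times> nat \<times> nat) list" where
 "crossing_ix n a = tower_ix n 0 (a 0) @ tower_ix n 1 (a 1) @ tower_ix n 2 (a 2)"

lemma less_3: "r < 3 \<longleftrightarrow> r = 0 \<or> r = 1 \<or> r = (2::nat)"
 by auto

lemma crossing_ix: "distinct (crossing_ix n a)" "set (crossing_ix n a) = pretzel_crossings a \<times> {..<n} \<times> {..<n}"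
 by (auto simp: crossing_ix_def tower_ix pretzel_crossings_def less_3)

lemma separated_place: "distinct js ==> separated (map (place n) js)"
proof (induction js)
 case (Cons j js)
 have "slots (place n j) \<inter> all_slots (map (place n) js) = {}"
  using Cons.prems by (cases j) (auto simp: all_slots_def cell_def)
 then show ?case using Cons by simp
qed simp

definition inner_pts :: "pt set" where
 "inner_pts = range JWpt \<union> {Grid (r, t) h v i | r t h v i. r < 3}"

definition crossings :: "nat => (nat => nat) => pt placed list" where
 "crossings n a = map (place n) (crossing_ix n a)"

text \<open>The diagram in the form that \<open>seval_crossings\<close> expects: the crossings start
  from the initial state and end at \<open>port\<close>, and above the idempotent the frame is
  attached at \<open>port'\<close>.\<close>

definition network :: "nat => (nat => nat) => (pt \<times> pt) set" where
 "network n a = st (labels n) (nxt (crossings n a) (port n)) initial \<union> wires (crossings n a) (port n) \<union> map_prod (port' n) (port' n) ` half_frame n"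

definition place_of :: "nat => bool => nat => nat" where
 "place_of n s i = (if s then n + i else n - 1 - i)"

text \<open>The extra points are recognised by a first index of at least 3; each is contracted to
  the end of the twist region to which it is attached.\<close>

definition collapse :: "nat => (nat => nat) => pt => pt" where
 "collapse n a p = (case p of Grid c h v i => if fst c < 3 then p else endpoint n a (fst c - 3) (v = 1) (place_of n (i = 1) h)
  | JWpt x => p)"

lemma port_special: "port n (Lab 0 True True i) = JWpt (Bot (n - 1 - i))" "port' n (Lab 0 True True i) = JWpt (Top (n - 1 - i))"
 "\<not> (r = 0 \<and> b \<and> s) ==> port' n (Lab r b s i) = port n (Lab r b s i)"
 by (auto simp: port_def port'_def)

lemma crossings_towers: "crossings n a = tower (pos n 0) (cell 0) n (a 0) @ tower (pos n 1) (cell 1) n (a 1) @ tower (pos n 2) (cell 2) n (a 2)"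
 by (simp add: crossings_def crossing_ix_def tower_ix)

context
 fixes n :: nat and a :: "nat => nat"
 assumes a: "\<And>r. r < 3 ==> 0 < a r"
begin

lemma pos_outside: "r \<noteq> r' ==> pos n r q \<notin> range (pos n r')" "Lab r False s i \<notin> range (pos n r')"
 by (auto simp: pos_def)

lemma nxt_crossings:
 "r < 3 ==> q < 2 * n ==> nxt (crossings n a) c (pos n r q) = endpoint n a r False q"
 "nxt (crossings n a) c (Lab r False s i) = c (Lab r False s i)"
 using a[of 0] a[of 1] a[of 2] by (auto simp: crossings_towers nxt_append nxt_tower inj_pos nxt_tower_outside pos_outside endpoint_def less_3)

lemma wires_crossings:
 "wires (crossings n a) c = (\<Union>r<3. {(endpoint n a r True q, c (pos n r q)) | q. q < 2 * n}
  \<union> {(top_end n (cell r (Suc t)) q, bot_end n (cell r t) q) | t q. Suc t < a r \<and> q < 2 * n}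
  \<union> (\<Union>t<a r. inner_arcs n (cell r t)))" (is "_ = (\<Union>r<3. ?W r)")
proof -
 have w: "wires (tower (pos n r) (cell r) n (a r)) c' = ?W r" if "r < 3" "\<And>q. c' (pos n r q) = c (pos n r q)" for r c'
  unfolding wires_tower[OF inj_pos] that(2) endpoint_def using a[OF that(1)] by simp
 have n3: "{..<3} = {0, 1, 2::nat}" by auto
 have "wires (crossings n a) c = ?W 0 \<union> (?W 1 \<union> ?W 2)"
  unfolding crossings_towers wires_append
  by (intro arg_cong2[where f = "(\<union>)"] w) (simp_all add: nxt_append nxt_tower_outside pos_outside)
 then show ?thesis unfolding n3 by (simp only: UN_insert UN_empty Un_empty_right)
qed

lemma labels_cases:
 assumes "x \<in> labels n"
 obtains r b s i where "x = Lab r b s i" "r < 3" "i < n"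
 using assms by (cases x) (auto simp: labels_def)

lemma port_conn:
 assumes "r < 3" "i < n"
 shows "(endpoint n a r b (place_of n s i), port n (Lab r b s i)) \<in> network n a \<union> (network n a)\<inverse>"
proof (cases b)
 case True
 have "(endpoint n a r True (place_of n s i), port n (pos n r (place_of n s i))) \<in> wires (crossings n a) (port n)"
 proof -
  have "place_of n s i < 2 * n" using assms by (auto simp: place_of_def)
  then show ?thesis unfolding wires_crossings using assms by blast
 qed
 moreover have "pos n r (place_of n s i) = Lab r True s i" using assms by (cases s) (auto simp: place_of_def pos_def)
 ultimately show ?thesis using True by (simp add: network_def)
next
 case False
 have *: "pos n r (place_of n s i) = Lab r True s i" "place_of n s i < 2 * n" using assms by (cases s; auto simp: place_of_def pos_def)+
 have l: "Lab r True s i \<in> labels n" using assms by (simp add: labels_def)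
 have "(nxt (crossings n a) (port n) (Lab r True s i), nxt (crossings n a) (port n) (Lab r False s i)) \<in> st (labels n) (nxt (crossings n a) (port n)) initial"
  using st_edge[OF l, of "nxt (crossings n a) (port n)" initial] by simp
 then show ?thesis
  using nxt_crossings(1)[OF assms(1) *(2), of "port n"] False by (simp add: network_def nxt_crossings(2) *(1))
qed

lemma network_cases:
 assumes "(x, y) \<in> network n a"
 obtains (port) r b s i where "r < 3" "i < n" "x = endpoint n a r b (place_of n s i)" "y = port n (Lab r b s i)"
  | (port_rev) r b s i where "r < 3" "i < n" "y = endpoint n a r b (place_of n s i)" "x = port n (Lab r b s i)"
  | (link) r t q where "r < 3" "Suc t < a r" "q < 2 * n" "x = top_end n (cell r (Suc t)) q" "y = bot_end n (cell r t) q"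
  | (inner) r t where "r < 3" "t < a r" "(x, y) \<in> inner_arcs n (cell r t)"
  | (frame) r b i where "r < 3" "i < n" "x = port' n (Lab r b True i)" "y = port' n (Lab ((r + 1) mod 3) b False i)"
proof -
 consider z where "z \<in> labels n" "x = nxt (crossings n a) (port n) z" "y = nxt (crossings n a) (port n) (partner initial z)"
  | r q where "r < 3" "q < 2 * n" "x = endpoint n a r True q" "y = port n (pos n r q)"
  | r t q where "r < 3" "Suc t < a r" "q < 2 * n" "x = top_end n (cell r (Suc t)) q" "y = bot_end n (cell r t) q"
  | r t where "r < 3" "t < a r" "(x, y) \<in> inner_arcs n (cell r t)"
  | r b i where "r < 3" "i < n" "x = port' n (Lab r b True i)" "y = port' n (Lab ((r + 1) mod 3) b False i)"
  using assms unfolding network_def wires_crossings st_def half_frame_def by blast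
 then show ?thesis
 proof cases
  case (1 z)
  then obtain r b s i where z: "z = Lab r b s i" "r < 3" "i < n" by (auto elim: labels_cases)
  have *: "pos n r (place_of n s i) = Lab r True s i" "place_of n s i < 2 * n" using z by (cases s; auto simp: place_of_def pos_def)+
  have "nxt (crossings n a) (port n) (Lab r True s i) = endpoint n a r False (place_of n s i)"
   using nxt_crossings(1)[OF z(2) *(2), of "port n"] by (simp add: *(1))
  then show ?thesis
   using 1 z port[of r i False s] port_rev[of r i False s] by (cases b) (simp_all add: nxt_crossings(2))
 next
  case (2 r q)
  have "\<exists>s i. q = place_of n s i \<and> i < n \<and> pos n r q = Lab r True s i"
  proof (cases "q < n")
   case True
   then show ?thesis by (intro exI[of _ False] exI[of _ "n - 1 - q"]) (auto simp: place_of_def pos_def)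
  next
   case False
   then show ?thesis using 2(2) by (intro exI[of _ True] exI[of _ "q - n"]) (auto simp: place_of_def pos_def)
  qed
  then obtain s i where "q = place_of n s i" "i < n" "pos n r q = Lab r True s i" by blast
  then show ?thesis using 2 port[of r i True s] by simp
 qed (use link inner frame in blast)+
qed

lemma ends_inner: "r < 3 ==> top_end n (cell r t) q \<in> inner_pts" "r < 3 ==> bot_end n (cell r t) q \<in> inner_pts"
 "r < 3 ==> endpoint n a r b q \<in> inner_pts"
 by (auto simp: inner_pts_def top_end_def bot_end_def endpoint_def cell_def)

lemma collapse_inner: "p \<in> inner_pts ==> collapse n a p = p"
 by (auto simp: inner_pts_def collapse_def)

lemma collapse_port: "collapse n a (port n (Lab r b s i)) =
  (if r = 0 \<and> b \<and> s then JWpt (Bot (n - 1 - i)) else endpoint n a r b (place_of n s i))"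
 by (auto simp: collapse_def port_def)

lemma collapse_port': "collapse n a (port' n (Lab r b s i)) =
  (if r = 0 \<and> b \<and> s then JWpt (Top (n - 1 - i)) else endpoint n a r b (place_of n s i))"
 by (auto simp: port'_def collapse_port) (simp add: collapse_def)

lemma inner_arcs_inner: "(x, y) \<in> inner_arcs n (cell r t) ==> r < 3 ==> x \<in> inner_pts \<and> y \<in> inner_pts"
 by (auto simp: inner_pts_def inner_arcs_def cell_def)

lemma diagram_cases:
 assumes "(x, y) \<in> diagram n a"
 obtains (inner) r t where "r < 3" "t < a r" "(x, y) \<in> inner_arcs n (cell r t)"
  | (link) r t q where "r < 3" "Suc t < a r" "q < 2 * n" "y = top_end n (cell r (Suc t)) q" "x = bot_end n (cell r t) q"
  | (frame) r b i where "r < 3" "i < n" "\<not> (r = 0 \<and> b)" "x = endpoint n a r b (place_of n True i)"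
    "y = endpoint n a ((r + 1) mod 3) b (place_of n False i)"
  | (jw_bot) i where "i < n" "x = endpoint n a 0 True (place_of n True i)" "y = JWpt (Bot (n - 1 - i))"
  | (jw_top) i where "i < n" "x = JWpt (Top (n - 1 - i))" "y = endpoint n a 1 True (place_of n False i)"
 using assms unfolding diagram_def link_arcs_def place_of_def by (simp only: if_True if_False) blast

lemma diagram_edges:
 "r < 3 ==> i < n ==> \<not> (r = 0 \<and> b) ==>
  (endpoint n a r b (place_of n True i), endpoint n a ((r + 1) mod 3) b (place_of n False i)) \<in> diagram n a"
 "i < n ==> (endpoint n a 0 True (place_of n True i), JWpt (Bot (n - 1 - i))) \<in> diagram n a"
 "i < n ==> (JWpt (Top (n - 1 - i)), endpoint n a 1 True (place_of n False i)) \<in> diagram n a"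
 unfolding diagram_def link_arcs_def place_of_def by (simp only: if_True if_False, blast)+

lemma endpoint_diagram:
 assumes "r < 3" "i < n"
 shows "endpoint n a r b (place_of n s i) \<in> Field (diagram n a)"
proof (cases s)
 case True
 then show ?thesis
  using diagram_edges(1)[OF assms, of b] diagram_edges(2)[OF assms(2)] by (cases "r = 0 \<and> b") (auto intro: FieldI1)
next
 case False
 show ?thesis
 proof (cases "r = 1 \<and> b")
  case True
  then show ?thesis using False diagram_edges(3)[OF assms(2)] by (auto intro: FieldI2)
 next
  case 2: False
  have "((r + 2) mod 3 + 1) mod 3 = r" "(r + 2) mod 3 < 3" "\<not> ((r + 2) mod 3 = 0 \<and> b)"
  proof -
   show "((r + 2) mod 3 + 1) mod 3 = r" "(r + 2) mod 3 < 3" using assms(1) by presburger+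
   have "(r + 2) mod 3 = 0 \<longrightarrow> r = 1" using assms(1) by presburger
   then show "\<not> ((r + 2) mod 3 = 0 \<and> b)" using 2 by metis
  qed
  then show ?thesis using False diagram_edges(1)[OF _ assms(2), of "(r + 2) mod 3" b] by (auto intro: FieldI2)
 qed
qed

lemma frame_network:
 "r < 3 ==> i < n ==> (port' n (Lab r b True i), port' n (Lab ((r + 1) mod 3) b False i)) \<in> network n a"
proof -
 assume "r < 3" "i < n"
 then have "(Lab r b True i, Lab ((r + 1) mod 3) b False i) \<in> half_frame n" by (auto simp: half_frame_def)
 from imageI[OF this, of "map_prod (port' n) (port' n)"] show ?thesis by (simp add: network_def)
qed

lemma link_network:
 "r < 3 ==> Suc t < a r ==> q < 2 * n ==> (top_end n (cell r (Suc t)) q, bot_end n (cell r t) q) \<in> network n a"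
 unfolding network_def wires_crossings by blast

lemma inner_network: "r < 3 ==> t < a r ==> e \<in> inner_arcs n (cell r t) ==> e \<in> network n a"
 unfolding network_def wires_crossings by blast

lemma port_network:
 assumes "r < 3" "i < n"
 shows "(endpoint n a r b (place_of n s i), port n (Lab r b s i)) \<in> conn (network n a)"
  and "(port n (Lab r b s i), endpoint n a r b (place_of n s i)) \<in> conn (network n a)"
  and "endpoint n a r b (place_of n s i) \<in> Field (network n a)" "port n (Lab r b s i) \<in> Field (network n a)"
proof -
 have "(endpoint n a r b (place_of n s i), port n (Lab r b s i)) \<in> network n a
   \<or> (port n (Lab r b s i), endpoint n a r b (place_of n s i)) \<in> network n a"
  using port_conn[OF assms, of b s] by auto
 then show "(endpoint n a r b (place_of n s i), port n (Lab r b s i)) \<in> conn (network n a)"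
  and "(port n (Lab r b s i), endpoint n a r b (place_of n s i)) \<in> conn (network n a)"
  and "endpoint n a r b (place_of n s i) \<in> Field (network n a)" "port n (Lab r b s i) \<in> Field (network n a)"
  by (auto intro: conn_edge FieldI1 FieldI2)
qed

lemma diagram_conn_network:
 assumes "(x, y) \<in> diagram n a"
 shows "(x, y) \<in> conn (network n a) \<and> x \<in> Field (network n a) \<and> y \<in> Field (network n a)"
 using assms
proof (cases rule: diagram_cases)
 case (inner r t)
 then have "(x, y) \<in> network n a" by (blast intro: inner_network)
 then show ?thesis by (auto intro: conn_edge FieldI1 FieldI2)
next
 case (link r t q)
 then have "(y, x) \<in> network n a" by (auto intro: link_network)
 then show ?thesis by (auto intro: conn_edge FieldI1 FieldI2)
next
 case (frame r b i)
 have m: "(r + 1) mod 3 < 3" by simp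
 have "(port n (Lab r b True i), port n (Lab ((r + 1) mod 3) b False i)) \<in> conn (network n a)"
  using frame_network[OF frame(1,2), of b] frame(3) by (auto simp: port_special(3) intro: conn_edge)
 from conn_trans[OF port_network(1)[OF frame(1,2), of b True] conn_trans[OF this port_network(2)[OF m frame(2)]]]
 show ?thesis using port_network(3)[OF frame(1,2)] port_network(3)[OF m frame(2)] frame by simp
next
 case (jw_bot i)
 then show ?thesis using port_network[of 0 i True True] by (simp add: port_special)
next
 case (jw_top i)
 have e: "(JWpt (Top (n - 1 - i)), port n (Lab 1 True False i)) \<in> network n a"
  using frame_network[of 0 i True] jw_top by (simp add: port_special)
 from conn_trans[OF conn_edge(1)[OF this] port_network(2)[of 1 i True False]]
 show ?thesis using port_network(3)[of 1 i True False] jw_top FieldI1[OF e] by simp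
qed

lemma network_conn_diagram:
 assumes "(x, y) \<in> network n a"
 shows "(collapse n a x, collapse n a y) \<in> conn (diagram n a) \<and> collapse n a x \<in> Field (diagram n a) \<and> collapse n a y \<in> Field (diagram n a)"
proof -
 have ports: "(endpoint n a r b (place_of n s i), collapse n a (port n (Lab r b s i))) \<in> conn (diagram n a)
  \<and> (collapse n a (port n (Lab r b s i)), endpoint n a r b (place_of n s i)) \<in> conn (diagram n a)
  \<and> collapse n a (port n (Lab r b s i)) \<in> Field (diagram n a)" if "r < 3" "i < n" for r b s i
  using diagram_edges(2)[OF that(2)] endpoint_diagram[OF that, of b s]
  by (auto simp: collapse_port intro: conn_edge FieldI1 FieldI2)
 show ?thesis
  using assms
 proof (cases rule: network_cases)
  case (port r b s i)
  then show ?thesis using ports[of r i b s] endpoint_diagram[of r i b s] by (simp add: collapse_inner ends_inner)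
 next
  case (port_rev r b s i)
  then show ?thesis using ports[of r i b s] endpoint_diagram[of r i b s] by (simp add: collapse_inner ends_inner)
 next
  case (link r t q)
  then have "(y, x) \<in> diagram n a" unfolding diagram_def link_arcs_def by blast
  then show ?thesis using link by (auto simp: collapse_inner ends_inner intro: conn_edge FieldI1 FieldI2)
 next
  case (inner r t)
  then have "(x, y) \<in> diagram n a" unfolding diagram_def by blast
  then show ?thesis using inner inner_arcs_inner[OF inner(3,1)] by (auto simp: collapse_inner intro: conn_edge FieldI1 FieldI2)
 next
  case (frame r b i)
  have m: "(r + 1) mod 3 < 3" by simp
  have "(collapse n a x, collapse n a y) \<in> diagram n a"
  proof (cases "r = 0 \<and> b")
   case True
   then show ?thesis using frame diagram_edges(3)[OF frame(2)] by (simp add: collapse_port')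
  next
   case False
   then show ?thesis using frame diagram_edges(1)[OF frame(1,2) False] by (auto simp: collapse_port')
  qed
  then show ?thesis by (auto intro: conn_edge FieldI1 FieldI2)
 qed
qed

lemma collapse_conn:
 assumes "x \<in> Field (network n a)"
 shows "(collapse n a x, x) \<in> conn (network n a)"
proof -
 have port: "(collapse n a (port n (Lab r b s i)), port n (Lab r b s i)) \<in> conn (network n a)" if "r < 3" "i < n" for r b s i
  using port_network(1)[OF that, of b s] by (auto simp: collapse_port port_special)
 have port': "(collapse n a (port' n (Lab r b s i)), port' n (Lab r b s i)) \<in> conn (network n a)" if "r < 3" "i < n" for r b s i
  using port_network(1)[OF that, of b s] by (auto simp: collapse_port' port_special)
 have "(collapse n a x, x) \<in> conn (network n a) \<and> (collapse n a y, y) \<in> conn (network n a)" if "(x, y) \<in> network n a" for x y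
  using that
 proof (cases rule: network_cases)
  case (inner r t)
  then show ?thesis using inner_arcs_inner[OF inner(3,1)] by (simp add: collapse_inner)
 next
  case (frame r b i)
  then show ?thesis using port'[OF frame(1,2)] port'[of "(r + 1) mod 3" i] by simp
 qed (simp_all add: collapse_inner ends_inner port)
 then show ?thesis using assms by (auto simp: Field_def)
qed

lemma diagram_inner: "(x, y) \<in> diagram n a ==> x \<in> inner_pts \<and> y \<in> inner_pts"
 by (erule diagram_cases, blast dest: inner_arcs_inner) (simp_all add: ends_inner inner_pts_def[THEN eqset_imp_iff, of "JWpt _"])

text \<open>The network is a subdivision of the diagram. The other arcs \<open>H\<close> end only at
  points that \<open>collapse\<close> fixes, so the contraction does not disturb them.\<close>

lemma n_components_diagram:
 assumes "Field H \<subseteq> inner_pts"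
 shows "nc (diagram n a \<union> H) = nc (network n a \<union> H)"
proof (rule n_components_retract[where f = "collapse n a" and g = id])
 have H: "collapse n a x = x" if "x \<in> Field H" for x using that assms by (auto intro: collapse_inner)
 have HE: "collapse n a x = x" "collapse n a y = y" if "(x, y) \<in> H" for x y
  using that H[OF FieldI1] H[OF FieldI2] by auto
 have N: "collapse n a x \<in> Field (diagram n a)" if "x \<in> Field (network n a)" for x
  using that network_conn_diagram by (auto simp: Field_def[of "network n a"])
 have D: "x \<in> Field (network n a)" if "x \<in> Field (diagram n a)" for x
  using that diagram_conn_network by (auto simp: Field_def[of "diagram n a"])
 have DI: "collapse n a x = x" if "x \<in> Field (diagram n a)" for x
  using that diagram_inner collapse_inner by (auto simp: Field_def[of "diagram n a"])
 show "collapse n a x \<in> Field (diagram n a \<union> H)" if "x \<in> Field (network n a \<union> H)" for x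
  using that N H by (auto simp: Field_Un)
 show "(collapse n a x, collapse n a y) \<in> conn (diagram n a \<union> H)" if "(x, y) \<in> network n a \<union> H" for x y
  using that network_conn_diagram[of x y] HE[of x y] by (auto intro: conn_UnI conn_edge)
 show "id x \<in> Field (network n a \<union> H)" if "x \<in> Field (diagram n a \<union> H)" for x
  using that D by (auto simp: Field_Un)
 show "(id x, id y) \<in> conn (network n a \<union> H)" if "(x, y) \<in> diagram n a \<union> H" for x y
  using that diagram_conn_network[of x y] by (auto intro: conn_UnI conn_edge)
 show "(id (collapse n a x), x) \<in> conn (network n a \<union> H)" if "x \<in> Field (network n a \<union> H)" for x
  using that collapse_conn H by (auto simp: Field_Un intro: conn_UnI)
 show "(collapse n a (id x), x) \<in> conn (diagram n a \<union> H)" if "x \<in> Field (diagram n a \<union> H)" for x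
  using that DI H by (auto simp: Field_Un)
qed

end

section \<open>The idempotent and the frame\<close>

lemma half_frame_labels: "half_frame n \<subseteq> labels n \<times> labels n"
 by (auto simp: half_frame_def labels_def)

lemma finite_half_frame: "finite (half_frame n)"
 by (rule finite_subset[OF half_frame_labels]) (simp add: finite_labels)

lemma half_frame_closure:
 assumes s: "closed_state (labels n) s" and c: "inj_on c (labels n)"
 shows "loop_val ^ nc (st (labels n) c s \<union> map_prod c c ` half_frame n) = closure n s"
proof -
 have F: "half_frame n \<union> (half_frame n)\<inverse> = frame_edges n \<union> (frame_edges n)\<inverse>"
 proof -
  have "(Lab r b True i, Lab ((r + 1) mod 3) b False i) \<in> frame_edges n" if "r < 3" "i < n" for r b i
   unfolding frame_edges_def by (rule image_eqI[of _ _ "Lab r b True i"]) (use that in \<open>simp_all add: labels_def\<close>)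
  then have h: "half_frame n \<subseteq> frame_edges n" by (auto simp: half_frame_def)
  have "(x, frame x) \<in> half_frame n \<union> (half_frame n)\<inverse>" if x: "x \<in> labels n" for x
  proof -
   obtain r b s i where l: "x = Lab r b s i" "r < 3" "i < n" using x by (cases x) (auto simp: labels_def)
   show ?thesis
   proof (cases s)
    case True
    then show ?thesis using l by (auto simp: half_frame_def)
   next
    case False
    have "((r + 2) mod 3 + 1) mod 3 = r" "(r + 2) mod 3 < 3" using l(2) by presburger+
    moreover have "(Lab p b True i, Lab ((p + 1) mod 3) b False i) \<in> half_frame n" if "p < 3" for p
     using that l(3) by (auto simp: half_frame_def)
    ultimately have "(Lab ((r + 2) mod 3) b True i, Lab r b False i) \<in> half_frame n" by metis
    then show ?thesis using l False by simp
   qed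
  qed
  then have "frame_edges n \<subseteq> half_frame n \<union> (half_frame n)\<inverse>" by (auto simp only: frame_edges_def)
  with h show ?thesis by blast
 qed
 have Fh: "Field (half_frame n) \<subseteq> labels n"
  by (auto simp: half_frame_def Field_def labels_def)
 have "st (labels n) c s \<union> map_prod c c ` half_frame n = map_prod c c ` (st (labels n) id s \<union> half_frame n)"
  by (simp add: st_def image_Un image_image)
 also have "nc ... = nc (st (labels n) id s \<union> half_frame n)"
  by (rule n_components_image, rule inj_on_subset[OF c]) (use Fh Field_st[OF s, of id] in \<open>auto simp: Field_Un\<close>)
 also have "... = nc (st (labels n) id s \<union> frame_edges n)"
  by (rule n_components_sym) (use F in \<open>simp add: converse_Un, blast\<close>)
 finally show ?thesis
  using closure_eq[OF finite_labels s order_refl] by simp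
qed

lemma inj_port: "inj_on (port n) (labels n)"
 by (rule inj_onI, case_tac x, case_tac y) (auto simp: port_def labels_def of_bool_def split: if_splits)

lemma inj_port': "inj_on (port' n) (labels n)"
 by (rule inj_onI, case_tac x, case_tac y) (auto simp: port'_def port_def labels_def of_bool_def split: if_splits)

definition jw_box :: "nat => (lser \<times> (pt \<times> pt) set) list" where
 "jw_box n = map (\<lambda>(c, M). (c, map_prod JWpt JWpt ` M)) (jw n)"

text \<open>Bottom point \<open>j\<close> of the idempotent meets strand \<open>n - 1 - j\<close>.
  The reversed sequence is continued injectively beyond \<open>n\<close>, and
  \<open>jw_op_flip\<close> removes the reversal.\<close>

lemma jw_strands:
 obtains y where "inj y" "\<And>j. j < n ==> y j = Lab 0 True True (n - 1 - j)" "jw_op y n = jw_op (Lab 0 True True) n"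
proof
 let ?y = "\<lambda>j. if j < n then Lab 0 True True (n - 1 - j) else Lab 0 True True j"
 show "inj ?y" by (rule injI) (auto split: if_splits)
 have "jw_op ?y n = jw_op (\<lambda>i. Lab 0 True True (n - 1 - i)) n" by (rule jw_op_cong) simp
 then show "jw_op ?y n = jw_op (Lab 0 True True) n" using jw_op_flip[OF inj_Lab] by simp
qed simp

lemma local_jw_op: "local_op (labels n) (jw_op (Lab 0 True True) n)"
proof -
 obtain y where y: "inj y" "\<And>j. j < n ==> y j = Lab 0 True True (n - 1 - j)" "jw_op y n = jw_op (Lab 0 True True) n"
  by (rule jw_strands[of n]) blast
 have "y ` {..<n} \<subseteq> labels n" by (auto simp: y(2) labels_def)
 then show ?thesis using represents_jw[OF y(1), of n] y(3) by (simp add: represents_def)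
qed

lemma seval_jw_box:
 assumes s: "closed_state (labels n) s"
 shows "seval [jw_box n] (st (labels n) (port n) s \<union> map_prod (port' n) (port' n) ` half_frame n)
  = ap (jw_op (Lab 0 True True) n) (closure n) s"
proof -
 obtain y where y: "inj y" "\<And>j. j < n ==> y j = Lab 0 True True (n - 1 - j)" "jw_op y n = jw_op (Lab 0 True True) n"
  by (rule jw_strands[of n]) blast
 let ?K = "map_prod (port' n) (port' n) ` half_frame n"
 have FK: "Field ?K = port' n ` Field (half_frame n)" by (rule Field_image)
 have bot: "port' n x \<noteq> JWpt (Bot j)" for x j by (simp add: port'_def port_def)
 have top: "port n x \<noteq> JWpt (Top j)" for x j by (simp add: port_def)
 have at: "attachable y n (labels n) s (port n) (port' n) JWpt ?K"
  unfolding attachable_def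
 proof (intro conjI allI impI ballI)
  fix j assume j: "j < n"
  show "port n (y j) = JWpt (Bot j)" "port' n (y j) = JWpt (Top j)"
   using j y(2)[OF j] by (simp_all add: port_special)
  have "(Lab 0 True True (n - 1 - j), Lab 1 True False (n - 1 - j)) \<in> half_frame n"
   using j unfolding half_frame_def by force
  from FieldI1[OF this] show "JWpt (Top j) \<in> Field ?K"
   unfolding FK using j by (force simp: port'_def intro!: image_eqI)
 next
  fix z assume z: "z \<in> labels n - y ` {..<n}"
  obtain r b s i where l: "z = Lab r b s i" "i < n" using z by (cases z) (auto simp: labels_def)
  have "\<not> (r = 0 \<and> b \<and> s)"
  proof
   assume "r = 0 \<and> b \<and> s"
   then have "z = y (n - 1 - i)" "n - 1 - i < n" using l y(2)[of "n - 1 - i"] by auto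
   then show False using z by blast
  qed
  then show "port' n z = port n z" using l by (simp add: port_special)
 next
  show "JWpt (Bot j) \<notin> Field ?K" "JWpt (Top j) \<notin> port n ` labels n" for j
   unfolding FK using bot[of _ j, symmetric] top[of _ j, symmetric] by auto
  show "y ` {..<n} \<subseteq> labels n" by (auto simp: y(2) labels_def)
 qed (simp_all add: s finite_labels inj_port finite_half_frame, simp add: inj_on_def)
 have "seval [jw_box n] (st (labels n) (port n) s \<union> ?K)
   = (\<Sum>(a, M)\<leftarrow>jw n. a * loop_val ^ nc (st (labels n) (port n) s \<union> map_prod JWpt JWpt ` M \<union> ?K))"
  by (simp add: jw_box_def o_def split_def Un_ac)
 also have "... = ap (jw_op y n) (\<lambda>s. loop_val ^ nc (st (labels n) (port' n) s \<union> ?K)) s"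
  by (rule representsD[OF represents_jw[OF y(1)] at])
 also have "... = ap (jw_op (Lab 0 True True) n) (closure n) s"
  unfolding y(3) by (rule local_opD[OF local_jw_op _ s]) (use half_frame_closure[OF _ inj_port'] in blast)
 finally show ?thesis .
qed

lemma placed_box_place: "placed_box (place n ((r, t), h, v)) = cabled_boxes n (Some ((r, t), h, v))"
 by (simp add: cabled_boxes_def cell_def)

text \<open>A state sum does not depend on the order of its boxes, so it can be evaluated in the
  order of processing: the crossings of each region from the bottom upwards, then the idempotent.
  What remains is the frame, whose loops \<open>closure\<close> counts.\<close>

theorem coloured_bracket_pretzel:
 assumes a: "\<And>r. r < 3 ==> 0 < a r"
 shows "coloured_bracket n (pretzel_crossings a) (pretzel_edges a) pretzel_jw_edge
  = bracket n (closure_functional.twisted n a * closure_functional.proj n (0, True, True))"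
proof -
 let ?bs = "crossings n a" and ?V = "labels n"
 let ?K = "map_prod (port' n) (port' n) ` half_frame n"
 let ?js = "map Some (crossing_ix n a) @ [None]"
 have bs: "?bs = map (place n) (crossing_ix n a)" by (rule crossings_def)
 have ix: "r < 3" "h < n" "v < n" if "((r, t), h, v) \<in> set (crossing_ix n a)" for r t h v
  using that by (auto simp: crossing_ix(2) pretzel_crossings_def)
 have boxes: "map (cabled_boxes n) ?js = map placed_box ?bs @ [jw_box n]"
 proof -
  have "cabled_boxes n (Some i) = placed_box (place n i)" for i
   by (cases i) (auto simp: placed_box_place simp del: place.simps placed_box.simps)
  moreover have "cabled_boxes n None = jw_box n"
   by (auto simp: cabled_boxes_def jw_box_def map_prod_def)
  ultimately show ?thesis by (simp add: bs)
 qed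
 have wf: "finite M \<and> Field M \<subseteq> strand_pts n" if "(c, M) \<in> set (jw n)" for c M
 proof -
  have "Field M \<subseteq> strand_pts n" using represents_jw[OF inj_Lab, of 0 True True n] that by (auto simp: represents_def)
  then show ?thesis using Field_finite by blast
 qed
 have slots: "slots b \<subseteq> {Grid (r, t) h v i | r t h v i. r < 3}" if "b \<in> set ?bs" for b
  using that ix unfolding bs by (auto simp: cell_def)
 then have all_slots: "all_slots ?bs \<subseteq> {Grid (r, t) h v i | r t h v i. r < 3}"
  unfolding all_slots_def by blast
 have slots_inner: "slots b \<subseteq> inner_pts" if "b \<in> set ?bs" for b
  using slots[OF that] by (auto simp: inner_pts_def)
 have port: "port n x \<notin> {Grid (r, t) h v i | r t h v i. r < 3}" "port' n x \<notin> {Grid (r, t) h v i | r t h v i. r < 3}" for x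
  by (auto simp: port_def port'_def)
 have proper: "list_all (proper ?V) ?bs"
  unfolding bs list_all_iff
 proof
  fix b assume "b \<in> set (map (place n) (crossing_ix n a))"
  then obtain r t h v where b: "b = place n ((r, t), h, v)" "((r, t), h, v) \<in> set (crossing_ix n a)" by auto
  have "pos n r (h + v) \<in> ?V" "pos n r (Suc (h + v)) \<in> ?V"
   using ix[OF b(2)] by (auto simp: pos_def labels_def)
  moreover have "pos n r (h + v) \<noteq> pos n r (Suc (h + v))" using inj_pos[of n r] by (simp add: inj_eq)
  ultimately show "proper ?V b" by (simp add: b(1) cell_def)
 qed
 have "coloured_bracket n (pretzel_crossings a) (pretzel_edges a) pretzel_jw_edge
   = skein_eval (set ?js) (cabled_boxes n) (diagram n a)"
  unfolding coloured_bracket_def diagram_eq by (simp add: crossing_ix(2))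
 also have "... = seval (map placed_box ?bs @ [jw_box n]) (diagram n a)"
  unfolding boxes[symmetric] by (rule skein_eval_seval) (simp add: distinct_map crossing_ix(1))
 also have "... = loop_val ^ 0 * seval (map placed_box ?bs @ [jw_box n]) (network n a)"
 proof (rule seval_cong)
  show "nc (diagram n a \<union> H) = 0 + nc (network n a \<union> H)" if "Field H \<subseteq> inner_pts" for H
   using n_components_diagram[OF a that] by simp
  show "finite M \<and> Field M \<subseteq> inner_pts" if B: "B \<in> set (map placed_box ?bs @ [jw_box n])" and M: "(c, M) \<in> set B" for B c M
  proof (cases "B = jw_box n")
   case True
   then show ?thesis using M wf by (fastforce simp: jw_box_def Field_image inner_pts_def)
  next
   case False
   then obtain b where b: "b \<in> set ?bs" "B = placed_box b" using B by auto
   then show ?thesis using placed_box_Field[of c M b] M slots_inner[OF b(1)] by blast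
  qed
 qed
 also have "... = ap (placed_ops ?bs) (\<lambda>s. seval [jw_box n] (st ?V (port n) s \<union> ?K)) initial"
  unfolding network_def power_0 mult_1
 proof (rule seval_crossings[OF finite_labels inj_port])
  show "finite ?K"
   by (intro finite_imageI finite_half_frame)
  show "list_all (proper ?V) ?bs" by (rule proper)
  show "all_slots ?bs \<inter> (port n ` ?V \<union> Field ?K) = {}"
   using all_slots port unfolding Field_image by blast
  show "separated ?bs" unfolding bs by (rule separated_place[OF crossing_ix(1)])
  show "finite M \<and> Field M \<inter> all_slots ?bs = {}" if "B \<in> set [jw_box n]" "(d, M) \<in> set B" for B d M
  proof -
   from that have m: "(d, M) \<in> set (jw_box n)" by simp
   obtain N where N: "(d, N) \<in> set (jw n)" "M = map_prod JWpt JWpt ` N" using m by (auto simp: jw_box_def)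
   then show ?thesis using wf[OF N(1)] all_slots by (auto simp: Field_image)
  qed
  show "closed_state ?V initial" by (rule closed_initial)
 qed
 also have "... = ap (placed_ops ?bs) (ap (jw_op (Lab 0 True True) n) (closure n)) initial"
  by (rule local_opD[OF local_placed_ops[OF proper] _ closed_initial]) (use seval_jw_box in blast)
 also have "placed_ops ?bs = twisted n a"
 proof -
  have tower: "placed_ops (tower (pos n r) (cell r) n T) = col n r ^ T" for r T
  proof -
   have ls: "map (\<lambda>i. pos n r (n - Suc i)) [0..<n] = map (Lab r True False) [0..<n]"
    and rs: "map (\<lambda>v. pos n r (n + v)) [0..<n] = map (Lab r True True) [0..<n]"
    by (auto simp: pos_def)
   show ?thesis unfolding placed_ops_tower ls rs col_def ..
  qed
  show ?thesis unfolding crossings_towers placed_ops_append twisted_def tower mult.assoc ..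
 qed
 finally show ?thesis by (simp add: bracket_def proj_def)
qed

section \<open>Partition identities\<close>

lemma gauss_fps_rec: "gauss fps_X (Suc n) (Suc k) = fps_X ^ Suc k * gauss fps_X n (Suc k) + gauss fps_X n k"
 by (rule gauss_Suc)

lemma qpoch_simps [simp]: "qpoch 0 = 1" "qpoch (Suc m) = qpoch m * (1 - fps_X ^ Suc m)"
 by (simp_all add: qpoch_def)

lemma qpoch_nth_0 [simp]: "fps_nth (qpoch m) 0 = 1"
 by (induction m) simp_all

lemma qpoch_nz [simp]: "qpoch m \<noteq> 0"
 using qpoch_nth_0[of m] by (metis fps_zero_nth zero_neq_one)

abbreviation iq :: "nat => rat fps" where
 "iq m \<equiv> inverse (qpoch m)"

lemma iq_qpoch [simp]: "iq m * qpoch m = 1" "qpoch m * iq m = 1"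
 using inverse_mult_eq_1[of "qpoch m"] by (simp_all add: mult.commute)

lemma iq_Suc: "iq m = iq (Suc m) * (1 - fps_X ^ Suc m)"
proof -
 have "iq m = iq m * (qpoch (Suc m) * iq (Suc m))" by (simp only: iq_qpoch mult_1_right)
 also have "... = (iq m * qpoch m) * (1 - fps_X ^ Suc m) * iq (Suc m)" by (simp only: qpoch_simps mult_ac)
 finally show ?thesis by (simp only: iq_qpoch mult_1_left mult.commute)
qed

lemma gauss_qpoch: "k \<le> n ==> gauss fps_X n k * (qpoch k * qpoch (n - k)) = qpoch n"
proof (induction n arbitrary: k)
 case (Suc n)
 show ?case
 proof (cases k)
  case (Suc j)
  then have j: "j \<le> n" using Suc.prems by simp
  have 1: "gauss fps_X n (Suc j) * (qpoch (Suc j) * qpoch (n - j)) = qpoch n * (1 - fps_X ^ (n - j))"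
  proof (cases "j = n")
   case False
   then have "n - j = Suc (n - Suc j)" "Suc j \<le> n" using j by auto
   then show ?thesis using Suc.IH[of "Suc j"] by (simp add: mult_ac)
  qed (simp add: gauss_eq_0)
  have "gauss fps_X (Suc n) (Suc j) * (qpoch (Suc j) * qpoch (n - j))
   = fps_X ^ Suc j * (gauss fps_X n (Suc j) * (qpoch (Suc j) * qpoch (n - j)))
    + gauss fps_X n j * (qpoch j * qpoch (n - j)) * (1 - fps_X ^ Suc j)"
  proof -
   have "(x * g + h) * ((p * (1 - x)) * r) = x * (g * ((p * (1 - x)) * r)) + h * (p * r) * (1 - x)" for x g h p r :: "rat fps"
    by (simp add: algebra_simps)
   then show ?thesis unfolding gauss_fps_rec qpoch_simps .
  qed
  also have "... = qpoch n * (fps_X ^ Suc j * (1 - fps_X ^ (n - j)) + (1 - fps_X ^ Suc j))"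
   unfolding 1 Suc.IH[OF j] by (simp add: algebra_simps)
  also have "fps_X ^ Suc j * (1 - fps_X ^ (n - j)) + (1 - fps_X ^ Suc j) = (1 - fps_X ^ Suc n :: rat fps)"
  proof -
   have "Suc n = Suc j + (n - j)" using j by simp
   then have e: "fps_X ^ Suc n = fps_X ^ Suc j * (fps_X ^ (n - j) :: rat fps)" by (metis power_add)
   have "x * (1 - y) + (1 - x) = 1 - x * y" for x y :: "rat fps" by (simp add: algebra_simps)
   then show ?thesis unfolding e .
  qed
  finally show ?thesis using \<open>k = Suc j\<close> by (simp only: diff_Suc_Suc qpoch_simps)
 qed simp
qed (simp add: gauss_eq_0)

lemma gauss_eq: "k \<le> n ==> gauss fps_X n k = qpoch n * iq k * iq (n - k)"
proof -
 assume "k \<le> n"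
 have "qpoch n * iq k * iq (n - k) = gauss fps_X n k * ((qpoch k * iq k) * (qpoch (n - k) * iq (n - k)))"
  unfolding gauss_qpoch[OF \<open>k \<le> n\<close>, symmetric] by (simp only: mult_ac)
 then show ?thesis by simp
qed

text \<open>\<open>t\<close> over 2, the exponent in the q-binomial theorem.\<close>

primrec tri :: "nat => nat" where
 "tri 0 = 0"
| "tri (Suc t) = tri t + t"

lemma tri_add: "tri (t + j) = tri t + tri j + t * j"
 by (induction j) simp_all

lemma tri_square: "tri t + tri t + t = t * t"
 by (induction t) simp_all

text \<open>The q-Pascal rule in summed form; it reduces the inductions for the q-binomial theorem,
  \<open>gauss_falling_sum\<close> and \<open>durfee_sum\<close> to comparing summands.\<close>

lemma sum_gauss_Suc:
 fixes f :: "nat => rat fps"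
 shows "(\<Sum>j\<le>Suc m. f j * gauss fps_X (Suc m) j) = (\<Sum>j\<le>m. (f j * fps_X ^ j + f (Suc j)) * gauss fps_X m j)"
proof -
 have "(\<Sum>j\<le>Suc m. f j * gauss fps_X (Suc m) j) = f 0 + (\<Sum>j\<le>m. f (Suc j) * gauss fps_X (Suc m) (Suc j))"
  by (subst sum.atMost_Suc_shift) simp
 also have "(\<Sum>j\<le>m. f (Suc j) * gauss fps_X (Suc m) (Suc j))
   = (\<Sum>j\<le>m. f (Suc j) * fps_X ^ Suc j * gauss fps_X m (Suc j)) + (\<Sum>j\<le>m. f (Suc j) * gauss fps_X m j)"
  unfolding gauss_fps_rec by (simp only: distrib_left sum.distrib mult.assoc)
 also have "f 0 + ((\<Sum>j\<le>m. f (Suc j) * fps_X ^ Suc j * gauss fps_X m (Suc j)) + (\<Sum>j\<le>m. f (Suc j) * gauss fps_X m j))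
   = (\<Sum>j\<le>Suc m. f j * fps_X ^ j * gauss fps_X m j) + (\<Sum>j\<le>m. f (Suc j) * gauss fps_X m j)"
  unfolding sum.atMost_Suc_shift[of "\<lambda>j. f j * fps_X ^ j * gauss fps_X m j"] by simp
 also have "(\<Sum>j\<le>Suc m. f j * fps_X ^ j * gauss fps_X m j) = (\<Sum>j\<le>m. f j * fps_X ^ j * gauss fps_X m j)"
  by (simp add: gauss_eq_0)
 finally show ?thesis by (simp only: distrib_right sum.distrib)
qed

lemma q_binomial: "(\<Sum>j\<le>m. (-1) ^ j * fps_X ^ tri j * z ^ j * gauss fps_X m j) = (\<Prod>i<m. 1 - z * fps_X ^ i)"
 for z :: "rat fps"
proof (induction m arbitrary: z)
 case (Suc m)
 have "(\<Sum>j\<le>Suc m. (-1) ^ j * fps_X ^ tri j * z ^ j * gauss fps_X (Suc m) j)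
   = (\<Sum>j\<le>m. (1 - z) * ((-1) ^ j * fps_X ^ tri j * (z * fps_X) ^ j * gauss fps_X m j))"
  unfolding sum_gauss_Suc by (rule sum.cong) (simp_all add: power_add power_mult_distrib algebra_simps)
 also have "... = (1 - z) * (\<Prod>i<m. 1 - z * fps_X * fps_X ^ i)"
  by (simp only: sum_distrib_left[symmetric] Suc.IH)
 also have "... = (\<Prod>i<Suc m. 1 - z * fps_X ^ i)"
  by (subst prod.lessThan_Suc_shift) (simp add: mult.assoc)
 finally show ?case .
qed simp

lemma qpoch_split: "qpoch (t + m) = qpoch t * (\<Prod>i<m. 1 - fps_X ^ Suc t * fps_X ^ i)"
 by (induction m) (simp_all add: mult.assoc flip: power_add power_Suc)

text \<open>Writing \<open>[x, y]\<close> for the Gaussian binomial,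
  \<open>[s, t][r, s] = [r, t][r-t, s-t]\<close>; what remains is the q-binomial theorem at
  \<open>z = q^(t+1)\<close>. This sum arises from two consecutive twists.\<close>

lemma gauss_product_sum:
 "(\<Sum>s\<le>r. (-1) ^ s * fps_X ^ (tri s + s) * gauss fps_X s t * gauss fps_X r s)
  = (-1) ^ t * fps_X ^ (tri t + t) * gauss fps_X r t * (qpoch r * iq t :: rat fps)"
proof (cases "t \<le> r")
 case True
 let ?f = "\<lambda>s. (-1) ^ s * fps_X ^ (tri s + s) * gauss fps_X s t * gauss fps_X r s :: rat fps"
 have "(\<Sum>s\<le>r. ?f s) = (\<Sum>s\<in>{t..r}. ?f s)"
  by (rule sum.mono_neutral_right) (auto simp: gauss_eq_0)
 also have "... = (\<Sum>j\<le>r - t. ?f (t + j))"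
  using True by (intro sum.reindex_bij_witness[where i = "\<lambda>j. t + j" and j = "\<lambda>s. s - t"]) auto
 also have "... = (\<Sum>j\<le>r - t. ((-1) ^ t * fps_X ^ (tri t + t) * gauss fps_X r t)
   * ((-1) ^ j * fps_X ^ tri j * (fps_X ^ Suc t) ^ j * gauss fps_X (r - t) j))"
 proof (rule sum.cong[OF refl])
  fix j assume "j \<in> {..r - t}"
  then have j: "j \<le> r - t" by simp
  have 1: "gauss fps_X (t + j) t = qpoch (t + j) * iq t * iq j" using gauss_eq[of t "t + j"] by simp
  have 2: "gauss fps_X r (t + j) = qpoch r * iq (t + j) * iq (r - t - j)" using gauss_eq[of "t + j" r] True j by simp
  have 3: "gauss fps_X (r - t) j = qpoch (r - t) * iq j * iq (r - t - j)" by (rule gauss_eq[OF j])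
  have 4: "gauss fps_X r t = qpoch r * iq t * iq (r - t)" by (rule gauss_eq[OF True])
  have "gauss fps_X (t + j) t * gauss fps_X r (t + j) = (qpoch (t + j) * iq (t + j)) * (qpoch r * iq t * iq j * iq (r - t - j))"
   unfolding 1 2 by (simp only: mult_ac)
  also have "... = (qpoch (r - t) * iq (r - t)) * (qpoch r * iq t * iq j * iq (r - t - j))" by simp
  also have "... = gauss fps_X r t * gauss fps_X (r - t) j" unfolding 3 4 by (simp only: mult_ac)
  finally have g: "gauss fps_X (t + j) t * gauss fps_X r (t + j) = gauss fps_X r t * (gauss fps_X (r - t) j :: rat fps)" .
  have e: "tri (t + j) + (t + j) = (tri t + t) + (tri j + Suc t * j)" by (simp add: tri_add)
  have "?f (t + j) = (-1) ^ (t + j) * fps_X ^ (tri (t + j) + (t + j)) * (gauss fps_X (t + j) t * gauss fps_X r (t + j))"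
   by (simp only: mult.assoc)
  also have "... = ((-1) ^ t * fps_X ^ (tri t + t) * gauss fps_X r t)
   * ((-1) ^ j * fps_X ^ tri j * (fps_X ^ Suc t) ^ j * gauss fps_X (r - t) j)"
   unfolding g e power_add power_mult by (simp only: mult_ac)
  finally show "?f (t + j) = ((-1) ^ t * fps_X ^ (tri t + t) * gauss fps_X r t)
   * ((-1) ^ j * fps_X ^ tri j * (fps_X ^ Suc t) ^ j * gauss fps_X (r - t) j)" .
 qed
 also have "... = ((-1) ^ t * fps_X ^ (tri t + t) * gauss fps_X r t) * (\<Prod>i<r - t. 1 - fps_X ^ Suc t * fps_X ^ i)"
  by (simp only: sum_distrib_left[symmetric] q_binomial)
 also have "(\<Prod>i<r - t. 1 - fps_X ^ Suc t * fps_X ^ i) = qpoch r * iq t"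
  using qpoch_split[of t "r - t"] True by (simp add: mult_ac)
 finally show ?thesis .
next
 case False
 then show ?thesis by (simp add: gauss_eq_0)
qed

text \<open>The q-falling factorial \<open>(q;q)_s / (q;q)_(s-t)\<close>. For \<open>t > s\<close>
  it vanishes because the factor with \<open>r = s\<close> does.\<close>

definition falling :: "nat => nat => rat fps" where
 "falling s t = (\<Prod>r<t. 1 - fps_X ^ (s - r))"

lemma falling_0: "s < t ==> falling s t = 0"
 unfolding falling_def by (rule prod_zero) (auto intro!: bexI[of _ s])

lemma falling_eq: "t \<le> s ==> falling s t = qpoch s * iq (s - t)"
proof (induction t)
 case (Suc t)
 have "s - t = Suc (s - Suc t)" using Suc.prems by simp
 then have i: "iq (s - Suc t) = iq (s - t) * (1 - fps_X ^ (s - t))"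
  using iq_Suc[of "s - Suc t"] by metis
 show ?case
  unfolding i using Suc by (simp add: falling_def mult.assoc)
qed (simp add: falling_def)

text \<open>The expansion of \<open>x^v\<close> in the products
  \<open>(x - 1)(x - q)...(x - q^(t-1))\<close> with Gaussian coefficients, taken at
  \<open>x = q^s\<close>.\<close>

lemma gauss_falling_sum: "(\<Sum>t\<le>v. (-1) ^ t * fps_X ^ tri t * falling s t * gauss fps_X v t) = fps_X ^ (s * v)"
proof (induction v)
 case (Suc v)
 have "(\<Sum>t\<le>Suc v. (-1) ^ t * fps_X ^ tri t * falling s t * gauss fps_X (Suc v) t)
   = (\<Sum>t\<le>v. fps_X ^ s * ((-1) ^ t * fps_X ^ tri t * falling s t * gauss fps_X v t))"
  unfolding sum_gauss_Suc
 proof (rule sum.cong[OF refl])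
  fix t
  show "((-1) ^ t * fps_X ^ tri t * falling s t * fps_X ^ t + (-1) ^ Suc t * fps_X ^ tri (Suc t) * falling s (Suc t)) * gauss fps_X v t
   = fps_X ^ s * ((-1) ^ t * fps_X ^ tri t * falling s t * gauss fps_X v t)"
  proof (cases "t \<le> s")
   case True
   then have "fps_X ^ s = fps_X ^ t * (fps_X ^ (s - t) :: rat fps)" by (simp flip: power_add)
   then show ?thesis by (simp add: falling_def power_add algebra_simps)
  qed (simp add: falling_0)
 qed
 also have "... = fps_X ^ (s * Suc v)" by (simp only: sum_distrib_left[symmetric] Suc.IH) (simp add: power_add)
 finally show ?case .
qed (simp add: falling_def)

text \<open>Partitions with parts at most \<open>s + a\<close>, sorted by their Durfee rectangle
  with \<open>t\<close> rows and \<open>t + a\<close> columns. To its right there are at most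
  \<open>t\<close> parts of size at most \<open>s - t\<close>, below it parts of size at most
  \<open>t + a\<close>.\<close>

lemma durfee_sum: "(\<Sum>t\<le>s. fps_X ^ (t * (t + a)) * iq (t + a) * gauss fps_X s t) = iq (s + a)"
proof (induction s arbitrary: a)
 case (Suc s)
 have "(\<Sum>t\<le>Suc s. fps_X ^ (t * (t + a)) * iq (t + a) * gauss fps_X (Suc s) t)
   = (\<Sum>t\<le>s. fps_X ^ (t * (t + Suc a)) * iq (t + Suc a) * gauss fps_X s t)"
  unfolding sum_gauss_Suc
 proof (rule sum.cong[OF refl])
  fix t
  have 1: "iq (t + a) = iq (t + Suc a) * (1 - fps_X ^ (t + Suc a))" using iq_Suc[of "t + a"] by simp
  have "Suc t * (Suc t + a) = t * (t + a) + t + (t + Suc a)" "t * (t + Suc a) = t * (t + a) + t" by simp_all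
  then have 2: "fps_X ^ (Suc t * (Suc t + a)) = fps_X ^ (t * (t + a)) * fps_X ^ t * (fps_X ^ (t + Suc a) :: rat fps)"
   and 3: "fps_X ^ (t * (t + Suc a)) = fps_X ^ (t * (t + a)) * (fps_X ^ t :: rat fps)"
   by (metis power_add)+
  have 4: "Suc t + a = t + Suc a" by simp
  have "(x * (i * (1 - y)) * z + x * z * y * i) * g = x * z * i * g" for x y z i g :: "rat fps"
   by (simp add: algebra_simps)
  then show "(fps_X ^ (t * (t + a)) * iq (t + a) * fps_X ^ t + fps_X ^ (Suc t * (Suc t + a)) * iq (Suc t + a)) * gauss fps_X s t
   = fps_X ^ (t * (t + Suc a)) * iq (t + Suc a) * gauss fps_X s t"
   unfolding 2 3 unfolding 4 1 .
 qed
 also have "... = iq (Suc s + a)" using Suc.IH[of "Suc a"] by simp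
 finally show ?case .
qed simp

section \<open>Congruence of power series\<close>

definition eqm :: "nat => rat fps => rat fps => bool" where
 "eqm m f g \<longleftrightarrow> fps_X ^ m dvd f - g"

lemma eqm_refl [simp]: "eqm m f f"
 by (simp add: eqm_def)

lemma eqm_sym: "eqm m f g ==> eqm m g f"
 unfolding eqm_def by (subst dvd_diff_commute)

lemma eqm_trans [trans]: "eqm m f g ==> eqm m g h ==> eqm m f h"
 unfolding eqm_def using dvd_add[of "fps_X ^ m" "f - g" "g - h"] by simp

lemma eqm_mult: "eqm m f g ==> eqm m f' g' ==> eqm m (f * f') (g * g')"
proof -
 assume "eqm m f g" "eqm m f' g'"
 then have "fps_X ^ m dvd (f - g) * f' + g * (f' - g')" unfolding eqm_def by simp
 then show ?thesis unfolding eqm_def by (simp add: algebra_simps)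
qed

lemma eqm_sum: "(\<And>i. i \<in> I ==> eqm m (f i) (g i)) ==> eqm m (sum f I) (sum g I)"
 unfolding eqm_def sum_subtractf[symmetric] by (rule dvd_sum)

lemma eqm_prod: "(\<And>i. i \<in> I ==> eqm m (f i) (g i)) ==> eqm m (prod f I) (prod g I)"
 by (induction I rule: infinite_finite_induct) (simp_all add: eqm_mult)

lemma eqm_mono: "eqm m f g ==> m' \<le> m ==> eqm m' f g"
 unfolding eqm_def using le_imp_power_dvd dvd_trans by blast

lemma eqm_shift: "eqm m f g ==> m' \<le> s + m ==> eqm m' (fps_X ^ s * f) (fps_X ^ s * g)"
proof -
 assume "eqm m f g" "m' \<le> s + m"
 then have "fps_X ^ (s + m) dvd fps_X ^ s * (f - g)" unfolding eqm_def power_add by (intro mult_dvd_mono dvd_refl)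
 then show ?thesis unfolding right_diff_distrib eqm_def[symmetric] using \<open>m' \<le> s + m\<close> by (rule eqm_mono)
qed

lemma eqm_factor: "m \<le> j ==> eqm m (1 - fps_X ^ j) 1"
 unfolding eqm_def by (simp add: le_imp_power_dvd)

lemma eqm_inverse: "fps_nth f 0 = 1 ==> eqm m f 1 ==> eqm m (inverse f) 1"
proof -
 assume f: "fps_nth f 0 = 1" and "eqm m f 1"
 then have "eqm m (inverse f * 1) (inverse f * f)" by (intro eqm_mult eqm_refl eqm_sym[of m f])
 then show ?thesis using f inverse_mult_eq_1[of f] by simp
qed

lemma eqm_nth: "eqm m f g \<longleftrightarrow> (\<forall>j<m. fps_nth f j = fps_nth g j)"
proof
 assume "eqm m f g"
 then obtain h where "f - g = fps_X ^ m * h" unfolding eqm_def by (elim dvdE)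
 then show "\<forall>j<m. fps_nth f j = fps_nth g j"
  by (metis eq_iff_diff_eq_0 fps_X_power_mult_nth fps_sub_nth)
next
 assume e: "\<forall>j<m. fps_nth f j = fps_nth g j"
 have "f - g = fps_X ^ m * fps_shift m (f - g)"
  using e by (intro fps_ext) (simp add: fps_X_power_mult_nth)
 then show "eqm m f g" unfolding eqm_def by (metis dvd_triv_left)
qed

lemma qpoch_inf_eqm: "eqm (Suc n) (qpoch n) qpoch_inf"
proof -
 have q: "(\<Prod>j\<in>{1..N}. 1 - fps_X ^ j) = qpoch N" for N
  by (induction N) (simp_all add: mult.commute)
 have "eqm (Suc N) (qpoch (N + d)) (qpoch N)" for N d
 proof (induction d)
  case (Suc d)
  have "eqm (Suc N) (qpoch (N + d) * (1 - fps_X ^ Suc (N + d))) (qpoch N * 1)"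
   by (intro eqm_mult Suc eqm_factor) simp
  then show ?case by simp
 qed simp
 then have "fps_nth (qpoch n) N = fps_nth (qpoch N) N" if "N \<le> n" for N
  using that unfolding eqm_nth by (metis le_add_diff_inverse lessI)
 then show ?thesis unfolding eqm_nth qpoch_inf_def q by simp
qed

text \<open>Euler's expansion of \<open>1 / (z;q)_\<infinity>\<close> in powers of \<open>z\<close>,
  truncated, at \<open>z = q^(m+1)\<close>. Raising \<open>m\<close> by one multiplies the sum by
  \<open>1 - q^(m+1)\<close>, with a truncation error divisible by \<open>q^((n+1)(m+1))\<close>; at
  \<open>m = n\<close> only the term \<open>s = 0\<close> survives, which fixes the
  constant.\<close>

lemma exp_sum_eqm: "eqm (Suc n) (qpoch n * (\<Sum>s\<le>n. fps_X ^ (s * Suc m) * iq s)) (qpoch m)"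
proof -
 let ?E = "\<lambda>m. \<Sum>s\<le>n. fps_X ^ (s * Suc m) * iq s"
 have step: "eqm (Suc n) (?E (Suc m)) (?E m * (1 - fps_X ^ Suc m))" for m
 proof -
  have "?E m - ?E (Suc m) = (\<Sum>s\<le>n. fps_X ^ (s * Suc m) * ((1 - fps_X ^ s) * iq s))"
   unfolding sum_subtractf[symmetric] by (rule sum.cong) (simp_all add: power_add algebra_simps)
  also have "... = (\<Sum>s<n. fps_X ^ (Suc s * Suc m) * ((1 - fps_X ^ Suc s) * iq (Suc s)))"
   unfolding lessThan_Suc_atMost[symmetric] sum.lessThan_Suc_shift by simp
  also have "... = (\<Sum>s<n. fps_X ^ Suc m * (fps_X ^ (s * Suc m) * iq s))"
   by (rule sum.cong[OF refl], subst (2) iq_Suc) (simp add: power_add mult_ac)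
  finally have d: "?E m - ?E (Suc m) = fps_X ^ Suc m * (\<Sum>s<n. fps_X ^ (s * Suc m) * iq s)"
   by (simp only: sum_distrib_left)
  have "?E m = (\<Sum>s<n. fps_X ^ (s * Suc m) * iq s) + fps_X ^ (n * Suc m) * iq n"
   by (simp add: lessThan_Suc_atMost[symmetric])
  moreover have "e' - e * (1 - x) = x * l" if "e - e' = x * r" "e = r + l" for e e' x r l :: "rat fps"
  proof -
   have "e' = e - x * r" using that(1) by (simp add: algebra_simps)
   then show ?thesis using that(2) by (simp add: algebra_simps)
  qed
  ultimately have "?E (Suc m) - ?E m * (1 - fps_X ^ Suc m) = fps_X ^ Suc m * (fps_X ^ (n * Suc m) * iq n)"
   using d by blast
  also have "... = fps_X ^ (Suc m + n * Suc m) * iq n" by (simp only: power_add mult.assoc)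
  finally have "?E (Suc m) - ?E m * (1 - fps_X ^ Suc m) = fps_X ^ (Suc m + n * Suc m) * iq n" .
  moreover have "Suc n \<le> Suc m + n * Suc m" by simp
  ultimately show ?thesis unfolding eqm_def by (simp only: dvd_mult2 le_imp_power_dvd)
 qed
 have E: "eqm (Suc n) (?E m) (?E 0 * qpoch m)" for m
 proof (induction m)
  case (Suc m)
  have "eqm (Suc n) (?E m * (1 - fps_X ^ Suc m)) (?E 0 * qpoch m * (1 - fps_X ^ Suc m))"
   by (intro eqm_mult Suc eqm_refl)
  then show ?case using eqm_trans[OF step] by (simp add: mult.assoc)
 qed simp
 have "eqm (Suc n) (fps_X ^ (s * Suc n) * iq s) (if s = 0 then 1 else 0)" for s
  unfolding eqm_def by (cases s) (auto intro!: dvd_mult2 le_imp_power_dvd)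
 then have "eqm (Suc n) (?E n) (\<Sum>s\<le>n. if s = 0 then 1 else 0)" by (intro eqm_sum)
 then have "eqm (Suc n) (?E n) 1" by simp
 then have E0: "eqm (Suc n) (?E 0 * qpoch n) 1" using eqm_trans[OF eqm_sym[OF E[of n]]] by blast
 have "eqm (Suc n) (qpoch n * ?E m) (qpoch n * (?E 0 * qpoch m))" by (intro eqm_mult eqm_refl E)
 moreover have "eqm (Suc n) (qpoch n * (?E 0 * qpoch m)) (1 * qpoch m)"
  using eqm_mult[OF E0 eqm_refl, of "qpoch m"] by (simp only: mult_ac)
 ultimately show ?thesis using eqm_trans unfolding mult_1_left by blast
qed

section \<open>The tail as a limit of finite sums\<close>

lemma eqm_eq_trans [trans]: "f = g ==> eqm m g h ==> eqm m f h" "eqm m f g ==> g = h ==> eqm m f h"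
 by simp_all

text \<open>Up to a power of \<open>A\<close>, \<open>twist_sum n a t\<close> is the coefficient of \<open>t\<close> through strands in the expansion of \<open>a + 1\<close> twists.\<close>
primrec twist_sum :: "nat => nat => nat => rat fps" where
 "twist_sum n 0 t = gauss fps_X n t"
| "twist_sum n (Suc a) t = (\<Sum>s\<le>n. (-1) ^ (n + s) * fps_X ^ (tri s + s) * gauss fps_X s t * twist_sum n a s)"

text \<open>What is left of \<open>twist_sum\<close> when pairs of twists are combined by
  \<open>gauss_product_sum\<close>: one summation for every two further twists.\<close>

primrec chain_sum :: "nat => nat => nat => rat fps" where
 "chain_sum n 0 t = qpoch n * (qpoch n * iq (n - t))"
| "chain_sum n (Suc k) t = (\<Sum>r\<in>{t..n}. fps_X ^ (r * Suc r) * chain_sum n k r * iq (r - t))"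

lemma sign_square: "(-1) ^ m * ((-1) ^ m * x) = (x :: 'a :: comm_ring_1)"
 by (simp flip: mult.assoc power_mult_distrib)

lemma gauss_product_sum_extended:
 assumes "r \<le> n" "t \<le> n"
 shows "(\<Sum>s\<le>n. (-1) ^ (n + s) * fps_X ^ (tri s + s) * gauss fps_X s t * gauss fps_X r s)
  = (-1) ^ (n + t) * fps_X ^ (tri t + t) * gauss fps_X r t * (qpoch r * iq t :: rat fps)"
proof -
 have "(\<Sum>s\<le>n. (-1) ^ (n + s) * fps_X ^ (tri s + s) * gauss fps_X s t * gauss fps_X r s)
   = (-1) ^ n * (\<Sum>s\<le>n. (-1) ^ s * fps_X ^ (tri s + s) * gauss fps_X s t * gauss fps_X r s :: rat fps)"
  by (simp add: sum_distrib_left power_add mult.assoc)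
 also have "(\<Sum>s\<le>n. (-1) ^ s * fps_X ^ (tri s + s) * gauss fps_X s t * gauss fps_X r s :: rat fps)
   = (\<Sum>s\<le>r. (-1) ^ s * fps_X ^ (tri s + s) * gauss fps_X s t * gauss fps_X r s)"
  by (rule sum.mono_neutral_right) (use assms in \<open>auto simp: gauss_eq_0\<close>)
 finally show ?thesis unfolding gauss_product_sum by (simp add: power_add mult.assoc)
qed

text \<open>The two cases are \<open>2k+2\<close> and \<open>2k+3\<close> twists. Adding a twist to
  the first squares the sign and the power of q, which leaves \<open>q^(s(s+1))\<close>. Adding
  another one makes the sum over the intermediate index accessible to
  \<open>gauss_product_sum\<close>.\<close>

lemma twist_sum_even_odd:
 assumes "t \<le> n"
 shows "twist_sum n (Suc (2 * k)) t = (-1) ^ (n + t) * fps_X ^ (tri t + t) * chain_sum n k t * iq t ^ 2"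
  and "twist_sum n (Suc (Suc (2 * k))) t = (\<Sum>s\<le>n. fps_X ^ (s * Suc s) * gauss fps_X s t * chain_sum n k s * iq s ^ 2)"
proof -
 have step: "twist_sum n (Suc a) t = (\<Sum>s\<le>n. fps_X ^ (s * Suc s) * gauss fps_X s t * f s * iq s ^ 2)"
  if "\<And>s. s \<le> n ==> twist_sum n a s = (-1) ^ (n + s) * fps_X ^ (tri s + s) * f s * iq s ^ 2" for a f t
 proof -
  have collect: "(-1) ^ (n + s) * fps_X ^ (tri s + s) * gauss fps_X s t * ((-1) ^ (n + s) * fps_X ^ (tri s + s) * f s * iq s ^ 2)
   = (fps_X ^ (s * Suc s) * gauss fps_X s t * f s * iq s ^ 2 :: rat fps)" for s
  proof -
   have e: "s * Suc s = (tri s + s) + (tri s + s)" using tri_square[of s] by simp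
   have "x * y * g * (x * y * f * i) = x * (x * (y * y * g * f * i))" for x y g f i :: "rat fps" by (simp only: mult_ac)
   then show ?thesis unfolding e power_add[of _ "tri s + s" "tri s + s"] by (simp only: sign_square)
  qed
  show ?thesis
   unfolding twist_sum.simps by (rule sum.cong[OF refl]) (simp only: that atMost_iff collect)
 qed
 have even: "twist_sum n (Suc (2 * k)) t = (-1) ^ (n + t) * fps_X ^ (tri t + t) * chain_sum n k t * iq t ^ 2" if "t \<le> n" for t
  using that
 proof (induction k arbitrary: t)
  case 0
  have "twist_sum n (Suc (2 * 0)) t = (-1) ^ (n + t) * fps_X ^ (tri t + t) * gauss fps_X n t * (qpoch n * iq t)"
   using gauss_product_sum_extended[OF order_refl 0] by simp
  then show ?case unfolding gauss_eq[OF 0] by (simp add: power2_eq_square mult_ac)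
 next
  case (Suc k)
  let ?a = "Suc (2 * k)"
  let ?X = "\<lambda>s. (-1) ^ (n + s) * fps_X ^ (tri s + s) * gauss fps_X s t :: rat fps"
  let ?c = "\<lambda>r. fps_X ^ (r * Suc r) * chain_sum n k r * iq r ^ 2"
  have "twist_sum n (Suc (2 * Suc k)) t = (\<Sum>s\<le>n. ?X s * twist_sum n (Suc ?a) s)" by simp
  also have "... = (\<Sum>s\<le>n. \<Sum>r\<le>n. ?c r * (?X s * gauss fps_X r s))"
  proof -
   have "twist_sum n (Suc ?a) s = (\<Sum>r\<le>n. fps_X ^ (r * Suc r) * gauss fps_X r s * chain_sum n k r * iq r ^ 2)" for s
    by (rule step) (rule Suc.IH)
   then show ?thesis by (simp only: sum_distrib_left mult_ac)
  qed
  also have "... = (\<Sum>r\<le>n. ?c r * (\<Sum>s\<le>n. ?X s * gauss fps_X r s))"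
   by (subst sum.swap) (simp only: sum_distrib_left)
  also have "... = (\<Sum>r\<le>n. ?c r * ((-1) ^ (n + t) * fps_X ^ (tri t + t) * gauss fps_X r t * (qpoch r * iq t)))"
   using Suc.prems by (intro sum.cong refl) (simp add: gauss_product_sum_extended)
  also have "... = (\<Sum>r\<in>{t..n}. ?c r * ((-1) ^ (n + t) * fps_X ^ (tri t + t) * gauss fps_X r t * (qpoch r * iq t)))"
   by (rule sum.mono_neutral_right) (auto simp: gauss_eq_0)
  also have "... = (\<Sum>r\<in>{t..n}. ((-1) ^ (n + t) * fps_X ^ (tri t + t) * iq t ^ 2) * (fps_X ^ (r * Suc r) * chain_sum n k r * iq (r - t)))"
  proof (rule sum.cong[OF refl])
   fix r assume "r \<in> {t..n}"
   then have g: "gauss fps_X r t = qpoch r * iq t * iq (r - t)" by (intro gauss_eq) simp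
   have "x * c * iq r ^ 2 * (s * y * (qpoch r * i * j) * (qpoch r * i)) = ((qpoch r * iq r) * (qpoch r * iq r)) * ((s * y * i ^ 2) * (x * c * j))"
    for x c s y i j by (simp only: power2_eq_square mult_ac)
   then show "?c r * ((-1) ^ (n + t) * fps_X ^ (tri t + t) * gauss fps_X r t * (qpoch r * iq t))
    = ((-1) ^ (n + t) * fps_X ^ (tri t + t) * iq t ^ 2) * (fps_X ^ (r * Suc r) * chain_sum n k r * iq (r - t))"
    unfolding g by (simp only: iq_qpoch mult_1_left)
  qed
  finally show ?case unfolding sum_distrib_left[symmetric] by (simp only: chain_sum.simps mult_ac)
 qed
 show "twist_sum n (Suc (2 * k)) t = (-1) ^ (n + t) * fps_X ^ (tri t + t) * chain_sum n k t * iq t ^ 2" by (rule even[OF assms])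
 show "twist_sum n (Suc (Suc (2 * k))) t = (\<Sum>s\<le>n. fps_X ^ (s * Suc s) * gauss fps_X s t * chain_sum n k s * iq s ^ 2)"
  by (rule step[OF even])
qed

text \<open>\<open>eta\<close> without its sign and its power of \<open>A\<close>; see
  \<open>eta_emb\<close>.\<close>

definition theta_weight :: "nat => nat => nat => rat fps" where
 "theta_weight n s t = (\<Prod>r<t. (1 - fps_X ^ (s - r)) * (1 - fps_X ^ (2 * n + 1 - s - r)) * inverse (1 - fps_X ^ (n - r)) ^ 2)"

text \<open>For \<open>r < t\<close> and \<open>t \<le> s\<close> the exponents
  \<open>2n+1-s-r\<close> and \<open>n-r\<close> are at least \<open>n+1-s\<close>, so these factors
  are 1 at the precision required of the term for \<open>s\<close>.\<close>

lemma theta_weight_eqm: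
 assumes "s \<le> n"
 shows "eqm (n + 1 - s) (theta_weight n s t) (falling s t)"
proof (cases "t \<le> s")
 case True
 have "eqm (n + 1 - s) ((1 - fps_X ^ (s - r)) * (1 - fps_X ^ (2 * n + 1 - s - r)) * inverse (1 - fps_X ^ (n - r)) ^ 2)
   ((1 - fps_X ^ (s - r)) * 1 * 1 ^ 2)" if "r < t" for r
  unfolding power2_eq_square using True that assms by (intro eqm_mult eqm_factor eqm_inverse eqm_refl) auto
 then show ?thesis unfolding theta_weight_def falling_def by (intro eqm_prod) simp
next
 case False
 then have "theta_weight n s t = 0"
  unfolding theta_weight_def by (intro prod_zero) (auto intro!: bexI[of _ s])
 then show ?thesis using False by (simp add: falling_0)
qed

text \<open>The factor that a region with \<open>a + 1\<close> twists contributes to the term for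
  \<open>s\<close>, up to a power of \<open>A\<close>.\<close>

definition leg_sum :: "nat => nat => nat => rat fps" where
 "leg_sum n a s = (\<Sum>t\<le>n. (-1) ^ t * fps_X ^ tri t * twist_sum n a t * theta_weight n s t)"

lemma falling_eqm: "v \<le> n ==> eqm (n + 1 - v) (falling n v) 1"
proof -
 assume "v \<le> n"
 then have "eqm (n + 1 - v) (falling n v) (\<Prod>r<v. 1)"
  unfolding falling_def by (intro eqm_prod eqm_factor) auto
 then show ?thesis by simp
qed

text \<open>At this precision the summand is \<open>q^(t*t) falling s t / (q;q)_t^2\<close> times a
  constant, and the sum is the decomposition of \<open>1 / (q;q)_s\<close> by Durfee
  squares.\<close>

lemma leg_sum_two:
 assumes "s \<le> n"
 shows "eqm (n + 1 - s) (leg_sum n 1 s) ((-1) ^ n * qpoch n * iq s)"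
proof -
 let ?c = "\<lambda>t x. (-1) ^ n * qpoch n * (fps_X ^ (t * t) * iq t ^ 2 * x)"
 have "leg_sum n 1 s = (\<Sum>t\<le>n. ?c t (falling n t * theta_weight n s t))"
  unfolding leg_sum_def
 proof (rule sum.cong[OF refl])
  fix t assume "t \<in> {..n}"
  then have t: "t \<le> n" by simp
  have e: "t * t = tri t + (tri t + t)" using tri_square[of t] by simp
  have "x * y * (((m * x) * z) * (p * (p * j)) * i) * h = x * (x * (m * p * ((y * z) * i * ((p * j) * h))))"
   for x y m z p j i h :: "rat fps" by (simp only: mult_ac)
  then show "(-1) ^ t * fps_X ^ tri t * twist_sum n 1 t * theta_weight n s t
   = ?c t (falling n t * theta_weight n s t)"
   using twist_sum_even_odd(1)[OF t, of 0] unfolding falling_eq[OF t] e power_add[of _ "tri t" "tri t + t"] power_add[of _ n t]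
   by (simp only: mult_0_right One_nat_def chain_sum.simps sign_square)
 qed
 also have "eqm (n + 1 - s) ... (\<Sum>t\<le>s. ?c t (1 * falling s t))"
 proof -
  have "eqm (n + 1 - s) (\<Sum>t\<le>n. ?c t (falling n t * theta_weight n s t))
    (\<Sum>t\<le>n. ?c t (1 * falling s t))"
  proof (rule eqm_sum)
   fix t assume "t \<in> {..n}"
   then have t: "t \<le> n" by simp
   show "eqm (n + 1 - s) (?c t (falling n t * theta_weight n s t))
    (?c t (1 * falling s t))"
   proof (cases "t \<le> s")
    case True
    then have "eqm (n + 1 - s) (falling n t) 1" by (intro eqm_mono[OF falling_eqm[OF t]]) simp
    then show ?thesis by (intro eqm_mult eqm_refl theta_weight_eqm assms)
   next
    case False
    then have "eqm (n + 1 - s) (theta_weight n s t) 0" using theta_weight_eqm[OF assms, of t] by (simp add: falling_0)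
    from eqm_mult[OF eqm_refl this, of "(-1) ^ n * qpoch n * (fps_X ^ (t * t) * iq t ^ 2 * falling n t)"]
    show ?thesis using False by (simp add: falling_0 mult.assoc)
   qed
  qed
  moreover have "(\<Sum>t\<le>n. ?c t (1 * falling s t))
    = (\<Sum>t\<le>s. ?c t (1 * falling s t))"
   by (rule sum.mono_neutral_right) (use assms in \<open>auto simp: falling_0\<close>)
  ultimately show ?thesis by simp
 qed
 also have "... = (-1) ^ n * qpoch n * (\<Sum>t\<le>s. fps_X ^ (t * (t + 0)) * iq (t + 0) * gauss fps_X s t)"
  unfolding sum_distrib_left
 proof (rule sum.cong[OF refl])
  fix t assume "t \<in> {..s}"
  then have t: "t \<le> s" by simp
  show "?c t (1 * falling s t) = (-1) ^ n * qpoch n * (fps_X ^ (t * (t + 0)) * iq (t + 0) * gauss fps_X s t)"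
   unfolding falling_eq[OF t] gauss_eq[OF t] by (simp only: power2_eq_square add_0_right mult_1_left mult_ac)
 qed
 also have "... = (-1) ^ n * qpoch n * iq s" unfolding durfee_sum by simp
 finally show ?thesis .
qed

text \<open>The sum over \<open>t\<close> is \<open>gauss_falling_sum\<close>. It leaves
  \<open>s\<close> only in the power \<open>q^(s v)\<close>, which is what allows the final sum over
  \<open>s\<close> to be Euler's expansion.\<close>

lemma leg_sum_odd:
 assumes "s \<le> n"
 shows "eqm (n + 1 - s) (leg_sum n (Suc (Suc (2 * k))) s) (\<Sum>v\<le>n. fps_X ^ (v * Suc v) * chain_sum n k v * iq v ^ 2 * fps_X ^ (s * v))"
proof -
 let ?c = "\<lambda>v. fps_X ^ (v * Suc v) * chain_sum n k v * iq v ^ 2"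
 let ?m = "n + 1 - s"
 have "leg_sum n (Suc (Suc (2 * k))) s
   = (\<Sum>t\<le>n. \<Sum>v\<le>n. ?c v * ((-1) ^ t * fps_X ^ tri t * theta_weight n s t * gauss fps_X v t))"
  unfolding leg_sum_def
 proof (rule sum.cong[OF refl])
  fix t assume "t \<in> {..n}"
  then have t: "t \<le> n" by simp
  show "(-1) ^ t * fps_X ^ tri t * twist_sum n (Suc (Suc (2 * k))) t * theta_weight n s t
   = (\<Sum>v\<le>n. ?c v * ((-1) ^ t * fps_X ^ tri t * theta_weight n s t * gauss fps_X v t))"
   unfolding twist_sum_even_odd(2)[OF t] sum_distrib_left sum_distrib_right by (simp only: mult_ac)
 qed
 also have "... = (\<Sum>v\<le>n. ?c v * (\<Sum>t\<le>n. (-1) ^ t * fps_X ^ tri t * theta_weight n s t * gauss fps_X v t))"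
  by (subst sum.swap) (simp only: sum_distrib_left)
 also have "eqm ?m ... (\<Sum>v\<le>n. ?c v * (\<Sum>t\<le>n. (-1) ^ t * fps_X ^ tri t * falling s t * gauss fps_X v t))"
  by (intro eqm_sum eqm_mult eqm_refl theta_weight_eqm assms)
 also have "... = (\<Sum>v\<le>n. ?c v * fps_X ^ (s * v))"
 proof (rule sum.cong[OF refl])
  fix v assume "v \<in> {..n}"
  then have e: "(\<Sum>t\<le>n. (-1) ^ t * fps_X ^ tri t * falling s t * gauss fps_X v t)
   = (\<Sum>t\<le>v. (-1) ^ t * fps_X ^ tri t * falling s t * gauss fps_X v t)"
   by (intro sum.mono_neutral_right) (auto simp: gauss_eq_0)
  show "?c v * (\<Sum>t\<le>n. (-1) ^ t * fps_X ^ tri t * falling s t * gauss fps_X v t) = ?c v * fps_X ^ (s * v)"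
   unfolding e gauss_falling_sum ..
 qed
 finally show ?thesis .
qed

text \<open>The limit form of \<open>chain_sum\<close>, summed over the differences \<open>l\<close>
  of consecutive indices; the indices \<open>t + l\<close> themselves are the partial sums
  \<open>i_j\<close> of the theorem.\<close>

primrec tail_chain :: "nat => nat => nat => rat fps" where
 "tail_chain n 0 t = 1"
| "tail_chain n (Suc k) t = (\<Sum>l\<le>n. fps_X ^ ((t + l) * Suc (t + l)) * tail_chain n k (t + l) * iq l)"

text \<open>\<open>falling n v\<close> is 1 only modulo \<open>q^(n+1-v)\<close>, and the power
  \<open>q^(v(v+1))\<close> makes up for the loss. The indices \<open>r > n\<close> that the change
  of variables adds carry \<open>q^(r(r+1))\<close> and lie beyond the precision.\<close>

lemma chain_sum_eqm: "v \<le> n ==> eqm (Suc n) (fps_X ^ (v * Suc v) * chain_sum n k v) (qpoch n * (fps_X ^ (v * Suc v) * tail_chain n k v))"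
proof (induction k arbitrary: v)
 case 0
 have "eqm (Suc n) (fps_X ^ (v * Suc v) * (qpoch n * falling n v)) (fps_X ^ (v * Suc v) * (qpoch n * 1))"
  by (rule eqm_shift[OF eqm_mult[OF eqm_refl falling_eqm[OF 0]]]) simp
 then show ?case unfolding falling_eq[OF 0] by (simp only: chain_sum.simps tail_chain.simps mult_ac)
next
 case (Suc k)
 let ?f = "\<lambda>r. fps_X ^ (r * Suc r) * tail_chain n k r * iq (r - v)"
 have "eqm (Suc n) (chain_sum n (Suc k) v) (\<Sum>r\<in>{v..n}. qpoch n * (fps_X ^ (r * Suc r) * tail_chain n k r) * iq (r - v))"
  unfolding chain_sum.simps by (intro eqm_sum eqm_mult[OF Suc.IH eqm_refl]) simp
 also have "... = qpoch n * (\<Sum>r\<in>{v..n}. ?f r)" by (simp only: sum_distrib_left mult.assoc)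
 also have "eqm (Suc n) ... (qpoch n * (\<Sum>r\<in>{v..v + n}. ?f r))"
 proof (intro eqm_mult eqm_refl)
  have "(\<Sum>r\<in>{v..v + n}. ?f r) = (\<Sum>r\<in>{v..n}. ?f r) + (\<Sum>r\<in>{Suc n..v + n}. ?f r)"
  proof (subst sum.union_disjoint[symmetric])
   have "{v..v + n} = {v..n} \<union> {Suc n..v + n}" using Suc.prems by auto
   then show "(\<Sum>r\<in>{v..v + n}. ?f r) = (\<Sum>r\<in>{v..n} \<union> {Suc n..v + n}. ?f r)" by simp
  qed auto
  moreover have "fps_X ^ Suc n dvd (\<Sum>r\<in>{Suc n..v + n}. ?f r)"
   by (intro dvd_sum dvd_mult2 le_imp_power_dvd) (auto intro: le_trans)
  ultimately show "eqm (Suc n) (\<Sum>r\<in>{v..n}. ?f r) (\<Sum>r\<in>{v..v + n}. ?f r)"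
   unfolding eqm_def by (simp add: dvd_diff_commute)
 qed
 also have "(\<Sum>r\<in>{v..v + n}. ?f r) = tail_chain n (Suc k) v"
  unfolding tail_chain.simps by (rule sum.reindex_bij_witness[where i = "\<lambda>l. v + l" and j = "\<lambda>r. r - v"]) auto
 finally have "eqm (Suc n) (chain_sum n (Suc k) v) (qpoch n * tail_chain n (Suc k) v)" .
 from eqm_mult[OF eqm_refl this, of "fps_X ^ (v * Suc v)"] show ?case by (simp only: mult_ac)
qed

text \<open>The sum of \<open>g\<close> over all its arguments but the last, which is
  \<open>v\<close>; see \<open>g_fun_sum\<close>.\<close>

definition tail_weight :: "nat => nat => nat => rat fps" where
 "tail_weight n k v = fps_X ^ (v * Suc v) * tail_chain n k v * iq v ^ 2"

lemma leg_sum_odd_tail: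
 assumes "s \<le> n"
 shows "eqm (n + 1 - s) (leg_sum n (Suc (Suc (2 * k))) s) (qpoch n * (\<Sum>v\<le>n. tail_weight n k v * fps_X ^ (s * v)))"
proof -
 have "eqm (n + 1 - s) (\<Sum>v\<le>n. fps_X ^ (v * Suc v) * chain_sum n k v * iq v ^ 2 * fps_X ^ (s * v))
   (\<Sum>v\<le>n. qpoch n * (fps_X ^ (v * Suc v) * tail_chain n k v) * iq v ^ 2 * fps_X ^ (s * v))"
  by (intro eqm_sum eqm_mult eqm_refl eqm_mono[OF chain_sum_eqm]) auto
 with eqm_trans[OF leg_sum_odd[OF assms]] show ?thesis
  by (simp only: tail_weight_def sum_distrib_left mult.assoc)
qed

section \<open>The multiple sum of the theorem\<close>

lemma sum_PiE_insert:
 assumes "i \<notin> S"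
 shows "(\<Sum>l\<in>PiE (insert i S) (\<lambda>_. A). f l) = (\<Sum>y\<in>A. \<Sum>l\<in>PiE S (\<lambda>_. A). f (l(i := y)))"
proof -
 have "(\<Sum>l\<in>PiE (insert i S) (\<lambda>_. A). f l) = (\<Sum>(y, l)\<in>A \<times> PiE S (\<lambda>_. A). f (l(i := y)))"
  unfolding PiE_insert_eq by (subst sum.reindex[OF inj_combinator[OF assms]]) (simp add: split_def)
 then show ?thesis by (simp only: sum.cartesian_product[symmetric])
qed

lemma tail_chain_PiE:
 "tail_chain n k t = (\<Sum>l\<in>PiE {1..k} (\<lambda>_. {0..n}).
  fps_X ^ (\<Sum>j\<in>{1..k}. (t + (\<Sum>s\<in>{j..k}. l s)) * Suc (t + (\<Sum>s\<in>{j..k}. l s))) * (\<Prod>j\<in>{1..k}. iq (l j)))"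
proof (induction k arbitrary: t)
 case (Suc k)
 have ins: "{1..Suc k} = insert (Suc k) {1..k}" and notin: "Suc k \<notin> {1..k}" by auto
 let ?e = "\<lambda>k t l. \<Sum>j\<in>{1..k}. (t + (\<Sum>s\<in>{j..k}. l s)) * Suc (t + (\<Sum>s\<in>{j..k}. l s))"
 have e: "?e (Suc k) t (l(Suc k := y)) = (t + y) * Suc (t + y) + ?e k (t + y) l" for l y
 proof -
  have "(\<Sum>s\<in>{j..Suc k}. (l(Suc k := y)) s) = y + (\<Sum>s\<in>{j..k}. l s)" if "j \<le> k" for j
   using that by (simp add: atLeastAtMostSuc_conv)
  then show ?thesis unfolding ins sum.insert[OF finite_atLeastAtMost notin] by (simp add: add_ac)
 qed
 have p: "(\<Prod>j\<in>{1..Suc k}. iq ((l(Suc k := y)) j)) = iq y * (\<Prod>j\<in>{1..k}. iq (l j))" for l y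
 proof -
  have "(\<Prod>j\<in>{1..k}. iq ((l(Suc k := y)) j)) = (\<Prod>j\<in>{1..k}. iq (l j))" by (intro prod.cong) auto
  then show ?thesis unfolding ins prod.insert[OF finite_atLeastAtMost notin] by simp
 qed
 have "(\<Sum>l\<in>PiE {1..Suc k} (\<lambda>_. {0..n}). fps_X ^ ?e (Suc k) t l * (\<Prod>j\<in>{1..Suc k}. iq (l j)))
   = (\<Sum>y\<in>{0..n}. \<Sum>l\<in>PiE {1..k} (\<lambda>_. {0..n}). fps_X ^ ?e (Suc k) t (l(Suc k := y)) * (\<Prod>j\<in>{1..Suc k}. iq ((l(Suc k := y)) j)))"
  by (subst (3) ins) (rule sum_PiE_insert[OF notin])
 also have "... = (\<Sum>y\<in>{0..n}. fps_X ^ ((t + y) * Suc (t + y)) * tail_chain n k (t + y) * iq y)"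
  unfolding e p Suc.IH power_add by (simp only: sum_distrib_left sum_distrib_right mult_ac)
 finally show ?case by (simp add: atMost_atLeast0)
qed simp

lemma g_fun_sum:
 "(\<Sum>l\<in>PiE {1..Suc k} (\<lambda>_. {0..n}). g_fun (Suc k) l * f (l (Suc k))) = (\<Sum>v\<le>n. tail_weight n k v * f v)"
proof -
 have ins: "{1..Suc k} = insert (Suc k) {1..k}" and notin: "Suc k \<notin> {1..k}" by auto
 have ip: "inverse (\<Prod>j\<in>A. qpoch (h j)) = (\<Prod>j\<in>A. iq (h j))" for A and h :: "nat => nat"
  by (induction A rule: infinite_finite_induct) (simp_all add: fps_inverse_mult)
 have g: "g_fun (Suc k) (l(Suc k := y)) = fps_X ^ (y * Suc y) * iq y ^ 2 *
   (fps_X ^ (\<Sum>j\<in>{1..k}. (y + (\<Sum>s\<in>{j..k}. l s)) * Suc (y + (\<Sum>s\<in>{j..k}. l s))) * (\<Prod>j\<in>{1..k}. iq (l j)))" for l y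
 proof -
  have s: "(\<Sum>s\<in>{j..Suc k}. (l(Suc k := y)) s) = y + (\<Sum>s\<in>{j..k}. l s)" if "j \<le> k" for j
   using that by (simp add: atLeastAtMostSuc_conv)
  have e: "(\<Sum>j\<in>{1..Suc k}. (\<Sum>s\<in>{j..Suc k}. (l(Suc k := y)) s) * ((\<Sum>s\<in>{j..Suc k}. (l(Suc k := y)) s) + 1))
    = y * Suc y + (\<Sum>j\<in>{1..k}. (y + (\<Sum>s\<in>{j..k}. l s)) * Suc (y + (\<Sum>s\<in>{j..k}. l s)))"
   unfolding ins sum.insert[OF finite_atLeastAtMost notin] using s by (simp add: add_ac)
  have p: "(\<Prod>j\<in>{1..Suc k - 1}. qpoch ((l(Suc k := y)) j)) = (\<Prod>j\<in>{1..k}. qpoch (l j))" by (intro prod.cong) auto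
  show ?thesis
   unfolding g_fun_def e p fun_upd_same fps_inverse_mult fps_inverse_power ip power_add by (simp only: mult_ac)
 qed
 have "(\<Sum>l\<in>PiE {1..Suc k} (\<lambda>_. {0..n}). g_fun (Suc k) l * f (l (Suc k)))
   = (\<Sum>y\<in>{0..n}. \<Sum>l\<in>PiE {1..k} (\<lambda>_. {0..n}). g_fun (Suc k) (l(Suc k := y)) * f ((l(Suc k := y)) (Suc k)))"
  by (subst ins) (rule sum_PiE_insert[OF notin])
 also have "... = (\<Sum>y\<in>{0..n}. tail_weight n k y * f y)"
  unfolding g fun_upd_same tail_weight_def tail_chain_PiE by (simp only: sum_distrib_left sum_distrib_right mult_ac)
 finally show ?thesis by (simp add: atMost_atLeast0)
qed

lemma g_fun_vanish:
 assumes "j \<in> {1..m}" "N < l j"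
 shows "fps_nth (g_fun m l * f) N = 0"
proof -
 let ?i = "\<lambda>j. \<Sum>s\<in>{j..m}. l s"
 have "l j \<le> ?i j" using assms(1) by (intro member_le_sum) auto
 also have "... \<le> ?i j * (?i j + 1)" by simp
 also have "... \<le> (\<Sum>j\<in>{1..m}. ?i j * (?i j + 1))" using assms(1) by (intro member_le_sum[of j "{1..m}" "\<lambda>j. ?i j * (?i j + 1)"]) auto
 finally have "N < (\<Sum>j\<in>{1..m}. ?i j * (?i j + 1))" using assms(2) by simp
 then show ?thesis unfolding g_fun_def mult.assoc fps_X_power_mult_nth by simp
qed

lemma sum_PiE_enlarge:
 fixes N n m :: nat and f :: "(nat => nat) => 'a :: comm_monoid_add"
 assumes "N \<le> n" "\<And>l. l \<in> PiE {1..m} (\<lambda>_. {0..n}) ==> (\<exists>j\<in>{1..m}. N < l j) ==> f l = 0"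
 shows "(\<Sum>l\<in>PiE {1..m} (\<lambda>_. {0..N}). f l) = (\<Sum>l\<in>PiE {1..m} (\<lambda>_. {0..n}). f l)"
proof (rule sum.mono_neutral_left)
 show "finite (PiE {1..m} (\<lambda>_. {0..n}))" by (intro finite_PiE) auto
 show "PiE {1..m} (\<lambda>_. {0..N}) \<subseteq> PiE {1..m} (\<lambda>_. {0..n})" using assms(1) by (intro PiE_mono) auto
 show "\<forall>l\<in>PiE {1..m} (\<lambda>_. {0..n}) - PiE {1..m} (\<lambda>_. {0..N}). f l = 0"
 proof
  fix l assume l: "l \<in> PiE {1..m} (\<lambda>_. {0..n}) - PiE {1..m} (\<lambda>_. {0..N})"
  then have "\<exists>j\<in>{1..m}. N < l j" by (auto simp: PiE_iff not_le)
  then show "f l = 0" using assms(2) l by blast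
 qed
qed

lemma tail_sum_eqm:
 "eqm (Suc n) (tail_sum (Suc k) (Suc u)) (\<Sum>v\<le>n. tail_weight n k v * (\<Sum>w\<le>n. tail_weight n u w * qpoch (v + w)))"
 unfolding eqm_nth
proof (intro allI impI)
 fix N assume "N < Suc n"
 then have N: "N \<le> n" by simp
 let ?S = "\<Sum>v\<le>n. tail_weight n k v * (\<Sum>w\<le>n. tail_weight n u w * qpoch (v + w))"
 let ?P = "\<lambda>m N. PiE {1..Suc m} (\<lambda>_. {0..N})"
 let ?f = "\<lambda>l p. g_fun (Suc k) l * g_fun (Suc u) p * qpoch (l (Suc k) + p (Suc u))"
 have "fps_nth (tail_sum (Suc k) (Suc u)) N = (\<Sum>l\<in>?P k N. \<Sum>p\<in>?P u N. fps_nth (?f l p) N)"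
  by (simp add: tail_sum_def)
 also have "... = (\<Sum>l\<in>?P k n. \<Sum>p\<in>?P u N. fps_nth (?f l p) N)"
  by (rule sum_PiE_enlarge[OF N]) (auto simp: mult.assoc g_fun_vanish intro!: sum.neutral)
 also have "... = (\<Sum>l\<in>?P k n. \<Sum>p\<in>?P u n. fps_nth (?f l p) N)"
 proof (rule sum.cong[OF refl], rule sum_PiE_enlarge[OF N])
  fix l p assume "\<exists>j\<in>{1..Suc u}. N < p j"
  then obtain j where "j \<in> {1..Suc u}" "N < p j" by blast
  from g_fun_vanish[of j "Suc u" N p, OF this, of "g_fun (Suc k) l * qpoch (l (Suc k) + p (Suc u))"]
  show "fps_nth (?f l p) N = 0" by (simp only: mult_ac)
 qed
 also have "... = fps_nth (\<Sum>l\<in>?P k n. g_fun (Suc k) l * (\<Sum>p\<in>?P u n. g_fun (Suc u) p * qpoch (l (Suc k) + p (Suc u)))) N"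
  by (simp add: fps_sum_nth sum_distrib_left mult.assoc)
 also have "... = fps_nth ?S N"
  unfolding g_fun_sum[where f = "\<lambda>w. qpoch (_ + w)"] g_fun_sum[where f = "\<lambda>v. \<Sum>w\<le>n. tail_weight n u w * qpoch (v + w)"] ..
 finally show "fps_nth (tail_sum (Suc k) (Suc u)) N = fps_nth ?S N" .
qed

text \<open>In the term for \<open>s\<close> the power \<open>q^s\<close> permits all other factors
  to be replaced modulo \<open>q^(n+1-s)\<close>. Then \<open>q^s q^(sv) q^(sw) / (q;q)_s\<close>
  sums over \<open>s\<close> to \<open>(q;q)_(v+w)\<close> divided by \<open>(q;q)_n\<close>. This
  produces the coupling of the two odd regions, and of the three factors \<open>(q;q)_n\<close>, one
  for each region, two remain.\<close>

lemma pretzel_sum_eqm: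
 "eqm (Suc n) (\<Sum>s\<le>n. fps_X ^ s * ((1 - fps_X ^ (2 * (n - s) + 1)) *
   (leg_sum n (Suc (Suc (2 * k))) s * leg_sum n 1 s * leg_sum n (Suc (Suc (2 * u))) s)))
  ((-1) ^ n * tail_formula (Suc k) (Suc u))"
proof -
 let ?L = "\<lambda>s. (1 - fps_X ^ (2 * (n - s) + 1)) *
   (leg_sum n (Suc (Suc (2 * k))) s * leg_sum n 1 s * leg_sum n (Suc (Suc (2 * u))) s)"
 let ?G = "\<lambda>k s. \<Sum>v\<le>n. tail_weight n k v * fps_X ^ (s * v)" and ?P = "qpoch n"
 let ?R = "\<lambda>s. 1 * ((?P * ?G k s) * ((-1) ^ n * ?P * iq s) * (?P * ?G u s))"
 have "eqm (Suc n) (\<Sum>s\<le>n. fps_X ^ s * ?L s)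
  (\<Sum>s\<le>n. fps_X ^ s * ?R s)"
 proof (rule eqm_sum)
  fix s assume "s \<in> {..n}"
  then have s: "s \<le> n" by simp
  show "eqm (Suc n) (fps_X ^ s * ?L s)
   (fps_X ^ s * ?R s)"
  proof (rule eqm_shift[where m = "n + 1 - s"])
   show "eqm (n + 1 - s) (?L s)
    (?R s)"
    by (intro eqm_mult leg_sum_odd_tail leg_sum_two eqm_factor s) (use s in simp)
  qed (use s in simp)
 qed
 also have "... = (-1) ^ n * ?P ^ 2 * (\<Sum>v\<le>n. tail_weight n k v * (\<Sum>w\<le>n. tail_weight n u w *
   (?P * (\<Sum>s\<le>n. fps_X ^ (s * Suc (v + w)) * iq s))))"
 proof -
  have "(\<Sum>s\<le>n. fps_X ^ s * ?R s)
    = (-1) ^ n * ?P ^ 2 * (\<Sum>s\<le>n. ?P * (fps_X ^ s * iq s) * (?G k s * ?G u s))"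
  proof -
   have "x * (1 * ((P * g) * (m * P * i) * (P * h))) = (m * P ^ 2) * (P * (x * i) * (g * h))" for x P g m i h :: "rat fps"
    by (simp only: power2_eq_square mult_1_left mult_ac)
   then show ?thesis by (simp only:) (rule sum_distrib_left[symmetric])
  qed
  also have "(\<Sum>s\<le>n. ?P * (fps_X ^ s * iq s) * (?G k s * ?G u s))
    = (\<Sum>s\<le>n. \<Sum>v\<le>n. \<Sum>w\<le>n. tail_weight n k v * (tail_weight n u w * (?P * (fps_X ^ (s * Suc (v + w)) * iq s))))"
   unfolding sum_product unfolding sum_distrib_left
   by (intro sum.cong refl) (simp add: power_add distrib_left mult_ac)
  also have "... = (\<Sum>v\<le>n. \<Sum>w\<le>n. \<Sum>s\<le>n. tail_weight n k v * (tail_weight n u w * (?P * (fps_X ^ (s * Suc (v + w)) * iq s))))"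
   by (subst sum.swap, rule sum.cong[OF refl], rule sum.swap)
  finally show ?thesis by (simp only: sum_distrib_left)
 qed
 also have "eqm (Suc n) ... ((-1) ^ n * qpoch_inf ^ 2 * (\<Sum>v\<le>n. tail_weight n k v * (\<Sum>w\<le>n. tail_weight n u w * qpoch (v + w))))"
  unfolding power2_eq_square by (intro eqm_mult eqm_sum eqm_refl exp_sum_eqm qpoch_inf_eqm)
 also have "eqm (Suc n) ... ((-1) ^ n * qpoch_inf ^ 2 * tail_sum (Suc k) (Suc u))"
  by (intro eqm_mult eqm_refl eqm_sym[OF tail_sum_eqm])
 finally show ?thesis by (simp only: tail_formula_def mult.assoc)
qed

lemma tail_formula_0: "fps_nth (tail_formula (Suc k) (Suc u)) 0 = 1"
proof -
 have w: "tail_weight 0 k 0 = 1" for k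
  by (induction k) (simp_all add: tail_weight_def)
 have "fps_nth (tail_sum (Suc k) (Suc u)) 0 = 1"
  using tail_sum_eqm[of 0 k u] by (simp add: eqm_nth w)
 moreover have "fps_nth qpoch_inf 0 = 1" by (simp add: qpoch_inf_def)
 ultimately show ?thesis by (simp add: tail_formula_def power2_eq_square)
qed

section \<open>From power series in q to Laurent series in A\<close>

text \<open>The substitution \<open>q = A^4\<close>, which turns congruences of power series into
  statements on brackets.\<close>

definition emb :: "rat fps => lser" where
 "emb f = fps_to_fls (f oo fps_X ^ 4)"

lemma X4_nth_0: "fps_nth (fps_X ^ 4 :: rat fps) 0 = 0"
 by simp

lemma emb_add: "emb (f + g) = emb f + emb g"
 by (simp add: emb_def fps_compose_add_distrib)

lemma emb_mult: "emb (f * g) = emb f * emb g"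
 unfolding emb_def fps_compose_mult_distrib[OF X4_nth_0] by (rule fls_times_fps_to_fls)

lemma emb_1 [simp]: "emb 1 = 1" and emb_0 [simp]: "emb 0 = 0"
 by (simp_all add: emb_def)

lemma emb_diff: "emb (f - g) = emb f - emb g"
 using emb_add[of "f - g" g] by simp

lemma emb_uminus: "emb (- f) = - emb f"
 using emb_diff[of 0 f] by simp

lemma emb_power: "emb (f ^ n) = emb f ^ n"
 by (induction n) (simp_all add: emb_mult)

lemma emb_sum: "emb (sum f I) = (\<Sum>i\<in>I. emb (f i))"
 by (induction I rule: infinite_finite_induct) (simp_all add: emb_add)

lemma emb_X: "emb fps_X = varA ^ 4"
 by (simp add: emb_def varA_def fps_to_fls_power)

lemma emb_inverse: "fps_nth f 0 \<noteq> 0 ==> emb (inverse f) = inverse (emb f)"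
proof -
 assume "fps_nth f 0 \<noteq> 0"
 then have "emb f * emb (inverse f) = 1" using inverse_mult_eq_1[of f] by (simp add: mult.commute flip: emb_mult)
 then show ?thesis by (simp add: inverse_unique)
qed

lemma emb_gauss: "emb (gauss fps_X m k) = gauss (varA ^ 4) m k"
 by (induction m arbitrary: k) (auto simp: emb_add emb_mult emb_power emb_X split: nat.splits)

lemma emb_nth: "fls_nth (emb f) i = (if 0 \<le> i \<and> 4 dvd i then fps_nth f (nat (i div 4)) else 0)"
proof -
 have "fps_nth (f oo fps_X ^ 4) m = (if 4 dvd m then fps_nth f (m div 4) else 0)" for m
 proof -
  have "fps_nth (f oo fps_X ^ 4) m = (\<Sum>i=0..m. if m = 4 * i then fps_nth f i else 0)"
   unfolding fps_compose_nth by (intro sum.cong refl) (auto simp flip: power_mult)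
  also have "... = (if 4 dvd m then fps_nth f (m div 4) else 0)"
  proof (cases "4 dvd m")
   case True
   then obtain j where j: "m = 4 * j" by (elim dvdE)
   then have "(\<Sum>i=0..m. if m = 4 * i then fps_nth f i else 0) = (\<Sum>i=0..m. if i = j then fps_nth f i else 0)"
    by (intro sum.cong) auto
   then show ?thesis using j by simp
  next
   case False
   then have "(\<Sum>i=0..m. if m = 4 * i then fps_nth f i else 0) = 0" by (intro sum.neutral) auto
   then show ?thesis using False by simp
  qed
  finally show ?thesis .
 qed
 note compose = this
 show ?thesis
 proof (cases "0 \<le> i")
  case True
  then obtain m where m: "i = int m" by (elim nonneg_int_cases)
  have "4 dvd int m \<longleftrightarrow> 4 dvd m" "int m div 4 = int (m div 4)" by presburger (simp add: zdiv_int)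
  then show ?thesis by (simp add: m emb_def compose)
 qed (simp add: emb_def)
qed

lemma emb_X_power: "emb (fps_X ^ m) = varA powi (4 * int m)"
 by (simp add: emb_power emb_X power_int_def nat_mult_distrib flip: power_mult)

lemma varA_powi_nz [simp]: "varA powi e \<noteq> 0"
 by simp

lemma varA_powi_add: "varA powi (d + e) = varA powi d * varA powi e"
 by (simp add: power_int_add)

lemma varAinv_power: "varAinv ^ m = varA powi (- int m)"
 by (simp add: varAinv_eq power_int_minus power_inverse)

lemma emb_factor_nz [simp]: "0 < m ==> emb (1 - fps_X ^ m) \<noteq> 0"
proof
 assume "0 < m" "emb (1 - fps_X ^ m) = 0"
 then have "fls_nth (emb (1 - fps_X ^ m)) 0 = 0" by simp
 then show False using \<open>0 < m\<close> by (simp add: emb_nth)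
qed

lemma qint_emb: "qint m = varA powi (2 - 2 * int m) * emb (1 - fps_X ^ m) / emb (1 - fps_X ^ 1)"
proof -
 have d: "varA ^ (2 * m) - varAinv ^ (2 * m) = - (varA powi (- 2 * int m) * emb (1 - fps_X ^ m))" for m
  unfolding varAinv_power emb_diff emb_X_power emb_1 right_diff_distrib varA_powi_add[symmetric]
  by (simp add: power_int_def nat_mult_distrib)
 have "varA powi (- 2 * int m) = varA powi (2 - 2 * int m) * varA powi (- 2)"
  by (simp add: flip: varA_powi_add)
 then show ?thesis unfolding qint_def d[of m] using d[of 1] by simp
qed

lemma eta_emb:
 assumes "t \<le> n" "s \<le> n"
 shows "eta n s t = (-1) ^ t * varA powi (- 2 * int t) * emb (theta_weight n s t)"
 using assms(1)
proof (induction t)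
 case 0
 then show ?case by (simp add: eta_def theta_weight_def)
next
 case (Suc t)
 let ?a = "s - t" and ?b = "2 * n + 1 - s - t" and ?c = "n - t"
 have c: "0 < ?c" using Suc.prems by simp
 have f: "- (qint ?a * qint ?b) / (qint ?c)\<^sup>2 = - (varA powi (- 2)) *
   emb ((1 - fps_X ^ ?a) * (1 - fps_X ^ ?b) * inverse (1 - fps_X ^ ?c) ^ 2)"
 proof (cases "t < s")
  case True
  \<comment> \<open>The powers of \<open>A\<close> in the four quantum integers combine to
    \<open>A^-2\<close>, independently of \<open>s\<close>, \<open>t\<close> and
    \<open>n\<close>.\<close>
  have e: "(2 - 2 * int ?a) + (2 - 2 * int ?b) = - 2 + (2 - 2 * int ?c) + (2 - 2 * int ?c)"
   using True assms(2) Suc.prems by (simp add: of_nat_diff)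
  have p: "varA powi (2 - 2 * int ?a) * varA powi (2 - 2 * int ?b) = varA powi (- 2) * (varA powi (2 - 2 * int ?c))\<^sup>2"
   unfolding varA_powi_add[symmetric] e by (simp only: varA_powi_add power2_eq_square mult.assoc)
  have i: "emb (inverse (1 - fps_X ^ ?c)) = inverse (emb (1 - fps_X ^ ?c))" using c by (intro emb_inverse) simp
  have gen: "- (A * x / z * (B * y / z)) / (C * w / z)\<^sup>2 = - P * (x * y * inverse w ^ 2)"
   if "A * B = P * C\<^sup>2" "C \<noteq> 0" "z \<noteq> 0" "w \<noteq> 0" for A B C P x y z w :: lser
  proof -
   have "- (A * x / z * (B * y / z)) / (C * w / z)\<^sup>2 = - (A * B) * x * y / (C\<^sup>2 * w\<^sup>2)"
    using that(2-4) by (simp add: field_simps power2_eq_square)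
   then show ?thesis using that by (simp add: field_simps power2_eq_square)
  qed
  show ?thesis
   unfolding qint_emb emb_mult emb_power i by (rule gen[OF p]) (use c emb_factor_nz[of 1] in simp_all)
 next
  case False
  then show ?thesis by simp
 qed
 have "eta n s (Suc t) = eta n s t * (- (qint ?a * qint ?b) / (qint ?c)\<^sup>2)" by (simp add: eta_def)
 also have "... = (-1) ^ Suc t * (varA powi (- 2 * int t) * varA powi (- 2)) * emb (theta_weight n s (Suc t))"
  unfolding f using Suc by (simp add: theta_weight_def emb_mult mult_ac)
 also have "varA powi (- 2 * int t) * varA powi (- 2) = varA powi (- 2 * int (Suc t))"
 proof -
  have "- 2 * int t + - 2 = - 2 * int (Suc t)" by simp
  then show ?thesis by (simp only: varA_powi_add[symmetric])
 qed
 finally show ?case .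
qed

text \<open>The exponent common to all terms of \<open>a + 1\<close> twists: \<open>- n^2\<close>
  from the first twist and \<open>- (n^2 + 2n)\<close> from each further one.\<close>

definition twist_shift :: "nat => nat => int" where
 "twist_shift n a = - (int n)\<^sup>2 - int a * ((int n)\<^sup>2 + 2 * int n)"

lemma tri_int: "4 * int (tri t) = 2 * (int t)\<^sup>2 - 2 * int t"
proof -
 have "int (tri t) + int (tri t) + int t = int t * int t" using tri_square[of t] by (metis of_nat_add of_nat_mult)
 then show ?thesis by (simp add: power2_eq_square)
qed

lemma pull_coeff_emb:
 assumes "s \<le> n"
 shows "pull_coeff n (n - s) = (-1) ^ (n + s) * varA powi ((int s + 1)\<^sup>2 - (int n + 1)\<^sup>2)"
proof -
 have "j \<le> n ==> pull_coeff n j = (-1) ^ j * varA powi ((int n - int j + 1)\<^sup>2 - (int n + 1)\<^sup>2)" for j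
 proof (induction j)
  case (Suc j)
  have "(int n - int (Suc j) + 1)\<^sup>2 - (int n + 1)\<^sup>2 = ((int n - int j + 1)\<^sup>2 - (int n + 1)\<^sup>2) + - int (2 * (n - j) + 1)"
   using Suc.prems by (simp add: of_nat_diff power2_eq_square algebra_simps)
  then have "varA powi ((int n - int (Suc j) + 1)\<^sup>2 - (int n + 1)\<^sup>2)
    = varA powi ((int n - int j + 1)\<^sup>2 - (int n + 1)\<^sup>2) * varAinv ^ (2 * (n - j) + 1)"
   by (simp only: varA_powi_add varAinv_power)
  then show ?case using Suc by (simp add: pull_coeff_def mult_ac)
 qed (simp add: pull_coeff_def)
 from this[of "n - s"] assms show ?thesis
  by (simp add: of_nat_diff minus_one_power_iff)
qed

lemma twist_coeff_emb:
 assumes "s \<le> n" "t \<le> n"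
 shows "twist_coeff n (n - s) (n - t) = (-1) ^ (n + s) *
  (varA powi (2 * (int t)\<^sup>2 + 2 * int s - (int n)\<^sup>2 - 2 * int n) * emb (gauss fps_X s t))"
proof (cases "t \<le> s")
 case True
 have g: "gauss fps_X s (s - t) = (gauss fps_X s t :: rat fps)"
  using gauss_eq[OF True] gauss_eq[of "s - t" s] True by (simp add: mult_ac)
 have "(int s + 1)\<^sup>2 - (int n + 1)\<^sup>2 + (2 * (int s - int (s - t))\<^sup>2 - (int s)\<^sup>2)
   = 2 * (int t)\<^sup>2 + 2 * int s - (int n)\<^sup>2 - 2 * int n"
  using True by (simp add: of_nat_diff power2_eq_square algebra_simps)
 then have p: "varA powi ((int s + 1)\<^sup>2 - (int n + 1)\<^sup>2) * varA powi (2 * (int s - int (s - t))\<^sup>2 - (int s)\<^sup>2)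
   = varA powi (2 * (int t)\<^sup>2 + 2 * int s - (int n)\<^sup>2 - 2 * int n)"
  by (simp only: varA_powi_add[symmetric])
 have "n - (n - s) = s" "n - t - (n - s) = s - t" "n - s \<le> n - t" using assms True by auto
 then show ?thesis
  unfolding twist_coeff_def crossing_coeff_def pull_coeff_emb[OF assms(1)] p[symmetric]
  by (simp add: emb_gauss[symmetric] g mult_ac)
next
 case False
 then show ?thesis using assms by (simp add: twist_coeff_def gauss_eq_0)
qed

lemma sum_reflect: "(\<Sum>i\<le>n. f i) = (\<Sum>s\<le>n. f (n - s))" for n :: nat
 by (rule sum.reindex_bij_witness[where i = "\<lambda>s. n - s" and j = "\<lambda>s. n - s"]) auto

text \<open>The index is reversed to count through strands. The exponent \<open>2 s^2\<close> of the
  preceding twists and the \<open>2 s\<close> of the new one add up to \<open>4 (tri s + s)\<close>,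
  a power of q, and a fresh \<open>2 t^2\<close> appears.\<close>

lemma twists_coeff_emb:
 "t \<le> n ==> twists_coeff n (Suc a) (n - t) = varA powi (2 * (int t)\<^sup>2 + twist_shift n a) * emb (twist_sum n a t)"
proof (induction a arbitrary: t)
 case 0
 have "twists_coeff n (Suc 0) (n - t) = (\<Sum>i\<le>n. if i = 0 then twist_coeff n 0 (n - t) else 0)"
  unfolding twists_coeff.simps by (intro sum.cong) auto
 also have "... = twist_coeff n (n - n) (n - t)" by simp
 finally show ?case
  using twist_coeff_emb[OF order_refl 0] by (simp add: twist_shift_def flip: mult_2)
next
 case (Suc a)
 have "twists_coeff n (Suc (Suc a)) (n - t) = (\<Sum>s\<le>n. twists_coeff n (Suc a) (n - s) * twist_coeff n (n - s) (n - t))"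
  unfolding twists_coeff.simps(2)[of n "Suc a"] by (rule sum_reflect)
 also have "... = (\<Sum>s\<le>n. varA powi (2 * (int t)\<^sup>2 + twist_shift n (Suc a)) *
   emb ((-1) ^ (n + s) * fps_X ^ (tri s + s) * gauss fps_X s t * twist_sum n a s))"
 proof (rule sum.cong[OF refl])
  fix s assume "s \<in> {..n}"
  then have s: "s \<le> n" by simp
  have e: "2 * (int s)\<^sup>2 + twist_shift n a + (2 * (int t)\<^sup>2 + 2 * int s - (int n)\<^sup>2 - 2 * int n)
    = 2 * (int t)\<^sup>2 + twist_shift n (Suc a) + 4 * int (tri s + s)"
   using tri_int[of s] by (simp add: twist_shift_def algebra_simps)
  have p: "varA powi (2 * (int s)\<^sup>2 + twist_shift n a) * varA powi (2 * (int t)\<^sup>2 + 2 * int s - (int n)\<^sup>2 - 2 * int n)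
    = varA powi (2 * (int t)\<^sup>2 + twist_shift n (Suc a)) * emb (fps_X ^ (tri s + s))"
   unfolding emb_X_power varA_powi_add[symmetric] e ..
  have gen: "x * b * (m * (y * g)) = z * (m * w * g * b)" if "x * y = z * w" for x y z w b m g :: lser
  proof -
   have "x * b * (m * (y * g)) = (x * y) * (b * m * g)" by (simp only: mult_ac)
   then show ?thesis unfolding that by (simp only: mult_ac)
  qed
  show "twists_coeff n (Suc a) (n - s) * twist_coeff n (n - s) (n - t) = varA powi (2 * (int t)\<^sup>2 + twist_shift n (Suc a)) *
   emb ((-1) ^ (n + s) * fps_X ^ (tri s + s) * gauss fps_X s t * twist_sum n a s)"
   unfolding Suc.IH[OF s] twist_coeff_emb[OF s Suc.prems] emb_mult emb_power[of "-1"] emb_uminus emb_1 by (rule gen[OF p])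
 qed
 finally show ?case by (simp only: twist_sum.simps emb_sum sum_distrib_left)
qed

text \<open>Here \<open>2 t^2\<close> meets the exponent \<open>- 2 t\<close> of
  \<open>eta_emb\<close>, and together they are \<open>4 tri t\<close>.\<close>

lemma leg_emb:
 assumes "s \<le> n"
 shows "(\<Sum>k\<le>n. twists_coeff n (Suc a) k * eta n s (n - k)) = varA powi twist_shift n a * emb (leg_sum n a s)"
proof -
 have "(\<Sum>k\<le>n. twists_coeff n (Suc a) k * eta n s (n - k)) = (\<Sum>t\<le>n. twists_coeff n (Suc a) (n - t) * eta n s (n - (n - t)))"
  by (rule sum_reflect)
 also have "... = (\<Sum>t\<le>n. varA powi twist_shift n a * emb ((-1) ^ t * fps_X ^ tri t * twist_sum n a t * theta_weight n s t))"
 proof (rule sum.cong[OF refl])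
  fix t assume "t \<in> {..n}"
  then have t: "t \<le> n" "n - (n - t) = t" by auto
  have e: "2 * (int t)\<^sup>2 + twist_shift n a + - 2 * int t = twist_shift n a + 4 * int (tri t)"
   using tri_int[of t] by simp
  have p: "varA powi (2 * (int t)\<^sup>2 + twist_shift n a) * varA powi (- 2 * int t) = varA powi twist_shift n a * emb (fps_X ^ tri t)"
   unfolding emb_X_power varA_powi_add[symmetric] e ..
  have gen: "x * b * (m * y * g) = z * (m * w * b * g)" if "x * y = z * w" for x y z w b m g :: lser
  proof -
   have "x * b * (m * y * g) = (x * y) * (b * m * g)" by (simp only: mult_ac)
   then show ?thesis unfolding that by (simp only: mult_ac)
  qed
  show "twists_coeff n (Suc a) (n - t) * eta n s (n - (n - t)) =
   varA powi twist_shift n a * emb ((-1) ^ t * fps_X ^ tri t * twist_sum n a t * theta_weight n s t)"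
   unfolding t(2) twists_coeff_emb[OF t(1)] eta_emb[OF t(1) assms] emb_mult emb_power[of "-1"] emb_uminus emb_1 by (rule gen[OF p])
 qed
 finally show ?thesis by (simp only: leg_sum_def emb_sum sum_distrib_left)
qed

text \<open>The constant terms of \<open>T\<close> and, up to sign, of \<open>f\<close> are 1, so
  \<open>e\<close> is the lowest degree and normalising removes the power of \<open>A\<close>. Both
  signs go into the sign of \<open>tail_agree\<close>.\<close>

lemma tail_agreeI:
 assumes f: "eqm (Suc n) f ((-1) ^ m * T)" and T: "fps_nth T 0 = 1"
 shows "tail_agree (Suc n) ((-1) ^ d * varA powi e * emb f) T"
proof -
 let ?P = "(-1) ^ d * varA powi e * emb f"
 have A: "varA powi e = fls_X_intpow e"
  by (cases "0 \<le> e") (simp_all add: power_int_def varA_def fls_X_power_conv_shift_1 fls_inverse_X fls_X_inv_power_conv_shift_1 power_inverse)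
 have sg: "fls_nth ((-1) ^ d * g) i = (-1) ^ d * fls_nth g i" for g :: lser and i
  by (cases "even d") simp_all
 have nth: "fls_nth ?P i = (-1) ^ d * fls_nth (emb f) (i - e)" for i
  unfolding mult.assoc sg A by (simp add: fls_X_intpow_times_conv_shift)
 have sT: "fps_nth ((-1) ^ m * T) j = (-1) ^ m * fps_nth T j" for j
  by (cases "even m") simp_all
 have fj: "fps_nth f j = (-1) ^ m * fps_nth T j" if "j < Suc n" for j
  using f that unfolding eqm_nth sT by blast
 have f0: "fps_nth f 0 = (-1) ^ m" using fj[of 0] T by simp
 have sub: "fls_subdegree ?P = e"
  by (rule fls_subdegree_eqI) (simp_all add: nth emb_nth f0)
 have "?P \<noteq> 0"
 proof
  assume "?P = 0"
  then have "fls_nth ?P e = 0" by simp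
  then show False by (simp add: nth emb_nth f0)
 qed
 moreover have "T \<noteq> 0" using T by auto
 moreover have "is_q_series ?P" unfolding is_q_series_def sub nth by (auto simp: emb_nth)
 moreover have "subdegree T = 0" using T by (simp add: subdegree_eq_0_iff)
 moreover have "qcoeff_norm ?P j = (-1) ^ (d + m) * fps_nth T j" if "j < Suc n" for j
  unfolding qcoeff_norm_def sub nth using fj[OF that] by (simp add: emb_nth power_add)
 moreover have "(-1) ^ (d + m) \<in> {1, -1 :: rat}" by (cases "even (d + m)") auto
 ultimately show ?thesis unfolding tail_agree_def by auto
qed

theorem mainTheorem1:
 fixes k u :: nat
 assumes "k \<ge> 1" and "u \<ge> 1"
 shows "\<forall>n \<ge> 1. tail_agree n (jones_pretzel k u n) (tail_formula k u)"
proof (intro allI impI)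
 fix N :: nat assume "N \<ge> 1"
 then obtain n where N: "N = Suc n" by (cases N) auto
 \<comment> \<open>The odd regions have \<open>2k+1 = 2k'+3\<close> twists, the case treated by
   \<open>leg_sum_odd\<close>; \<open>k'\<close> summations besides the one over \<open>v\<close>
   make up the \<open>k\<close> of the theorem.\<close>
 obtain k' u' where ku: "k = Suc k'" "u = Suc u'" using assms by (cases k; cases u) auto
 let ?a = "pretzel_twists k u"
 let ?L = "\<lambda>s. leg_sum n (Suc (Suc (2 * k'))) s * leg_sum n 1 s * leg_sum n (Suc (Suc (2 * u'))) s"
 let ?F = "\<Sum>s\<le>n. fps_X ^ s * ((1 - fps_X ^ (2 * (n - s) + 1)) * ?L s)"
 define e where "e = twist_shift n (Suc (Suc (2 * k'))) + twist_shift n 1 + twist_shift n (Suc (Suc (2 * u')))"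
 have a: "?a 0 = Suc (Suc (Suc (2 * k')))" "?a 1 = Suc 1" "?a 2 = Suc (Suc (Suc (2 * u')))"
  by (simp_all add: pretzel_twists_def ku)
 have "coloured_bracket n (pretzel_crossings ?a) (pretzel_edges ?a) pretzel_jw_edge
   = bracket n (closure_functional.twisted n ?a * closure_functional.proj n (0, True, True))"
  by (rule coloured_bracket_pretzel) (simp add: pretzel_twists_def)
 also have "... = (\<Sum>s\<le>n. Delta (2 * (n - s)) * (\<Prod>r<3. \<Sum>k\<le>n. twists_coeff n (?a r) k * eta n s (n - k)))"
  by (rule v_twisted) (simp_all only: a, simp_all)
 also have "... = (\<Sum>s\<le>n. varA powi (e - 4 * int n) * emb (fps_X ^ s * ((1 - fps_X ^ (2 * (n - s) + 1)) * ?L s)) / emb (1 - fps_X ^ 1))"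
 proof (rule sum.cong[OF refl])
  fix s assume "s \<in> {..n}"
  then have s: "s \<le> n" by simp
  have "(\<Prod>r<3. \<Sum>k\<le>n. twists_coeff n (?a r) k * eta n s (n - k)) = varA powi e * emb (?L s)"
  proof -
   have "(\<Prod>r<3. \<Sum>k\<le>n. twists_coeff n (?a r) k * eta n s (n - k)) = (\<Sum>k\<le>n. twists_coeff n (?a 0) k * eta n s (n - k))
    * (\<Sum>k\<le>n. twists_coeff n (?a 1) k * eta n s (n - k)) * (\<Sum>k\<le>n. twists_coeff n (?a 2) k * eta n s (n - k))"
    by (simp add: numeral_3_eq_3 numeral_2_eq_2)
   then show ?thesis unfolding a leg_emb[OF s] e_def varA_powi_add emb_mult by (simp only: mult_ac)
  qed
  \<comment> \<open>The factor \<open>q^s\<close> on which all precisions rely comes from the lowest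
    power of \<open>A\<close> in the weight.\<close>
  moreover have "Delta (2 * (n - s)) = varA powi (- 4 * int n) * emb (fps_X ^ s) * emb (1 - fps_X ^ (2 * (n - s) + 1)) / emb (1 - fps_X ^ 1)"
  proof -
   have "2 - 2 * int (Suc (2 * (n - s))) = - 4 * int n + 4 * int s" using s by (simp add: of_nat_diff)
   then show ?thesis unfolding Delta_qint qint_emb emb_X_power varA_powi_add[symmetric] by simp
  qed
  moreover have "varA powi (e - 4 * int n) = varA powi e * varA powi (- 4 * int n)"
   by (simp flip: varA_powi_add)
  ultimately show "Delta (2 * (n - s)) * (\<Prod>r<3. \<Sum>k\<le>n. twists_coeff n (?a r) k * eta n s (n - k))
   = varA powi (e - 4 * int n) * emb (fps_X ^ s * ((1 - fps_X ^ (2 * (n - s) + 1)) * ?L s)) / emb (1 - fps_X ^ 1)"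
   by (simp only: emb_mult times_divide_eq_left times_divide_eq_right mult_ac)
 qed
 also have "... = varA powi (e - 4 * int n) * emb ?F / emb (1 - fps_X ^ 1)"
  by (simp only: emb_sum sum_distrib_left sum_divide_distrib)
 finally have b: "coloured_bracket n (pretzel_crossings ?a) (pretzel_edges ?a) pretzel_jw_edge
  = varA powi (e - 4 * int n) * emb ?F / emb (1 - fps_X ^ 1)" .
 \<comment> \<open>Division by \<open>Delta n\<close> leaves the inverse of
   \<open>1 - q^(n+1)\<close>, which is 1 modulo \<open>q^(n+1)\<close>. The precision is thus that
   of the \<open>N = n + 1\<close> coefficients claimed.\<close>
 let ?I = "inverse (1 - fps_X ^ Suc n) :: rat fps"
 have I: "eqm (Suc n) ?I 1" by (intro eqm_inverse eqm_factor) simp_all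
 have F: "eqm (Suc n) (?F * ?I) ((-1) ^ n * tail_formula k u)"
  using eqm_mult[OF pretzel_sum_eqm I, of k' u'] by (simp only: ku mult_1_right)
 let ?w = "pretzel_writhe k u"
 have w: "fls_X_intpow (- ?w * int (n ^ 2 + 2 * n)) = varA powi (- ?w * int (n ^ 2 + 2 * n))"
  by (simp add: varA_def power_int_def fls_X_power_conv_shift_1 fls_inverse_X fls_X_inv_power_conv_shift_1 power_inverse)
 have d: "Delta n = (-1) ^ n * varA powi (- 2 * int n) * emb (1 - fps_X ^ Suc n) / emb (1 - fps_X ^ 1)"
 proof -
  have "2 - 2 * int (Suc n) = - 2 * int n" by simp
  then show ?thesis unfolding Delta_qint qint_emb by (simp only: times_divide_eq_right mult.assoc)
 qed
 have iI: "emb ?I = inverse (emb (1 - fps_X ^ Suc n))" by (rule emb_inverse) simp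
 have "jones_pretzel k u N = (-1) ^ (n * nat \<bar>?w\<bar>) * varA powi (- ?w * int (n ^ 2 + 2 * n))
   * (varA powi (e - 4 * int n) * emb ?F / emb (1 - fps_X ^ 1)) / Delta n"
  unfolding jones_pretzel_def coloured_jones_def N Let_def diff_Suc_1 b w ..
 also have "... = (-1) ^ (n * nat \<bar>?w\<bar> + n) * varA powi (- ?w * int (n ^ 2 + 2 * n) + (e - 4 * int n) + 2 * int n) * emb (?F * ?I)"
 proof -
  have gen: "m * x * (y * f / z) / (p * v * g / z) = m * p * (x * y * inverse v) * (f * inverse g)"
   if "z \<noteq> 0" "g \<noteq> 0" "v \<noteq> 0" "p * p = 1" for m x y f z p v g :: lser
  proof -
   have "p \<noteq> 0" "inverse p = p" using that(4) by (auto simp: inverse_unique)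
   then have "m * x * (y * f / z) / (p * v * g / z) = m * x * y * f * inverse p * inverse v * inverse g"
    using that by (simp add: field_simps)
   then show ?thesis by (simp only: \<open>inverse p = p\<close> mult_ac)
  qed
  have inv: "varA powi (2 * int n) = inverse (varA powi (- 2 * int n))" by (simp add: power_int_minus)
  have "emb (1 - fps_X ^ 1) \<noteq> 0" "emb (1 - fps_X ^ Suc n) \<noteq> 0" by (rule emb_factor_nz, simp)+
  moreover have "(-1) ^ n * (-1) ^ n = (1 :: lser)" by (simp flip: power_mult_distrib)
  ultimately show ?thesis
   unfolding d emb_mult iI varA_powi_add power_add inv by (intro gen varA_powi_nz)
 qed
 finally show "tail_agree N (jones_pretzel k u N) (tail_formula k u)"
  using tail_agreeI[OF F] tail_formula_0[of k' u'] by (simp only: N ku)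
qed

end
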